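(* Let $\mathbb K^{\rm Ai}$ (extended Airy kernel) and $\mathbb K^{\rm S_1}$ be as defined in the context. Then for all $u,v,\tau_1,\tau_2\in\mathbb R$, $$\frac{1}{\sqrt a}\,\mathbb K^{\rm Ai}_{\tau_1/a,\tau_2/a}\Big(\frac{u}{\sqrt a}-a,\frac{v}{\sqrt a}-a\Big)=\mathbb K^{\rm S_1}_{\tau_1,\tau_2}(u,v)+\mathrm{fluc}^{\rm S_1}(u,v;\tau_1,\tau_2;a)+\mathcal O(a^{-3})$$ as $a\to+\infty$, uniformly for $u,v,\tau_1,\tau_2$ in compact subsets of $\mathbb R$, where $$\mathrm{fluc}^{\rm S_1}(u,v;\tau_1,\tau_2;a)=\frac{\pi}{(2\pi i)^2}\,\frac{1}{a^{3/2}}\,e^{-(\tau_1-\tau_2)}\Big(f^{\rm S_1}_{\tau_1,\tau_2}(u,v)+\cos\big(\tfrac43 a^{3/2}-(u+v)\big)\Big),$$ $$f^{\rm S_1}_{\tau_1,\tau_2}(u,v)=(u+v)\cos(u-v)-2(\tau_1+\tau_2)\sin(u-v).$$ More generally, there is a complete asymptotic expansion: for every integer $N\ge 0$, $$\frac{1}{\sqrt a}\,\mathbb K^{\rm Ai}_{\tau_1/a,\tau_2/a}\Big(\frac{u}{\sqrt a}-a,\frac{v}{\sqrt a}-a\Big)-\mathbb K^{\rm S_1}_{\tau_1,\tau_2}(u,v)-\sum_{\nu=1}^{N}\frac{2}{(2\pi i)^2a^{\frac32\nu}}\sum_{\substack{k,l\ge0\\k+l=2\nu-1}}\Re\{b_{k,l}B_{k,l}\}$$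 $$-\sum_{\nu=1}^{N}\frac{2}{(2\pi i)^2a^{\frac32\nu}}\sum_{\substack{k,l\ge0\\k+l=\nu-1}}\Re\Big\{c_{2k,2l}\,e^{i\frac43 a^{3/2}}\Big\}\Gamma\big(k+\tfrac12\big)\Gamma\big(l+\tfrac12\big)=\mathcal O\big(a^{-\frac32(N+1)}\big)$$ as $a\to+\infty$, uniformly for $u,v,\tau_1,\tau_2$ in compact subsets of $\mathbb R$, where the coefficients $b_{k,l},c_{k,l}$ (depending on $u,v,\tau_1,\tau_2$) and $B_{k,l}$ are as defined in the context.
   Context: Extended Airy kernel: for $\tau_1,\tau_2,u,v\in\mathbb R$, $$\mathbb K^{\rm Ai}_{\tau_1,\tau_2}(u,v)=\frac{1}{(2\pi i)^2}\int_{\Sigma^{\rm Ai}}d\zeta\int_{\Gamma^{\rm Ai}}d\omega\,\frac{\exp\big(\frac{\zeta^3}{3}-\zeta v-\tau_2\zeta^2-\frac{\omega^3}{3}+\omega u+\tau_1\omega^2\big)}{\zeta-\omega}-\mathbf 1(\tau_1>\tau_2)\frac{1}{\sqrt{4\pi(\tau_1-\tau_2)}}\exp\Big(-\frac{(u-v)^2}{4(\tau_1-\tau_2)}\Big),$$ where $\Sigma^{\rm Ai}$ consists of the ray from $\infty e^{-i\pi/3}$ to $0$ followed by the ray from $0$ to $\infty e^{i\pi/3}$, and $\Gamma^{\rm Ai}$ consists of the ray from $\infty e^{-2i\pi/3}$ to $0$ followed by the ray from $0$ to $\infty e^{2i\pi/3}$. Kernel $\mathbb K^{\rm S_1}$ (a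 variant of the extended sine kernel): $$\mathbb K^{\rm S_1}_{\tau_1,\tau_2}(u,v)=\frac{1}{2\pi i}\int_{-i}^{i}e^{(\tau_1-\tau_2)\omega^2+(u-v)\omega}d\omega-\mathbf 1(\tau_1>\tau_2)\frac{1}{\sqrt{4\pi(\tau_1-\tau_2)}}\exp\Big(-\frac{(u-v)^2}{4(\tau_1-\tau_2)}\Big).$$ Coefficients: Let $f(\zeta)=\frac{\zeta^3}{3}+\zeta$. Let $g$ be the analytic function on a neighbourhood of $0$ solving $f(g(x))-\frac23 i=-x^2$ with $g(0)=i$ and $g'(0)=e^{i\pi/4}$ (so $g(x)=i+e^{i\pi/4}x-\frac16x^2+\frac{5}{72}e^{-i\pi/4}x^3+\dots$). Define, for $(x,y)$ near $(0,0)$, $$\varphi(x,y)=\frac{x-iy}{g(x)-g(iy)}\exp\{-v\,g(x)-\tau_2 g(x)^2+u\,g(iy)+\tau_1 g(iy)^2\}\,g'(x)\,\frac{d}{dy}g(iy),$$ $$\Phi(x,y)=\frac{\exp\{-v\,g(x)-\tau_2 g(x)^2-u\,g(-y)+\tau_1 g(-y)^2\}}{g(x)+g(-y)}\,g'(x)\,\frac{d}{dy}\big(-g(-y)\big),$$ both analytic near the origin, with power series $\varphi(x,y)=\sum_{k,l\ge0}b_{k,l}x^ky^l$ and $\Phi(x,y)=\sum_{k,l\ge0}c_{k,l}x^ky^l$. Finally $$B_{k,l}=\int_{-\infty}^{\infty}\int_{-\infty}^{\infty}e^{-(x^2+y^2)}\frac{x^ky^l}{x-iy}\,dx\,dy,\qquad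 k,l\ge0.$$ *)

theory Defs
  imports "HOL-Complex_Analysis.Complex_Analysis"
begin

text \<open>Sigma^Ai: ray from infinity e^(-i pi/3) to 0, then ray from 0 to infinity e^(i pi/3),
  parametrised by t over the real line (t < 0 on the first ray, t >= 0 on the second);
  sigma_Ai' is its derivative (defined for t <> 0).\<close>
definition sigma_Ai :: "real \<Rightarrow> complex" where
  "sigma_Ai t = (if t < 0 then of_real (-t) * exp (- \<i> * of_real pi / 3)
                 else of_real t * exp (\<i> * of_real pi / 3))"

definition sigma_Ai' :: "real \<Rightarrow> complex" where
  "sigma_Ai' t = (if t < 0 then - exp (- \<i> * of_real pi / 3) else exp (\<i> * of_real pi / 3))"

definition gamma_Ai :: "real \<Rightarrow> complex" where
  "gamma_Ai t = (if t < 0 then of_real (-t) * exp (- 2 * \<i> * of_real pi / 3)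
                 else of_real t * exp (2 * \<i> * of_real pi / 3))"

definition gamma_Ai' :: "real \<Rightarrow> complex" where
  "gamma_Ai' t = (if t < 0 then - exp (- 2 * \<i> * of_real pi / 3) else exp (2 * \<i> * of_real pi / 3))"

definition airy_integrand :: "real \<Rightarrow> real \<Rightarrow> real \<Rightarrow> real \<Rightarrow> complex \<Rightarrow> complex \<Rightarrow> complex" where
  "airy_integrand \<tau>1 \<tau>2 u v \<zeta> \<omega> =
     exp (\<zeta>^3 / 3 - \<zeta> * of_real v - of_real \<tau>2 * \<zeta>^2 - \<omega>^3 / 3 + \<omega> * of_real u + of_real \<tau>1 * \<omega>^2)
     / (\<zeta> - \<omega>)"

definition heat_term :: "real \<Rightarrow> real \<Rightarrow> real \<Rightarrow> real \<Rightarrow> real" where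
  "heat_term \<tau>1 \<tau>2 u v = (if \<tau>1 > \<tau>2 then
      1 / sqrt (4 * pi * (\<tau>1 - \<tau>2)) * exp (- ((u - v)^2) / (4 * (\<tau>1 - \<tau>2))) else 0)"

text \<open>Extended Airy kernel; the double contour integral is absolutely convergent and is
  written as a Lebesgue integral over the parameter plane.\<close>
definition K_Ai :: "real \<Rightarrow> real \<Rightarrow> real \<Rightarrow> real \<Rightarrow> complex" where
  "K_Ai \<tau>1 \<tau>2 u v =
     1 / (2 * of_real pi * \<i>)^2 *
       (\<integral>p. airy_integrand \<tau>1 \<tau>2 u v (sigma_Ai (fst p)) (gamma_Ai (snd p))
               * sigma_Ai' (fst p) * gamma_Ai' (snd p) \<partial>(lborel :: (real \<times> real) measure))
     - of_real (heat_term \<tau>1 \<tau>2 u v)"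

text \<open>The kernel K^{S_1}; the integral from -i to i is along the segment (integrand entire).\<close>
definition K_S1 :: "real \<Rightarrow> real \<Rightarrow> real \<Rightarrow> real \<Rightarrow> complex" where
  "K_S1 \<tau>1 \<tau>2 u v =
     1 / (2 * of_real pi * \<i>) *
       contour_integral (linepath (- \<i>) \<i>)
         (\<lambda>\<omega>. exp (of_real (\<tau>1 - \<tau>2) * \<omega>^2 + of_real (u - v) * \<omega>))
     - of_real (heat_term \<tau>1 \<tau>2 u v)"

definition fAi :: "complex \<Rightarrow> complex" where
  "fAi \<zeta> = \<zeta>^3 / 3 + \<zeta>"

definition is_g :: "(complex \<Rightarrow> complex) \<Rightarrow> real \<Rightarrow> bool" where
  "is_g g r \<longleftrightarrow> r > 0 \<and> g holomorphic_on ball 0 r \<and>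
     (\<forall>x\<in>ball 0 r. fAi (g x) - 2 / 3 * \<i> = - (x^2)) \<and>
     g 0 = \<i> \<and> deriv g 0 = exp (\<i> * of_real pi / 4)"

definition gS :: "complex \<Rightarrow> complex" where
  "gS = (SOME g. \<exists>r. is_g g r)"

definition phi_fun :: "real \<Rightarrow> real \<Rightarrow> real \<Rightarrow> real \<Rightarrow> complex \<Rightarrow> complex \<Rightarrow> complex" where
  "phi_fun \<tau>1 \<tau>2 u v x y =
     (x - \<i> * y) / (gS x - gS (\<i> * y)) *
     exp (- of_real v * gS x - of_real \<tau>2 * (gS x)^2 + of_real u * gS (\<i> * y) + of_real \<tau>1 * (gS (\<i> * y))^2)
     * deriv gS x * deriv (\<lambda>y. gS (\<i> * y)) y"

definition Phi_fun :: "real \<Rightarrow> real \<Rightarrow> real \<Rightarrow> real \<Rightarrow> complex \<Rightarrow> complex \<Rightarrow> complex" where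
  "Phi_fun \<tau>1 \<tau>2 u v x y =
     exp (- of_real v * gS x - of_real \<tau>2 * (gS x)^2 - of_real u * gS (- y) + of_real \<tau>1 * (gS (- y))^2)
     / (gS x + gS (- y))
     * deriv gS x * deriv (\<lambda>y. - gS (- y)) y"

text \<open>b_{k,l}: coefficients of the power series of phi at the origin (phi has a removable
  singularity on x = iy, where the series is not required to match the literal formula).\<close>
definition b_coef :: "real \<Rightarrow> real \<Rightarrow> real \<Rightarrow> real \<Rightarrow> nat \<Rightarrow> nat \<Rightarrow> complex" where
  "b_coef \<tau>1 \<tau>2 u v = (THE b. \<exists>r>0. \<forall>x y. x \<in> ball 0 r \<longrightarrow> y \<in> ball 0 r \<longrightarrow> x \<noteq> \<i> * y \<longrightarrow>
      ((\<lambda>(k, l). b k l * x^k * y^l) has_sum phi_fun \<tau>1 \<tau>2 u v x y) UNIV)"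

definition c_coef :: "real \<Rightarrow> real \<Rightarrow> real \<Rightarrow> real \<Rightarrow> nat \<Rightarrow> nat \<Rightarrow> complex" where
  "c_coef \<tau>1 \<tau>2 u v = (THE c. \<exists>r>0. \<forall>x y. x \<in> ball 0 r \<longrightarrow> y \<in> ball 0 r \<longrightarrow>
      ((\<lambda>(k, l). c k l * x^k * y^l) has_sum Phi_fun \<tau>1 \<tau>2 u v x y) UNIV)"

definition B_coef :: "nat \<Rightarrow> nat \<Rightarrow> complex" where
  "B_coef k l = (\<integral>p. of_real (exp (- ((fst p)^2 + (snd p)^2)) * (fst p)^k * (snd p)^l)
                      / (of_real (fst p) - \<i> * of_real (snd p)) \<partial>(lborel :: (real \<times> real) measure))"

definition f_S1 :: "real \<Rightarrow> real \<Rightarrow> real \<Rightarrow> real \<Rightarrow> real" where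
  "f_S1 \<tau>1 \<tau>2 u v = (u + v) * cos (u - v) - 2 * (\<tau>1 + \<tau>2) * sin (u - v)"

definition fluc_S1 :: "real \<Rightarrow> real \<Rightarrow> real \<Rightarrow> real \<Rightarrow> real \<Rightarrow> complex" where
  "fluc_S1 u v \<tau>1 \<tau>2 a =
     of_real pi / (2 * of_real pi * \<i>)^2 * of_real (1 / a powr (3/2)) * of_real (exp (- (\<tau>1 - \<tau>2)))
     * of_real (f_S1 \<tau>1 \<tau>2 u v + cos (4/3 * a powr (3/2) - (u + v)))"

definition K_Ai_scaled :: "real \<Rightarrow> real \<Rightarrow> real \<Rightarrow> real \<Rightarrow> real \<Rightarrow> complex" where
  "K_Ai_scaled a \<tau>1 \<tau>2 u v =
     of_real (1 / sqrt a) * K_Ai (\<tau>1 / a) (\<tau>2 / a) (u / sqrt a - a) (v / sqrt a - a)"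

end

theory Submission
  imports Defs "HOL-Probability.Probability" "HOL-Real_Asymp.Real_Asymp"
begin

text \<open>
  With \<open>\<Lambda> = a powr (3/2)\<close> the scaled Airy kernel is the double contour integral of
  \<open>exp (\<Lambda> * (f z - f w)) / (z - w)\<close> times an entire factor independent of \<open>\<Lambda>\<close>, with saddle points
  \<open>\<plusminus> \<i>\<close>. Deforming both contours to steepest descent paths through \<open>\<plusminus> \<i>\<close> makes them cross along the
  segment from \<open>- \<i>\<close> to \<open>\<i>\<close>, whose residue contribution is the sine kernel integral. The remaining
  double integral is, up to exponentially small terms, concentrated at the four pairs of saddle
  points. By conjugation symmetry it is twice the real part of the contributions with \<open>z\<close> near
  \<open>\<i>\<close>. There \<open>z = g x\<close>, with \<open>w = g (\<i> y)\<close> near \<open>\<i>\<close> or \<open>w = - g (- y)\<close> near \<open>- \<i>\<close>, turns the exponent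
  into \<open>- \<Lambda> (x^2 + y^2)\<close>, up to the constant \<open>4/3 \<i> \<Lambda>\<close> in the second case, and the integrands into
  \<open>\<phi>(x, y) / (x - \<i> y)\<close> and \<open>\<Phi>(x, y)\<close>. Since \<open>1 / (x - \<i> y)\<close> is homogeneous and locally
  integrable, Taylor expansion and rescaling give the complete expansion.
\<close>

text \<open>The obstacle is the pole at z = w. Both deformed contours pass through
  \<open>\<i>\<close> and \<open>- \<i>\<close>, so the double integral over them is singular at the
  saddle points themselves, and the deformation moves one variable at a time through pairs of
  contours that already touch. At every touching point the two contours lie in separated cones,
  which bounds 1 / (z - w) by a constant times 1 / sqrt (\<bar>t\<bar> * \<bar>s\<bar>) in the
  parameters measured from that point. This is locally integrable in the plane, so Fubini applies at
  each stage, and exceptional parameters form null sets.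

  Steepest descent is followed only along short arcs near the saddle points. Straight chords
  continue these arcs to the Airy contours, cut at modulus 2, and to the real axis. On the chords
  only a strictly negative bound on the real part of f matters, and beyond modulus 2 the cubic term
  dominates. All contours are thereby finite lists of compact edges.

  The parameters enter the error bounds only through a common bound B of their absolute values,
  whence the uniformity on compact sets.\<close>

section \<open>Bivariate power series\<close>

text \<open>Within half the radius the tail is dominated by a geometric series of ratio at most 1/2;
  its sum contributes the factor 2.\<close>

lemma power_series_tail_bound:
  fixes a :: "nat \<Rightarrow> complex"
  assumes a: "\<And>j. norm (a j) \<le> M / \<rho>^j" and \<rho>: "\<rho> > 0" and x: "norm x \<le> \<rho>/2"
    and s: "(\<lambda>j. a j * x^j) sums s"
  shows "norm (s - (\<Sum>j<n. a j * x^j)) \<le> 2 * M * (norm x / \<rho>)^n"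
proof -
  define q where "q = norm x / \<rho>"
  have q: "0 \<le> q" "q \<le> 1/2" using \<rho> x by (auto simp: q_def field_simps)
  have M: "M \<ge> 0" using norm_ge_zero[of "a 0"] a[of 0] by (simp del: norm_ge_zero)
  have le: "norm (a (j+n) * x^(j+n)) \<le> M * q^n * q^j" for j
  proof -
    have "norm (a (j+n) * x^(j+n)) \<le> M / \<rho>^(j+n) * norm x^(j+n)"
      unfolding norm_mult norm_power by (intro mult_right_mono a) auto
    also have "\<dots> = M * q^n * q^j" by (simp add: q_def power_divide power_add mult_ac)
    finally show ?thesis .
  qed
  have geo: "(\<lambda>j. M * q^n * q^j) sums (M * q^n * (1 / (1 - q)))"
    by (intro sums_mult geometric_sums) (use q in auto)
  have "(\<lambda>j. a (j+n) * x^(j+n)) sums (s - (\<Sum>j<n. a j * x^j))"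
    using sums_split_initial_segment[OF s] .
  hence "norm (s - (\<Sum>j<n. a j * x^j)) \<le> (\<Sum>j. M * q^n * q^j)"
    using norm_suminf_le[OF le sums_summable[OF geo]] by (simp add: sums_iff)
  also have "\<dots> = M * q^n * (1 / (1 - q))" using geo by (simp add: sums_iff)
  also have "\<dots> \<le> M * q^n * 2" by (intro mult_left_mono) (use q M in \<open>auto simp: field_simps\<close>)
  finally show ?thesis by (simp add: q_def mult_ac)
qed

text \<open>Separate holomorphy with a uniform bound is the form in which \<open>phi_ext\<close> and
  \<open>Phi_ext\<close> can be checked. The double power series is built from it by one-variable
  Cauchy theory; \<open>\<rho>\<close> < \<open>R\<close> leaves room for Cauchy's inequality on a
  closed disc.\<close>

locale bivariate_bounded =
  fixes h :: "complex \<Rightarrow> complex \<Rightarrow> complex" and R M \<rho> :: real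
  assumes holx: "\<And>y. y \<in> ball 0 R \<Longrightarrow> (\<lambda>x. h x y) holomorphic_on ball 0 R"
    and holy: "\<And>x. x \<in> ball 0 R \<Longrightarrow> h x holomorphic_on ball 0 R"
    and bound: "\<And>x y. x \<in> ball 0 R \<Longrightarrow> y \<in> ball 0 R \<Longrightarrow> norm (h x y) \<le> M"
    and \<rho>: "0 < \<rho>" "\<rho> < R"
begin

definition xcoeff :: "nat \<Rightarrow> complex \<Rightarrow> complex" where
  "xcoeff k y = (deriv ^^ k) (\<lambda>x. h x y) 0 / fact k"

definition coeff :: "nat \<Rightarrow> nat \<Rightarrow> complex" where
  "coeff k l = (deriv ^^ l) (xcoeff k) 0 / fact l"

lemma taylor_coeff_bound:
  assumes "f holomorphic_on ball 0 R" "\<And>x. x \<in> ball 0 R \<Longrightarrow> norm (f x) \<le> B"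
  shows "norm ((deriv ^^ k) f 0 / fact k) \<le> B / \<rho>^k"
proof -
  have "norm ((deriv ^^ k) f 0) \<le> fact k * B / \<rho>^k"
  proof (rule Cauchy_inequality)
    show "f holomorphic_on ball 0 \<rho>" using assms(1) by (rule holomorphic_on_subset) (use \<rho> in auto)
    show "continuous_on (cball 0 \<rho>) f"
      by (rule holomorphic_on_imp_continuous_on, rule holomorphic_on_subset[OF assms(1)]) (use \<rho> in auto)
  qed (use \<rho> assms(2) in auto)
  thus ?thesis by (simp add: norm_divide field_simps)
qed

lemma xcoeff_bound: "y \<in> ball 0 R \<Longrightarrow> norm (xcoeff k y) \<le> M / \<rho>^k"
  unfolding xcoeff_def by (rule taylor_coeff_bound) (auto intro: holx bound)

lemma xcoeff_sums:
  assumes "x \<in> ball 0 R" "y \<in> ball 0 R"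
  shows "(\<lambda>k. xcoeff k y * x^k) sums h x y"
  using holomorphic_power_series[OF holx[OF assms(2)] assms(1)] by (simp add: xcoeff_def)

text \<open>Induction on k: for fixed x \<noteq> 0 the remainder of the x-expansion after the terms
  below k, divided by x^k, is holomorphic in y. As x tends to 0 it converges to
  \<open>xcoeff k y\<close> uniformly in y, and uniform limits preserve holomorphy.\<close>

lemma xcoeff_holomorphic: "xcoeff k holomorphic_on ball 0 R"
proof (induction k rule: less_induct)
  case (less k)
  define x where "x n = complex_of_real (\<rho>/2 / real (Suc n))" for n
  have nx: "norm (x n) = \<rho>/2 / real (Suc n)" for n
    using \<rho> unfolding x_def norm_of_real by (intro abs_of_nonneg) auto
  have nx2: "norm (x n) \<le> \<rho>/2" for n unfolding nx using \<rho> by (simp add: field_simps)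
  have x0: "x n \<noteq> 0" for n using \<rho> by (simp add: x_def del: of_nat_Suc)
  have xR: "x n \<in> ball 0 R" for n using nx2[of n] \<rho> by simp
  define F where "F n y = (h (x n) y - (\<Sum>j<k. xcoeff j y * x n^j)) / x n^k" for n y
  have M: "M \<ge> 0" using bound[of 0 0] \<rho> order.trans[OF norm_ge_zero] by fastforce
  have err: "norm (F n y - xcoeff k y) \<le> 2*M/\<rho>^(k+1) * norm (x n)" if y: "y \<in> ball 0 R" for n y
  proof -
    have "norm (h (x n) y - (\<Sum>j<Suc k. xcoeff j y * x n^j)) \<le> 2 * M * (norm (x n) / \<rho>)^(Suc k)"
      by (rule power_series_tail_bound[OF _ _ nx2 xcoeff_sums]) (use \<rho> xcoeff_bound[OF y] y xR in auto)
    moreover have "F n y - xcoeff k y = (h (x n) y - (\<Sum>j<Suc k. xcoeff j y * x n^j)) / x n^k"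
      using x0[of n] by (simp add: F_def field_simps)
    ultimately have "norm (F n y - xcoeff k y) \<le> 2 * M * (norm (x n) / \<rho>)^(Suc k) / norm (x n)^k"
      by (metis (no_types, lifting) norm_divide norm_power divide_right_mono norm_ge_zero zero_le_power)
    also have "\<dots> = 2*M/\<rho>^(k+1) * norm (x n)" using x0[of n] by (simp add: power_divide field_simps)
    finally show ?thesis .
  qed
  have lim: "(\<lambda>n. 2*M/\<rho>^(k+1) * norm (x n)) \<longlonglongrightarrow> 2*M/\<rho>^(k+1) * 0"
    unfolding nx by (intro tendsto_intros LIMSEQ_Suc[OF lim_const_over_n])
  have ul: "uniform_limit (ball 0 R) F (xcoeff k) sequentially"
  proof (rule uniform_limitI)
    fix e :: real assume "e > 0"
    with lim have "\<forall>\<^sub>F n in sequentially. 2*M/\<rho>^(k+1) * norm (x n) < e"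
      by (auto dest: order_tendstoD(2))
    thus "\<forall>\<^sub>F n in sequentially. \<forall>y\<in>ball 0 R. dist (F n y) (xcoeff k y) < e"
      by eventually_elim (use err le_less_trans in \<open>unfold dist_norm, blast\<close>)
  qed
  show ?case
  proof (rule holomorphic_uniform_sequence[of _ F])
    show "F n holomorphic_on ball 0 R" for n
      unfolding F_def using x0 by (intro holomorphic_intros holy xR less.IH) auto
    fix y :: complex assume "y \<in> ball 0 R"
    then obtain d where "d > 0" "cball y d \<subseteq> ball 0 R" by (meson open_ball open_contains_cball)
    thus "\<exists>d. 0 < d \<and> cball y d \<subseteq> ball 0 R \<and> uniform_limit (cball y d) F (xcoeff k) sequentially"
      using uniform_limit_on_subset[OF ul] by blast
  qed auto
qed

lemma coeff_bound: "norm (coeff k l) \<le> M / \<rho>^(k+l)"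
  using taylor_coeff_bound[OF xcoeff_holomorphic[of k] xcoeff_bound[of _ k], where k=l]
  by (simp add: coeff_def power_add field_simps)

lemma coeff_sums: "y \<in> ball 0 R \<Longrightarrow> (\<lambda>l. coeff k l * y^l) sums xcoeff k y"
  using holomorphic_power_series[OF xcoeff_holomorphic[of k], of y] by (simp add: coeff_def)

text \<open>Absolute summability comes from the majorant \<open>M * (p^k * q^l)\<close> with p, q <
  1. The value is then identified by summing over l first.\<close>

lemma coeff_has_sum:
  assumes x: "x \<in> ball 0 \<rho>" and y: "y \<in> ball 0 \<rho>"
  shows "((\<lambda>(k, l). coeff k l * x^k * y^l) has_sum h x y) UNIV"
proof -
  define p q where "p = norm x / \<rho>" and "q = norm y / \<rho>"
  have pq: "0 \<le> p" "p < 1" "0 \<le> q" "q < 1" using \<rho> x y by (auto simp: p_def q_def)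
  have M: "M \<ge> 0" using bound[of 0 0] \<rho> order.trans[OF norm_ge_zero] by fastforce
  have R: "x \<in> ball 0 R" "y \<in> ball 0 R" using x y \<rho> by auto
  have s1: "(\<lambda>(k, l). M * (p^k * q^l)) summable_on (UNIV \<times> UNIV)"
  proof -
    have geo: "((\<lambda>k. t^k) has_sum (1/(1-t))) UNIV" if "0 \<le> t" "t < 1" for t :: real
      using that by (intro norm_summable_imp_has_sum geometric_sums summable_geometric)
          (auto simp: norm_power summable_geometric)
    have i1: "((\<lambda>l. M * (p^k * q^l)) has_sum M * (p^k * (1/(1-q)))) UNIV" for k
      by (intro has_sum_cmult_right geo pq)
    have i2: "(\<lambda>k. M * (p^k * (1/(1-q)))) summable_on UNIV"
      using geo[OF pq(1,2)] by (intro summable_on_cmult_right summable_on_cmult_left) (auto simp: summable_on_def)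
    show ?thesis
      by (rule summable_on_SigmaI[where g="\<lambda>k. M * (p^k * (1/(1-q)))"]) (use i1 i2 pq M in auto)
  qed
  have "(\<lambda>kl. norm (case kl of (k, l) \<Rightarrow> coeff k l * x^k * y^l)) summable_on (UNIV \<times> UNIV)"
  proof (rule Infinite_Sum.abs_summable_on_comparison_test'[OF s1])
    fix kl :: "nat \<times> nat"
    show "norm (case kl of (k, l) \<Rightarrow> coeff k l * x^k * y^l) \<le> (case kl of (k, l) \<Rightarrow> M * (p^k * q^l))"
    proof (cases kl)
      case (Pair k l)
      have "norm (coeff k l * x^k * y^l) \<le> M / \<rho>^(k+l) * norm x^k * norm y^l"
        unfolding norm_mult norm_power by (intro mult_right_mono coeff_bound) auto
      also have "\<dots> = M * (p^k * q^l)" by (simp add: p_def q_def power_divide power_add)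
      finally show ?thesis using Pair by simp
    qed
  qed
  hence sm: "(\<lambda>(k, l). coeff k l * x^k * y^l) summable_on (UNIV \<times> UNIV)"
    by (rule Infinite_Sum.abs_summable_summable)
  then obtain s where s: "((\<lambda>(k, l). coeff k l * x^k * y^l) has_sum s) (UNIV \<times> UNIV)"
    by (auto simp: summable_on_def)
  have inner: "((\<lambda>l. coeff k l * x^k * y^l) has_sum xcoeff k y * x^k) UNIV" for k
  proof -
    have "(\<lambda>l. coeff k l * x^k * y^l) summable_on UNIV"
      using summable_on_SigmaD1[where f="\<lambda>k l. coeff k l * x^k * y^l" and A=UNIV and B="\<lambda>_. UNIV" and x=k] sm by simp
    then obtain t where t: "((\<lambda>l. coeff k l * x^k * y^l) has_sum t) UNIV" by (auto simp: summable_on_def)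
    moreover have "(\<lambda>l. coeff k l * x^k * y^l) sums (xcoeff k y * x^k)"
      using sums_mult2[OF coeff_sums[OF R(2)], of k "x^k"] by (simp add: mult_ac)
    ultimately show ?thesis using has_sum_imp_sums[OF t] sums_unique2 by blast
  qed
  have "((\<lambda>k. xcoeff k y * x^k) has_sum s) UNIV"
    by (rule has_sum_SigmaD[OF s[unfolded case_prod_unfold]]) (use inner in auto)
  hence "s = h x y" using xcoeff_sums[OF R] has_sum_imp_sums sums_unique2 by blast
  thus ?thesis using s by simp
qed

text \<open>The triangle k + l < m is reached by cutting the x-series at m and then, for each k < m,
  the y-series of \<open>xcoeff k\<close> at m - k. Each of the m + 1 errors is of degree m in norm
  x + norm y, so the bound is homogeneous, as the rescaling in \<open>watson_2d\<close>
  requires.\<close>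

lemma taylor_remainder:
  assumes x: "norm x \<le> \<rho>/2" and y: "norm y \<le> \<rho>/2"
  shows "norm (h x y - (\<Sum>k<m. \<Sum>l<m-k. coeff k l * x^k * y^l))
      \<le> 2 * M * (m + 1) * ((norm x + norm y) / \<rho>)^m"
proof -
  define s where "s = (norm x + norm y) / \<rho>"
  have R: "x \<in> ball 0 R" "y \<in> ball 0 R" using x y \<rho> by auto
  have M: "M \<ge> 0" using bound[of 0 0] \<rho> order.trans[OF norm_ge_zero] by fastforce
  have le: "norm x / \<rho> \<le> s" "norm y / \<rho> \<le> s" "0 \<le> norm x / \<rho>" "0 \<le> norm y / \<rho>" "0 \<le> s"
    using \<rho> by (auto simp: s_def divide_right_mono)
  have A: "norm (h x y - (\<Sum>k<m. xcoeff k y * x^k)) \<le> 2 * M * s^m"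
  proof -
    have "norm (h x y - (\<Sum>k<m. xcoeff k y * x^k)) \<le> 2 * M * (norm x / \<rho>)^m"
      by (rule power_series_tail_bound[OF xcoeff_bound[OF R(2)] \<rho>(1) x xcoeff_sums[OF R]])
    also have "\<dots> \<le> 2 * M * s^m" using M le by (intro mult_left_mono power_mono) auto
    finally show ?thesis .
  qed
  have B: "norm ((xcoeff k y - (\<Sum>l<m-k. coeff k l * y^l)) * x^k) \<le> 2 * M * s^m" if "k < m" for k
  proof -
    have "norm (xcoeff k y - (\<Sum>l<m-k. coeff k l * y^l)) \<le> 2 * (M / \<rho>^k) * (norm y / \<rho>)^(m-k)"
      by (rule power_series_tail_bound[OF _ \<rho>(1) y coeff_sums[OF R(2)]])
        (use coeff_bound[of k] in \<open>simp add: power_add\<close>)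
    hence "norm ((xcoeff k y - (\<Sum>l<m-k. coeff k l * y^l)) * x^k)
       \<le> 2 * (M / \<rho>^k) * (norm y / \<rho>)^(m-k) * norm x^k"
      unfolding norm_mult norm_power by (intro mult_right_mono) auto
    also have "\<dots> = 2 * M * ((norm y / \<rho>)^(m-k) * (norm x / \<rho>)^k)" by (simp add: power_divide mult_ac)
    also have "\<dots> \<le> 2 * M * (s^(m-k) * s^k)"
      using M le by (intro mult_left_mono mult_mono power_mono) auto
    also have "s^(m-k) * s^k = s^m" using that by (simp flip: power_add)
    finally show ?thesis .
  qed
  have "h x y - (\<Sum>k<m. \<Sum>l<m-k. coeff k l * x^k * y^l) =
     (h x y - (\<Sum>k<m. xcoeff k y * x^k)) + (\<Sum>k<m. (xcoeff k y - (\<Sum>l<m-k. coeff k l * y^l)) * x^k)"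
    by (simp add: sum_subtractf algebra_simps sum_distrib_left)
  also have "norm \<dots> \<le> 2 * M * s^m + (\<Sum>k<m. 2 * M * s^m)"
    by (intro norm_triangle_mono A order.trans[OF norm_sum] sum_mono B) auto
  also have "\<dots> = 2 * M * (m + 1) * s^m" by (simp add: algebra_simps)
  finally show ?thesis by (simp add: s_def)
qed

end

section \<open>Uniqueness of power series coefficients\<close>

lemma power_series_unique:
  fixes a b :: "nat \<Rightarrow> complex"
  assumes "r > 0" and "\<And>x. x \<in> ball 0 r \<Longrightarrow> x \<noteq> 0 \<Longrightarrow> (\<lambda>n. a n * x^n) sums f x"
    and "\<And>x. x \<in> ball 0 r \<Longrightarrow> x \<noteq> 0 \<Longrightarrow> (\<lambda>n. b n * x^n) sums f x"
  shows "a = b"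
proof (rule ccontr)
  assume "a \<noteq> b"
  define d where "d n = a n - b n" for n
  from \<open>a \<noteq> b\<close> have "\<exists>n. d n \<noteq> 0" by (auto simp: d_def fun_eq_iff)
  define m where "m = (LEAST n. d n \<noteq> 0)"
  have m: "d m \<noteq> 0" using LeastI_ex[OF \<open>\<exists>n. d n \<noteq> 0\<close>] by (simp add: m_def)
  have m': "d n = 0" if "n < m" for n using not_less_Least that by (auto simp: m_def)
  \<comment> \<open>With m the first index of disagreement, division by x^m leaves a series that
    vanishes off the origin and has constant term \<open>d m\<close>; its limit at 0 gives the
    contradiction.\<close>
  have s: "(\<lambda>n. d (n + m) * x^n) sums 0" if x: "x \<in> ball 0 r" "x \<noteq> 0" for x
  proof -
    have "(\<lambda>n. d n * x^n) sums 0"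
      using sums_diff[OF assms(2,3)[OF x]] by (simp add: d_def left_diff_distrib)
    hence "(\<lambda>n. d (n + m) * x^(n+m)) sums 0" using m' sums_zero_iff_shift[of m "\<lambda>n. d n * x^n"] by simp
    from sums_divide[OF this, of "x^m"] show ?thesis using x by (simp add: power_add)
  qed
  have "((\<lambda>x. 0::complex) \<longlongrightarrow> d m) (at (0::complex))"
    using powser_limit_0_strong[OF \<open>r>0\<close>, of "\<lambda>n. d (n + m)" "\<lambda>_. 0"] s by simp
  hence "d m = 0" by (simp add: tendsto_const_iff)
  with m show False by simp
qed

text \<open>The excluded line x = \<i> y is avoided by fixing y \<noteq> 0 and restricting x to 0 <
  norm x < norm y. Uniqueness in x identifies the coefficient functions of y, uniqueness in y then
  the coefficients. This evaluates the definite descriptions in \<open>b_coef\<close> and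
  \<open>c_coef\<close>.\<close>

lemma bivariate_coeff_unique:
  fixes b b' :: "nat \<Rightarrow> nat \<Rightarrow> complex"
  assumes r: "r > 0" "r' > 0"
    and b: "\<And>x y. x \<in> ball 0 r \<Longrightarrow> y \<in> ball 0 r \<Longrightarrow> x \<noteq> \<i> * y \<Longrightarrow> ((\<lambda>(k, l). b k l * x^k * y^l) has_sum f x y) UNIV"
    and b': "\<And>x y. x \<in> ball 0 r' \<Longrightarrow> y \<in> ball 0 r' \<Longrightarrow> x \<noteq> \<i> * y \<Longrightarrow> ((\<lambda>(k, l). b' k l * x^k * y^l) has_sum f x y) UNIV"
  shows "b = b'"
proof -
  define s where "s = min r r'"
  have inner: "\<exists>A. (\<forall>k. (\<lambda>l. b k l * y^l) sums A k) \<and> (\<lambda>k. A k * x^k) sums f x y"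
    if b: "((\<lambda>(k, l). b k l * x^k * y^l) has_sum f x y) UNIV" and x: "x \<noteq> 0" for x y b
  proof -
    have sm: "(\<lambda>(k, l). b k l * x^k * y^l) summable_on (UNIV \<times> UNIV)"
      using b by (auto simp: summable_on_def)
    have "(\<lambda>l. b k l * x^k * y^l) summable_on UNIV" for k
      using summable_on_SigmaD1[where f="\<lambda>k l. b k l * x^k * y^l" and A=UNIV and B="\<lambda>_. UNIV" and x=k] sm by simp
    then obtain t where t: "\<And>k. ((\<lambda>l. b k l * x^k * y^l) has_sum t k) UNIV"
      unfolding summable_on_def by metis
    have "(t has_sum f x y) UNIV"
      by (rule has_sum_SigmaD[where f="\<lambda>(k,l). b k l * x^k * y^l" and B="\<lambda>_. UNIV"]) (use b t in auto)
    hence 1: "t sums f x y" by (rule has_sum_imp_sums)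
    have 2: "(\<lambda>l. b k l * y^l) sums (t k / x^k)" for k
      using sums_divide[OF has_sum_imp_sums[OF t], of k "x^k"] x by (simp add: field_simps)
    show ?thesis by (rule exI[of _ "\<lambda>k. t k / x^k"]) (use 1 2 x in auto)
  qed
  have S: "(\<lambda>l. b k l * y^l) sums (\<Sum>l. b' k l * y^l)" "(\<lambda>l. b' k l * y^l) sums (\<Sum>l. b' k l * y^l)"
    if y: "y \<in> ball 0 s" "y \<noteq> 0" for y k
  proof -
    have *: "\<exists>A A'. (\<forall>k. (\<lambda>l. b k l * y^l) sums A k) \<and> (\<lambda>k. A k * x^k) sums f x y
        \<and> (\<forall>k. (\<lambda>l. b' k l * y^l) sums A' k) \<and> (\<lambda>k. A' k * x^k) sums f x y"
      if x: "x \<in> ball 0 (norm y)" "x \<noteq> 0" for x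
    proof -
      have "x \<noteq> \<i> * y" using x by (auto simp: norm_mult)
      with x y show ?thesis using inner[OF b] inner[OF b'] by (auto simp: s_def)
    qed
    \<comment> \<open>The sample point y/2 serves to extract the inner sums \<open>A\<close> and
      \<open>A'\<close>, which do not depend on x.\<close>
    have "y/2 \<in> ball 0 (norm y)" "y/2 \<noteq> 0" using y by (auto simp: norm_divide)
    from *[OF this] obtain A A' where A: "\<And>k. (\<lambda>l. b k l * y^l) sums A k" "\<And>k. (\<lambda>l. b' k l * y^l) sums A' k" by blast
    have AA: "(\<lambda>k. A k * x^k) sums f x y" "(\<lambda>k. A' k * x^k) sums f x y"
      if "x \<in> ball 0 (norm y)" "x \<noteq> 0" for x
      using *[OF that] sums_unique2[OF A(1)] sums_unique2[OF A(2)] by (metis (no_types, lifting) sums_cong)+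
    have "A = A'" by (rule power_series_unique[of "norm y" A "\<lambda>x. f x y"]) (use y AA in auto)
    thus "(\<lambda>l. b k l * y^l) sums (\<Sum>l. b' k l * y^l)" "(\<lambda>l. b' k l * y^l) sums (\<Sum>l. b' k l * y^l)"
      using A by (metis sums_unique)+
  qed
  show ?thesis
  proof
    fix k show "b k = b' k"
      by (rule power_series_unique[of s _ "\<lambda>y. (\<Sum>l. b' k l * y^l)"]) (use r S in \<open>auto simp: s_def\<close>)
  qed
qed

section \<open>The local inverse at the saddle point\<close>

abbreviation e8 :: complex where "e8 \<equiv> exp (\<i> * of_real pi / 4)"

lemma e8_eq: "e8 = Complex (sqrt 2 / 2) (sqrt 2 / 2)"
  by (simp add: complex_eq_iff Re_exp Im_exp cos_45 sin_45)

lemma e8_squared: "e8^2 = \<i>"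
  by (simp add: e8_eq complex_eq_iff power2_eq_square)

text \<open>Since fAi z - 2/3 \<i> = \<i> (z - \<i>)^2 + (z - \<i>)^3 / 3 has a double zero at \<i>,
  its negative has the explicit holomorphic square root \<open>\<psi>\<close> there, with derivative
  1 / e8. The function g is a local inverse of \<open>\<psi>\<close>.\<close>

lemma is_g_exists: "\<exists>g r. is_g g r"
proof -
  define s where "s z = csqrt (1 + (z - \<i>) / (3 * \<i>))" for z
  define \<psi> where "\<psi> z = (z - \<i>) / e8 * s z" for z
  have Re: "1 + (z - \<i>) / (3 * \<i>) \<notin> \<real>\<^sub>\<le>\<^sub>0" if "z \<in> ball \<i> 1" for z
  proof
    assume "1 + (z - \<i>) / (3 * \<i>) \<in> \<real>\<^sub>\<le>\<^sub>0"
    hence "Re (1 + (z - \<i>) / (3 * \<i>)) \<le> 0" using complex_nonpos_Reals_iff by blast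
    moreover have "\<bar>Re ((z - \<i>) / (3 * \<i>))\<bar> \<le> norm ((z - \<i>) / (3 * \<i>))" by (rule abs_Re_le_cmod)
    moreover have "norm ((z - \<i>) / (3 * \<i>)) < 1"
      using that by (simp add: norm_divide norm_mult dist_norm norm_minus_commute)
    ultimately show False by simp
  qed
  have hol: "\<psi> holomorphic_on ball \<i> 1"
    unfolding \<psi>_def s_def using Re by (intro holomorphic_intros) (auto simp: s_def)
  have hs: "s holomorphic_on ball \<i> 1"
    unfolding s_def using Re by (intro holomorphic_intros) auto
  have sd: "(s has_field_derivative deriv s \<i>) (at \<i>)"
    using hs by (intro holomorphic_derivI[of _ "ball \<i> 1"]) auto
  have "(\<psi> has_field_derivative (1 / e8 * s \<i> + deriv s \<i> * ((\<i> - \<i>) / e8))) (at \<i>)"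
    unfolding \<psi>_def by (rule DERIV_mult[OF _ sd]) (auto intro!: derivative_eq_intros)
  hence d\<psi>: "(\<psi> has_field_derivative (1 / e8)) (at \<i>)" by (simp add: s_def)
  have sq: "fAi z - 2/3 * \<i> = - ((\<psi> z)^2)" for z
  proof -
    have "(\<psi> z)^2 = (z - \<i>)^2 / \<i> * (1 + (z - \<i>) / (3 * \<i>))"
      by (simp add: \<psi>_def s_def power_mult_distrib power_divide e8_squared)
    also have "\<dots> = - (fAi z - 2/3 * \<i>)"
      by (simp add: fAi_def divide_simps) (simp add: algebra_simps power2_eq_square power3_eq_cube)
    finally show ?thesis by simp
  qed
  obtain r0 where r0: "r0 > 0" "ball \<i> r0 \<subseteq> ball \<i> 1" "open (\<psi> ` ball \<i> r0)" "inj_on \<psi> (ball \<i> r0)"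
    by (rule has_complex_derivative_locally_invertible[OF hol, of \<i>])
       (use DERIV_imp_deriv[OF d\<psi>] in auto)
  obtain g where g: "g holomorphic_on (\<psi> ` ball \<i> r0)"
    "\<And>z. z \<in> ball \<i> r0 \<Longrightarrow> deriv \<psi> z * deriv g (\<psi> z) = 1" "\<And>z. z \<in> ball \<i> r0 \<Longrightarrow> g (\<psi> z) = z"
    by (rule holomorphic_has_inverse[OF holomorphic_on_subset[OF hol r0(2)] open_ball r0(4)]) blast
  have \<psi>0: "\<psi> \<i> = 0" by (simp add: \<psi>_def)
  have "0 \<in> \<psi> ` ball \<i> r0" using \<psi>0 r0(1) by (metis centre_in_ball image_eqI)
  then obtain r where r: "r > 0" "ball 0 r \<subseteq> \<psi> ` ball \<i> r0"
    using r0(3) open_contains_ball by blast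
  have "deriv g 0 = e8"
    using g(2)[of \<i>] r0(1) DERIV_imp_deriv[OF d\<psi>] \<psi>0 by (simp add: field_simps)
  moreover have "fAi (g x) - 2 / 3 * \<i> = - (x^2)" if "x \<in> ball 0 r" for x
    using r(2) that g(3) sq by auto
  moreover have "g 0 = \<i>" using g(3)[of \<i>] r0(1) \<psi>0 by simp
  ultimately have "is_g g r"
    unfolding is_g_def using r g(1) holomorphic_on_subset by blast
  thus ?thesis by blast
qed

lemma gS_is_g: "\<exists>r. is_g gS r"
  unfolding gS_def using someI_ex[OF is_g_exists] .

lemma is_g_linearization:
  assumes "is_g g r" "\<epsilon> > 0"
  shows "\<exists>\<delta>>0. \<forall>x\<in>ball 0 \<delta>. norm (g x - \<i> - e8 * x) \<le> \<epsilon> * norm x"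
proof -
  have "(g has_field_derivative e8) (at 0)"
    using assms holomorphic_derivI[of g "ball 0 r" 0] by (auto simp: is_g_def)
  hence "(g has_derivative (\<lambda>x. e8 * x)) (at 0)"
    by (simp add: has_field_derivative_def)
  then obtain d where "d > 0" "\<And>y. norm (y - 0) < d \<Longrightarrow> norm (g y - g 0 - e8 * (y - 0)) \<le> \<epsilon> * norm (y - 0)"
    unfolding has_derivative_at_alt using assms(2) by blast
  thus ?thesis using assms(1) by (intro exI[of _ d]) (auto simp: is_g_def)
qed

text \<open>Writing the two values as \<i> + a and \<i> + b, equality of \<open>fAi\<close> says
  that (a - b) times 3 \<i> (a + b) + a^2 + a b + b^2 is 0. Both a and b equal e8 * x up to a tenth
  of norm x, so 3 \<i> (a + b) has norm at least 5.4 norm x, whereas for norm x \<le> 1/10 the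
  quadratic part is at most 0.363 norm x. Hence a = b. The lemma is applied to \<open>gS\<close> and
  its mirror image.\<close>

lemma is_g_unique:
  assumes "is_g g r" "is_g h s"
  shows "\<exists>\<delta>>0. \<forall>x\<in>ball 0 \<delta>. g x = h x"
proof -
  obtain d1 d2 where d: "d1 > 0" "d2 > 0"
    and d1: "\<And>x. x \<in> ball 0 d1 \<Longrightarrow> norm (g x - \<i> - e8 * x) \<le> 1/10 * norm x"
    and d2: "\<And>x. x \<in> ball 0 d2 \<Longrightarrow> norm (h x - \<i> - e8 * x) \<le> 1/10 * norm x"
    using is_g_linearization[OF assms(1), of "1/10"] is_g_linearization[OF assms(2), of "1/10"] by fastforce
  define \<delta> where "\<delta> = Min {d1, d2, r, s, 1/10}"
  have rs: "r > 0" "s > 0" using assms by (auto simp: is_g_def)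
  have "g x = h x" if x: "x \<in> ball 0 \<delta>" for x
  proof (rule ccontr)
    assume ne: "g x \<noteq> h x"
    hence x0: "x \<noteq> 0" using assms by (auto simp: is_g_def)
    define a b where "a = g x - \<i>" and "b = h x - \<i>"
    have "fAi (g x) = fAi (h x)"
    proof -
      have "fAi (g x) - 2 / 3 * \<i> = fAi (h x) - 2 / 3 * \<i>"
        using assms x by (simp add: is_g_def \<delta>_def)
      thus ?thesis by simp
    qed
    moreover have "(a - b) * (3 * \<i> * (a + b) + (a^2 + a*b + b^2)) = 3 * (fAi (g x) - fAi (h x))"
      by (simp add: fAi_def a_def b_def field_simps power2_eq_square power3_eq_cube)
    ultimately have "(a - b) * (3 * \<i> * (a + b) + (a^2 + a*b + b^2)) = 0" by simp
    hence "3 * \<i> * (a + b) = - (a^2 + a*b + b^2)"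
      using ne by (simp add: a_def b_def) (simp add: algebra_simps eq_neg_iff_add_eq_0)
    hence eq: "norm (3 * \<i> * (a + b)) = norm (a^2 + a*b + b^2)" by (simp only: norm_minus_cancel)
    have ne8: "norm (e8 * x) = norm x" by (simp add: norm_mult norm_exp_eq_Re)
    have A: "norm (a - e8 * x) \<le> 1/10 * norm x" "norm (b - e8 * x) \<le> 1/10 * norm x"
      using d1 d2 x by (auto simp: a_def b_def \<delta>_def)
    have nx: "norm x \<le> 1/10" using x by (auto simp: \<delta>_def)
    have na: "norm a \<le> 11/10 * norm x" "norm b \<le> 11/10 * norm x"
      using A norm_triangle_sub[of a "e8*x"] norm_triangle_sub[of b "e8*x"] ne8 by auto
    have "2 * (e8 * x) = (a + b) - (a - e8 * x) - (b - e8 * x)" by algebra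
    hence "norm (2 * (e8 * x)) = norm ((a + b) - (a - e8 * x) - (b - e8 * x))" by (rule arg_cong)
    also have "\<dots> \<le> norm (a + b) + norm (a - e8 * x) + norm (b - e8 * x)"
      by (meson norm_triangle_ineq4 order_trans add_right_mono)
    finally have "norm (2 * (e8 * x)) \<le> norm (a + b) + norm (a - e8 * x) + norm (b - e8 * x)" .
    moreover have "norm (2 * (e8 * x)) = 2 * norm x" using ne8 by (simp only: norm_mult[of 2]) simp
    ultimately have 1: "norm (a + b) \<ge> 18/10 * norm x" using A by linarith
    have "norm (a^2 + a*b + b^2) \<le> norm (a^2 + a*b) + norm (b^2)" by (rule norm_triangle_ineq)
    also have "\<dots> \<le> norm (a^2) + norm (a*b) + norm (b^2)" using norm_triangle_ineq[of "a^2" "a*b"] by simp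
    also have "\<dots> \<le> (11/10*norm x)^2 + (11/10 * norm x) * (11/10 * norm x) + (11/10*norm x)^2"
      unfolding norm_mult norm_power using na by (intro add_mono mult_mono power_mono) auto
    also have "\<dots> = 363/100 * (norm x * norm x)" by (simp add: power2_eq_square)
    also have "\<dots> \<le> 363/100 * (1/10 * norm x)" using nx by (intro mult_left_mono mult_right_mono) auto
    finally have "norm (a^2 + a*b + b^2) \<le> 363/1000 * norm x" by simp
    moreover have "norm x > 0" using x0 by simp
    ultimately have "norm (3 * \<i> * (a + b)) < 1 * norm x" unfolding eq by linarith
    moreover have "norm (3 * \<i> * (a + b)) = 3 * norm (a + b)" by (simp add: norm_mult)
    ultimately show False using 1 \<open>norm x > 0\<close> by linarith
  qed
  thus ?thesis using d rs by (intro exI[of _ \<delta>]) (auto simp: \<delta>_def)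
qed

text \<open>
  Together with uniqueness this gives \<open>g (\<i> y) = - cnj (g y)\<close> for real \<open>y\<close>: the steepest
  descent path of \<open>w\<close> is the mirror image of that of \<open>z\<close>.
\<close>

lemma is_g_mirror:
  assumes "is_g g r"
  shows "is_g (\<lambda>x. - cnj (g (cnj (- \<i> * x)))) r"
proof -
  have r: "r > 0" and hol: "g holomorphic_on ball 0 r" and g0: "g 0 = \<i>" "deriv g 0 = e8"
    and eq: "\<And>x. x \<in> ball 0 r \<Longrightarrow> fAi (g x) - 2 / 3 * \<i> = - (x^2)"
    using assms by (auto simp: is_g_def)
  have der: "((\<lambda>x. - cnj (g (cnj (- \<i> * x)))) has_field_derivative - (cnj (deriv g (cnj (- \<i> * x))) * (- \<i>))) (at x)"
    if "x \<in> ball 0 r" for x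
  proof -
    have "(g has_field_derivative deriv g (cnj (- \<i> * x))) (at (cnj (- \<i> * x)))"
      using that by (intro holomorphic_derivI[OF hol]) (auto simp: norm_mult)
    hence 1: "((cnj \<circ> g \<circ> cnj) has_field_derivative cnj (deriv g (cnj (- \<i> * x)))) (at (- \<i> * x))"
      by (simp only: has_field_derivative_cnj_cnj complex_cnj_cnj)
    have 2: "((\<lambda>x. - \<i> * x) has_field_derivative - \<i>) (at x)"
      by (auto intro!: derivative_eq_intros)
    show ?thesis
      using DERIV_chain2[where f="cnj \<circ> g \<circ> cnj" and g="\<lambda>x. - \<i> * x", OF 1 2]
      by (intro DERIV_minus) (simp add: o_def)
  qed
  show ?thesis unfolding is_g_def
  proof (intro conjI ballI)
    show "(\<lambda>x. - cnj (g (cnj (- \<i> * x)))) holomorphic_on ball 0 r"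
      using der by (meson field_differentiable_at_within field_differentiable_def holomorphic_on_def)
    have "cnj e8 * \<i> = e8" by (simp add: e8_eq complex_eq_iff)
    thus "deriv (\<lambda>x. - cnj (g (cnj (- \<i> * x)))) 0 = e8"
      using DERIV_imp_deriv[OF der[of 0]] r g0 by simp
    fix x :: complex assume x: "x \<in> ball 0 r"
    have "fAi (- cnj w) = - cnj (fAi w)" for w by (simp add: fAi_def power3_eq_cube)
    moreover have "fAi (g (cnj (- \<i> * x))) = 2/3 * \<i> - (cnj (- \<i> * x))^2"
      using eq[of "cnj (- \<i> * x)"] x by (simp add: norm_mult algebra_simps)
    ultimately show "fAi (- cnj (g (cnj (- \<i> * x)))) - 2 / 3 * \<i> = - (x^2)"
      by (simp add: power_mult_distrib)
  qed (use r g0 in auto)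
qed

section \<open>Double integrals over pairs of edges\<close>

text \<open>One factor of a product majorant: 1 / sqrt \<bar>t\<bar> takes one half of a singularity
  such as 1 / (x - \<i> y), because \<bar>x\<bar> \<bar>y\<bar> \<le> x^2 + y^2. The power m
  provides for moments, the Gaussian for decay at infinity.\<close>

definition sing_weight :: "nat \<Rightarrow> real \<Rightarrow> real" where
  "sing_weight m t = exp (- (t^2)) * (1 + \<bar>t\<bar>)^m / sqrt \<bar>t\<bar>"

lemma sing_weight_nonneg: "sing_weight m t \<ge> 0" by (simp add: sing_weight_def)

lemma sing_weight_measurable [measurable]: "sing_weight m \<in> borel_measurable borel"
  unfolding sing_weight_def by measurable

lemma integrable_gauss_even: "integrable lborel (\<lambda>x::real. exp (- (x^2)) * x^(2*k))"
proof -
  have "has_bochner_integral lborel (\<lambda>x::real. exp (- (x^2)) * x^(2*k))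
      (2 * ((sqrt pi / 2) * (fact (2 * k) / (2 ^ (2 * k) * fact k))))"
    using has_bochner_integral_even_function[OF gaussian_moment_even_pos[where k=k]] by simp
  thus ?thesis by (simp add: has_bochner_integral_iff)
qed

lemma integrable_gauss_poly: "integrable lborel (\<lambda>x::real. exp (- (x^2)) * (1 + \<bar>x\<bar>)^m)"
proof (rule Bochner_Integration.integrable_bound)
  show "integrable lborel (\<lambda>x::real. 2^m * (exp (- (x^2)) * x^(2*0) + exp (- (x^2)) * x^(2*m)))"
    by (intro integrable_mult_right Bochner_Integration.integrable_add integrable_gauss_even)
  have "(1 + \<bar>x\<bar>)^m \<le> 2^m * (1 + x^(2*m))" for x :: real
  proof (cases "\<bar>x\<bar> \<le> 1")
    case True
    have "(1 + \<bar>x\<bar>)^m \<le> 2^m" using True by (intro power_mono) auto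
    also have "\<dots> \<le> 2^m * (1 + x^(2*m))" by (simp add: power_mult)
    finally show ?thesis .
  next
    case False
    have "(1 + \<bar>x\<bar>)^m \<le> (2 * (x^2))^m"
    proof (intro power_mono)
      have "\<bar>x\<bar> * 1 \<le> \<bar>x\<bar> * \<bar>x\<bar>" using False by (intro mult_left_mono) auto
      thus "1 + \<bar>x\<bar> \<le> 2 * (x^2)" using False by (simp add: power2_eq_square)
    qed auto
    also have "\<dots> \<le> 2^m * (1 + x^(2*m))" by (simp add: power_mult power_mult_distrib)
    finally show ?thesis .
  qed
  hence "exp (- (x^2)) * (1 + \<bar>x\<bar>)^m \<le> exp (- (x^2)) * (2^m * (1 + x^(2*m)))" for x :: real
    by (intro mult_left_mono) auto
  thus "AE x::real in lborel. norm (exp (- (x^2)) * (1 + \<bar>x\<bar>)^m)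
      \<le> norm (2^m * (exp (- (x^2)) * x^(2*0) + exp (- (x^2)) * x^(2*m)))"
    by (intro AE_I2) (simp add: algebra_simps abs_mult order_trans[OF _ abs_ge_self])
qed auto

lemma integrable_inverse_sqrt: "integrable lborel (\<lambda>x::real. indicator {0..1} x / sqrt x)"
proof -
  have "(\<lambda>x::real. x powr (-1/2)) absolutely_integrable_on {0..1}"
    using has_integral_powr_from_0[of "-1/2" 1] by (intro nonnegative_absolutely_integrable_1) auto
  hence "integrable lebesgue (\<lambda>x::real. indicator {0..1} x *\<^sub>R x powr (-1/2))"
    by (simp add: set_integrable_def)
  hence "integrable lborel (\<lambda>x::real. indicator {0..1} x *\<^sub>R x powr (-1/2))"
    by (simp add: integrable_completion)
  moreover have "(\<lambda>x::real. indicator {0..1} x *\<^sub>R x powr (-1/2)) = (\<lambda>x. indicator {0..1} x / sqrt x)"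
    by (auto simp: fun_eq_iff indicator_def powr_minus powr_half_sqrt field_simps)
  ultimately show ?thesis by simp
qed

lemma integrable_sing_weight: "integrable lborel (sing_weight m)"
proof (rule Bochner_Integration.integrable_bound)
  have "integrable lborel (\<lambda>x::real. indicator {0..1} (0 + (-1) * x) / sqrt (0 + (-1) * x))"
    using lborel_integrable_real_affine[OF integrable_inverse_sqrt, of "-1" 0] by simp
  thus "integrable lborel (\<lambda>x. 2^m * (indicator {0..1} x / sqrt x)
      + 2^m * (indicator {0..1} (0 + (-1) * x) / sqrt (0 + (-1) * x))
     + exp (- (x^2)) * (1 + \<bar>x\<bar>)^m)"
    by (intro Bochner_Integration.integrable_add integrable_mult_right integrable_gauss_poly integrable_inverse_sqrt)
  have "sing_weight m x \<le> 2^m * (indicator {0..1} x / sqrt x)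
      + 2^m * (indicator {0..1} (0 + (-1) * x) / sqrt (0 + (-1) * x))
     + exp (- (x^2)) * (1 + \<bar>x\<bar>)^m" for x
  proof (cases "\<bar>x\<bar> \<le> 1")
    case True
    have "exp (- (x^2)) * (1 + \<bar>x\<bar>)^m \<le> 1 * 2^m"
      using True by (intro mult_mono power_mono) auto
    hence "sing_weight m x \<le> 2^m / sqrt \<bar>x\<bar>"
      unfolding sing_weight_def by (intro divide_right_mono) auto
    also have "\<dots> \<le> 2^m * (indicator {0..1} x / sqrt x)
        + 2^m * (indicator {0..1} (0 + (-1) * x) / sqrt (0 + (-1) * x))"
      using True by (cases "x \<ge> 0") (auto simp: indicator_def)
    finally show ?thesis by (simp add: add_increasing2)
  next
    case False
    hence "sqrt \<bar>x\<bar> \<ge> 1" by simp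
    hence "sing_weight m x \<le> exp (- (x^2)) * (1 + \<bar>x\<bar>)^m / 1"
      unfolding sing_weight_def by (intro divide_left_mono) auto
    thus ?thesis using False by (auto simp: indicator_def)
  qed
  thus "AE x in lborel. norm (sing_weight m x) \<le> norm (2^m * (indicator {0..1} x / sqrt x)
      + 2^m * (indicator {0..1} (0 + (-1) * x) / sqrt (0 + (-1) * x))
     + exp (- (x^2)) * (1 + \<bar>x\<bar>)^m)"
    unfolding real_norm_def abs_of_nonneg[OF sing_weight_nonneg] by (intro AE_I2 order_trans[OF _ abs_ge_self])
qed auto

lemma integrable_prod_lborel:
  fixes f g :: "real \<Rightarrow> real"
  assumes "integrable lborel f" "integrable lborel g"
  shows "integrable (lborel :: (real \<times> real) measure) (\<lambda>p. f (fst p) * g (snd p))"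
proof -
  have "integrable (lborel \<Otimes>\<^sub>M lborel) (\<lambda>(x, y). f x * g y)"
  proof (rule lborel_pair.Fubini_integrable)
    show "(\<lambda>(x, y). f x * g y) \<in> borel_measurable (lborel \<Otimes>\<^sub>M lborel)"
      using assms by measurable
    have "integrable lborel (\<lambda>x. norm (f x) * (\<integral>y. norm (g y) \<partial>lborel))"
      using assms by (intro integrable_mult_left integrable_norm)
    thus "integrable lborel (\<lambda>x. \<integral>y. norm (case (x, y) of (x, y) \<Rightarrow> f x * g y) \<partial>lborel)"
      by (simp add: abs_mult)
    show "AE x in lborel. integrable lborel (\<lambda>y. case (x, y) of (x, y) \<Rightarrow> f x * g y)"
      using assms by auto
  qed
  thus ?thesis by (simp add: lborel_prod case_prod_unfold)
qed

text \<open>Coordinate lines are null sets, so pointwise bounds and identities may fail where edges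
  share an end point or where a majorant divides by zero.\<close>

lemma AE_fst_neq: "AE p in (lborel :: (real \<times> real) measure). fst p \<noteq> t"
proof -
  have "emeasure (lborel \<Otimes>\<^sub>M lborel) ({t} \<times> (UNIV :: real set)) = 0"
    by (subst lborel.emeasure_pair_measure_Times) auto
  hence "{t} \<times> (UNIV :: real set) \<in> null_sets lborel"
    by (auto simp: null_sets_def lborel_prod intro!: borel_Times)
  from AE_not_in[OF this] show ?thesis by eventually_elim auto
qed

lemma AE_snd_neq: "AE p in (lborel :: (real \<times> real) measure). snd p \<noteq> t"
proof -
  have "emeasure (lborel \<Otimes>\<^sub>M lborel) ((UNIV :: real set) \<times> {t}) = 0"
    by (subst lborel.emeasure_pair_measure_Times) auto
  hence "(UNIV :: real set) \<times> {t} \<in> null_sets lborel"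
    by (auto simp: null_sets_def lborel_prod intro!: borel_Times)
  from AE_not_in[OF this] show ?thesis by eventually_elim auto
qed

section \<open>Contours as lists of parametrised edges\<close>

datatype edge = Edge (ev: "real \<Rightarrow> complex") (ed: "real \<Rightarrow> complex") (lo: real) (hi: real)

definition is_edge :: "edge \<Rightarrow> bool" where
  "is_edge e \<longleftrightarrow> lo e \<le> hi e \<and> continuous_on {lo e..hi e} (ed e) \<and>
     (\<forall>t\<in>{lo e..hi e}. (ev e has_vector_derivative ed e t) (at t within {lo e..hi e}))"

text \<open>A Lebesgue integral over the whole line with an indicator: integrals over pairs of edges
  become integrals over the plane, to which Fubini and almost-everywhere arguments apply
  directly.\<close>

definition eint :: "edge \<Rightarrow> (complex \<Rightarrow> complex) \<Rightarrow> complex" where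
  "eint e f = (LINT t|lborel. indicator {lo e..hi e} t *\<^sub>R (f (ev e t) * ed e t))"

definition cint :: "edge list \<Rightarrow> (complex \<Rightarrow> complex) \<Rightarrow> complex" where
  "cint c f = (\<Sum>e\<leftarrow>c. eint e f)"

definition epair :: "edge \<Rightarrow> edge \<Rightarrow> (complex \<Rightarrow> complex \<Rightarrow> complex) \<Rightarrow> real \<times> real \<Rightarrow> complex" where
  "epair e1 e2 f p = (indicator {lo e1..hi e1} (fst p) * indicator {lo e2..hi e2} (snd p)) *\<^sub>R
     (f (ev e1 (fst p)) (ev e2 (snd p)) * ed e1 (fst p) * ed e2 (snd p))"

definition dint :: "edge \<Rightarrow> edge \<Rightarrow> (complex \<Rightarrow> complex \<Rightarrow> complex) \<Rightarrow> complex" where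
  "dint e1 e2 f = (LINT p|lborel. epair e1 e2 f p)"

lemma is_edge_continuous: "is_edge e \<Longrightarrow> continuous_on {lo e..hi e} (ev e)"
  unfolding is_edge_def
  by (meson has_vector_derivative_continuous continuous_on_eq_continuous_within)

lemma eint_FTC:
  assumes e: "is_edge e" and S: "\<And>t. t \<in> {lo e..hi e} \<Longrightarrow> ev e t \<in> S"
    and P: "\<And>z. z \<in> S \<Longrightarrow> (P has_field_derivative f z) (at z within S)" and f: "continuous_on S f"
  shows "eint e f = P (ev e (hi e)) - P (ev e (lo e))"
proof -
  have c: "continuous_on {lo e..hi e} (\<lambda>t. f (ev e t) * ed e t)"
    using e is_edge_continuous[OF e] S unfolding is_edge_def
    by (intro continuous_intros continuous_on_compose2[OF f]) auto
  have "((\<lambda>t. f (ev e t) * ed e t) has_integral (P \<circ> ev e) (hi e) - (P \<circ> ev e) (lo e)) {lo e..hi e}"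
  proof (rule fundamental_theorem_of_calculus)
    show "lo e \<le> hi e" using e by (simp add: is_edge_def)
    fix t assume t: "t \<in> {lo e..hi e}"
    have "(P has_field_derivative f (ev e t)) (at (ev e t) within ev e ` {lo e..hi e})"
      using P[OF S[OF t]] S by (meson DERIV_subset image_subsetI)
    from field_vector_diff_chain_within[OF _ this, of "ed e t"]
    show "(P \<circ> ev e has_vector_derivative f (ev e t) * ed e t) (at t within {lo e..hi e})"
      using e t by (simp add: is_edge_def mult.commute)
  qed
  moreover have "eint e f = integral {lo e..hi e} (\<lambda>t. f (ev e t) * ed e t)"
    using set_borel_integral_eq_integral(2)[OF borel_integrable_atLeastAtMost'[OF c]]
    by (simp add: eint_def set_lebesgue_integral_def)
  ultimately show ?thesis by (simp add: integral_unique)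
qed

text \<open>The form of Cauchy's theorem behind the contour shifts: where the kernel is holomorphic
  on a convex set, each edge integral is a difference of one primitive at the end points, and sums
  over chains telescope. S may be closed, since derivatives are taken within S.\<close>

lemma eint_convex_primitive:
  assumes "convex S" "f holomorphic_on S"
  shows "\<exists>P. \<forall>e. is_edge e \<longrightarrow> (\<forall>t\<in>{lo e..hi e}. ev e t \<in> S) \<longrightarrow>
            eint e f = P (ev e (hi e)) - P (ev e (lo e))" (is "\<exists>P. ?Q P")
proof -
  have c: "continuous_on S f" using assms(2) by (rule holomorphic_on_imp_continuous_on)
  obtain P where P: "\<And>z. z \<in> S \<Longrightarrow> (P has_field_derivative f z) (at z within S)"
  proof (rule holomorphic_convex_primitive[OF assms(1) finite.emptyI c])
    fix x assume "x \<in> interior S - {}"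
    thus "f field_differentiable at x"
      using assms(2) by (metis Diff_empty at_within_interior holomorphic_onD interior_subset subsetD)
  qed blast
  have "?Q P" by (intro allI impI eint_FTC[OF _ _ P c]) auto
  thus ?thesis by (intro exI[of _ P])
qed

definition seg :: "complex \<Rightarrow> complex \<Rightarrow> edge" where
  "seg a b = Edge (\<lambda>t. a + of_real t * (b - a)) (\<lambda>_. b - a) 0 1"

text \<open>
  The contours are symmetric about the real axis, so only their upper halves are recorded. The
  conjugated half is run backwards, which makes \<open>cnj_sym c\<close> a correctly oriented contour.
\<close>

definition rev_cnj :: "edge \<Rightarrow> edge" where
  "rev_cnj e = Edge (\<lambda>t. cnj (ev e (- t))) (\<lambda>t. - cnj (ed e (- t))) (- hi e) (- lo e)"

definition neg_cnj :: "edge \<Rightarrow> edge" where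
  "neg_cnj e = Edge (\<lambda>t. - cnj (ev e t)) (\<lambda>t. - cnj (ed e t)) (lo e) (hi e)"

definition cnj_sym :: "edge list \<Rightarrow> edge list" where "cnj_sym c = map rev_cnj c @ c"

lemma rev_cnj_simps [simp]: "ev (rev_cnj e) t = cnj (ev e (- t))" "ed (rev_cnj e) t = - cnj (ed e (- t))"
   "lo (rev_cnj e) = - hi e" "hi (rev_cnj e) = - lo e"
  by (simp_all add: rev_cnj_def)

lemma neg_cnj_simps [simp]: "ev (neg_cnj e) t = - cnj (ev e t)" "ed (neg_cnj e) t = - cnj (ed e t)"
   "lo (neg_cnj e) = lo e" "hi (neg_cnj e) = hi e"
  by (simp_all add: neg_cnj_def)

lemma seg_simps [simp]: "ev (seg a b) t = a + of_real t * (b - a)" "ed (seg a b) t = b - a"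
   "lo (seg a b) = 0" "hi (seg a b) = 1"
  by (simp_all add: seg_def)

lemma is_edge_seg: "is_edge (seg a b)"
proof -
  have "((\<lambda>t. a + of_real t * (b - a)) has_vector_derivative (b - a)) (at t within {0..1})" for t :: real
    by (auto intro!: derivative_eq_intros simp: has_vector_derivative_def scaleR_conv_of_real)
  moreover have "ev (seg a b) = (\<lambda>t. a + of_real t * (b - a))" "ed (seg a b) = (\<lambda>_. b - a)" by (auto simp: seg_def)
  ultimately show ?thesis unfolding is_edge_def by auto
qed

lemma seg_in_convex:
  assumes "convex S" "a \<in> S" "b \<in> S" "t \<in> {lo (seg a b)..hi (seg a b)}"
  shows "ev (seg a b) t \<in> S"
proof -
  have "(1 - t) *\<^sub>R a + t *\<^sub>R b \<in> S" using assms by (intro convexD) auto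
  thus ?thesis by (simp add: scaleR_conv_of_real algebra_simps)
qed

lemma is_edge_neg_cnj: "is_edge e \<Longrightarrow> is_edge (neg_cnj e)"
proof -
  assume e: "is_edge e"
  have "((\<lambda>t. - cnj (ev e t)) has_vector_derivative - cnj (ed e t)) (at t within {lo e..hi e})"
    if "t \<in> {lo e..hi e}" for t
    using e that unfolding is_edge_def
    by (intro has_vector_derivative_minus has_vector_derivative_cnj) auto
  moreover have "ev (neg_cnj e) = (\<lambda>t. - cnj (ev e t))" "ed (neg_cnj e) = (\<lambda>t. - cnj (ed e t))"
      by (auto simp: neg_cnj_def)
  ultimately show ?thesis using e unfolding is_edge_def by (auto intro!: continuous_intros)
qed

lemma is_edge_rev_cnj: "is_edge e \<Longrightarrow> is_edge (rev_cnj e)"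
proof -
  assume e: "is_edge e"
  have im: "uminus ` {- hi e..- lo e} = {lo e..hi e}" by (simp add: image_uminus_atLeastAtMost)
  have "((\<lambda>t. cnj (ev e (- t))) has_vector_derivative - cnj (ed e (- t))) (at t within {- hi e..- lo e})"
    if t: "t \<in> {- hi e..- lo e}" for t
  proof -
    have "(ev e has_vector_derivative ed e (- t)) (at (- t) within uminus ` {- hi e..- lo e})"
      using e t unfolding is_edge_def im by simp
    moreover have "(uminus has_vector_derivative (-1)) (at t within {- hi e..- lo e})"
      by (auto intro!: derivative_eq_intros simp: has_vector_derivative_def)
    ultimately have "((ev e \<circ> uminus) has_vector_derivative (-1) *\<^sub>R ed e (- t)) (at t within {- hi e..- lo e})"
      using vector_diff_chain_within by blast
    from has_vector_derivative_cnj[OF this] show ?thesis by (simp add: o_def)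
  qed
  moreover have "continuous_on {- hi e..- lo e} (\<lambda>t. - cnj (ed e (- t)))"
  proof -
    have "continuous_on {- hi e..- lo e} (\<lambda>t. ed e (- t))"
      by (rule continuous_on_compose2[of "{lo e..hi e}" "ed e" _ uminus])
         (use e in \<open>auto simp: is_edge_def intro: continuous_on_minus continuous_on_id\<close>)
    thus ?thesis by (intro continuous_on_minus continuous_on_cnj)
  qed
  moreover have "ev (rev_cnj e) = (\<lambda>t. cnj (ev e (- t)))" "ed (rev_cnj e) = (\<lambda>t. - cnj (ed e (- t)))"
      by (auto simp: rev_cnj_def)
  ultimately show ?thesis using e unfolding is_edge_def by auto
qed

lemma rev_cnj_rev_cnj [simp]: "rev_cnj (rev_cnj e) = e"
  by (cases e) (simp add: rev_cnj_def)

lemma eint_rev_cnj: "eint (rev_cnj e) f = - cnj (eint e (\<lambda>z. cnj (f (cnj z))))"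
proof -
  have "eint (rev_cnj e) f = (LINT t|lborel. indicator {lo (rev_cnj e)..hi (rev_cnj e)} (0
      + (-1) * t) *\<^sub>R (f (ev (rev_cnj e) (0 + (-1) * t)) * ed (rev_cnj e) (0 + (-1) * t)))"
    unfolding eint_def by (subst lborel_integral_real_affine[where c="-1" and t=0]) auto
  also have "\<dots> = (LINT t|lborel. - cnj (indicator {lo e..hi e} t *\<^sub>R (cnj (f (cnj (ev e t))) * ed e t)))"
    by (intro Bochner_Integration.integral_cong) (auto simp: indicator_def)
  also have "\<dots> = - cnj (eint e (\<lambda>z. cnj (f (cnj z))))"
    unfolding eint_def Bochner_Integration.integral_minus Bochner_Integration.integral_cnj ..
  finally show ?thesis .
qed

lemma cint_append: "cint (c @ d) f = cint c f + cint d f" by (simp add: cint_def)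

lemma cint_rev_cnj: "cint (map rev_cnj c) f = - cnj (cint c (\<lambda>z. cnj (f (cnj z))))"
  by (induction c) (auto simp: cint_def eint_rev_cnj)

lemma cint_sym: "cint (cnj_sym c) f = cint c f - cnj (cint c (\<lambda>z. cnj (f (cnj z))))"
  by (simp add: cnj_sym_def cint_append cint_rev_cnj)

lemma cint_sym_cnj:
  "cint (cnj_sym c) (\<lambda>z. cnj (f (cnj z))) = - cnj (cint (cnj_sym c) f)"
  by (simp add: cint_sym)

text \<open>Identities between inner integrals break down at the few parameters where the outer
  variable lies on an inner contour; these do not affect the outer integral.\<close>

lemma eint_cong_finite:
  assumes "finite N" "\<And>t. t \<in> {lo e..hi e} \<Longrightarrow> t \<notin> N \<Longrightarrow> f (ev e t) = g (ev e t)"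
  shows "eint e f = eint e g"
  unfolding eint_def
  by (rule integral_discrete_difference[of N]) (use assms in \<open>auto simp: countable_finite indicator_def\<close>)

text \<open>
  At a common endpoint (parameters \<open>t1\<close>, \<open>t2\<close>), AM-GM turns a lower bound linear in
  \<open>\<bar>t - t1\<bar> + \<bar>s - t2\<bar>\<close> into this one, so that \<open>1 / (z - w)\<close> is dominated by a product of
  integrable inverse square roots.
\<close>

definition separated :: "edge \<Rightarrow> edge \<Rightarrow> bool" where
  "separated e1 e2 \<longleftrightarrow> (\<exists>c>0. \<exists>t1 t2. \<forall>t\<in>{lo e1..hi e1}. \<forall>s\<in>{lo e2..hi e2}.
      c * sqrt (\<bar>t - t1\<bar> * \<bar>s - t2\<bar>) \<le> norm (ev e1 t - ev e2 s))"

text \<open>The edge departs from p at positive speed, with t0 the parameter of p. If p lies off the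
  edge, any t0 will do.\<close>

definition leaves :: "edge \<Rightarrow> complex \<Rightarrow> bool" where
  "leaves e p \<longleftrightarrow> (\<exists>c>0. \<exists>t0. \<forall>t\<in>{lo e..hi e}. c * \<bar>t - t0\<bar> \<le> norm (ev e t - p))"

lemma separated_rev_cnj: "separated e1 e2 \<Longrightarrow> separated (rev_cnj e1) (rev_cnj e2)"
proof -
  assume "separated e1 e2"
  then obtain c t1 t2 where c: "c > 0" and *: "\<And>t s. t\<in>{lo e1..hi e1} \<Longrightarrow> s\<in>{lo e2..hi e2} \<Longrightarrow>
      c * sqrt (\<bar>t - t1\<bar> * \<bar>s - t2\<bar>) \<le> norm (ev e1 t - ev e2 s)"
    unfolding separated_def by blast
  have "c * sqrt (\<bar>t - (-t1)\<bar> * \<bar>s - (-t2)\<bar>) \<le> norm (ev (rev_cnj e1) t - ev (rev_cnj e2) s)"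
    if "t\<in>{lo (rev_cnj e1)..hi (rev_cnj e1)}" "s\<in>{lo (rev_cnj e2)..hi (rev_cnj e2)}" for t s
  proof -
    have "\<bar>t - (-t1)\<bar> = \<bar>-t - t1\<bar>" "\<bar>s - (-t2)\<bar> = \<bar>-s - t2\<bar>" by linarith+
    moreover have "norm (ev (rev_cnj e1) t - ev (rev_cnj e2) s) = norm (ev e1 (-t) - ev e2 (-s))"
      by (simp flip: complex_cnj_diff)
    ultimately show ?thesis using *[of "-t" "-s"] that by auto
  qed
  thus ?thesis unfolding separated_def using c
    by (intro exI[of _ c] conjI exI[of _ "-t1"] exI[of _ "-t2"] ballI)
qed

lemma separatedI_cone:
  assumes "leaves e1 p" "leaves e2 p" "c > 0"
    and c: "\<And>t s. t\<in>{lo e1..hi e1} \<Longrightarrow> s\<in>{lo e2..hi e2} \<Longrightarrow>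
       c * (norm (ev e1 t - p) + norm (ev e2 s - p)) \<le> norm (ev e1 t - ev e2 s)"
  shows "separated e1 e2"
proof -
  obtain c1 t1 where c1: "c1 > 0" "\<And>t. t\<in>{lo e1..hi e1} \<Longrightarrow> c1 * \<bar>t - t1\<bar> \<le> norm (ev e1 t - p)"
    using assms(1) unfolding leaves_def by blast
  obtain c2 t2 where c2: "c2 > 0" "\<And>t. t\<in>{lo e2..hi e2} \<Longrightarrow> c2 * \<bar>t - t2\<bar> \<le> norm (ev e2 t - p)"
    using assms(2) unfolding leaves_def by blast
  have "(c * 2 * sqrt (c1 * c2)) * sqrt (\<bar>t - t1\<bar> * \<bar>s - t2\<bar>) \<le> norm (ev e1 t - ev e2 s)"
    if t: "t\<in>{lo e1..hi e1}" "s\<in>{lo e2..hi e2}" for t s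
  proof -
    have "(c * 2 * sqrt (c1 * c2)) * sqrt (\<bar>t - t1\<bar> * \<bar>s - t2\<bar>) = c * 2 * sqrt ((c1 * \<bar>t - t1\<bar>) * (c2 * \<bar>s - t2\<bar>))"
      by (simp add: real_sqrt_mult mult_ac)
    also have "\<dots> \<le> c * 2 * ((c1 * \<bar>t - t1\<bar> + c2 * \<bar>s - t2\<bar>) / 2)"
      using assms(3) c1 c2 by (intro mult_left_mono arith_geo_mean_sqrt) auto
    also have "\<dots> = c * (c1 * \<bar>t - t1\<bar> + c2 * \<bar>s - t2\<bar>)" by simp
    also have "\<dots> \<le> c * (norm (ev e1 t - p) + norm (ev e2 s - p))"
      using assms(3) c1 c2 t by (intro mult_left_mono add_mono) auto
    also have "\<dots> \<le> norm (ev e1 t - ev e2 s)" by (rule c[OF t])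
    finally show ?thesis .
  qed
  thus ?thesis unfolding separated_def using c1 c2 assms(3)
    by (intro exI[of _ "c * 2 * sqrt (c1 * c2)"] conjI exI[of _ t1] exI[of _ t2]) auto
qed

text \<open>Compactness bounds the distance from below, while the product of the parameter
  differences is bounded above; the base parameters are arbitrary and the left ends serve.\<close>

lemma separatedI_disjoint:
  assumes "is_edge e1" "is_edge e2"
    and ne: "\<And>t s. t\<in>{lo e1..hi e1} \<Longrightarrow> s\<in>{lo e2..hi e2} \<Longrightarrow> ev e1 t \<noteq> ev e2 s"
  shows "separated e1 e2"
proof -
  have cp: "compact (ev e1 ` {lo e1..hi e1})" "compact (ev e2 ` {lo e2..hi e2})"
    using assms is_edge_continuous by (auto intro!: compact_continuous_image)
  have "ev e1 ` {lo e1..hi e1} \<inter> ev e2 ` {lo e2..hi e2} = {}" using ne by blast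
  then obtain d where d: "d > 0" "\<And>x y. x \<in> ev e1 ` {lo e1..hi e1} \<Longrightarrow> y \<in> ev e2 ` {lo e2..hi e2} \<Longrightarrow> d \<le> dist x y"
    using separate_compact_closed[OF cp(1) compact_imp_closed[OF cp(2)]] by blast
  \<comment> \<open>Adding 1 keeps \<open>L\<close> positive when an interval degenerates to a
    point.\<close>
  define L where "L = (\<bar>hi e1 - lo e1\<bar> + 1) * (\<bar>hi e2 - lo e2\<bar> + 1)"
  have L: "L > 0" by (simp add: L_def add_pos_nonneg add_nonneg_pos)
  have "d / sqrt L * sqrt (\<bar>t - lo e1\<bar> * \<bar>s - lo e2\<bar>) \<le> norm (ev e1 t - ev e2 s)"
    if t: "t\<in>{lo e1..hi e1}" "s\<in>{lo e2..hi e2}" for t s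
  proof -
    have "\<bar>t - lo e1\<bar> * \<bar>s - lo e2\<bar> \<le> L" unfolding L_def using t by (intro mult_mono) auto
    hence "d / sqrt L * sqrt (\<bar>t - lo e1\<bar> * \<bar>s - lo e2\<bar>) \<le> d / sqrt L * sqrt L"
      using d L by (intro mult_left_mono) auto
    also have "\<dots> = d" using L by simp
    also have "\<dots> \<le> norm (ev e1 t - ev e2 s)" using d(2) t by (simp add: dist_norm)
    finally show ?thesis .
  qed
  thus ?thesis unfolding separated_def using d L
    by (intro exI[of _ "d / sqrt L"] conjI exI[of _ "lo e1"] exI[of _ "lo e2"]) auto
qed

lemma leavesI_avoid:
  assumes "is_edge e" and ne: "\<And>t. t\<in>{lo e..hi e} \<Longrightarrow> ev e t \<noteq> p"
  shows "leaves e p"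
proof -
  have cp: "closed (ev e ` {lo e..hi e})"
    using assms is_edge_continuous by (auto intro!: compact_imp_closed compact_continuous_image)
  have "p \<notin> ev e ` {lo e..hi e}" using ne by blast
  then obtain d where d: "d > 0" "\<And>x. x \<in> ev e ` {lo e..hi e} \<Longrightarrow> d \<le> dist p x"
    using separate_point_closed[OF cp] by blast
  define L where "L = \<bar>hi e - lo e\<bar> + 1"
  have "d / L * \<bar>t - lo e\<bar> \<le> norm (ev e t - p)" if t: "t\<in>{lo e..hi e}" for t
  proof -
    have "d / L * \<bar>t - lo e\<bar> \<le> d / L * L"
      using d t by (intro mult_left_mono) (auto simp: L_def)
    also have "\<dots> = d" by (simp add: L_def add_nonneg_pos)
    also have "\<dots> \<le> norm (ev e t - p)" using d(2)[of "ev e t"] t by (simp add: dist_norm norm_minus_commute)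
    finally show ?thesis .
  qed
  moreover have "L > 0" by (simp add: L_def add_nonneg_pos)
  ultimately show ?thesis unfolding leaves_def using d
    by (intro exI[of _ "d / L"] conjI exI[of _ "lo e"]) auto
qed

text \<open>On a bounded interval the Gaussian factor is at least exp (- L^2), so a truncated
  inverse square root is dominated by a translate of \<open>sing_weight 0\<close>, whose
  integrability is already known.\<close>

lemma indicator_le_sing_weight:
  "\<exists>C\<ge>0. \<forall>t::real. t \<noteq> t0 \<longrightarrow> indicator {a..b} t / sqrt \<bar>t - t0\<bar> \<le> C * sing_weight 0 (t - t0)"
proof -
  define L where "L = \<bar>a - t0\<bar> + \<bar>b - t0\<bar>"
  have "indicator {a..b} t / sqrt \<bar>t - t0\<bar> \<le> exp (L^2) * sing_weight 0 (t - t0)" if "t \<noteq> t0" for t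
  proof (cases "t \<in> {a..b}")
    case True
    have "\<bar>t - t0\<bar>^2 \<le> L^2" using True by (intro power_mono) (auto simp: L_def)
    hence "exp 0 \<le> exp (L^2 + (- ((t - t0)^2)))" by (subst exp_le_cancel_iff) simp
    hence "1 \<le> exp (L^2) * exp (- ((t - t0)^2))" by (simp only: exp_add exp_zero)
    hence "1 / sqrt \<bar>t - t0\<bar> \<le> exp (L^2) * exp (- ((t - t0)^2)) / sqrt \<bar>t - t0\<bar>"
      by (intro divide_right_mono) auto
    thus ?thesis using True by (simp add: sing_weight_def)
  next
    case False thus ?thesis by (auto simp: sing_weight_nonneg)
  qed
  thus ?thesis by (intro exI[of _ "exp (L^2)"]) auto
qed

lemma edge_bounded:
  assumes "is_edge e"
  shows "\<exists>B\<ge>0. \<forall>t\<in>{lo e..hi e}. norm (ev e t) \<le> B \<and> norm (ed e t) \<le> B"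
proof -
  have "bounded (ev e ` {lo e..hi e})" "bounded (ed e ` {lo e..hi e})"
    using assms is_edge_continuous[OF assms] unfolding is_edge_def
    by (auto intro!: compact_imp_bounded compact_continuous_image)
  then obtain B1 B2 where "\<And>t. t\<in>{lo e..hi e} \<Longrightarrow> norm (ev e t) \<le> B1" "\<And>t. t\<in>{lo e..hi e} \<Longrightarrow> norm (ed e t) \<le> B2"
    unfolding bounded_iff by blast
  thus ?thesis by (intro exI[of _ "max 0 (max B1 B2)"]) (auto simp: le_max_iff_disj)
qed

section \<open>Absolute integrability over pairs of edges and Fubini\<close>

lemma epair_measurable:
  assumes e: "is_edge e1" "is_edge e2" and F: "continuous_on UNIV (\<lambda>(z, w). F z w)"
  shows "epair e1 e2 (\<lambda>z w. F z w / (z - w)) \<in> borel_measurable borel"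
proof -
  define A where "A = {lo e1..hi e1} \<times> {lo e2..hi e2}"
  have A: "A \<in> sets borel" by (simp add: A_def borel_closed closed_Times)
  have c1: "continuous_on A (\<lambda>p. ev e1 (fst p))" "continuous_on A (\<lambda>p. ev e2 (snd p))"
     "continuous_on A (\<lambda>p. ed e1 (fst p))" "continuous_on A (\<lambda>p. ed e2 (snd p))"
    unfolding A_def using e is_edge_continuous[OF e(1)] is_edge_continuous[OF e(2)]
    by (auto intro!: continuous_on_compose2[of _ _ _ fst] continuous_on_compose2[of _ _ _ snd]
        continuous_on_fst[OF continuous_on_id] continuous_on_snd[OF continuous_on_id] simp: is_edge_def)
  have c2: "continuous_on A (\<lambda>p. F (ev e1 (fst p)) (ev e2 (snd p)))"
    using continuous_on_compose2[OF F, of A "\<lambda>p. (ev e1 (fst p), ev e2 (snd p))"]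
      continuous_on_Pair[OF c1(1,2)] by simp
  have "(\<lambda>p. indicator A p *\<^sub>R (F (ev e1 (fst p)) (ev e2 (snd p)) * ed e1 (fst p)
      * ed e2 (snd p))) \<in> borel_measurable borel"
    by (intro borel_measurable_continuous_on_indicator[OF A] continuous_intros c1 c2)
  moreover have "(\<lambda>p. indicator A p *\<^sub>R (ev e1 (fst p) - ev e2 (snd p))) \<in> borel_measurable borel"
    by (intro borel_measurable_continuous_on_indicator[OF A] continuous_intros c1 c2)
  \<comment> \<open>The integrand is discontinuous where the edges meet. Numerator and denominator
    are separately continuous on the rectangle \<open>A\<close> and 0 off it, so their quotient is
    measurable; off \<open>A\<close> it is 0 / 0 = 0, as required.\<close>
  ultimately have "(\<lambda>p. (indicator A p *\<^sub>R (F (ev e1 (fst p)) (ev e2 (snd p)) * ed e1 (fst p) * ed e2 (snd p))) /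
       (indicator A p *\<^sub>R (ev e1 (fst p) - ev e2 (snd p)))) \<in> borel_measurable borel"
    by (rule borel_measurable_divide)
  also have "(\<lambda>p. (indicator A p *\<^sub>R (F (ev e1 (fst p)) (ev e2 (snd p)) * ed e1 (fst p) * ed e2 (snd p))) /
       (indicator A p *\<^sub>R (ev e1 (fst p) - ev e2 (snd p)))) = epair e1 e2 (\<lambda>z w. F z w / (z - w))"
    by (auto simp: fun_eq_iff epair_def A_def indicator_def)
  finally show ?thesis .
qed

text \<open>\<open>F\<close> and the line elements are bounded on the compact edges, and
  \<open>separated\<close> bounds 1 / (z - w) by a product of inverse square roots; translates of
  \<open>sing_weight 0\<close> dominate the whole.\<close>

lemma epair_integrable:
  assumes e: "is_edge e1" "is_edge e2" and sep: "separated e1 e2"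
    and F: "continuous_on UNIV (\<lambda>(z, w). F z w)"
  shows "integrable lborel (epair e1 e2 (\<lambda>z w. F z w / (z - w)))"
proof -
  obtain c t1 t2 where c: "c > 0" and *: "\<And>t s. t\<in>{lo e1..hi e1} \<Longrightarrow> s\<in>{lo e2..hi e2} \<Longrightarrow>
      c * sqrt (\<bar>t - t1\<bar> * \<bar>s - t2\<bar>) \<le> norm (ev e1 t - ev e2 s)"
    using sep unfolding separated_def by blast
  obtain B1 where B1: "B1 \<ge> 0" "\<And>t. t \<in> {lo e1..hi e1} \<Longrightarrow> norm (ev e1 t) \<le> B1 \<and> norm (ed e1 t) \<le> B1"
    using edge_bounded[OF e(1)] by blast
  obtain B2 where B2: "B2 \<ge> 0" "\<And>t. t \<in> {lo e2..hi e2} \<Longrightarrow> norm (ev e2 t) \<le> B2 \<and> norm (ed e2 t) \<le> B2"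
    using edge_bounded[OF e(2)] by blast
  have "compact ((\<lambda>(z, w). F z w) ` (cball 0 B1 \<times> cball 0 B2))"
    by (intro compact_continuous_image compact_Times compact_cball continuous_on_subset[OF F]) auto
  hence "bounded ((\<lambda>(z, w). F z w) ` (cball 0 B1 \<times> cball 0 B2))" by (rule compact_imp_bounded)
  then obtain M where "\<forall>x\<in>(\<lambda>(z, w). F z w) ` (cball 0 B1 \<times> cball 0 B2). norm x \<le> M"
    unfolding bounded_iff ..
  hence M: "norm (F z w) \<le> M" if "z \<in> cball 0 B1" "w \<in> cball 0 B2" for z w
    using that by blast
  obtain C1 where C1: "C1 \<ge> 0" "\<And>t. t \<noteq> t1 \<Longrightarrow> indicator {lo e1..hi e1} t / sqrt \<bar>t - t1\<bar> \<le> C1 * sing_weight 0 (t - t1)"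
    using indicator_le_sing_weight by blast
  obtain C2 where C2: "C2 \<ge> 0" "\<And>t. t \<noteq> t2 \<Longrightarrow> indicator {lo e2..hi e2} t / sqrt \<bar>t - t2\<bar> \<le> C2 * sing_weight 0 (t - t2)"
    using indicator_le_sing_weight by blast
  define K where "K = \<bar>M\<bar> * B1 * B2 / c"
  have K: "K \<ge> 0" using B1 B2 c by (simp add: K_def)
  have sw: "integrable lborel (\<lambda>t. sing_weight 0 (t - u))" for u
    using lborel_integrable_real_affine[OF integrable_sing_weight[of 0], of 1 "-u"] by (simp add: add.commute)
  show ?thesis
  proof (rule Bochner_Integration.integrable_bound)
    show "integrable lborel (\<lambda>p. K * ((C1 * sing_weight 0 (fst p - t1)) * (C2 * sing_weight 0 (snd p - t2))))"
      by (intro integrable_mult_right integrable_prod_lborel[of "\<lambda>t. C1 * sing_weight 0 (t - t1)"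
          "\<lambda>t. C2 * sing_weight 0 (t - t2)"] sw)
    show "AE p in lborel. norm (epair e1 e2 (\<lambda>z w. F z w / (z - w)) p)
        \<le> norm (K * ((C1 * sing_weight 0 (fst p - t1)) * (C2 * sing_weight 0 (snd p - t2))))"
      using AE_fst_neq[of t1] AE_snd_neq[of t2]
    proof eventually_elim
      case (elim p)
      obtain t s where p: "p = (t, s)" by (cases p)
      have pos: "0 \<le> K * ((C1 * sing_weight 0 (t - t1)) * (C2 * sing_weight 0 (s - t2)))"
        using K C1 C2 by (intro mult_nonneg_nonneg) (auto simp: sing_weight_nonneg)
      show ?case
      proof (cases "t \<in> {lo e1..hi e1} \<and> s \<in> {lo e2..hi e2}")
        case True
        have pos2: "c * sqrt (\<bar>t - t1\<bar> * \<bar>s - t2\<bar>) > 0" using elim c p by simp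
        have "norm (epair e1 e2 (\<lambda>z w. F z w / (z - w)) p) = norm (F (ev e1 t) (ev e2 s)) * norm (ed e1 t)
            * norm (ed e2 s) / norm (ev e1 t - ev e2 s)"
          using True by (simp add: epair_def p norm_mult norm_divide)
        also have "\<dots> \<le> \<bar>M\<bar> * B1 * B2 / (c * sqrt (\<bar>t - t1\<bar> * \<bar>s - t2\<bar>))"
        proof (intro frac_le mult_mono)
          show "norm (F (ev e1 t) (ev e2 s)) \<le> \<bar>M\<bar>"
            using M[of "ev e1 t" "ev e2 s"] B1 B2 True by force
        qed (use True B1 B2 pos2 * in auto)
        also have "\<dots> = K * ((indicator {lo e1..hi e1} t / sqrt \<bar>t - t1\<bar>) * (indicator {lo e2..hi e2} s / sqrt \<bar>s
            - t2\<bar>))"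
          using True by (simp add: K_def real_sqrt_mult)
        also have "\<dots> \<le> K * ((C1 * sing_weight 0 (t - t1)) * (C2 * sing_weight 0 (s - t2)))"
          using elim p K C1(1) by (intro mult_left_mono mult_mono C1 C2) (auto simp: sing_weight_nonneg)
        finally show ?thesis using pos p by simp
      next
        case False
        thus ?thesis using p by (auto simp: epair_def)
      qed
    qed
  qed (use epair_measurable[OF e F] in simp)
qed

text \<open>The integral on the right is independent of \<open>F\<close>, hence of \<Lambda> and the
  parameters. All decay is carried by the pointwise bound \<open>B\<close>.\<close>

lemma norm_dint_le:
  assumes e: "is_edge e1" "is_edge e2" and sep: "separated e1 e2"
    and B: "\<And>t s. t\<in>{lo e1..hi e1} \<Longrightarrow> s\<in>{lo e2..hi e2} \<Longrightarrow> norm (F (ev e1 t) (ev e2 s)) \<le> B"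
  shows "norm (dint e1 e2 (\<lambda>z w. F z w / (z - w))) \<le> B * (LINT p|lborel. norm (epair e1 e2 (\<lambda>z w. 1 / (z - w)) p))"
proof -
  have "norm (dint e1 e2 (\<lambda>z w. F z w / (z - w))) \<le> (LINT p|lborel. norm (epair e1 e2 (\<lambda>z w. F z w / (z - w)) p))"
    unfolding dint_def by (rule integral_norm_bound)
  also have "\<dots> \<le> (LINT p|lborel. B * norm (epair e1 e2 (\<lambda>z w. 1 / (z - w)) p))"
  proof (rule Bochner_Integration.integral_mono')
    show "integrable lborel (\<lambda>p. B * norm (epair e1 e2 (\<lambda>z w. 1 / (z - w)) p))"
      by (intro integrable_mult_right integrable_norm epair_integrable[OF e sep, of "\<lambda>_ _. 1"]) auto
    show "norm (epair e1 e2 (\<lambda>z w. F z w / (z - w)) p) \<le> B * norm (epair e1 e2 (\<lambda>z w. 1 / (z - w)) p)" for p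
    proof (cases "fst p \<in> {lo e1..hi e1} \<and> snd p \<in> {lo e2..hi e2}")
      case True
      have "norm (epair e1 e2 (\<lambda>z w. F z w / (z - w)) p) = norm (F (ev e1 (fst p)) (ev e2 (snd p)))
          * norm (epair e1 e2 (\<lambda>z w. 1 / (z - w)) p)"
        using True by (simp add: epair_def norm_mult norm_divide)
      also have "\<dots> \<le> B * norm (epair e1 e2 (\<lambda>z w. 1 / (z - w)) p)"
        using B True by (intro mult_right_mono) auto
      finally show ?thesis .
    qed (auto simp: epair_def)
    show "0 \<le> B * norm (epair e1 e2 (\<lambda>z w. 1 / (z - w)) p)" for p
    proof (cases "fst p \<in> {lo e1..hi e1} \<and> snd p \<in> {lo e2..hi e2}")
      case True
      hence "0 \<le> B" using B order_trans[OF norm_ge_zero] by blast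
      thus ?thesis by simp
    qed (auto simp: epair_def)
  qed
  finally show ?thesis by simp
qed

lemma iterated_eint:
  assumes i: "integrable lborel (epair e1 e2 f)"
  shows "eint e2 (\<lambda>w. eint e1 (\<lambda>z. f z w)) = dint e1 e2 f"
    and "eint e1 (\<lambda>z. eint e2 (\<lambda>w. f z w)) = dint e1 e2 f"
    and "integrable lborel (\<lambda>s. indicator {lo e2..hi e2} s *\<^sub>R (eint e1 (\<lambda>z. f z (ev e2 s)) * ed e2 s))"
    and "integrable lborel (\<lambda>t. indicator {lo e1..hi e1} t *\<^sub>R (eint e2 (f (ev e1 t)) * ed e1 t))"
proof -
  have i': "integrable (lborel \<Otimes>\<^sub>M lborel) (case_prod (\<lambda>t s. epair e1 e2 f (t, s)))"
    using i by (simp add: lborel_prod)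
  have 1: "(LINT t|lborel. epair e1 e2 f (t, s)) = indicator {lo e2..hi e2} s *\<^sub>R (eint e1 (\<lambda>z. f z (ev e2 s))
      * ed e2 s)" for s
  proof -
    have "(LINT t|lborel. epair e1 e2 f (t, s)) = (LINT t|lborel. indicator {lo e2..hi e2} s *\<^sub>R
       (indicator {lo e1..hi e1} t *\<^sub>R (f (ev e1 t) (ev e2 s) * ed e1 t) * ed e2 s))"
      by (intro Bochner_Integration.integral_cong) (auto simp: epair_def indicator_def)
    thus ?thesis unfolding eint_def
        by (simp only: Bochner_Integration.integral_scaleR_right Bochner_Integration.integral_mult_left_zero)
  qed
  have 2: "(LINT s|lborel. epair e1 e2 f (t, s)) = indicator {lo e1..hi e1} t *\<^sub>R (eint e2 (f (ev e1 t))
      * ed e1 t)" for t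
  proof -
    have "(LINT s|lborel. epair e1 e2 f (t, s)) = (LINT s|lborel. indicator {lo e1..hi e1} t *\<^sub>R
       (indicator {lo e2..hi e2} s *\<^sub>R (f (ev e1 t) (ev e2 s) * ed e2 s) * ed e1 t))"
      by (intro Bochner_Integration.integral_cong) (auto simp: epair_def indicator_def)
    thus ?thesis unfolding eint_def
        by (simp only: Bochner_Integration.integral_scaleR_right Bochner_Integration.integral_mult_left_zero)
  qed
  show "eint e2 (\<lambda>w. eint e1 (\<lambda>z. f z w)) = dint e1 e2 f"
    using lborel_pair.integral_snd[OF i'] unfolding 1 dint_def eint_def[of e2] by (simp add: lborel_prod)
  show "eint e1 (\<lambda>z. eint e2 (\<lambda>w. f z w)) = dint e1 e2 f"
    using lborel_pair.integral_fst[OF i'] unfolding 2 dint_def eint_def[of e1] by (simp add: lborel_prod)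
  show "integrable lborel (\<lambda>s. indicator {lo e2..hi e2} s *\<^sub>R (eint e1 (\<lambda>z. f z (ev e2 s)) * ed e2 s))"
    using lborel_pair.integrable_snd[OF i'] unfolding 1 .
  show "integrable lborel (\<lambda>t. indicator {lo e1..hi e1} t *\<^sub>R (eint e2 (f (ev e1 t)) * ed e1 t))"
    using lborel_pair.integrable_fst[OF i'] unfolding 2 .
qed

lemma eint_sum_list:
  assumes "\<And>d. d \<in> set c \<Longrightarrow> integrable lborel (\<lambda>s. indicator {lo e..hi e} s *\<^sub>R (F d (ev e s) * ed e s))"
  shows "eint e (\<lambda>w. \<Sum>d\<leftarrow>c. F d w) = (\<Sum>d\<leftarrow>c. eint e (F d))"
    and "integrable lborel (\<lambda>s. indicator {lo e..hi e} s *\<^sub>R ((\<Sum>d\<leftarrow>c. F d (ev e s)) * ed e s))"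
  using assms
proof (induction c)
  case Nil
  {
    case 1
    show ?case by (simp add: eint_def)
  next
    case 2
    show ?case by simp
  }
next
  case (Cons d c)
  {
    case 1
    have "integrable lborel (\<lambda>s. indicator {lo e..hi e} s *\<^sub>R ((\<Sum>d\<leftarrow>c. F d (ev e s)) * ed e s))"
      using Cons.IH(2) 1 by simp
    thus ?case using Cons.IH(1) 1 unfolding eint_def
      by (simp add: distrib_right scaleR_add_right)
  next
    case 2
    thus ?case using Cons.IH(2) by (simp add: distrib_right scaleR_add_right)
  }
qed

definition integrable_pair :: "edge list \<Rightarrow> edge list \<Rightarrow> (complex \<Rightarrow> complex \<Rightarrow> complex) \<Rightarrow> bool" where
  "integrable_pair c1 c2 f \<longleftrightarrow> (\<forall>e1\<in>set c1. \<forall>e2\<in>set c2. integrable lborel (epair e1 e2 f))"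

lemma iterated_cint:
  assumes "integrable_pair c1 c2 f"
  shows "cint c2 (\<lambda>w. cint c1 (\<lambda>z. f z w)) = (\<Sum>e2\<leftarrow>c2. \<Sum>e1\<leftarrow>c1. dint e1 e2 f)"
    and "cint c1 (\<lambda>z. cint c2 (\<lambda>w. f z w)) = (\<Sum>e1\<leftarrow>c1. \<Sum>e2\<leftarrow>c2. dint e1 e2 f)"
proof -
  show "cint c2 (\<lambda>w. cint c1 (\<lambda>z. f z w)) = (\<Sum>e2\<leftarrow>c2. \<Sum>e1\<leftarrow>c1. dint e1 e2 f)"
    unfolding cint_def[of c2]
  proof (intro arg_cong[where f=sum_list] map_cong refl)
    fix e2 assume e2: "e2 \<in> set c2"
    have "eint e2 (\<lambda>w. cint c1 (\<lambda>z. f z w)) = (\<Sum>e1\<leftarrow>c1. eint e2 (\<lambda>w. eint e1 (\<lambda>z. f z w)))"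
      unfolding cint_def by (rule eint_sum_list)
          (use assms e2 in \<open>auto simp: integrable_pair_def intro!: iterated_eint(3)\<close>)
    also have "\<dots> = (\<Sum>e1\<leftarrow>c1. dint e1 e2 f)"
      by (intro arg_cong[where f=sum_list] map_cong refl iterated_eint(1))
          (use assms e2 in \<open>auto simp: integrable_pair_def\<close>)
    finally show "eint e2 (\<lambda>w. cint c1 (\<lambda>z. f z w)) = (\<Sum>e1\<leftarrow>c1. dint e1 e2 f)" .
  qed
  show "cint c1 (\<lambda>z. cint c2 (\<lambda>w. f z w)) = (\<Sum>e1\<leftarrow>c1. \<Sum>e2\<leftarrow>c2. dint e1 e2 f)"
    unfolding cint_def[of c1]
  proof (intro arg_cong[where f=sum_list] map_cong refl)
    fix e1 assume e1: "e1 \<in> set c1"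
    have "eint e1 (\<lambda>z. cint c2 (\<lambda>w. f z w)) = (\<Sum>e2\<leftarrow>c2. eint e1 (\<lambda>z. eint e2 (\<lambda>w. f z w)))"
      unfolding cint_def by (rule eint_sum_list)
          (use assms e1 in \<open>auto simp: integrable_pair_def intro!: iterated_eint(4)\<close>)
    also have "\<dots> = (\<Sum>e2\<leftarrow>c2. dint e1 e2 f)"
      by (intro arg_cong[where f=sum_list] map_cong refl iterated_eint(2))
          (use assms e1 in \<open>auto simp: integrable_pair_def\<close>)
    finally show "eint e1 (\<lambda>z. cint c2 (\<lambda>w. f z w)) = (\<Sum>e2\<leftarrow>c2. dint e1 e2 f)" .
  qed
qed

lemma sum_list_swap: "(\<Sum>x\<leftarrow>xs. \<Sum>y\<leftarrow>ys. f x y) = (\<Sum>y\<leftarrow>ys. \<Sum>x\<leftarrow>xs. (f x y :: 'a :: comm_monoid_add))"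
  by (induction xs) (auto simp: sum_list_addf)

lemma cint_swap:
  assumes "integrable_pair c1 c2 f"
  shows "cint c2 (\<lambda>w. cint c1 (\<lambda>z. f z w)) = cint c1 (\<lambda>z. cint c2 (\<lambda>w. f z w))"
  unfolding iterated_cint[OF assms] by (rule sum_list_swap)

section \<open>Contours through the saddle point\<close>

text \<open>
  Cones with vertex \<open>\<i>\<close> around the two halves of the steepest descent path of \<open>fAi z\<close>. The
  path of \<open>w\<close> lies in their mirror images under \<open>z \<mapsto> - cnj z\<close>.
\<close>

definition NE :: "complex set" where "NE = {z. Re z / 2 \<le> Im z - 1 \<and> Im z - 1 \<le> 2 * Re z}"
definition SW :: "complex set" where "SW = {z. 2 * Re z \<le> Im z - 1 \<and> Im z - 1 \<le> Re z / 2}"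

lemma convex_halfplane: "convex {z. a * Re z + b * Im z \<le> c}"
  using convex_halfspace_le[of "Complex a b" c] by (simp add: inner_complex_def)

lemma convex_NE: "convex NE"
proof -
  have *: "NE = {z. (1/2) * Re z + (-1) * Im z \<le> -1} \<inter> {z. (-2) * Re z + 1 * Im z \<le> 1}"
    by (auto simp: NE_def)
  show ?thesis by (subst *) (intro convex_Int convex_halfplane)
qed

lemma convex_SW: "convex SW"
proof -
  have *: "SW = {z. 2 * Re z + (-1) * Im z \<le> -1} \<inter> {z. (-1/2) * Re z + 1 * Im z \<le> 1}"
    by (auto simp: SW_def)
  show ?thesis by (subst *) (intro convex_Int convex_halfplane)
qed

text \<open>A real-linear functional takes opposite signs on the two edges, each of which stays in a
  cone about its axis. The constant 1/3 lies below the cosine 1/2 of the angle between the Airy rays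
  and the real axis.\<close>

lemma separatedI_linear:
  assumes "leaves e1 p" "leaves e2 p" "norm \<alpha> \<le> 1"
    and z: "\<And>t. t\<in>{lo e1..hi e1} \<Longrightarrow> norm (ev e1 t - p) / 3 \<le> Re (\<alpha> * (ev e1 t - p))"
    and w: "\<And>s. s\<in>{lo e2..hi e2} \<Longrightarrow> Re (\<alpha> * (ev e2 s - p)) \<le> - norm (ev e2 s - p) / 3"
  shows "separated e1 e2"
proof (rule separatedI_cone[OF assms(1,2), of "1/3"])
  fix t s assume ts: "t\<in>{lo e1..hi e1}" "s\<in>{lo e2..hi e2}"
  have "1/3 * (norm (ev e1 t - p) + norm (ev e2 s - p)) \<le> Re (\<alpha> * (ev e1 t - p)) - Re (\<alpha> * (ev e2 s - p))"
    using z[OF ts(1)] w[OF ts(2)] by simp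
  also have "\<dots> = Re (\<alpha> * (ev e1 t - ev e2 s))" by (simp add: algebra_simps)
  also have "\<dots> \<le> norm (\<alpha> * (ev e1 t - ev e2 s))" by (rule complex_Re_le_cmod)
  also have "\<dots> \<le> 1 * norm (ev e1 t - ev e2 s)"
    unfolding norm_mult using assms(3) by (intro mult_right_mono) auto
  finally show "1/3 * (norm (ev e1 t - p) + norm (ev e2 s - p)) \<le> norm (ev e1 t - ev e2 s)" by simp
qed auto

text \<open>When each contour passes through p in two opposite directions, no line separates them.
  Squaring identifies opposite directions, so the sign of Im (\<mu> (z - p)^2) can distinguish the
  contours. The factorisation a^2 - b^2 = (a - b) (a + b) turns the quadratic gap into a linear one;
  the bound 5 on norm \<mu> then gives the cone constant 1/10.\<close>

lemma separatedI_quadratic: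
  assumes "leaves e1 p" "leaves e2 p" "norm \<mu> \<le> 5"
    and z: "\<And>t. t\<in>{lo e1..hi e1} \<Longrightarrow> norm (ev e1 t - p)^2 \<le> Im (\<mu> * (ev e1 t - p)^2)"
    and w: "\<And>s. s\<in>{lo e2..hi e2} \<Longrightarrow> Im (\<mu> * (ev e2 s - p)^2) \<le> - (norm (ev e2 s - p)^2)"
  shows "separated e1 e2"
proof (rule separatedI_cone[OF assms(1,2), of "1/10"])
  fix t s assume ts: "t\<in>{lo e1..hi e1}" "s\<in>{lo e2..hi e2}"
  define a b where "a = ev e1 t - p" and "b = ev e2 s - p"
  have "(norm a + norm b)^2 \<le> 2 * (norm a^2 + norm b^2)"
    using zero_le_power2[of "norm a - norm b"] by (simp add: power2_eq_square algebra_simps)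
  also have "norm a^2 + norm b^2 \<le> Im (\<mu> * a^2) - Im (\<mu> * b^2)"
    using z[OF ts(1)] w[OF ts(2)] by (simp add: a_def b_def)
  also have "\<dots> = Im (\<mu> * ((a - b) * (a + b)))" by (simp add: algebra_simps power2_eq_square)
  also have "\<dots> \<le> norm (\<mu> * ((a - b) * (a + b)))" using abs_Im_le_cmod abs_le_D1 by blast
  also have "\<dots> \<le> 5 * (norm (a - b) * (norm a + norm b))"
    unfolding norm_mult using assms(3) by (intro mult_mono norm_triangle_ineq) auto
  finally have "(norm a + norm b) * (norm a + norm b) \<le> 10 * norm (a - b) * (norm a + norm b)"
    by (simp add: power2_eq_square mult_ac)
  hence "norm a + norm b \<le> 10 * norm (a - b)"
    using norm_ge_zero[of a] norm_ge_zero[of b] norm_ge_zero[of "a - b"]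
    by (cases "norm a + norm b = 0") (auto simp: mult_le_cancel_right)
  thus "1/10 * (norm (ev e1 t - p) + norm (ev e2 s - p)) \<le> norm (ev e1 t - ev e2 s)"
    by (simp add: a_def b_def)
qed auto

lemma leaves_neg_cnj: "leaves e p \<Longrightarrow> leaves (neg_cnj e) (- cnj p)"
proof -
  have "norm (- cnj z - - cnj p) = norm (z - p)" for z
  proof -
    have "- cnj z - - cnj p = - cnj (z - p)" by simp
    thus ?thesis by (simp only: norm_minus_cancel complex_mod_cnj)
  qed
  thus "leaves e p \<Longrightarrow> leaves (neg_cnj e) (- cnj p)" unfolding leaves_def by simp
qed

lemma leaves_rev_cnj: assumes "leaves e p" shows "leaves (rev_cnj e) (cnj p)"
proof -
  obtain c t0 where c: "c > 0" "\<And>t. t\<in>{lo e..hi e} \<Longrightarrow> c * \<bar>t - t0\<bar> \<le> norm (ev e t - p)"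
    using assms unfolding leaves_def by blast
  have "c * \<bar>t - (-t0)\<bar> \<le> norm (ev (rev_cnj e) t - cnj p)" if "t\<in>{lo (rev_cnj e)..hi (rev_cnj e)}" for t
  proof -
    have "\<bar>t - (-t0)\<bar> = \<bar>-t - t0\<bar>" by linarith
    thus ?thesis using c(2)[of "-t"] that by (simp flip: complex_cnj_diff)
  qed
  thus ?thesis unfolding leaves_def using c(1) by (intro exI[of _ c] conjI exI[of _ "-t0"] ballI)
qed

lemma leaves_seg: "a \<noteq> b \<Longrightarrow> leaves (seg a b) a" "a \<noteq> b \<Longrightarrow> leaves (seg a b) b"
proof -
  assume ab: "a \<noteq> b"
  show "leaves (seg a b) a" unfolding leaves_def using ab
    by (intro exI[of _ "norm (b - a)"] conjI exI[of _ 0]) (auto simp: norm_mult)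
  have "a + of_real t * (b - a) - b = of_real (t - 1) * (b - a)" for t by (simp add: algebra_simps)
  hence "norm (ev (seg a b) t - b) = \<bar>t - 1\<bar> * norm (b - a)" for t
    by (simp only: seg_simps norm_mult norm_of_real)
  thus "leaves (seg a b) b" unfolding leaves_def using ab
    by (intro exI[of _ "norm (b - a)"] conjI exI[of _ 1]) auto
qed

text \<open>Conjugating both edges preserves separation, so of the four combinations of upper and
  lower halves only two have to be checked.\<close>

lemma integrable_pair_sym:
  assumes e1: "\<And>e. e \<in> set c1 \<Longrightarrow> is_edge e" and e2: "\<And>e. e \<in> set c2 \<Longrightarrow> is_edge e"
    and s: "\<And>e e'. e \<in> set c1 \<Longrightarrow> e' \<in> set c2 \<Longrightarrow> separated e e'"
    and s': "\<And>e e'. e \<in> set c1 \<Longrightarrow> e' \<in> set c2 \<Longrightarrow> separated e (rev_cnj e')"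
    and F: "continuous_on UNIV (\<lambda>(z, w). F z w)"
  shows "integrable_pair (cnj_sym c1) (cnj_sym c2) (\<lambda>z w. F z w / (z - w))"
  unfolding integrable_pair_def
proof (intro ballI epair_integrable F)
  fix a b assume ab: "a \<in> set (cnj_sym c1)" "b \<in> set (cnj_sym c2)"
  show "is_edge a" "is_edge b" using ab e1 e2 is_edge_rev_cnj by (auto simp: cnj_sym_def)
  from ab have "(a \<in> set c1 \<or> (\<exists>x\<in>set c1. a = rev_cnj x)) \<and> (b \<in> set c2 \<or> (\<exists>x\<in>set c2. b = rev_cnj x))"
    by (auto simp: cnj_sym_def)
  then consider "a \<in> set c1" "b \<in> set c2" | x where "x \<in> set c1" "a = rev_cnj x" "b \<in> set c2"
    | y where "a \<in> set c1" "y \<in> set c2" "b = rev_cnj y" | x y where "x \<in> set c1" "a = rev_cnj x" "y \<in> set c2"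
        "b = rev_cnj y"
    by blast
  thus "separated a b"
  proof cases
    case 1 thus ?thesis by (rule s)
  next
    case 2 thus ?thesis using separated_rev_cnj[OF s'[of x b]] by simp
  next
    case 3 thus ?thesis using s' by simp
  next
    case 4 thus ?thesis using separated_rev_cnj[OF s[of x y]] by simp
  qed
qed

text \<open>The lower half contributes the conjugate of the upper half. Outer integrals of such
  functions can therefore be compared on the upper half alone.\<close>

lemma cint_sym_odd:
  assumes "\<And>z. f (cnj z) = - cnj (f z)"
  shows "cint (cnj_sym c) f = of_real (2 * Re (cint c f))"
proof -
  have "cint c (\<lambda>z. - f z) = - cint c f"
    by (induction c) (simp_all add: cint_def eint_def)
  thus ?thesis by (simp add: cint_sym assms complex_add_cnj)
qed

section \<open>The cut Airy ray and the arcs through the saddle point\<close>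

definition ray :: edge where
  "ray = Edge (\<lambda>t. of_real t * Complex (1/2) (sqrt 3/2)) (\<lambda>_. Complex (1/2) (sqrt 3/2)) 0 2"

abbreviation corner :: complex where "corner \<equiv> Complex 1 (sqrt 3)"

lemma ray_simps [simp]: "ev ray t = of_real t * Complex (1/2) (sqrt 3/2)" "ed ray t = Complex (1/2) (sqrt 3/2)"
   "lo ray = 0" "hi ray = 2"
  by (simp_all add: ray_def)

lemma sqrt3_bounds: "sqrt 3 \<ge> 3/2" "sqrt 3 \<le> 2" "sqrt 3 * sqrt 3 = 3"
proof -
  show "sqrt 3 \<ge> 3/2" by (rule real_le_rsqrt) (simp add: power2_eq_square)
  show "sqrt 3 \<le> 2" by (rule real_le_lsqrt) (simp_all add: power2_eq_square)
qed simp

lemma is_edge_ray: "is_edge ray"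
proof -
  have "((\<lambda>t. of_real t * Complex (1/2) (sqrt 3/2)) has_vector_derivative Complex (1/2) (sqrt 3/2))
      (at t within {0..2})" for t :: real
    by (auto intro!: derivative_eq_intros simp: has_vector_derivative_def scaleR_conv_of_real)
  moreover have "ev ray = (\<lambda>t. of_real t * Complex (1/2) (sqrt 3/2))" "ed ray = (\<lambda>_. Complex (1/2) (sqrt 3/2))"
      by (auto simp: ray_def)
  ultimately show ?thesis unfolding is_edge_def by auto
qed

lemma norm_ray: "norm (of_real t * Complex (1/2) (sqrt 3/2)) = \<bar>t\<bar>"
proof -
  have "norm (Complex (1/2) (sqrt 3/2)) = 1" by (simp add: cmod_def power_divide)
  thus ?thesis by (simp only: norm_mult norm_of_real mult_1_right)
qed

lemma leaves_ray: "leaves ray 0"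
  unfolding leaves_def by (intro exI[of _ 1] conjI exI[of _ 0]) (simp_all add: norm_ray del: of_real_mult)

text \<open>This isolates the geometry used by the deformation: two arcs leaving \<i> at positive
  speed into opposite cones, the descending one staying in the closed upper half plane.\<close>

locale saddle_curve =
  fixes g :: "complex \<Rightarrow> complex" and r \<delta> :: real
  assumes \<delta>: "0 < \<delta>" "\<delta> < r" and hol: "g holomorphic_on ball 0 r" and g0: "g 0 = \<i>"
    and g_NE: "\<And>t. 0 \<le> t \<Longrightarrow> t \<le> \<delta> \<Longrightarrow> g (of_real t) \<in> NE"
    and g_SW: "\<And>t. - \<delta> \<le> t \<Longrightarrow> t \<le> 0 \<Longrightarrow> g (of_real t) \<in> SW"
    and g_Im: "\<And>t. - \<delta> \<le> t \<Longrightarrow> t \<le> 0 \<Longrightarrow> Im (g (of_real t)) \<ge> 0"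
    and g_leave: "\<And>t. - \<delta> \<le> t \<Longrightarrow> t \<le> \<delta> \<Longrightarrow> \<bar>t\<bar> / 2 \<le> norm (g (of_real t) - \<i>)"
begin

definition "Cp = Edge (\<lambda>t. g (of_real t)) (\<lambda>t. deriv g (of_real t)) 0 \<delta>"
definition "Cm = Edge (\<lambda>t. g (of_real t)) (\<lambda>t. deriv g (of_real t)) (-\<delta>) 0"
abbreviation "V \<equiv> seg 0 \<i>"
abbreviation "Lp \<equiv> seg (g \<delta>) corner"
text \<open>The point -2 is where a boundary ray of \<open>SW\<close> meets the real axis. Being
  real, it is also the end of the conjugate chord, so the symmetric contour is connected.\<close>

abbreviation "Lm \<equiv> seg (-2) (g (- complex_of_real \<delta>))"

lemma C_simps [simp]: "ev Cp t = g t" "ev Cm t = g t" "ed Cp t = deriv g t" "ed Cm t = deriv g t"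
  "lo Cp = 0" "hi Cp = \<delta>" "lo Cm = - \<delta>" "hi Cm = 0"
  by (simp_all add: Cp_def Cm_def)

lemma is_edge_g:
  assumes "a \<le> b" "- \<delta> \<le> a" "b \<le> \<delta>"
  shows "is_edge (Edge (\<lambda>t. g (of_real t)) (\<lambda>t. deriv g (of_real t)) a b)"
proof -
  have sub: "of_real t \<in> ball (0::complex) r" if "t \<in> {a..b}" for t
    using that assms \<delta> by auto
  have "((\<lambda>t. g (of_real t)) has_vector_derivative deriv g (of_real t)) (at t within {a..b})" if "t \<in> {a..b}" for t
    using holomorphic_derivI[OF hol open_ball sub[OF that]]
    by (intro has_vector_derivative_real_field) auto
  moreover have "continuous_on {a..b} (\<lambda>t. deriv g (of_real t))"
    by (rule continuous_on_compose2[OF holomorphic_on_imp_continuous_on[OF holomorphic_deriv[OF hol open_ball]]])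
       (use sub in \<open>auto intro!: continuous_intros\<close>)
  ultimately show ?thesis using assms by (simp add: is_edge_def)
qed

lemma is_edge_C: "is_edge Cp" "is_edge Cm"
  unfolding Cp_def Cm_def using \<delta> by (auto intro!: is_edge_g)

lemma NE_pos: "z \<in> NE \<Longrightarrow> z \<noteq> \<i> \<Longrightarrow> Re z > 0 \<and> Im z > 1"
  by (auto simp: NE_def complex_eq_iff)
lemma SW_neg: "z \<in> SW \<Longrightarrow> z \<noteq> \<i> \<Longrightarrow> Re z < 0 \<and> Im z < 1"
  by (auto simp: SW_def complex_eq_iff)

lemma g_ne: "- \<delta> \<le> t \<Longrightarrow> t \<le> \<delta> \<Longrightarrow> t \<noteq> 0 \<Longrightarrow> g (of_real t) \<noteq> \<i>"
  using g_leave[of t] by auto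

lemma Cp_mem: "t \<in> {lo Cp..hi Cp} \<Longrightarrow> ev Cp t \<in> NE"
  using g_NE by simp
lemma Cm_mem: "t \<in> {lo Cm..hi Cm} \<Longrightarrow> ev Cm t \<in> SW" "t \<in> {lo Cm..hi Cm} \<Longrightarrow> Im (ev Cm t) \<ge> 0"
  using g_SW g_Im by auto
lemma Cp_pos: "t \<in> {lo Cp..hi Cp} \<Longrightarrow> t \<noteq> 0 \<Longrightarrow> Re (ev Cp t) > 0 \<and> Im (ev Cp t) > 1"
  using NE_pos[OF Cp_mem] g_ne[of t] \<delta> by simp
lemma Cm_neg: "t \<in> {lo Cm..hi Cm} \<Longrightarrow> t \<noteq> 0 \<Longrightarrow> Re (ev Cm t) < 0 \<and> Im (ev Cm t) < 1"
  using SW_neg[OF Cm_mem(1)] g_ne[of t] \<delta> by simp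

lemma corner_NE: "corner \<in> NE" using sqrt3_bounds by (simp add: NE_def)

lemma Lp_mem: "t \<in> {lo Lp..hi Lp} \<Longrightarrow> ev Lp t \<in> NE"
  by (rule seg_in_convex[OF convex_NE _ corner_NE]) (use g_NE \<delta> in auto)

lemma Lp_pos: "t \<in> {lo Lp..hi Lp} \<Longrightarrow> Re (ev Lp t) > 0 \<and> Im (ev Lp t) > 1"
proof -
  assume t: "t \<in> {lo Lp..hi Lp}"
  have "ev Lp t \<in> {z. Re z > 0}"
    by (rule seg_in_convex[OF convex_halfspace_Re_gt _ _ t]) (use Cp_pos[of \<delta>] \<delta> in auto)
  hence "ev Lp t \<noteq> \<i>" by (auto simp del: seg_simps)
  with Lp_mem[OF t] NE_pos show ?thesis by blast
qed

lemma Lm_mem: "t \<in> {lo Lm..hi Lm} \<Longrightarrow> ev Lm t \<in> SW"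
  by (rule seg_in_convex[OF convex_SW]) (use g_SW[of "-\<delta>"] \<delta> in \<open>auto simp: SW_def\<close>)

lemma Lm_neg: "t \<in> {lo Lm..hi Lm} \<Longrightarrow> Re (ev Lm t) < 0 \<and> Im (ev Lm t) < 1"
proof -
  assume t: "t \<in> {lo Lm..hi Lm}"
  have "ev Lm t \<in> {z. Re z < 0}"
    by (rule seg_in_convex[OF convex_halfspace_Re_lt _ _ t]) (use Cm_neg[of "-\<delta>"] \<delta> in auto)
  hence "ev Lm t \<noteq> \<i>" by (auto simp del: seg_simps)
  with Lm_mem[OF t] SW_neg show ?thesis by blast
qed

lemma Lm_Im_nonneg: "t \<in> {lo Lm..hi Lm} \<Longrightarrow> Im (ev Lm t) \<ge> 0"
  using seg_in_convex[OF convex_halfspace_Im_ge[of 0], of "-2" "g (- complex_of_real \<delta>)" t] g_Im[of "-\<delta>"] \<delta> by simp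

lemmas basic_edges = is_edge_C is_edge_seg is_edge_ray

text \<open>
  \<open>Sig0\<close> and \<open>Sig1\<close> start at \<open>0\<close>, \<open>Sig2\<close> at \<open>- 2\<close>; all three end at \<open>corner\<close>, the point of
  the Airy contour with modulus \<open>2\<close>.
\<close>

definition "Sig0 = [ray]"
definition "Sig1 = [V, Cp, Lp]"
definition "Sig2 = [Lm, Cm, Cp, Lp]"
definition "Gam0 = map neg_cnj Sig0"
definition "Gam2 = map neg_cnj Sig2"

lemma chain_edges: "e \<in> set Sig0 \<Longrightarrow> is_edge e" "e \<in> set Sig1 \<Longrightarrow> is_edge e" "e \<in> set Sig2 \<Longrightarrow> is_edge e"
  "e \<in> set Gam0 \<Longrightarrow> is_edge e" "e \<in> set Gam2 \<Longrightarrow> is_edge e"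
  by (auto simp: Sig0_def Sig1_def Sig2_def Gam0_def Gam2_def intro!: basic_edges is_edge_neg_cnj)

end

section \<open>Cauchy deformation\<close>

text \<open>What Cauchy deformation needs of the numerator: holomorphy in each variable for moving
  one contour, holomorphy on the diagonal for integrating the residues, and reality under
  conjugation for the symmetry argument.\<close>

locale kernel_data =
  fixes F :: "complex \<Rightarrow> complex \<Rightarrow> complex"
  assumes F_cont: "continuous_on UNIV (\<lambda>(z, w). F z w)"
    and F_holo1: "\<And>w. (\<lambda>z. F z w) holomorphic_on UNIV"
    and F_holo2: "\<And>z. F z holomorphic_on UNIV"
    and F_diag: "(\<lambda>z. F z z) holomorphic_on UNIV"
    and F_cnj: "\<And>z w. F (cnj z) (cnj w) = cnj (F z w)"
begin

definition kern :: "complex \<Rightarrow> complex \<Rightarrow> complex" where "kern z w = F z w / (z - w)"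

lemma kern_holo1: "w \<notin> S \<Longrightarrow> (\<lambda>z. kern z w) holomorphic_on S"
  unfolding kern_def by (intro holomorphic_intros holomorphic_on_subset[OF F_holo1]) auto

lemma kern_holo2: "z \<notin> S \<Longrightarrow> kern z holomorphic_on S"
  unfolding kern_def[abs_def] by (intro holomorphic_intros holomorphic_on_subset[OF F_holo2]) auto

lemma kern_cnj: "kern (cnj z) (cnj w) = cnj (kern z w)"
  by (simp add: kern_def F_cnj)

text \<open>Supplies the hypothesis of \<open>cint_sym_odd\<close> when an inner integral over a
  symmetric contour is integrated over the other contour.\<close>

lemma inner_odd1: "cint (cnj_sym c) (kern (cnj z)) = - cnj (cint (cnj_sym c) (kern z))"
proof -
  have "kern (cnj z) = (\<lambda>w. cnj (kern z (cnj w)))"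
    using kern_cnj[of z "cnj w" for w] by (simp add: fun_eq_iff)
  thus ?thesis using cint_sym_cnj[of c "kern z"] by simp
qed

lemma inner_odd2: "cint (cnj_sym c) (\<lambda>z. kern z (cnj w)) = - cnj (cint (cnj_sym c) (\<lambda>z. kern z w))"
proof -
  have "(\<lambda>z. kern z (cnj w)) = (\<lambda>z. cnj (kern (cnj z) w))"
    using kern_cnj[of "cnj z" w for z] by (simp add: fun_eq_iff)
  thus ?thesis using cint_sym_cnj[of c "\<lambda>z. kern z w"] by simp
qed

end

definition runs_in :: "complex set \<Rightarrow> edge \<Rightarrow> bool" where
  "runs_in S e \<longleftrightarrow> (\<forall>t\<in>{lo e..hi e}. ev e t \<in> S)"
definition start_pt :: "edge \<Rightarrow> complex" where "start_pt e = ev e (lo e)"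
definition end_pt :: "edge \<Rightarrow> complex" where "end_pt e = ev e (hi e)"

definition "right_half = {z. Re z \<ge> 0}"
definition "left_half = {z. Re z \<le> 0}"
definition "above_i = {z. Im z \<ge> 1}"
definition "below_i = {z. Im z \<le> 1}"
definition "upper_half = {z. Im z \<ge> 0}"
definition "lower_half = {z. Im z \<le> 0}"
text \<open>A half plane that contains the mirror image of \<open>SW\<close> and whose boundary
  passes through \<i>, so that it excludes every \<i> y with y < 1.\<close>

definition "SW_mirror = {z. Im z + 2 * Re z \<ge> 1}"

lemmas halfplane_defs = right_half_def left_half_def above_i_def below_i_def upper_half_def lower_half_def
    SW_mirror_def

lemma convex_halfplanes: "convex right_half" "convex left_half" "convex above_i" "convex below_i"
    "convex lower_half" "convex SW_mirror"
  using convex_halfplane[of "-2" "-1" "-1"] unfolding halfplane_defs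
  by (auto simp: convex_halfspace_Re_ge convex_halfspace_Re_le convex_halfspace_Im_ge convex_halfspace_Im_le
      algebra_simps)

lemma runs_in_reflected [simp]:
  "runs_in right_half e \<Longrightarrow> runs_in right_half (rev_cnj e)" "runs_in left_half e \<Longrightarrow> runs_in left_half (rev_cnj e)"
  "runs_in right_half e \<Longrightarrow> runs_in left_half (neg_cnj e)" "runs_in left_half e \<Longrightarrow> runs_in right_half (neg_cnj e)"
  "runs_in above_i e \<Longrightarrow> runs_in above_i (neg_cnj e)" "runs_in below_i e \<Longrightarrow> runs_in below_i (neg_cnj e)"
  "runs_in upper_half e \<Longrightarrow> runs_in upper_half (neg_cnj e)" "runs_in upper_half e \<Longrightarrow> runs_in lower_half (rev_cnj e)"
  unfolding runs_in_def halfplane_defs by auto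

lemma endpoints_simps [simp]: "start_pt (rev_cnj e) = cnj (end_pt e)" "end_pt (rev_cnj e) = cnj (start_pt e)"
  "start_pt (neg_cnj e) = - cnj (start_pt e)" "end_pt (neg_cnj e) = - cnj (end_pt e)" "start_pt (seg a b) = a"
      "end_pt (seg a b) = b"
  by (simp_all add: start_pt_def end_pt_def)

lemma runs_in_seg: "convex S \<Longrightarrow> a \<in> S \<Longrightarrow> b \<in> S \<Longrightarrow> runs_in S (seg a b)"
  unfolding runs_in_def using seg_in_convex by blast

lemma obtain_primitive:
  assumes "convex S" "f holomorphic_on S"
  shows "\<exists>P. \<forall>e. is_edge e \<longrightarrow> runs_in S e \<longrightarrow> eint e f = P (end_pt e) - P (start_pt e)"
  using eint_convex_primitive[OF assms] unfolding runs_in_def start_pt_def end_pt_def .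

section \<open>Shifting one contour with the other variable fixed\<close>

locale contour_setup = saddle_curve g r \<delta> + kernel_data F
  for g :: "complex \<Rightarrow> complex" and r \<delta> :: real and F
begin

lemma NE_subset: "z \<in> NE \<Longrightarrow> Re z \<ge> 0 \<and> Im z \<ge> 1" by (auto simp: NE_def)

lemma runs_in_upper [simp]:
  "runs_in right_half ray" "runs_in right_half V" "runs_in right_half Cp" "runs_in right_half Lp"
  "runs_in left_half V" "runs_in left_half Cm" "runs_in left_half Lm"
  "runs_in above_i Cp" "runs_in above_i Lp" "runs_in below_i V" "runs_in below_i Cm" "runs_in below_i Lm"
  "runs_in upper_half ray" "runs_in upper_half V" "runs_in upper_half Cp" "runs_in upper_half Lp"
      "runs_in upper_half Cm" "runs_in upper_half Lm"
proof -
  have "NE \<subseteq> right_half" "NE \<subseteq> above_i" "NE \<subseteq> upper_half" "SW \<subseteq> left_half" "SW \<subseteq> below_i"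
    by (auto simp: NE_def SW_def halfplane_defs)
  thus "runs_in right_half Cp" "runs_in right_half Lp" "runs_in left_half Cm" "runs_in left_half Lm"
      "runs_in above_i Cp" "runs_in above_i Lp"
    "runs_in below_i Cm" "runs_in below_i Lm" "runs_in upper_half Cp" "runs_in upper_half Lp"
    using Cp_mem Lp_mem Cm_mem(1) Lm_mem unfolding runs_in_def by blast+
  show "runs_in right_half ray" "runs_in upper_half ray" by (auto simp: runs_in_def halfplane_defs)
  show "runs_in right_half V" "runs_in left_half V" "runs_in below_i V" "runs_in upper_half V"
      by (auto simp: runs_in_def halfplane_defs)
  show "runs_in upper_half Cm" "runs_in upper_half Lm" using Lm_Im_nonneg Cm_mem(2)
      unfolding runs_in_def upper_half_def by blast+
qed

lemma runs_in_below_i_rev_cnj [simp]: "runs_in upper_half e \<Longrightarrow> runs_in below_i (rev_cnj e)"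
proof -
  assume e: "runs_in upper_half e"
  have "Im (ev (rev_cnj e) t) \<le> 1" if "t \<in> {lo (rev_cnj e)..hi (rev_cnj e)}" for t
    using bspec[OF e[unfolded runs_in_def], of "-t"] that by (auto simp: halfplane_defs)
  thus ?thesis by (simp add: runs_in_def halfplane_defs)
qed

lemma runs_in_SW_mirror [simp]: "runs_in SW_mirror (neg_cnj Cm)" "runs_in SW_mirror (neg_cnj Lm)"
proof -
  have "- cnj z \<in> SW_mirror" if "z \<in> SW" for z using that by (simp add: SW_def halfplane_defs)
  thus "runs_in SW_mirror (neg_cnj Cm)" "runs_in SW_mirror (neg_cnj Lm)"
    using Cm_mem(1) Lm_mem unfolding runs_in_def neg_cnj_simps by blast+
qed

lemma endpoints [simp]:
  "start_pt ray = 0" "end_pt ray = corner" "start_pt Cp = \<i>" "end_pt Cp = g \<delta>" "start_pt Cm = g (-\<delta>)" "end_pt Cm = \<i>"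
  by (simp_all add: start_pt_def end_pt_def g0 complex_eq_iff)

lemma edge_simps [simp]: "is_edge Cp" "is_edge Cm" "is_edge ray" "is_edge (seg a b)"
  "is_edge e \<Longrightarrow> is_edge (rev_cnj e)" "is_edge e \<Longrightarrow> is_edge (neg_cnj e)"
  using basic_edges is_edge_rev_cnj is_edge_neg_cnj by auto

lemma cint_sym_chains:
  "cint (cnj_sym Sig0) f = eint (rev_cnj ray) f + eint ray f"
  "cint (cnj_sym Sig1) f = eint (rev_cnj V) f + eint (rev_cnj Cp) f + eint (rev_cnj Lp) f + eint V f + eint Cp f
      + eint Lp f"
  "cint (cnj_sym Sig2) f = eint (rev_cnj Lm) f + eint (rev_cnj Cm) f + eint (rev_cnj Cp) f + eint (rev_cnj Lp) f
      + eint Lm f + eint Cm f + eint Cp f + eint Lp f"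
  "cint (cnj_sym Gam0) f = eint (rev_cnj (neg_cnj ray)) f + eint (neg_cnj ray) f"
  "cint (cnj_sym Gam2) f = eint (rev_cnj (neg_cnj Lm)) f + eint (rev_cnj (neg_cnj Cm)) f
      + eint (rev_cnj (neg_cnj Cp)) f + eint (rev_cnj (neg_cnj Lp)) f
      + eint (neg_cnj Lm) f + eint (neg_cnj Cm) f + eint (neg_cnj Cp) f + eint (neg_cnj Lp) f"
  by (simp_all only: cint_def cnj_sym_def Sig0_def Sig1_def Sig2_def Gam0_def Gam2_def list.map append.simps
       sum_list.Cons sum_list.Nil add.assoc add_0_right)

text \<open>Both contours lead from \<open>cnj corner\<close> to \<open>corner\<close> inside the
  closed right half plane, which does not contain w.\<close>

lemma shift_Sig0_Sig1:
  assumes w: "Re w < 0"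
  shows "cint (cnj_sym Sig0) (\<lambda>z. kern z w) = cint (cnj_sym Sig1) (\<lambda>z. kern z w)"
proof -
  have "w \<notin> right_half" using w by (simp add: halfplane_defs)
  from obtain_primitive[OF convex_halfplanes(1) kern_holo1[OF this]] obtain P where
    P: "\<forall>e. is_edge e \<longrightarrow> runs_in right_half e \<longrightarrow> eint e (\<lambda>z. kern z w) = P (end_pt e) - P (start_pt e)" ..
  note [simp] = P[rule_format]
  show ?thesis unfolding cint_sym_chains by simp
qed

text \<open>The contours differ only between - \<i> and \<i>, where one follows the segment and the
  other makes a detour through -2. Both pieces lie in \<open>left_half\<close> as well as in
  \<open>below_i\<close>, and w is outside at least one of these.\<close>

lemma shift_Sig1_Sig2:
  assumes w: "Re w > 0 \<and> 0 \<le> Im w \<and> Im w < 1 \<or> Re w < 0 \<and> Im w > 1"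
  shows "cint (cnj_sym Sig1) (\<lambda>z. kern z w) = cint (cnj_sym Sig2) (\<lambda>z. kern z w)"
proof -
  obtain S where S: "S = left_half \<or> S = below_i" "w \<notin> S"
  proof (cases "Re w > 0")
    case True
    thus ?thesis using that[of left_half] by (simp add: left_half_def)
  next
    case False
    thus ?thesis using w that[of below_i] by (simp add: below_i_def)
  qed
  have "convex S" using S(1) convex_halfplanes by auto
  from obtain_primitive[OF this kern_holo1[OF S(2)]] obtain P where
    P: "\<forall>e. is_edge e \<longrightarrow> runs_in S e \<longrightarrow> eint e (\<lambda>z. kern z w) = P (end_pt e) - P (start_pt e)" ..
  note [simp] = P[rule_format]
  have [simp]: "runs_in S V" "runs_in S Cm" "runs_in S Lm" "runs_in S (rev_cnj V)" "runs_in S (rev_cnj Cm)"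
      "runs_in S (rev_cnj Lm)"
    using S(1) by auto
  show ?thesis unfolding cint_sym_chains by simp
qed

text \<open>All edges involved lie in one of the half planes \<open>left_half\<close> and
  \<open>below_i\<close>, and z in neither. The primitives on the two are matched along the segment
  from - \<i> to \<i>, which both contain.\<close>

lemma shift_Gam0_Gam2_outside:
  assumes z: "Re z > 0" "Im z > 1"
  shows "cint (cnj_sym Gam0) (kern z) = cint (cnj_sym Gam2) (kern z)"
proof -
  have "z \<notin> left_half" "z \<notin> below_i" using z by (auto simp: halfplane_defs)
  from obtain_primitive[OF convex_halfplanes(2) kern_holo2[OF \<open>z \<notin> left_half\<close>]] obtain P where
    "\<forall>e. is_edge e \<longrightarrow> runs_in left_half e \<longrightarrow> eint e (kern z) = P (end_pt e) - P (start_pt e)" ..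
  note P = this[rule_format]
  from obtain_primitive[OF convex_halfplanes(4) kern_holo2[OF \<open>z \<notin> below_i\<close>]] obtain Q where
    "\<forall>e. is_edge e \<longrightarrow> runs_in below_i e \<longrightarrow> eint e (kern z) = Q (end_pt e) - Q (start_pt e)" ..
  note Q = this[rule_format]
  have "runs_in left_half (seg (-\<i>) \<i>)" "runs_in below_i (seg (-\<i>) \<i>)"
    by (intro runs_in_seg convex_halfplanes; simp add: halfplane_defs)+
  with P[of "seg (-\<i>) \<i>"] Q[of "seg (-\<i>) \<i>"] have PQ: "P \<i> - P (-\<i>) = Q \<i> - Q (-\<i>)" by simp
  show ?thesis unfolding cint_sym_chains using PQ by (simp add: P Q algebra_simps)
qed

text \<open>The link to library contour integrals, through which winding numbers enter.\<close>

lemma eint_seg_contour: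
  assumes "z \<notin> closed_segment a b"
  shows "eint (seg a b) (kern z) = contour_integral (linepath a b) (kern z)"
proof -
  have hol: "kern z holomorphic_on closed_segment a b" by (rule kern_holo2[OF assms])
  have c: "continuous_on (closed_segment a b) (kern z)" using hol by (rule holomorphic_on_imp_continuous_on)
  obtain P where P: "\<And>w. w \<in> closed_segment a b \<Longrightarrow> (P has_field_derivative kern z w) (at w within closed_segment a b)"
  proof (rule holomorphic_convex_primitive[OF convex_closed_segment finite.emptyI c])
    fix x assume "x \<in> interior (closed_segment a b) - {}"
    thus "kern z field_differentiable at x"
      using hol by (metis Diff_empty at_within_interior holomorphic_onD interior_subset subsetD)
  qed blast
  have "eint (seg a b) (kern z) = P b - P a"
    using eint_FTC[OF is_edge_seg _ P c] seg_in_convex[OF convex_closed_segment] by simp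
  moreover have "(kern z has_contour_integral (P b - P a)) (linepath a b)"
    using contour_integral_primitive[OF P, of "linepath a b"] by simp
  ultimately show ?thesis by (simp add: contour_integral_unique)
qed

text \<open>The triangle 0, \<open>- cnj corner\<close>, 2 is traversed clockwise and contains \<i>
  y in its interior, because its third side crosses the imaginary axis at height 2/3 sqrt 3 > 1. The
  winding number -1 and the sign of z - w in \<open>kern\<close> cancel.\<close>

lemma triangle_residue:
  assumes y: "0 < y" "y < 1"
  defines "z \<equiv> \<i> * of_real y"
  shows "eint (seg 0 (- cnj corner)) (kern z) + eint (seg (- cnj corner) 2) (kern z) + eint (seg 2 0) (kern z)
      = 2 * of_real pi * \<i> * F z z"
proof -
  define A where "A = - cnj corner"
  have zA: "z = Complex 0 y" by (simp add: z_def complex_eq_iff)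
  have A: "A = Complex (-1) (sqrt 3)" by (simp add: A_def complex_eq_iff)
  have lt: "2 * sqrt 3 - 3 * y > 0" using y sqrt3_bounds by simp
  have "z \<in> interior (convex hull {0, A, 2})"
  proof -
    \<comment> \<open>The three open half planes bounded by the sides of the triangle.\<close>
    define H1 where "H1 = {w. sqrt 3 * Re w + Im w > 0} \<inter> {w. Im w > 0} \<inter> {w. sqrt 3 * Re w + 3 * Im w < 2 * sqrt 3}"
    have "open H1" unfolding H1_def
      by (intro open_Int open_Collect_less continuous_intros)
    moreover have "H1 \<subseteq> convex hull {0, A, 2}"
    proof
      fix w assume w: "w \<in> H1"
      define b c where "b = Im w / sqrt 3" and "c = (Re w + b) / 2"
      have s3: "sqrt 3 > 0" by simp
      have bs: "b * sqrt 3 = Im w" by (simp add: b_def)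
      have b: "b \<ge> 0" using w by (simp add: H1_def b_def)
      have "sqrt 3 * (Re w + b) > 0" using w bs by (simp add: H1_def algebra_simps)
      hence c: "c \<ge> 0" by (simp add: c_def zero_less_mult_iff)
      have "sqrt 3 * (Re w + 3 * b) < sqrt 3 * 2" using w bs by (simp add: H1_def algebra_simps)
      hence "Re w + 3 * b < 2" by simp
      hence a: "1 - b - c \<ge> 0" by (simp add: c_def)
      have "w = (1 - b - c) *\<^sub>R 0 + b *\<^sub>R A + c *\<^sub>R 2"
        using bs by (simp add: A complex_eq_iff c_def add_divide_distrib)
      moreover have "(1 - b - c) *\<^sub>R 0 + b *\<^sub>R A + c *\<^sub>R 2 \<in> convex hull {0, A, 2}"
        unfolding convex_hull_3 using a b c
        by (intro CollectI exI[of _ "1 - b - c"] exI[of _ b] exI[of _ c]) auto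
      ultimately show "w \<in> convex hull {0, A, 2}" by metis
    qed
    moreover have "z \<in> H1" using y lt by (simp add: H1_def zA)
    ultimately show ?thesis by (meson interior_maximal subsetD)
  qed
  hence wn: "winding_number (linepath 0 A +++ linepath A 2 +++ linepath 2 0) z = -1"
    by (subst winding_number_triangle) (use y in \<open>auto simp: A zA\<close>)
  have seg: "z \<notin> closed_segment 0 A" "z \<notin> closed_segment A 2" "z \<notin> closed_segment 2 0"
  proof -
    show "z \<notin> closed_segment 0 A" using y by (auto simp: in_segment A zA complex_eq_iff)
    show "z \<notin> closed_segment 2 0" using y by (auto simp: in_segment zA complex_eq_iff)
    show "z \<notin> closed_segment A 2"
    proof
      assume "z \<in> closed_segment A 2"
      then obtain u where "z = (1 - u) *\<^sub>R A + u *\<^sub>R 2" by (auto simp: in_segment)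
      hence "3 * u = 1" "y = (1 - u) * sqrt 3" by (auto simp: A zA complex_eq_iff)
      moreover from this(1) have "u = 1/3" by simp
      ultimately have "y = 2/3 * sqrt 3" by simp
      with y sqrt3_bounds show False by simp
    qed
  qed
  have "((\<lambda>w. F z w / (w - z)) has_contour_integral (2*pi * \<i> * (-1)
      * F z z)) (linepath 0 A +++ linepath A 2 +++ linepath 2 0)"
    using Cauchy_integral_formula_convex_simple[of UNIV "F z" z
        "linepath 0 A +++ linepath A 2 +++ linepath 2 0"] F_holo2 wn seg
    by (simp add: path_image_join subset_Diff_insert)
  from has_contour_integral_neg[OF this]
  have "(kern z has_contour_integral (2*pi * \<i> * F z z)) (linepath 0 A +++ linepath A 2 +++ linepath 2 0)"
    by (simp add: kern_def[abs_def] minus_divide_right)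
  moreover have "kern z contour_integrable_on linepath a b" if "z \<notin> closed_segment a b" for a b
    using kern_holo2[OF that] by (intro contour_integrable_continuous_linepath holomorphic_on_imp_continuous_on)
  ultimately have "contour_integral (linepath 0 A) (kern z) + (contour_integral (linepath A 2) (kern z)
      + contour_integral (linepath 2 0) (kern z)) = 2 * of_real pi * \<i> * F z z"
    using seg by (simp add: contour_integral_unique flip: contour_integral_join)
  thus ?thesis using seg by (simp add: eint_seg_contour A_def add.assoc)
qed

lemma runs_in_SW_mirror_seg: "runs_in SW_mirror (seg \<i> (Complex 0 (2/3 * sqrt 3)))"
    "runs_in SW_mirror (seg (Complex 0 (2/3 * sqrt 3)) 2)"
    "runs_in above_i (seg \<i> (Complex 0 (2/3 * sqrt 3)))"
        "runs_in above_i (seg (- cnj corner) (Complex 0 (2/3 * sqrt 3)))"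
proof -
  have m: "Complex 0 (2/3 * sqrt 3) \<in> SW_mirror" "Complex 0 (2/3 * sqrt 3) \<in> above_i" "\<i> \<in> SW_mirror" "\<i> \<in> above_i"
     "2 \<in> SW_mirror" "- cnj corner \<in> above_i"
    using sqrt3_bounds by (simp_all add: SW_mirror_def above_i_def)
  show "runs_in SW_mirror (seg \<i> (Complex 0 (2/3 * sqrt 3)))" "runs_in SW_mirror (seg (Complex 0 (2/3 * sqrt 3)) 2)"
    by (rule runs_in_seg[OF convex_halfplanes(6)], (rule m)+)+
  show "runs_in above_i (seg \<i> (Complex 0 (2/3 * sqrt 3)))"
      "runs_in above_i (seg (- cnj corner) (Complex 0 (2/3 * sqrt 3)))"
    by (rule runs_in_seg[OF convex_halfplanes(3)], (rule m)+)+
qed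

text \<open>The two contours pass z = \<i> y on opposite sides. The triangle of
  \<open>triangle_residue\<close> accounts for the residue; every remaining piece lies in a convex
  set that avoids z, namely \<open>lower_half\<close>, \<open>above_i\<close>,
  \<open>SW_mirror\<close> or a side of the triangle, and is evaluated by a primitive there.\<close>

lemma shift_Gam0_Gam2_runs_in:
  assumes y: "0 < y" "y < 1"
  defines "z \<equiv> \<i> * of_real y"
  shows "cint (cnj_sym Gam0) (kern z) = cint (cnj_sym Gam2) (kern z) + 2 * of_real pi * \<i> * F z z"
proof -
  \<comment> \<open>\<open>m\<close> is where the segment from \<open>A\<close> to \<open>2\<close> meets the imaginary axis\<close>
  define A m where "A = - cnj corner" and "m = Complex 0 (2/3 * sqrt 3)"
  have zA: "z = Complex 0 y" by (simp add: z_def complex_eq_iff)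
  have nz: "z \<notin> lower_half" "z \<notin> above_i" "z \<notin> SW_mirror" using y by (auto simp: zA halfplane_defs)
  have conv: "convex (closed_segment 0 A)" "convex (closed_segment A 2)" by (rule convex_closed_segment)+
  have AA: "A = Complex (-1) (sqrt 3)" by (simp add: A_def complex_eq_iff)
  have z0: "z \<notin> closed_segment 0 A" using y by (auto simp: in_segment AA zA complex_eq_iff)
  have z2: "z \<notin> closed_segment A 2"
  proof
    assume "z \<in> closed_segment A 2"
    hence "z \<in> {w. - sqrt 3 * Re w + (-3) * Im w \<le> - 2 * sqrt 3}"
      using closed_segment_subset[OF _ _ convex_halfplane, of A "- sqrt 3" "-3" "- 2 * sqrt 3" 2] by (auto simp: AA)
    thus False using y sqrt3_bounds by (simp add: zA)
  qed
  from obtain_primitive[OF convex_halfplanes(5) kern_holo2[OF nz(1)]] obtain P0 where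
    "\<forall>e. is_edge e \<longrightarrow> runs_in lower_half e \<longrightarrow> eint e (kern z) = P0 (end_pt e) - P0 (start_pt e)" ..
  note P0 = this[rule_format]
  from obtain_primitive[OF convex_halfplanes(3) kern_holo2[OF nz(2)]] obtain Pa where
    "\<forall>e. is_edge e \<longrightarrow> runs_in above_i e \<longrightarrow> eint e (kern z) = Pa (end_pt e) - Pa (start_pt e)" ..
  note Pa = this[rule_format]
  from obtain_primitive[OF convex_halfplanes(6) kern_holo2[OF nz(3)]] obtain Pb where
    "\<forall>e. is_edge e \<longrightarrow> runs_in SW_mirror e \<longrightarrow> eint e (kern z) = Pb (end_pt e) - Pb (start_pt e)" ..
  note Pb = this[rule_format]
  from obtain_primitive[OF conv(1) kern_holo2[OF z0]] obtain Pr where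
    "\<forall>e. is_edge e \<longrightarrow> runs_in (closed_segment 0 A) e \<longrightarrow> eint e (kern z) = Pr (end_pt e) - Pr (start_pt e)" ..
  note Pr = this[rule_format]
  from obtain_primitive[OF conv(2) kern_holo2[OF z2]] obtain Ps where
    "\<forall>e. is_edge e \<longrightarrow> runs_in (closed_segment A 2) e \<longrightarrow> eint e (kern z) = Ps (end_pt e) - Ps (start_pt e)" ..
  note Ps = this[rule_format]
  have mA: "m \<in> closed_segment A 2"
    unfolding in_segment by (intro exI[of _ "1/3"]) (auto simp: AA m_def complex_eq_iff)
  have ray: "runs_in (closed_segment 0 A) (neg_cnj ray)"
    unfolding runs_in_def
  proof
    fix t assume t: "t \<in> {lo (neg_cnj ray)..hi (neg_cnj ray)}"
    have "ev (neg_cnj ray) t = (1 - t/2) *\<^sub>R 0 + (t/2) *\<^sub>R A" by (simp add: AA complex_eq_iff)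
    thus "ev (neg_cnj ray) t \<in> closed_segment 0 A" using t unfolding in_segment by (intro exI[of _ "t/2"]) auto
  qed
  have e1: "eint (neg_cnj ray) (kern z) = eint (seg 0 A) (kern z)"
    using Pr[of "neg_cnj ray"] Pr[of "seg 0 A"] ray runs_in_seg[OF conv(1), of 0 A] by (simp add: A_def)
  have e2: "eint (seg 0 A) (kern z) + eint (seg A 2) (kern z) + eint (seg 2 0) (kern z) = 2 * of_real pi * \<i> * F z z"
    unfolding A_def z_def using triangle_residue[OF y] .
  have e3: "eint (seg A 2) (kern z) = eint (seg A m) (kern z) + eint (seg m 2) (kern z)"
    using mA by (simp add: Ps runs_in_seg[OF conv(2)])
  note ins = runs_in_SW_mirror_seg[folded A_def m_def]
  have e4: "eint (seg A m) (kern z) = Pa m - Pa A" "eint (seg m 2) (kern z) = Pb 2 - Pb m"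
    using Pa[of "seg A m"] Pb[of "seg m 2"] ins by simp_all
  \<comment> \<open>The primitives on \<open>above_i\<close> and \<open>SW_mirror\<close> are
    matched along the segment from \<i> to \<open>m\<close>, which lies in both.\<close>
  have e5: "Pa m = Pb m - Pb \<i> + Pa \<i>"
    using Pa[of "seg \<i> m"] Pb[of "seg \<i> m"] ins by (simp add: algebra_simps)
  have e6: "eint (seg 2 0) (kern z) = P0 0 - P0 2"
    using P0[of "seg 2 0"] runs_in_seg[OF convex_halfplanes(5), of 2 0] by (simp add: lower_half_def)
  have e7: "eint (neg_cnj Lm) (kern z) = - (Pb (- cnj (g (- complex_of_real \<delta>)))) * (-1) - Pb 2"
     "eint (neg_cnj Cm) (kern z) = Pb \<i> - Pb (- cnj (g (- complex_of_real \<delta>)))" by (simp_all add: Pb)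
  have e8: "eint (neg_cnj Cp) (kern z) + eint (neg_cnj Lp) (kern z) = Pa A - Pa \<i>" by (simp add: Pa A_def)
  have e9: "eint (rev_cnj (neg_cnj ray)) (kern z) = P0 0 - P0 (cnj A)"
    "eint (rev_cnj (neg_cnj Lm)) (kern z) + eint (rev_cnj (neg_cnj Cm)) (kern z)
        + eint (rev_cnj (neg_cnj Cp)) (kern z) + eint (rev_cnj (neg_cnj Lp)) (kern z) = P0 2 - P0 (cnj A)"
    by (simp_all add: P0 A_def)
  have R: "eint (neg_cnj ray) (kern z) = 2 * of_real pi * \<i> * F z z
      - (Pb m - Pb \<i> + Pa \<i> - Pa A + (Pb 2 - Pb m)) - (P0 0 - P0 2)"
    using e1 e2 unfolding e3 e4 e5 e6 by (simp add: algebra_simps)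
  have G2: "cint (cnj_sym Gam2) (kern z) = (P0 2 - P0 (cnj A)) + (Pb \<i> - Pb 2) + (Pa A - Pa \<i>)"
    unfolding cint_sym_chains e9(2) e8[symmetric] e7 by (simp add: algebra_simps)
  show ?thesis unfolding cint_sym_chains(4) e9(1) R G2 by (simp add: algebra_simps)
qed

text \<open>
  Multiplied by \<open>4 - 3 \<i>\<close>, the squares of the directions of \<open>NE\<close>, \<open>SW\<close> and of the imaginary
  axis lie in the upper half plane, those of the mirrored cones in the lower one. This separates the
  contours of \<open>z\<close> and \<open>w\<close> at their common point \<open>\<i>\<close>.
\<close>

lemma NE_SW_quadratic:
  assumes "z \<in> NE \<or> z \<in> SW"
  shows "norm (z - \<i>)^2 \<le> Im ((4 - 3 * \<i>) * (z - \<i>)^2)"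
    and "Im ((4 - 3 * \<i>) * (- cnj z - \<i>)^2) \<le> - (norm (- cnj z - \<i>)^2)"
proof -
  define x y where "x = Re z" and "y = Im z - 1"
  have "0 \<le> x \<and> 0 \<le> y \<and> x / 2 \<le> y \<and> y \<le> 2 * x \<or> x \<le> 0 \<and> y \<le> 0 \<and> 2 * x \<le> y \<and> y \<le> x / 2"
    using assms by (auto simp: NE_def SW_def x_def y_def)
  hence "0 \<le> x * (y - x / 2) \<and> 0 \<le> y * (2 * x - y)"
    by (elim disjE) (simp_all add: mult_nonneg_nonneg mult_nonpos_nonpos)
  \<comment> \<open>Slopes between 1/2 and 2 make x y dominate both squares up to a factor 2; the
    coefficient 8 of x y below then absorbs the indefinite part.\<close>
  hence *: "x * x \<le> 2 * (x * y)" "y * y \<le> 2 * (x * y)" by (auto simp: algebra_simps)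
  have 1: "norm (z - \<i>)^2 = x * x + y * y" "norm (- cnj z - \<i>)^2 = x * x + y * y"
    unfolding cmod_power2 by (simp_all add: x_def y_def power2_eq_square algebra_simps)
  have 2: "Im ((4 - 3 * \<i>) * (z - \<i>)^2) = 8 * (x * y) - 3 * (x * x) + 3 * (y * y)"
    "Im ((4 - 3 * \<i>) * (- cnj z - \<i>)^2) = - 8 * (x * y) - 3 * (x * x) + 3 * (y * y)"
    by (simp_all add: x_def y_def power2_eq_square algebra_simps)
  show "norm (z - \<i>)^2 \<le> Im ((4 - 3 * \<i>) * (z - \<i>)^2)"
    "Im ((4 - 3 * \<i>) * (- cnj z - \<i>)^2) \<le> - (norm (- cnj z - \<i>)^2)"
    unfolding 1 2 using * zero_le_square[of x] zero_le_square[of y] by linarith+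
qed

section \<open>Separation of the contours of z and w\<close>

lemma leaves_C: "leaves Cp \<i>" "leaves Cm \<i>"
proof -
  have "1/2 * \<bar>t - 0\<bar> \<le> norm (g (of_real t) - \<i>)" if "t \<in> {-\<delta>..\<delta>}" for t
    using g_leave[of t] that by simp
  note * = this
  have "\<forall>t\<in>{lo Cp..hi Cp}. 1/2 * \<bar>t - 0\<bar> \<le> norm (ev Cp t - \<i>)" "\<forall>t\<in>{lo Cm..hi Cm}. 1/2 * \<bar>t - 0\<bar> \<le> norm (ev Cm t - \<i>)"
    by (intro ballI; unfold C_simps; rule *; use \<delta> in auto)+
  moreover have "(1/2::real) > 0" by simp
  ultimately show "leaves Cp \<i>" "leaves Cm \<i>" unfolding leaves_def by blast+
qed

lemma leaves_L: "leaves Lp \<i>" "leaves Lm \<i>"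
proof -
  have *: "z \<noteq> \<i>" if "Re z > 0 \<or> Re z < 0" for z using that by auto
  show "leaves Lp \<i>" by (rule leavesI_avoid[OF is_edge_seg], rule *) (use Lp_pos in blast)
  show "leaves Lm \<i>" by (rule leavesI_avoid[OF is_edge_seg], rule *) (use Lm_neg in blast)
qed

lemma norm_four_minus_3i: "norm (4 - 3 * \<i>) \<le> 5"
  by (simp add: cmod_def power2_eq_square real_le_lsqrt)

lemma separated_at_i:
  assumes e: "e \<in> {V, Cp, Lp, Lm, Cm}" and e': "e' \<in> {Lm, Cm, Cp, Lp}"
  shows "separated e (neg_cnj e')"
proof (rule separatedI_quadratic[OF _ _ norm_four_minus_3i])
  show "leaves e \<i>" using e leaves_C leaves_L leaves_seg(2)[of 0 \<i>] by auto
  have "leaves e' \<i>" using e' leaves_C leaves_L by auto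
  from leaves_neg_cnj[OF this] show "leaves (neg_cnj e') \<i>" by simp
  show "norm (ev e t - \<i>)^2 \<le> Im ((4 - 3 * \<i>) * (ev e t - \<i>)^2)" if t: "t \<in> {lo e..hi e}" for t
  proof (cases "e = V")
    case True
    have "ev V t - \<i> = Complex 0 (t - 1)" by (simp add: complex_eq_iff)
    hence "norm (ev V t - \<i>)^2 = (t - 1)^2" "(ev V t - \<i>)^2 = Complex (- ((t - 1)^2)) 0"
      by (simp_all only: cmod_power2) (simp_all add: complex_eq_iff power2_eq_square)
    thus ?thesis unfolding True by simp
  next
    case False
    hence "ev e t \<in> NE \<or> ev e t \<in> SW" using e t Cp_mem Lp_mem Cm_mem(1) Lm_mem by blast
    thus ?thesis by (rule NE_SW_quadratic)
  qed
  show "Im ((4 - 3 * \<i>) * (ev (neg_cnj e') t - \<i>)^2) \<le> - (norm (ev (neg_cnj e') t - \<i>)^2)"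
      if t: "t \<in> {lo (neg_cnj e')..hi (neg_cnj e')}" for t
  proof -
    have "ev e' t \<in> NE \<or> ev e' t \<in> SW" using e' t Cp_mem Lp_mem Cm_mem(1) Lm_mem unfolding neg_cnj_simps by blast
    thus ?thesis unfolding neg_cnj_simps by (rule NE_SW_quadratic)
  qed
qed

text \<open>The upper half of the z contour and the lower half of the w contour could meet only on
  the real axis, where the former has nonpositive and the latter positive real part.\<close>

lemma separated_lower:
  assumes e: "e \<in> {V, Cp, Lp, Lm, Cm}" and e': "e' \<in> {Lm, Cm, Cp, Lp}"
  shows "separated e (rev_cnj (neg_cnj e'))"
proof (rule separatedI_disjoint)
  show "is_edge e" "is_edge (rev_cnj (neg_cnj e'))" using e e' by auto
  fix t s assume t: "t \<in> {lo e..hi e}" and s: "s \<in> {lo (rev_cnj (neg_cnj e'))..hi (rev_cnj (neg_cnj e'))}"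
  have z: "Im (ev e t) \<ge> 0 \<and> (Im (ev e t) = 0 \<longrightarrow> Re (ev e t) \<le> 0)"
  proof -
    have "runs_in upper_half e" "runs_in left_half e \<or> runs_in above_i e" using e by auto
    hence "ev e t \<in> upper_half" "ev e t \<in> left_half \<or> ev e t \<in> above_i" using t unfolding runs_in_def by blast+
    thus ?thesis by (auto simp: halfplane_defs)
  qed
  define w where "w = ev e' (-s)"
  have s': "-s \<in> {lo e'..hi e'}" using s by auto
  have "w \<in> NE \<or> w \<in> SW" using e' s' Cp_mem Lp_mem Cm_mem(1) Lm_mem unfolding w_def by blast
  moreover have "runs_in upper_half e'" using e' by auto
  hence "Im w \<ge> 0" using s' unfolding runs_in_def w_def upper_half_def by blast
  ultimately have "Im w \<ge> 0 \<and> (Im w = 0 \<longrightarrow> Re w < 0)" by (auto simp: NE_def SW_def)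
  moreover have "ev (rev_cnj (neg_cnj e')) s = - w" by (simp add: w_def)
  ultimately show "ev e t \<noteq> ev (rev_cnj (neg_cnj e')) s" using z by auto
qed

lemma separated_ray:
  assumes e: "e \<in> {ray, V, Cp, Lp}"
  shows "separated e (neg_cnj ray)" "separated e (rev_cnj (neg_cnj ray))"
proof -
  have l1: "leaves (neg_cnj ray) 0" using leaves_neg_cnj[OF leaves_ray] by simp
  have l2: "leaves (rev_cnj (neg_cnj ray)) 0" using leaves_rev_cnj[OF l1] by simp
  have nr: "norm (ev ray t) = \<bar>t\<bar>" for t by (simp only: ray_simps norm_ray)
  have nm: "norm (ev (neg_cnj ray) t) = \<bar>t\<bar>" for t unfolding neg_cnj_simps norm_minus_cancel complex_mod_cnj nr ..
  have nrm: "norm (ev (rev_cnj (neg_cnj ray)) t) = \<bar>t\<bar>" for t unfolding rev_cnj_simps complex_mod_cnj nm by simp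
  have ray: "separated ray (neg_cnj ray)" "separated ray (rev_cnj (neg_cnj ray))"
  proof -
    show "separated ray (neg_cnj ray)"
      by (rule separatedI_linear[where \<alpha> = 1, OF leaves_ray l1]) (simp_all only: diff_zero nr nm, auto)
    show "separated ray (rev_cnj (neg_cnj ray))"
      by (rule separatedI_linear[where \<alpha> = 1, OF leaves_ray l2]) (simp_all only: diff_zero nr nrm, auto)
  qed
  have V: "separated V (neg_cnj ray)" "separated V (rev_cnj (neg_cnj ray))"
  proof -
    \<comment> \<open>The imaginary axis and the ray at 120 degrees enclose only 30 degrees, too
      narrow for the linear criterion with constant 1/3 (sin 15 degrees < 1/3). With \<mu> = 2 -
      \<i> the quadratic form is t^2 at \<i> t and (1/2 - sqrt 3) s^2 on the ray.\<close>
    show "separated V (neg_cnj ray)"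
    proof (rule separatedI_quadratic[where \<mu> = "2 - \<i>", OF leaves_seg(1) l1])
      have "norm (2 - \<i>) \<le> norm (2::complex) + norm \<i>" by (rule norm_triangle_ineq4)
      thus "norm (2 - \<i>) \<le> 5" by simp
      show "norm (ev V t - 0)^2 \<le> Im ((2 - \<i>) * (ev V t - 0)^2)" for t
        by (simp add: norm_mult power2_eq_square)
      show "Im ((2 - \<i>) * (ev (neg_cnj ray) s - 0)^2) \<le> - (norm (ev (neg_cnj ray) s - 0)^2)" for s
      proof -
        have "Im ((2 - \<i>) * (ev (neg_cnj ray) s - 0)^2) = (1/2 - sqrt 3) * s^2"
          by (simp add: power2_eq_square algebra_simps)
        also have "\<dots> \<le> (-1) * s^2" using sqrt3_bounds by (intro mult_right_mono) auto
        finally show ?thesis by (simp only: diff_zero nm) simp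
      qed
    qed auto
    show "separated V (rev_cnj (neg_cnj ray))"
    proof (rule separatedI_linear[where \<alpha> = "-\<i>", OF leaves_seg(1) l2])
      fix s assume s: "s \<in> {lo (rev_cnj (neg_cnj ray))..hi (rev_cnj (neg_cnj ray))}"
      have "Re (- \<i> * (ev (rev_cnj (neg_cnj ray)) s - 0)) = s * sqrt 3 / 2" by simp
      also have "\<dots> \<le> s / 3" using s sqrt3_bounds mult_left_mono_neg[of "2/3" "sqrt 3" s] by simp
      finally show "Re (- \<i> * (ev (rev_cnj (neg_cnj ray)) s - 0)) \<le> - norm (ev (rev_cnj (neg_cnj ray)) s - 0) / 3"
        using s by (simp only: diff_zero nrm) simp
    qed (auto simp: norm_mult)
  qed
  have C: "separated e (neg_cnj ray)" "separated e (rev_cnj (neg_cnj ray))" if e: "e \<in> {Cp, Lp}"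
  proof -
    have z: "Im (ev e t) \<ge> 1" "Re (ev e t) \<ge> 0" if "t \<in> {lo e..hi e}" for t
    proof -
      have "ev e t \<in> NE" using e that Cp_mem Lp_mem by blast
      thus "Im (ev e t) \<ge> 1" "Re (ev e t) \<ge> 0" using NE_subset by auto
    qed
    show "separated e (neg_cnj ray)"
    proof (rule separatedI_disjoint)
      fix t s assume "t \<in> {lo e..hi e}" "s \<in> {lo (neg_cnj ray)..hi (neg_cnj ray)}"
      thus "ev e t \<noteq> ev (neg_cnj ray) s" using z[of t] by (auto simp: complex_eq_iff)
    qed (use e in auto)
    show "separated e (rev_cnj (neg_cnj ray))"
    proof (rule separatedI_disjoint)
      fix t s assume "t \<in> {lo e..hi e}" "s \<in> {lo (rev_cnj (neg_cnj ray))..hi (rev_cnj (neg_cnj ray))}"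
      thus "ev e t \<noteq> ev (rev_cnj (neg_cnj ray)) s" using z[of t] by (auto simp: complex_eq_iff)
    qed (use e in auto)
  qed
  show "separated e (neg_cnj ray)" "separated e (rev_cnj (neg_cnj ray))"
    using e ray V C by blast+
qed

text \<open>These are the successive stages of the deformation. The contours of the first two pairs
  touch at 0, those of the last two at \<i> and - \<i>.\<close>

lemma integrable_pairs:
  "integrable_pair (cnj_sym Sig0) (cnj_sym Gam0) kern" "integrable_pair (cnj_sym Sig1) (cnj_sym Gam0) kern"
  "integrable_pair (cnj_sym Sig1) (cnj_sym Gam2) kern" "integrable_pair (cnj_sym Sig2) (cnj_sym Gam2) kern"
proof -
  have set: "set Sig0 = {ray}" "set Sig1 = {V, Cp, Lp}" "set Sig2 = {Lm, Cm, Cp, Lp}"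
     "set Gam0 = {neg_cnj ray}" "set Gam2 = neg_cnj ` {Lm, Cm, Cp, Lp}"
    by (auto simp: Sig0_def Sig1_def Sig2_def Gam0_def Gam2_def)
  have k: "kern = (\<lambda>z w. F z w / (z - w))" by (simp add: kern_def fun_eq_iff)
  have r: "separated e e' \<and> separated e (rev_cnj e')" if "e \<in> {ray, V, Cp, Lp}" "e' \<in> {neg_cnj ray}" for e e'
    using separated_ray[OF that(1)] that(2) by simp
  show "integrable_pair (cnj_sym Sig0) (cnj_sym Gam0) kern"
  proof (unfold k, rule integrable_pair_sym[OF chain_edges(1) chain_edges(4) _ _ F_cont])
    fix e e' assume "e \<in> set Sig0" "e' \<in> set Gam0"
    hence "e \<in> {ray, V, Cp, Lp}" "e' \<in> {neg_cnj ray}" unfolding set by blast+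
    thus "separated e e'" "separated e (rev_cnj e')" using r by blast+
  qed auto
  show "integrable_pair (cnj_sym Sig1) (cnj_sym Gam0) kern"
  proof (unfold k, rule integrable_pair_sym[OF chain_edges(2) chain_edges(4) _ _ F_cont])
    fix e e' assume "e \<in> set Sig1" "e' \<in> set Gam0"
    hence "e \<in> {ray, V, Cp, Lp}" "e' \<in> {neg_cnj ray}" unfolding set by blast+
    thus "separated e e'" "separated e (rev_cnj e')" using r by blast+
  qed auto
  show "integrable_pair (cnj_sym Sig1) (cnj_sym Gam2) kern"
  proof (unfold k, rule integrable_pair_sym[OF chain_edges(2) chain_edges(5) _ _ F_cont])
    fix e e' assume *: "e \<in> set Sig1" "e' \<in> set Gam2"
    then obtain b where "b \<in> {Lm, Cm, Cp, Lp}" "e' = neg_cnj b" "e \<in> {V, Cp, Lp, Lm, Cm}" unfolding set by blast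
    thus "separated e e'" "separated e (rev_cnj e')" using separated_at_i separated_lower by blast+
  qed auto
  show "integrable_pair (cnj_sym Sig2) (cnj_sym Gam2) kern"
  proof (unfold k, rule integrable_pair_sym[OF chain_edges(3) chain_edges(5) _ _ F_cont])
    fix e e' assume *: "e \<in> set Sig2" "e' \<in> set Gam2"
    then obtain b where "b \<in> {Lm, Cm, Cp, Lp}" "e' = neg_cnj b" "e \<in> {V, Cp, Lp, Lm, Cm}" unfolding set by blast
    thus "separated e e'" "separated e (rev_cnj e')" using separated_at_i separated_lower by blast+
  qed auto
qed

end

section \<open>Assembling the deformation\<close>

lemma cint_inner_integrable:
  assumes "integrable_pair c1 c2 f" "e \<in> set c1"
  shows "integrable lborel (\<lambda>t. indicator {lo e..hi e} t *\<^sub>R (cint c2 (f (ev e t)) * ed e t))"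
proof -
  have "integrable lborel (\<lambda>t. indicator {lo e..hi e} t *\<^sub>R ((\<Sum>d\<leftarrow>c2. eint d (f (ev e t))) * ed e t))"
    by (rule eint_sum_list(2)[where F="\<lambda>d z. eint d (f z)"], rule iterated_eint(4))
       (use assms in \<open>auto simp: integrable_pair_def\<close>)
  thus ?thesis by (simp add: cint_def)
qed

lemma eint_add:
  assumes "integrable lborel (\<lambda>t. indicator {lo e..hi e} t *\<^sub>R (f (ev e t) * ed e t))"
    and "integrable lborel (\<lambda>t. indicator {lo e..hi e} t *\<^sub>R (h (ev e t) * ed e t))"
  shows "eint e (\<lambda>z. f z + h z) = eint e f + eint e h"
  unfolding eint_def using Bochner_Integration.integral_add[OF assms]
  by (simp add: distrib_right scaleR_add_right)

lemma eint_integrable_continuous: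
  assumes "is_edge e" "continuous_on UNIV f"
  shows "integrable lborel (\<lambda>t. indicator {lo e..hi e} t *\<^sub>R (f (ev e t) * ed e t))"
proof -
  have "continuous_on {lo e..hi e} (\<lambda>t. f (ev e t) * ed e t)"
    using assms is_edge_continuous[OF assms(1)] unfolding is_edge_def
    by (intro continuous_on_mult continuous_on_compose2[OF assms(2)]) auto
  from borel_integrable_atLeastAtMost'[OF this] show ?thesis by (simp add: set_integrable_def)
qed

lemma eint_cmult: "eint e (\<lambda>z. c * f z) = c * eint e f"
proof -
  have "eint e (\<lambda>z. c * f z) = (LINT t|lborel. c * (indicator {lo e..hi e} t *\<^sub>R (f (ev e t) * ed e t)))"
    unfolding eint_def by (intro Bochner_Integration.integral_cong) (auto simp: indicator_def)
  thus ?thesis unfolding eint_def by (simp only: Bochner_Integration.integral_mult_right_zero)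
qed

context contour_setup
begin

lemma cint_chains:
  "cint Sig1 f = eint V f + eint Cp f + eint Lp f"
  "cint Gam2 f = eint (neg_cnj Lm) f + eint (neg_cnj Cm) f + eint (neg_cnj Cp) f + eint (neg_cnj Lp) f"
  "cint Sig2 f = eint Lm f + eint Cm f + eint Cp f + eint Lp f"
  by (simp_all only: cint_def Sig1_def Sig2_def Gam2_def list.map sum_list.Cons sum_list.Nil add.assoc add_0_right)

text \<open>
  With \<open>w\<close> on \<open>Gam0\<close>, the \<open>z\<close> contour moves freely to \<open>Sig1\<close>. Moving \<open>w\<close> to \<open>Gam2\<close> then crosses
  exactly the points of \<open>V\<close>, whose residues are collected in the last term. Finally \<open>z\<close> moves
  to \<open>Sig2\<close>.
\<close>

theorem contour_deformation:
  "cint (cnj_sym Gam0) (\<lambda>w. cint (cnj_sym Sig0) (\<lambda>z. kern z w)) =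
   cint (cnj_sym Gam2) (\<lambda>w. cint (cnj_sym Sig2) (\<lambda>z. kern z w)) + 2 * of_real pi * \<i> * cint (cnj_sym [V]) (\<lambda>z. F z z)"
proof -
  define f where "f z = cint (cnj_sym Gam0) (kern z)" for z
  define h where "h z = cint (cnj_sym Gam2) (kern z)" for z
  define D where "D z = 2 * of_real pi * \<i> * F z z" for z
  have A: "cint (cnj_sym Gam0) (\<lambda>w. cint (cnj_sym Sig0) (\<lambda>z. kern z w))
      = cint (cnj_sym Gam0) (\<lambda>w. cint (cnj_sym Sig1) (\<lambda>z. kern z w))"
  proof -
    have "eint e (\<lambda>w. cint (cnj_sym Sig0) (\<lambda>z. kern z w)) = eint e (\<lambda>w. cint (cnj_sym Sig1) (\<lambda>z. kern z w))"
      if e: "e = neg_cnj ray \<or> e = rev_cnj (neg_cnj ray)" for e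
    proof (rule eint_cong_finite[of "{0}"])
      \<comment> \<open>The excluded parameter is w = 0, which lies on both z contours.\<close>
      fix t assume "t \<in> {lo e..hi e}" "t \<notin> {0}"
      hence "Re (ev e t) < 0" using e by auto
      thus "cint (cnj_sym Sig0) (\<lambda>z. kern z (ev e t)) = cint (cnj_sym Sig1) (\<lambda>z. kern z (ev e t))"
        by (rule shift_Sig0_Sig1)
    qed auto
    thus ?thesis unfolding cint_sym_chains(4) by simp
  qed
  have B: "cint (cnj_sym Gam0) (\<lambda>w. cint (cnj_sym Sig1) (\<lambda>z. kern z w)) = cint (cnj_sym Sig1) f"
    unfolding f_def by (rule cint_swap[OF integrable_pairs(2)])
  have odd: "f (cnj z) = - cnj (f z)" "h (cnj z) = - cnj (h z)" "D (cnj z) = - cnj (D z)" for z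
    unfolding f_def h_def D_def by (rule inner_odd1)+ (simp add: F_cnj)
  have C: "cint Sig1 f = cint Sig1 h + cint [V] D"
  proof -
    have "eint Cp f = eint Cp h"
      by (rule eint_cong_finite[of "{0}"]) (use Cp_pos shift_Gam0_Gam2_outside in \<open>simp_all add: f_def h_def\<close>)
    moreover have "eint Lp f = eint Lp h"
      by (rule eint_cong_finite[of "{}"], simp, unfold f_def h_def, rule shift_Gam0_Gam2_outside)
          (use Lp_pos in blast)+
    moreover have "eint V f = eint V (\<lambda>z. h z + D z)"
    proof (rule eint_cong_finite[of "{0, 1}"])
      \<comment> \<open>The excluded end points are z = 0 on the old and z = \<i> on the new w
        contour.\<close>
      fix t assume "t \<in> {lo V..hi V}" "t \<notin> {0, 1}"
      hence t: "0 < t" "t < 1" by auto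
      have Vt: "ev V t = \<i> * of_real t" by simp
      show "f (ev V t) = h (ev V t) + D (ev V t)"
        unfolding Vt f_def h_def D_def by (rule shift_Gam0_Gam2_runs_in[OF t])
    qed auto
    moreover have "eint V (\<lambda>z. h z + D z) = eint V h + eint V D"
    proof (rule eint_add)
      show "integrable lborel (\<lambda>t. indicator {lo V..hi V} t *\<^sub>R (h (ev V t) * ed V t))"
        unfolding h_def by (rule cint_inner_integrable[OF integrable_pairs(3)]) (simp add: Sig1_def cnj_sym_def)
      show "integrable lborel (\<lambda>t. indicator {lo V..hi V} t *\<^sub>R (D (ev V t) * ed V t))"
        unfolding D_def
        by (rule eint_integrable_continuous[OF is_edge_seg])
           (intro continuous_on_mult continuous_on_const holomorphic_on_imp_continuous_on[OF F_diag])
    qed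
    ultimately show ?thesis by (simp add: cint_chains(1)) (simp add: cint_def)
  qed
  have "cint (cnj_sym Sig1) f = of_real (2 * Re (cint Sig1 f))" by (rule cint_sym_odd) (rule odd)
  also have "\<dots> = of_real (2 * Re (cint Sig1 h)) + of_real (2 * Re (cint [V] D))" by (simp add: C)
  also have "of_real (2 * Re (cint Sig1 h)) = cint (cnj_sym Sig1) h" by (rule cint_sym_odd[symmetric]) (rule odd)
  also have "of_real (2 * Re (cint [V] D)) = cint (cnj_sym [V]) D" by (rule cint_sym_odd[symmetric]) (rule odd)
  also have "cint (cnj_sym [V]) D = 2 * of_real pi * \<i> * cint (cnj_sym [V]) (\<lambda>z. F z z)"
    unfolding D_def by (simp add: cint_def cnj_sym_def eint_cmult distrib_left)
  finally have C': "cint (cnj_sym Sig1) f = cint (cnj_sym Sig1) h + 2 * of_real pi * \<i>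
      * cint (cnj_sym [V]) (\<lambda>z. F z z)" .
  have E: "cint (cnj_sym Sig1) h = cint (cnj_sym Gam2) (\<lambda>w. cint (cnj_sym Sig1) (\<lambda>z. kern z w))"
    unfolding h_def by (rule cint_swap[OF integrable_pairs(3), symmetric])
  define p where "p w = cint (cnj_sym Sig1) (\<lambda>z. kern z w)" for w
  define q where "q w = cint (cnj_sym Sig2) (\<lambda>z. kern z w)" for w
  have pq: "p (cnj w) = - cnj (p w)" "q (cnj w) = - cnj (q w)" for w
    unfolding p_def q_def by (rule inner_odd2)+
  \<comment> \<open>Apart from w = \<i>, the mirror images of \<open>Lm\<close> and
    \<open>Cm\<close> satisfy the first alternative, those of \<open>Cp\<close> and
    \<open>Lp\<close> the second.\<close>
  have pq_eq: "p w = q w" if "Re w > 0 \<and> 0 \<le> Im w \<and> Im w < 1 \<or> Re w < 0 \<and> Im w > 1" for w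
    unfolding p_def q_def by (rule shift_Sig1_Sig2[OF that])
  have G: "cint Gam2 p = cint Gam2 q"
  proof -
    have "eint (neg_cnj Lm) p = eint (neg_cnj Lm) q"
    proof (rule eint_cong_finite[of "{}"])
      fix t assume "t \<in> {lo (neg_cnj Lm)..hi (neg_cnj Lm)}"
      hence "t \<in> {lo Lm..hi Lm}" by simp
      from Lm_neg[OF this] Lm_Im_nonneg[OF this] show "p (ev (neg_cnj Lm) t) = q (ev (neg_cnj Lm) t)"
        unfolding neg_cnj_simps by (intro pq_eq) (simp del: seg_simps C_simps)
    qed auto
    moreover have "eint (neg_cnj Cm) p = eint (neg_cnj Cm) q"
    proof (rule eint_cong_finite[of "{0}"])
      fix t assume *: "t \<in> {lo (neg_cnj Cm)..hi (neg_cnj Cm)}" "t \<notin> {0}"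
      hence t: "t \<in> {lo Cm..hi Cm}" "t \<noteq> 0" by simp_all
      from Cm_neg[OF t] Cm_mem(2)[OF t(1)] show "p (ev (neg_cnj Cm) t) = q (ev (neg_cnj Cm) t)"
        unfolding neg_cnj_simps by (intro pq_eq) (simp del: seg_simps C_simps)
    qed auto
    moreover have "eint (neg_cnj Cp) p = eint (neg_cnj Cp) q"
    proof (rule eint_cong_finite[of "{0}"])
      fix t assume *: "t \<in> {lo (neg_cnj Cp)..hi (neg_cnj Cp)}" "t \<notin> {0}"
      hence t: "t \<in> {lo Cp..hi Cp}" "t \<noteq> 0" by simp_all
      from Cp_pos[OF t] show "p (ev (neg_cnj Cp) t) = q (ev (neg_cnj Cp) t)"
        unfolding neg_cnj_simps by (intro pq_eq) (simp del: seg_simps C_simps)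
    qed auto
    moreover have "eint (neg_cnj Lp) p = eint (neg_cnj Lp) q"
    proof (rule eint_cong_finite[of "{}"])
      fix t assume "t \<in> {lo (neg_cnj Lp)..hi (neg_cnj Lp)}"
      hence "t \<in> {lo Lp..hi Lp}" by simp
      from Lp_pos[OF this] show "p (ev (neg_cnj Lp) t) = q (ev (neg_cnj Lp) t)"
        unfolding neg_cnj_simps by (intro pq_eq) (simp del: seg_simps C_simps)
    qed auto
    ultimately show ?thesis unfolding cint_chains by simp
  qed
  have "cint (cnj_sym Gam2) p = cint (cnj_sym Gam2) q"
    using cint_sym_odd[of p, OF pq(1)] cint_sym_odd[of q, OF pq(2)] G by simp
  thus ?thesis using A B C' E unfolding p_def q_def by simp
qed

lemma segment_chain:
  "cint (cnj_sym [V]) (\<lambda>z. F z z) = contour_integral (linepath (- \<i>) \<i>) (\<lambda>z. F z z)"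
proof -
  obtain P where P: "\<And>z. z \<in> UNIV \<Longrightarrow> (P has_field_derivative F z z) (at z within UNIV)"
    using holomorphic_convex_primitive'[OF convex_UNIV open_UNIV F_diag] by metis
  have c: "continuous_on UNIV (\<lambda>z. F z z)" by (rule holomorphic_on_imp_continuous_on[OF F_diag])
  have "eint e (\<lambda>z. F z z) = P (end_pt e) - P (start_pt e)" if "is_edge e" for e
    unfolding start_pt_def end_pt_def by (rule eint_FTC[OF that _ P c]) auto
  moreover have "((\<lambda>z. F z z) has_contour_integral (P \<i> - P (-\<i>))) (linepath (-\<i>) \<i>)"
    using contour_integral_primitive[OF P, of "linepath (-\<i>) \<i>"] by simp
  ultimately show ?thesis by (simp add: cint_def cnj_sym_def contour_integral_unique)
qed

end

section \<open>A two-dimensional Watson lemma\<close>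

lemma borel_measurable_fst_snd [measurable]:
  "(fst :: real \<times> real \<Rightarrow> real) \<in> borel_measurable borel" "(snd :: real \<times> real \<Rightarrow> real) \<in> borel_measurable borel"
  by (intro borel_measurable_continuous_onI continuous_intros)+

text \<open>Negative s is included: s = -1 is the reflection used for the parity of moments.\<close>

lemma lborel_integral_scale:
  fixes f :: "real \<times> real \<Rightarrow> complex"
  assumes [measurable]: "f \<in> borel_measurable borel" and s: "s \<noteq> 0"
  shows "(LINT p|lborel. f p) = of_real (s^2) * (LINT p|lborel. f (s *\<^sub>R p))"
proof -
  have "(LINT p|lborel. f p)
      = (LINT p|density (distr lborel borel (\<lambda>x. 0 + s *\<^sub>R x)) (\<lambda>_. ennreal (\<bar>s\<bar> ^ DIM(real \<times> real))). f p)"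
    using s by (subst lborel_affine[of s 0]) auto
  also have "\<dots> = (LINT p|distr lborel borel (\<lambda>x. 0 + s *\<^sub>R x). (s^2) *\<^sub>R f p)"
    using s by (subst integral_density) (auto simp: power2_eq_square)
  also have "\<dots> = (LINT p|lborel. (s^2) *\<^sub>R f (s *\<^sub>R p))"
    by (subst integral_distr) auto
  finally show ?thesis by (simp add: scaleR_conv_of_real)
qed

lemma sum_triangle:
  fixes f :: "nat \<Rightarrow> nat \<Rightarrow> 'a :: comm_monoid_add"
  shows "(\<Sum>k<m. \<Sum>l<m-k. f k l) = (\<Sum>n<m. \<Sum>k\<le>n. f k (n - k))"
proof -
  have "(\<Sum>k<m. \<Sum>l<m-k. f k l) = (\<Sum>(k,l)\<in>Sigma {..<m} (\<lambda>k. {..<m-k}). f k l)"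
    by (rule sum.Sigma) auto
  also have "Sigma {..<m} (\<lambda>k. {..<m-k}) = {(i,j). i + j < m}" by auto
  finally show ?thesis by (simp add: sum.triangle_reindex)
qed

text \<open>Covers both kinds of saddle pairs at once: the constant 1 with d = 0 and 1 / (x - \<i>
  y) with d = 1. Homogeneity of degree - d fixes the powers of s; the finite absolute moments
  express local integrability.\<close>

definition gauss_kernel :: "(real \<times> real \<Rightarrow> complex) \<Rightarrow> nat \<Rightarrow> bool" where
  "gauss_kernel \<kappa> d \<longleftrightarrow> \<kappa> \<in> borel_measurable borel \<and>
     (\<forall>s>0. \<forall>p. \<kappa> (s *\<^sub>R p) = \<kappa> p / of_real (s^d)) \<and>
     (\<forall>m. integrable lborel (\<lambda>p. exp (- ((fst p)^2 + (snd p)^2)) * (\<bar>fst p\<bar> + \<bar>snd p\<bar>)^m * norm (\<kappa> p)))"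

definition gauss_moment :: "(real \<times> real \<Rightarrow> complex) \<Rightarrow> nat \<Rightarrow> nat \<Rightarrow> complex" where
  "gauss_moment \<kappa> k l = (LINT p|lborel. of_real (exp (- ((fst p)^2 + (snd p)^2)) * (fst p)^k * (snd p)^l) * \<kappa> p)"

definition gauss_abs_moment :: "(real \<times> real \<Rightarrow> complex) \<Rightarrow> nat \<Rightarrow> real" where
  "gauss_abs_moment \<kappa> m = (LINT p|lborel. exp (- ((fst p)^2 + (snd p)^2)) * (\<bar>fst p\<bar> + \<bar>snd p\<bar>)^m * norm (\<kappa> p))"

lemma gauss_monomial_integrable:
  assumes "gauss_kernel \<kappa> d"
  shows "integrable lborel (\<lambda>p. of_real (exp (- ((fst p)^2 + (snd p)^2)) * (fst p)^k * (snd p)^l) * \<kappa> p)"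
proof (rule Bochner_Integration.integrable_bound)
  show "integrable lborel (\<lambda>p. exp (- ((fst p)^2 + (snd p)^2)) * (\<bar>fst p\<bar> + \<bar>snd p\<bar>)^(k+l) * norm (\<kappa> p))"
    using assms by (simp add: gauss_kernel_def)
  have [measurable]: "\<kappa> \<in> borel_measurable borel" using assms by (simp add: gauss_kernel_def)
  show "(\<lambda>p. of_real (exp (- ((fst p)^2 + (snd p)^2)) * (fst p)^k * (snd p)^l) * \<kappa> p) \<in> borel_measurable lborel"
    by measurable
  have "norm (of_real (exp (- ((fst p)^2 + (snd p)^2)) * (fst p)^k * (snd p)^l) * \<kappa> p)
     \<le> exp (- ((fst p)^2 + (snd p)^2)) * (\<bar>fst p\<bar> + \<bar>snd p\<bar>)^(k+l) * norm (\<kappa> p)" for p :: "real \<times> real"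
  proof -
    have "\<bar>fst p\<bar>^k * \<bar>snd p\<bar>^l \<le> (\<bar>fst p\<bar> + \<bar>snd p\<bar>)^k * (\<bar>fst p\<bar> + \<bar>snd p\<bar>)^l"
      by (intro mult_mono power_mono) auto
    hence "exp (- ((fst p)^2 + (snd p)^2)) * (\<bar>fst p\<bar>^k * \<bar>snd p\<bar>^l) * norm (\<kappa> p)
        \<le> exp (- ((fst p)^2 + (snd p)^2)) * (\<bar>fst p\<bar> + \<bar>snd p\<bar>)^(k+l) * norm (\<kappa> p)"
      by (intro mult_right_mono mult_left_mono) (auto simp: power_add)
    thus ?thesis by (simp add: norm_mult norm_power abs_mult power_abs mult.assoc)
  qed
  thus "AE p in lborel. norm (of_real (exp (- ((fst p)^2 + (snd p)^2)) * (fst p)^k * (snd p)^l) * \<kappa> p)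
     \<le> norm (exp (- ((fst p)^2 + (snd p)^2)) * (\<bar>fst p\<bar> + \<bar>snd p\<bar>)^(k+l) * norm (\<kappa> p))"
    by (intro AE_I2) (simp add: abs_mult order_trans[OF _ abs_ge_self])
qed

text \<open>Rescaling by s makes the Gaussian standard; the Jacobian gives s^2, the kernel s^(-d),
  and a monomial of degree n gives s^n. The remainder bound is assumed on the whole plane so that it
  can be integrated without splitting the domain; \<open>box_remainder\<close> provides it for
  cut-off functions.\<close>

lemma watson_2d:
  fixes \<psi> :: "real \<times> real \<Rightarrow> complex" and b :: "nat \<Rightarrow> nat \<Rightarrow> complex" and d m :: nat and s C :: real
  assumes \<kappa>: "gauss_kernel \<kappa> d" and \<psi>[measurable]: "\<psi> \<in> borel_measurable borel" and s: "s > 0"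
    and rem: "\<And>p. norm (\<psi> p - (\<Sum>n<m. \<Sum>k\<le>n. b k (n - k) * of_real (fst p)^k * of_real (snd p)^(n-k)))
        \<le> C * (\<bar>fst p\<bar> + \<bar>snd p\<bar>)^m"
  shows "norm ((LINT p|lborel. of_real (exp (- (((fst p)^2 + (snd p)^2) / s^2))) * \<psi> p * \<kappa> p)
      - (\<Sum>n<m. \<Sum>k\<le>n. b k (n - k) * gauss_moment \<kappa> k (n - k) * of_real (s^(n+2) / s^d)))
     \<le> C * gauss_abs_moment \<kappa> m * (s^(m+2) / s^d)"
proof -
  have [measurable]: "\<kappa> \<in> borel_measurable borel" and hom: "\<And>p. \<kappa> (s *\<^sub>R p) = \<kappa> p / of_real (s^d)"
    and int: "integrable lborel (\<lambda>p. exp (- ((fst p)^2 + (snd p)^2)) * (\<bar>fst p\<bar> + \<bar>snd p\<bar>)^m * norm (\<kappa> p))"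
    using \<kappa> s by (auto simp: gauss_kernel_def)
  define T where "T p = (\<Sum>n<m. \<Sum>k\<le>n. b k (n - k) * of_real (fst p)^k * of_real (snd p)^(n-k))" for p :: "real \<times> real"
  define e where "e p = exp (- ((fst p)^2 + (snd p)^2))" for p :: "real \<times> real"
  define S where "S = (\<Sum>n<m. \<Sum>k\<le>n. b k (n - k) * of_real (s^n) * gauss_moment \<kappa> k (n - k))"
  have [measurable]: "(\<lambda>p. complex_of_real (exp (- (((fst p)^2 + (snd p)^2) / s^2)))) \<in> borel_measurable borel"
    "e \<in> borel_measurable borel"
    unfolding e_def by measurable
  have 1: "(LINT p|lborel. of_real (exp (- (((fst p)^2 + (snd p)^2) / s^2))) * \<psi> p * \<kappa> p)
     = of_real (s^2 / s^d) * (LINT p|lborel. of_real (e p) * \<psi> (s *\<^sub>R p) * \<kappa> p)"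
  proof -
    have "(LINT p|lborel. of_real (exp (- (((fst p)^2 + (snd p)^2) / s^2))) * \<psi> p * \<kappa> p)
     = of_real (s^2) * (LINT p|lborel. (of_real (e p) * \<psi> (s *\<^sub>R p) * \<kappa> p) / of_real (s^d))"
      using s by (subst lborel_integral_scale[OF _ less_imp_neq[OF s, symmetric]])
        (simp_all add: hom e_def power_mult_distrib distrib_left[symmetric] flip: of_real_power)
    thus ?thesis by simp
  qed
  have dT: "integrable lborel (\<lambda>p. of_real (e p) * T (s *\<^sub>R p) * \<kappa> p)"
    "(LINT p|lborel. of_real (e p) * T (s *\<^sub>R p) * \<kappa> p) = S"
  proof -
    have eq: "of_real (e p) * T (s *\<^sub>R p) * \<kappa> p = (\<Sum>n<m. \<Sum>k\<le>n. b k (n - k) * of_real (s^n) *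
        (of_real (exp (- ((fst p)^2 + (snd p)^2)) * (fst p)^k * (snd p)^(n-k)) * \<kappa> p))" for p
      unfolding T_def e_def sum_distrib_left sum_distrib_right
    proof (intro sum.cong refl)
      fix n k :: nat assume "k \<in> {..n}"
      hence "s^n = s^k * s^(n-k)" by (simp flip: power_add)
      thus "complex_of_real (exp (- ((fst p)^2 + (snd p)^2)))
          * (b k (n - k) * complex_of_real (fst (s *\<^sub>R p)) ^ k * complex_of_real (snd (s *\<^sub>R p)) ^ (n - k)) * \<kappa> p
        = b k (n - k) * of_real (s^n) * (of_real (exp (- ((fst p)^2 + (snd p)^2)) * (fst p)^k * (snd p)^(n-k)) * \<kappa> p)"
        by (simp add: power_mult_distrib)
    qed
    note i = gauss_monomial_integrable[OF \<kappa>]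
    show "integrable lborel (\<lambda>p. of_real (e p) * T (s *\<^sub>R p) * \<kappa> p)"
      unfolding eq by (intro Bochner_Integration.integrable_sum integrable_mult_right i)
    show "(LINT p|lborel. of_real (e p) * T (s *\<^sub>R p) * \<kappa> p) = S"
      unfolding eq S_def gauss_moment_def
      by (subst Bochner_Integration.integral_sum, (intro Bochner_Integration.integrable_sum
          integrable_mult_right i; fail)?)+
         (simp only: Bochner_Integration.integral_mult_right_zero)
  qed
  have bd: "norm (of_real (e p) * \<psi> (s *\<^sub>R p) * \<kappa> p - of_real (e p) * T (s *\<^sub>R p) * \<kappa> p)
      \<le> C * s^m * (exp (- ((fst p)^2 + (snd p)^2)) * (\<bar>fst p\<bar> + \<bar>snd p\<bar>)^m * norm (\<kappa> p))" for p
  proof -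
    have "of_real (e p) * \<psi> (s *\<^sub>R p) * \<kappa> p - of_real (e p) * T (s *\<^sub>R p) * \<kappa> p
        = of_real (e p) * (\<psi> (s *\<^sub>R p) - T (s *\<^sub>R p)) * \<kappa> p"
      by (simp add: algebra_simps)
    also have "norm \<dots> = e p * norm (\<psi> (s *\<^sub>R p) - T (s *\<^sub>R p)) * norm (\<kappa> p)" by (simp add: norm_mult e_def)
    also have "\<dots> \<le> e p * (C * (\<bar>fst (s *\<^sub>R p)\<bar> + \<bar>snd (s *\<^sub>R p)\<bar>)^m) * norm (\<kappa> p)"
      unfolding T_def by (intro mult_right_mono mult_left_mono rem) (auto simp: e_def)
    also have "\<bar>fst (s *\<^sub>R p)\<bar> + \<bar>snd (s *\<^sub>R p)\<bar> = s * (\<bar>fst p\<bar> + \<bar>snd p\<bar>)"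
      using s by (simp add: abs_mult distrib_left)
    finally show ?thesis by (simp add: power_mult_distrib e_def mult_ac)
  qed
  have id: "integrable lborel (\<lambda>p. of_real (e p) * \<psi> (s *\<^sub>R p) * \<kappa> p - of_real (e p) * T (s *\<^sub>R p) * \<kappa> p)"
  proof (rule Bochner_Integration.integrable_bound)
    show "integrable lborel (\<lambda>p. C * s^m * (exp (- ((fst p)^2 + (snd p)^2)) * (\<bar>fst p\<bar> + \<bar>snd p\<bar>)^m * norm (\<kappa> p)))"
      by (intro integrable_mult_right int)
    show "AE p in lborel. norm (of_real (e p) * \<psi> (s *\<^sub>R p) * \<kappa> p - of_real (e p) * T (s *\<^sub>R p) * \<kappa> p)
      \<le> norm (C * s^m * (exp (- ((fst p)^2 + (snd p)^2)) * (\<bar>fst p\<bar> + \<bar>snd p\<bar>)^m * norm (\<kappa> p)))"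
      unfolding real_norm_def by (intro AE_I2 order_trans[OF bd abs_ge_self])
    have "(\<lambda>p. of_real (e p) * T (s *\<^sub>R p) * \<kappa> p) \<in> borel_measurable lborel"
      using dT(1) by (rule borel_measurable_integrable)
    moreover have "(\<lambda>p. of_real (e p) * \<psi> (s *\<^sub>R p) * \<kappa> p) \<in> borel_measurable lborel" by measurable
    ultimately show "(\<lambda>p. of_real (e p) * \<psi> (s *\<^sub>R p) * \<kappa> p - of_real (e p) * T (s *\<^sub>R p)
        * \<kappa> p) \<in> borel_measurable lborel"
      by (intro borel_measurable_diff)
  qed
  have i\<psi>: "integrable lborel (\<lambda>p. of_real (e p) * \<psi> (s *\<^sub>R p) * \<kappa> p)"
    using Bochner_Integration.integrable_add[OF id dT(1)] by simp
  have "norm ((LINT p|lborel. of_real (e p) * \<psi> (s *\<^sub>R p) * \<kappa> p) - S)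
     = norm (LINT p|lborel. of_real (e p) * \<psi> (s *\<^sub>R p) * \<kappa> p - of_real (e p) * T (s *\<^sub>R p) * \<kappa> p)"
    unfolding dT(2)[symmetric] Bochner_Integration.integral_diff[OF i\<psi> dT(1)] ..
  also have "\<dots> \<le> (LINT p|lborel. C * s^m * (exp (- ((fst p)^2 + (snd p)^2)) * (\<bar>fst p\<bar> + \<bar>snd p\<bar>)^m * norm (\<kappa> p)))"
    by (rule order_trans[OF integral_norm_bound integral_mono[OF integrable_norm[OF id] _ bd]])
       (intro integrable_mult_right int)
  also have "\<dots> = C * s^m * gauss_abs_moment \<kappa> m" by (simp add: gauss_abs_moment_def)
  finally have 2: "norm ((LINT p|lborel. of_real (e p) * \<psi> (s *\<^sub>R p) * \<kappa> p) - S) \<le> C * s^m * gauss_abs_moment \<kappa> m" .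
  have 3: "(\<Sum>n<m. \<Sum>k\<le>n. b k (n - k) * gauss_moment \<kappa> k (n - k) * of_real (s^(n+2) / s^d)) = of_real (s^2 / s^d) * S"
    unfolding S_def sum_distrib_left by (intro sum.cong refl) (simp add: power_add power2_eq_square)
  have "norm (of_real (s^2 / s^d) * (LINT p|lborel. of_real (e p) * \<psi> (s *\<^sub>R p) * \<kappa> p) - of_real (s^2 / s^d) * S)
    = (s^2 / s^d) * norm ((LINT p|lborel. of_real (e p) * \<psi> (s *\<^sub>R p) * \<kappa> p) - S)"
    using s by (simp only: right_diff_distrib[symmetric] norm_mult norm_of_real) simp
  also have "\<dots> \<le> (s^2 / s^d) * (C * s^m * gauss_abs_moment \<kappa> m)"
    using s by (intro mult_left_mono 2) auto
  also have "\<dots> = C * gauss_abs_moment \<kappa> m * (s^(m+2) / s^d)" by (simp add: power_add mult_ac power2_eq_square)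
  finally show ?thesis unfolding 1 3 .
qed

section \<open>The two kernels and their Gaussian moments\<close>

lemma gauss_kernel_one: "gauss_kernel (\<lambda>_. 1) 0"
  unfolding gauss_kernel_def
proof (intro conjI allI impI)
  fix m :: nat
  show "integrable lborel (\<lambda>p. exp (- ((fst p)^2 + (snd p)^2)) * (\<bar>fst p\<bar> + \<bar>snd p\<bar>)^m * norm (1::complex))"
  proof (rule Bochner_Integration.integrable_bound)
    show "integrable lborel (\<lambda>p :: real \<times> real. (exp (- (fst p^2)) * (1 + \<bar>fst p\<bar>)^m)
        * (exp (- (snd p^2)) * (1 + \<bar>snd p\<bar>)^m))"
      by (rule integrable_prod_lborel[of "\<lambda>x. exp (- (x^2)) * (1 + \<bar>x\<bar>)^m" "\<lambda>x. exp (- (x^2)) * (1 + \<bar>x\<bar>)^m",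
            OF integrable_gauss_poly integrable_gauss_poly])
    have "(\<bar>x\<bar> + \<bar>y\<bar>)^m \<le> ((1 + \<bar>x\<bar>) * (1 + \<bar>y\<bar>))^m" for x y :: real
      by (intro power_mono) (auto simp: algebra_simps)
    hence "exp (- ((fst p)^2 + (snd p)^2)) * (\<bar>fst p\<bar> + \<bar>snd p\<bar>)^m \<le> exp (- ((fst p)^2 + (snd p)^2))
        * ((1 + \<bar>fst p\<bar>) * (1 + \<bar>snd p\<bar>))^m" for p :: "real \<times> real"
      by (intro mult_left_mono) auto
    thus "AE p in lborel. norm (exp (- ((fst p)^2 + (snd p)^2)) * (\<bar>fst p\<bar> + \<bar>snd p\<bar>)^m * norm (1::complex))
       \<le> norm ((exp (- (fst p^2)) * (1 + \<bar>fst p\<bar>)^m) * (exp (- (snd p^2)) * (1 + \<bar>snd p\<bar>)^m))"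
      by (intro AE_I2) (simp add: abs_mult exp_add[symmetric] power_mult_distrib mult_ac flip: exp_add)
  qed auto
qed auto

definition cauchy_kernel :: "real \<times> real \<Rightarrow> complex" where
  "cauchy_kernel p = 1 / (of_real (fst p) - \<i> * of_real (snd p))"

lemma cauchy_kernel_measurable [measurable]: "cauchy_kernel \<in> borel_measurable borel"
  unfolding cauchy_kernel_def by measurable

lemma gauss_kernel_cauchy: "gauss_kernel cauchy_kernel 1"
  unfolding gauss_kernel_def
proof (intro conjI allI impI)
  show "cauchy_kernel (s *\<^sub>R p) = cauchy_kernel p / of_real (s^1)" if "s > 0" for s p
  proof -
    have "of_real (fst (s *\<^sub>R p)) - \<i> * of_real (snd (s *\<^sub>R p)) = of_real s * (of_real (fst p) - \<i> * of_real (snd p))"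
      by (simp add: algebra_simps)
    thus ?thesis by (simp add: cauchy_kernel_def)
  qed
  fix m :: nat
  show "integrable lborel (\<lambda>p. exp (- ((fst p)^2 + (snd p)^2)) * (\<bar>fst p\<bar> + \<bar>snd p\<bar>)^m * norm (cauchy_kernel p))"
  proof (rule Bochner_Integration.integrable_bound)
    show "integrable lborel (\<lambda>p. sing_weight m (fst p) * sing_weight m (snd p))"
      by (rule integrable_prod_lborel[OF integrable_sing_weight integrable_sing_weight])
    show "AE p in lborel. norm (exp (- ((fst p)^2 + (snd p)^2)) * (\<bar>fst p\<bar> + \<bar>snd p\<bar>)^m * norm (cauchy_kernel p))
       \<le> norm (sing_weight m (fst p) * sing_weight m (snd p))"
      using AE_fst_neq[of 0] AE_snd_neq[of 0]
    proof eventually_elim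
      case (elim p)
      obtain x y where p: "p = (x, y)" by (cases p)
      have xy: "x \<noteq> 0" "y \<noteq> 0" using elim by (simp_all add: p)
      have "sqrt (\<bar>x\<bar> * \<bar>y\<bar>) \<le> norm (complex_of_real x - \<i> * of_real y)"
      proof -
        have "0 \<le> (\<bar>x\<bar> - \<bar>y\<bar>)^2" by simp
        hence "2 * (\<bar>x\<bar> * \<bar>y\<bar>) \<le> x^2 + y^2" by (simp add: power2_eq_square algebra_simps abs_mult_self_eq)
        moreover have "0 \<le> \<bar>x\<bar> * \<bar>y\<bar>" by simp
        ultimately have "\<bar>x\<bar> * \<bar>y\<bar> \<le> x^2 + y^2" by linarith
        thus ?thesis by (simp add: cmod_def)
      qed
      moreover have "sqrt (\<bar>x\<bar> * \<bar>y\<bar>) > 0" using xy by simp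
      ultimately have k: "norm (cauchy_kernel p) \<le> 1 / sqrt (\<bar>x\<bar> * \<bar>y\<bar>)"
        unfolding cauchy_kernel_def p by (simp add: norm_divide frac_le)
      have "(\<bar>x\<bar> + \<bar>y\<bar>)^m \<le> ((1 + \<bar>x\<bar>) * (1 + \<bar>y\<bar>))^m"
        by (intro power_mono) (auto simp: algebra_simps)
      hence "exp (- (x^2 + y^2)) * (\<bar>x\<bar> + \<bar>y\<bar>)^m * norm (cauchy_kernel p) \<le>
         exp (- (x^2 + y^2)) * ((1 + \<bar>x\<bar>) * (1 + \<bar>y\<bar>))^m * (1 / sqrt (\<bar>x\<bar> * \<bar>y\<bar>))"
        by (intro mult_mono k mult_left_mono) auto
      also have "\<dots> = sing_weight m x * sing_weight m y"
        unfolding sing_weight_def power_mult_distrib real_sqrt_mult minus_add_distrib exp_add by simp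
      finally show ?case by (simp add: p abs_mult sing_weight_nonneg abs_of_nonneg)
    qed
  qed measurable
qed measurable

text \<open>The kernel is odd under p \<mapsto> - p. This is why only k + l = 2 \<nu> - 1 appears in
  the expansion.\<close>

lemma gauss_moment_cauchy_even:
  assumes "even (k + l)"
  shows "gauss_moment cauchy_kernel k l = 0"
proof -
  define f where "f p = of_real (exp (- ((fst p)^2 + (snd p)^2)) * (fst p)^k * (snd p)^l) * cauchy_kernel p" for p
  have [measurable]: "f \<in> borel_measurable borel" unfolding f_def by measurable
  have odd: "f (- p) = - f p" for p
  proof -
    have "(- x)^k * (- y)^l = x^k * y^l" for x y :: real
      using assms by (cases "even k") (auto simp: power_minus_even power_minus_odd)
    hence "exp (- ((- fst p)^2 + (- snd p)^2)) * (- fst p)^k * (- snd p)^l = exp (- ((fst p)^2 + (snd p)^2))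
        * (fst p)^k * (snd p)^l"
      by (simp add: mult.assoc)
    moreover have "cauchy_kernel (- p) = - cauchy_kernel p"
    proof -
      have "complex_of_real (fst (- p)) - \<i> * of_real (snd (- p)) = - (of_real (fst p) - \<i> * of_real (snd p))" by simp
      thus ?thesis unfolding cauchy_kernel_def by (simp only: minus_divide_right)
    qed
    ultimately show ?thesis by (simp only: f_def fst_uminus snd_uminus mult_minus_right)
  qed
  have "(LINT p|lborel. f p) = (LINT p|lborel. - f p)"
    using lborel_integral_scale[of f "-1"] by (simp add: odd)
  thus ?thesis by (simp add: gauss_moment_def f_def)
qed

text \<open>A rotation by a right angle, carried out as a reflection of x followed by an exchange of
  the variables, multiplies the kernel by \<i> and exchanges the two weights.\<close>

lemma gauss_moment_cauchy_10_01:
  "gauss_moment cauchy_kernel 0 1 = \<i> * gauss_moment cauchy_kernel 1 0"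
proof -
  define F where "F k l p = of_real (exp (- ((fst p)^2 + (snd p)^2)) * (fst p)^k * (snd p)^l) * cauchy_kernel p"
      for k l and p :: "real \<times> real"
  have i: "integrable (lborel \<Otimes>\<^sub>M lborel) (case_prod (\<lambda>x y. F k l (x, y)))" for k l
    using gauss_monomial_integrable[OF gauss_kernel_cauchy, of k l] by (simp add: F_def lborel_prod case_prod_unfold)
  have rot: "F 0 1 (- x, y) = \<i> * F 1 0 (y, x)" for x y
  proof -
    have "complex_of_real (- x) - \<i> * of_real y = - \<i> * (of_real y - \<i> * of_real x)" by (simp add: algebra_simps)
    moreover have "1 / (- \<i> * D) = \<i> * (1 / D)" for D by (simp add: divide_inverse)
    ultimately have "1 / (complex_of_real (- x) - \<i> * of_real y) = \<i> * (1 / (of_real y - \<i> * of_real x))"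
      by (simp only:)
    thus ?thesis by (simp add: F_def cauchy_kernel_def add.commute)
  qed
  have "(LINT p|lborel. F 0 1 p) = (LINT y|lborel. LINT x|lborel. F 0 1 (x, y))"
    using lborel_pair.integral_snd[OF i[of 0 1]] by (simp add: lborel_prod)
  also have "\<dots> = (LINT y|lborel. LINT x|lborel. F 0 1 (- x, y))"
    by (subst lborel_integral_real_affine[of "-1" _ 0]) auto
  also have "\<dots> = \<i> * (LINT y|lborel. LINT x|lborel. F 1 0 (y, x))"
    unfolding rot by (simp only: Bochner_Integration.integral_mult_right_zero)
  also have "(LINT y|lborel. LINT x|lborel. F 1 0 (y, x)) = (LINT p|lborel. F 1 0 p)"
    using lborel_pair.integral_fst[OF i[of 1 0]] by (simp add: lborel_prod)
  finally show ?thesis by (simp add: gauss_moment_def F_def)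
qed

lemma gauss_moment_1d:
  "(LINT x|lborel. exp (- (x^2)) * x^(2*k)) = Gamma (real k + 1/2)"
  "(LINT x|lborel. exp (- (x^2)) * x^(2*k+1) :: real) = 0"
proof -
  have "has_bochner_integral lborel (\<lambda>x::real. exp (- (x^2)) * x^(2*k))
      (2 * ((sqrt pi / 2) * (fact (2 * k) / (2 ^ (2 * k) * fact k))))"
    using has_bochner_integral_even_function[OF gaussian_moment_even_pos[where k=k]] by simp
  hence "(LINT x|lborel. exp (- (x^2)) * x^(2*k)) = sqrt pi * (fact (2 * k) / (2 ^ (2 * k) * fact k))"
    by (simp add: has_bochner_integral_integral_eq)
  also have "\<dots> = Gamma (real k + 1/2)"
  proof (induction k)
    case 0 thus ?case by (simp add: Gamma_one_half_real)
  next
    case (Suc k)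
    have "Gamma (real (Suc k) + 1/2) = (real k + 1/2) * Gamma (real k + 1/2)"
      using Gamma_plus1[of "real k + 1/2"] by (simp add: add_ac nonpos_Ints_def)
    also have "\<dots> = (real k + 1/2) * (sqrt pi * (fact (2 * k) / (2 ^ (2 * k) * fact k)))" by (simp only: Suc.IH)
    also have "\<dots> = sqrt pi * (fact (2 * Suc k) / (2 ^ (2 * Suc k) * fact (Suc k)))"
    proof -
      have "fact (2 * Suc k) = (2 * real (Suc k)) * (2 * real k + 1) * fact (2 * k)" by (simp add: algebra_simps)
      moreover have "2 ^ (2 * Suc k) * fact (Suc k) = (2 * real (Suc k)) * (2 * (2 ^ (2 * k) * fact k))" by simp
      ultimately have "fact (2 * Suc k) / (2 ^ (2 * Suc k) * fact (Suc k))
          = (2 * real k + 1) * fact (2 * k) / (2 * (2 ^ (2 * k) * fact k))"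
        by (simp only: mult.assoc) (subst mult_divide_mult_cancel_left, simp_all)
      thus ?thesis by (simp only:) (simp add: field_simps)
    qed
    finally show ?case ..
  qed
  finally show "(LINT x|lborel. exp (- (x^2)) * x^(2*k)) = Gamma (real k + 1/2)" .
  have "has_bochner_integral lborel (\<lambda>x::real. exp (- (x^2)) * x^(2*k+1)) 0"
    by (rule has_bochner_integral_odd_function[OF gaussian_moment_odd_pos[where k=k]]) simp
  thus "(LINT x|lborel. exp (- (x^2)) * x^(2*k+1) :: real) = 0"
    by (simp add: has_bochner_integral_integral_eq)
qed

lemma gauss_moment_one_product:
  "gauss_moment (\<lambda>_. 1) k l = of_real ((LINT x|lborel. exp (- (x^2)) * x^k) * (LINT x|lborel. exp (- (x^2)) * x^l))"
proof -
  have i: "integrable (lborel \<Otimes>\<^sub>M lborel) (case_prod (\<lambda>x y. complex_of_real (exp (- (x^2 + y^2)) * x^k * y^l)))"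
    using gauss_monomial_integrable[OF gauss_kernel_one, of k l] by (simp add: lborel_prod case_prod_unfold)
  have "gauss_moment (\<lambda>_. 1) k l = (LINT x|lborel. LINT y|lborel. complex_of_real (exp (- (x^2 + y^2)) * x^k * y^l))"
    using lborel_pair.integral_fst[OF i] by (simp add: gauss_moment_def lborel_prod case_prod_unfold)
  also have "\<dots> = (LINT x|lborel. LINT y|lborel. of_real ((exp (- (x^2)) * x^k) * (exp (- (y^2)) * y^l)))"
    by (simp add: exp_add mult_ac flip: exp_add)
  also have "\<dots> = of_real ((LINT x|lborel. exp (- (x^2)) * x^k) * (LINT x|lborel. exp (- (x^2)) * x^l))"
    by (simp only: integral_complex_of_real Bochner_Integration.integral_mult_right_zero
        Bochner_Integration.integral_mult_left_zero)
  finally show ?thesis .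
qed

lemma gauss_moment_one_even:
  "gauss_moment (\<lambda>_. 1) (2*k) (2*l) = of_real (Gamma (real k + 1/2) * Gamma (real l + 1/2))"
  unfolding gauss_moment_one_product gauss_moment_1d ..

lemma gauss_moment_one_odd:
  assumes "odd k \<or> odd l"
  shows "gauss_moment (\<lambda>_. 1) k l = 0"
proof -
  have "(LINT x|lborel. exp (- (x^2)) * x^k :: real) = 0" if "odd k" for k
    using that gauss_moment_1d(2) by (auto elim!: oddE)
  thus ?thesis using assms unfolding gauss_moment_one_product by auto
qed

text \<open>The combination x - \<i> y cancels the kernel, so the (1,0) moment minus \<i> times the
  (0,1) moment is the Gaussian integral pi. By the rotation identity the left-hand side is twice the
  (1,0) moment.\<close>

lemma gauss_moment_cauchy_10: "gauss_moment cauchy_kernel 1 0 = of_real (pi / 2)"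
proof -
  note i = gauss_monomial_integrable[OF gauss_kernel_cauchy]
  have "gauss_moment cauchy_kernel 1 0 - \<i> * gauss_moment cauchy_kernel 0 1 = gauss_moment (\<lambda>_. 1) 0 0"
  proof -
    have "gauss_moment cauchy_kernel 1 0 - \<i> * gauss_moment cauchy_kernel 0 1 =
      (LINT p|lborel. of_real (exp (- ((fst p)^2 + (snd p)^2)) * (fst p)^1 * (snd p)^0) * cauchy_kernel p
        - \<i> * (of_real (exp (- ((fst p)^2 + (snd p)^2)) * (fst p)^0 * (snd p)^1) * cauchy_kernel p))"
      unfolding gauss_moment_def
      by (subst Bochner_Integration.integral_diff[OF i integrable_mult_right[OF i]])
         (simp only: Bochner_Integration.integral_mult_right_zero)
    also have "\<dots> = gauss_moment (\<lambda>_. 1) 0 0"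
      unfolding gauss_moment_def
    proof (rule integral_cong_AE)
      show "AE p in lborel. of_real (exp (- ((fst p)^2 + (snd p)^2)) * (fst p)^1 * (snd p)^0) * cauchy_kernel p
        - \<i> * (of_real (exp (- ((fst p)^2 + (snd p)^2)) * (fst p)^0 * (snd p)^1) * cauchy_kernel p)
        = of_real (exp (- ((fst p)^2 + (snd p)^2)) * (fst p)^0 * (snd p)^0) * 1"
        using AE_fst_neq[of 0]
      proof eventually_elim
        case (elim p)
        hence "complex_of_real (fst p) - \<i> * of_real (snd p) \<noteq> 0" by (auto simp: complex_eq_iff)
        thus ?case by (simp add: cauchy_kernel_def divide_simps) (simp add: algebra_simps)
      qed
    qed measurable
    finally show ?thesis .
  qed
  also have "\<dots> = of_real pi"
    using gauss_moment_one_even[of 0 0] Gamma_one_half_real by simp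
  finally show ?thesis unfolding gauss_moment_cauchy_10_01 by (simp add: algebra_simps)
qed

section \<open>Taylor expansions cut off to a box\<close>

context bivariate_bounded
begin

text \<open>Inside the box this is \<open>taylor_remainder\<close>. Outside, the cut-off function is
  0 and (\<bar>x\<bar> + \<bar>y\<bar>) / \<delta> \<ge> 1, so every monomial of lower degree is
  dominated by the power m; there are at most m * m of them.\<close>

lemma box_remainder:
  assumes \<delta>: "0 < \<delta>" "\<delta> \<le> \<rho> / 2"
  shows "norm (indicator ({-\<delta>..\<delta>} \<times> {-\<delta>..\<delta>}) p *\<^sub>R h (of_real (fst p)) (of_real (snd p))
      - (\<Sum>n<m. \<Sum>k\<le>n. coeff k (n - k) * of_real (fst p)^k * of_real (snd p)^(n-k)))
      \<le> (2 * M * (m + 1) + M * (m * m)) / \<delta>^m * (\<bar>fst p\<bar> + \<bar>snd p\<bar>)^m"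
proof -
  obtain x y where p: "p = (x, y)" by (cases p)
  define q where "q = \<bar>x\<bar> + \<bar>y\<bar>"
  have q: "q \<ge> 0" by (simp add: q_def)
  have M: "M \<ge> 0" using bound[of 0 0] \<rho> order.trans[OF norm_ge_zero] by fastforce
  have mono: "(q / \<rho>)^j \<le> (q / \<delta>)^j" for j
    using \<delta> \<rho> q by (intro power_mono divide_left_mono) auto
  have sum_eq: "(\<Sum>n<m. \<Sum>k\<le>n. coeff k (n - k) * of_real x^k * of_real y^(n-k))
      = (\<Sum>k<m. \<Sum>l<m-k. coeff k l * of_real x^k * of_real y^l)"
    by (rule sum_triangle[symmetric])
  have goal: "norm (indicator ({-\<delta>..\<delta>} \<times> {-\<delta>..\<delta>}) (x, y) *\<^sub>R h (of_real x) (of_real y)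
      - (\<Sum>k<m. \<Sum>l<m-k. coeff k l * of_real x^k * of_real y^l)) \<le> (2 * M * (m + 1) + M * (m * m)) * (q / \<delta>)^m"
  proof (cases "x \<in> {-\<delta>..\<delta>} \<and> y \<in> {-\<delta>..\<delta>}")
    case True
    hence "norm (h (of_real x) (of_real y) - (\<Sum>k<m. \<Sum>l<m-k. coeff k l * of_real x^k * of_real y^l))
       \<le> 2 * M * (m + 1) * ((norm (complex_of_real x) + norm (complex_of_real y)) / \<rho>)^m"
      using \<delta> by (intro taylor_remainder) auto
    also have "\<dots> = 2 * M * (m + 1) * (q / \<rho>)^m" by (simp add: q_def)
    also have "\<dots> \<le> 2 * M * (m + 1) * (q / \<delta>)^m" using M by (intro mult_left_mono mono) auto
    also have "\<dots> \<le> (2 * M * (m + 1) + M * (m * m)) * (q / \<delta>)^m"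
      using M q \<delta> by (intro mult_right_mono) auto
    finally show ?thesis using True by simp
  next
    case False
    hence "q \<ge> \<delta>" by (auto simp: q_def)
    hence q1: "q / \<delta> \<ge> 1" using \<delta> by simp
    have "norm (\<Sum>k<m. \<Sum>l<m-k. coeff k l * of_real x^k * of_real y^l) \<le> (\<Sum>k<m. \<Sum>l<m-k. M * (q / \<delta>)^m)"
    proof (intro sum_norm_le)
      fix k l assume kl: "k \<in> {..<m}" "l \<in> {..<m-k}"
      have "norm (coeff k l * of_real x^k * of_real y^l) \<le> M / \<rho>^(k+l) * q^k * q^l"
        unfolding norm_mult norm_power using M \<rho>
        by (intro mult_mono coeff_bound power_mono) (auto simp: q_def)
      also have "\<dots> = M * (q / \<rho>)^(k+l)" by (simp add: power_divide power_add)
      also have "\<dots> \<le> M * (q / \<delta>)^(k+l)" using M by (intro mult_left_mono mono)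
      also have "\<dots> \<le> M * (q / \<delta>)^m" using M q1 kl by (intro mult_left_mono power_increasing) auto
      finally show "norm (coeff k l * of_real x^k * of_real y^l) \<le> M * (q / \<delta>)^m" .
    qed
    also have "\<dots> \<le> (\<Sum>k<m. \<Sum>l<m. M * (q / \<delta>)^m)"
      using M q \<delta> by (intro sum_mono sum_mono2) auto
    also have "\<dots> = M * (m * m) * (q / \<delta>)^m" by simp
    also have "\<dots> \<le> (2 * M * (m + 1) + M * (m * m)) * (q / \<delta>)^m"
      using M q \<delta> by (intro mult_right_mono) auto
    finally show ?thesis using False by simp
  qed
  thus ?thesis unfolding p fst_conv snd_conv sum_eq by (simp add: q_def power_divide)
qed

text \<open>Only separate holomorphy is assumed, so measurability is inherited from the pointwise
  limit of Taylor polynomials. The bound \<delta> \<le> \<rho> / 4 keeps (\<bar>x\<bar> +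
  \<bar>y\<bar>) / \<rho> at most 1/2, and the remainder (m + 1) / 2^m tends to 0 up to a constant
  factor.\<close>

lemma box_measurable:
  assumes \<delta>: "0 < \<delta>" "\<delta> \<le> \<rho> / 4"
  shows "(\<lambda>p. indicator ({-\<delta>..\<delta>} \<times> {-\<delta>..\<delta>}) p *\<^sub>R h (of_real (fst p)) (of_real (snd p))) \<in> borel_measurable borel"
proof (rule borel_measurable_LIMSEQ_metric)
  have [measurable]: "{-\<delta>..\<delta>} \<times> {-\<delta>..\<delta>} \<in> sets borel" by (intro borel_closed closed_Times closed_atLeastAtMost)
  show "(\<lambda>p. indicator ({-\<delta>..\<delta>} \<times> {-\<delta>..\<delta>}) p *\<^sub>R (\<Sum>k<m. \<Sum>l<m-k. coeff k l * of_real (fst p)^k * of_real (snd p)^l))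
     \<in> borel_measurable borel" for m
    by measurable
  have M: "M \<ge> 0" using bound[of 0 0] \<rho> order.trans[OF norm_ge_zero] by fastforce
  fix p :: "real \<times> real"
  show "(\<lambda>m. indicator ({-\<delta>..\<delta>} \<times> {-\<delta>..\<delta>}) p *\<^sub>R (\<Sum>k<m. \<Sum>l<m-k. coeff k l * of_real (fst p)^k * of_real (snd p)^l))
     \<longlonglongrightarrow> indicator ({-\<delta>..\<delta>} \<times> {-\<delta>..\<delta>}) p *\<^sub>R h (of_real (fst p)) (of_real (snd p))"
  proof (cases "p \<in> {-\<delta>..\<delta>} \<times> {-\<delta>..\<delta>}")
    case True
    hence xy: "\<bar>fst p\<bar> \<le> \<delta>" "\<bar>snd p\<bar> \<le> \<delta>" by (auto simp: mem_Times_iff)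
    have "(\<lambda>m. (\<Sum>k<m. \<Sum>l<m-k. coeff k l * of_real (fst p)^k
        * of_real (snd p)^l)) \<longlonglongrightarrow> h (of_real (fst p)) (of_real (snd p))"
    proof (rule LIM_zero_cancel, rule Lim_null_comparison)
      show "\<forall>\<^sub>F m in sequentially. norm ((\<Sum>k<m. \<Sum>l<m-k. coeff k l * of_real (fst p)^k * of_real (snd p)^l)
          - h (of_real (fst p)) (of_real (snd p)))
          \<le> 2 * M * ((real m + 1) * (1/2)^m)"
      proof (intro always_eventually allI)
        fix m
        have q: "(norm (complex_of_real (fst p)) + norm (complex_of_real (snd p))) / \<rho> \<le> 1/2"
          using xy \<delta> \<rho> by (simp add: divide_le_eq)
        have "norm (h (of_real (fst p)) (of_real (snd p)) - (\<Sum>k<m. \<Sum>l<m-k. coeff k l * of_real (fst p)^k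
            * of_real (snd p)^l))
          \<le> 2 * M * (m + 1) * ((norm (complex_of_real (fst p)) + norm (complex_of_real (snd p))) / \<rho>)^m"
          using xy \<delta> \<rho> by (intro taylor_remainder) auto
        also have "\<dots> \<le> 2 * M * (m + 1) * (1/2)^m"
          using M \<rho> by (intro mult_left_mono power_mono q) auto
        finally show "norm ((\<Sum>k<m. \<Sum>l<m-k. coeff k l * of_real (fst p)^k * of_real (snd p)^l)
            - h (of_real (fst p)) (of_real (snd p)))
          \<le> 2 * M * ((real m + 1) * (1/2)^m)" by (simp add: norm_minus_commute algebra_simps)
      qed
      have "(\<lambda>m. (real m + 1) * (1/2)^m) \<longlonglongrightarrow> 0" by real_asymp
      thus "(\<lambda>m. 2 * M * ((real m + 1) * (1/2)^m)) \<longlonglongrightarrow> 0" by (intro tendsto_mult_right_zero)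
    qed
    thus ?thesis using True by simp
  qed simp
qed

end

section \<open>Saddle point coordinates\<close>

text \<open>The radius is shrunk until all local facts hold with explicit constants. The deviation
  1/10 keeps the arcs in the cones \<open>NE\<close> and \<open>SW\<close>, and 1/2 in
  \<open>der\<close> keeps divided differences of \<open>gS\<close> away from 0.\<close>

locale gS_disc =
  fixes R :: real
  assumes R: "0 < R" "R \<le> 1/4" and hol: "gS holomorphic_on ball 0 R"
    and gS_eq: "\<And>x. x \<in> ball 0 R \<Longrightarrow> fAi (gS x) = 2 / 3 * \<i> - x^2"
    and lin: "\<And>x. x \<in> ball 0 R \<Longrightarrow> norm (gS x - \<i> - e8 * x) \<le> norm x / 10"
    and mirror: "\<And>x. x \<in> ball 0 R \<Longrightarrow> gS x = - cnj (gS (cnj (- \<i> * x)))"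
    and der: "\<And>x. x \<in> ball 0 R \<Longrightarrow> norm (deriv gS x - e8) \<le> 1/2"

lemma gS_disc_exists: "\<exists>R. gS_disc R"
proof -
  obtain r where r: "is_g gS r" using gS_is_g by blast
  hence r0: "r > 0" and hol: "gS holomorphic_on ball 0 r" and d0: "deriv gS 0 = e8" by (auto simp: is_g_def)
  obtain d1 where d1: "d1 > 0" "\<forall>x\<in>ball 0 d1. norm (gS x - \<i> - e8 * x) \<le> 1/10 * norm x"
    using is_g_linearization[OF r, of "1/10"] by auto
  obtain d2 where d2: "d2 > 0" "\<forall>x\<in>ball 0 d2. gS x = - cnj (gS (cnj (- \<i> * x)))"
    using is_g_unique[OF r is_g_mirror[OF r]] by blast
  have "continuous_on (ball 0 r) (deriv gS)"
    by (intro holomorphic_on_imp_continuous_on holomorphic_deriv hol open_ball)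
  hence "isCont (deriv gS) 0" using r0 by (simp add: continuous_on_eq_continuous_at)
  then obtain d3 where d3: "d3 > 0" "\<And>x. norm (x - 0) < d3 \<Longrightarrow> norm (deriv gS x - deriv gS 0) < 1/2"
    unfolding continuous_at_eps_delta dist_norm by (metis half_gt_zero zero_less_one)
  define R where "R = Min {r, d1, d2, d3, 1/4}"
  have R: "R \<le> r" "R \<le> d1" "R \<le> d2" "R \<le> d3" "R \<le> 1/4" "R > 0" using r0 d1 d2 d3 by (auto simp: R_def)
  have "gS_disc R"
  proof
    show "gS holomorphic_on ball 0 R" using hol R by (rule_tac holomorphic_on_subset) auto
    fix x :: complex assume x: "x \<in> ball 0 R"
    hence x': "x \<in> ball 0 r" "x \<in> ball 0 d1" "x \<in> ball 0 d2" "norm x < d3" using R by auto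
    have "fAi (gS x) - 2 / 3 * \<i> = - (x^2)" using r x' by (auto simp: is_g_def)
    thus "fAi (gS x) = 2 / 3 * \<i> - x^2" by (simp add: algebra_simps)
    show "norm (gS x - \<i> - e8 * x) \<le> norm x / 10" using d1(2) x' by fastforce
    show "gS x = - cnj (gS (cnj (- \<i> * x)))" using d2(2) x' by blast
    show "norm (deriv gS x - e8) \<le> 1/2" using d3(2)[of x] x' d0 by simp
  qed (use R in auto)
  thus ?thesis by blast
qed

section \<open>Bounds for g and analytic extensions of the two amplitudes\<close>

context gS_disc
begin

lemma gS_0: "gS 0 = \<i>"
  using lin[of 0] R by simp

lemma gS_near: "x \<in> ball 0 R \<Longrightarrow> norm (gS x - \<i>) \<le> 1/2"
proof -
  assume x: "x \<in> ball 0 R"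
  have "norm (gS x - \<i>) \<le> norm (gS x - \<i> - e8 * x) + norm (e8 * x)"
    using norm_triangle_ineq[of "gS x - \<i> - e8 * x" "e8 * x"] by simp
  also have "norm (e8 * x) = norm x" by (simp add: norm_mult norm_exp_eq_Re)
  finally show ?thesis using lin[OF x] x R by simp
qed

lemma gS_bound: "x \<in> ball 0 R \<Longrightarrow> norm (gS x) \<le> 3/2"
  using gS_near[of x] norm_triangle_ineq[of "gS x - \<i>" \<i>] by simp

lemma deriv_gS_bound: "x \<in> ball 0 R \<Longrightarrow> norm (deriv gS x) \<le> 3/2"
  using der[of x] norm_triangle_ineq[of "deriv gS x - e8" e8] by (simp add: norm_exp_eq_Re)

text \<open>The divided difference completed on the diagonal; its reciprocal extends the first
  factor of \<open>phi_fun\<close> across the line x = \<i> y.\<close>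

definition gS_slope :: "complex \<Rightarrow> complex \<Rightarrow> complex" where
  "gS_slope x w = (if x = w then deriv gS w else (gS x - gS w) / (x - w))"

lemma gS_slope_commute: "gS_slope x w = gS_slope w x"
  unfolding gS_slope_def by (auto simp: divide_simps) (simp add: algebra_simps)

lemma gS_slope_holomorphic: "(\<lambda>x. gS_slope x w) holomorphic_on ball 0 R"
  unfolding gS_slope_def by (rule pole_lemma_open[OF hol open_ball])

text \<open>The mean value inequality for gS x - e8 * x on the convex disc. Since norm e8 = 1, the
  slope keeps distance 1/2 from 0.\<close>

lemma gS_slope_near:
  assumes "x \<in> ball 0 R" "w \<in> ball 0 R"
  shows "norm (gS_slope x w - e8) \<le> 1/2"
proof (cases "x = w")
  case True thus ?thesis using der assms by (simp add: gS_slope_def)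
next
  case False
  have "norm ((gS x - e8 * x) - (gS w - e8 * w)) \<le> 1/2 * norm (x - w)"
  proof (rule field_differentiable_bound[of "ball 0 R" "\<lambda>x. gS x - e8 * x" "\<lambda>x. deriv gS x - e8"])
    fix z :: complex assume z: "z \<in> ball 0 R"
    have "(gS has_field_derivative deriv gS z) (at z within ball 0 R)"
      using holomorphic_derivI[OF hol open_ball z] by blast
    thus "((\<lambda>x. gS x - e8 * x) has_field_derivative deriv gS z - e8) (at z within ball 0 R)"
      by (auto intro!: derivative_eq_intros)
    show "norm (deriv gS z - e8) \<le> 1/2" by (rule der[OF z])
  qed (use assms in auto)
  moreover have "(gS x - e8 * x) - (gS w - e8 * w) = (gS_slope x w - e8) * (x - w)"
    using False by (simp add: gS_slope_def field_simps)
  ultimately have "norm (gS_slope x w - e8) * norm (x - w) \<le> 1/2 * norm (x - w)" by (simp only: norm_mult)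
  thus ?thesis using False by simp
qed

lemma gS_slope_lower:
  assumes "x \<in> ball 0 R" "w \<in> ball 0 R"
  shows "norm (gS_slope x w) \<ge> 1/2" "gS_slope x w \<noteq> 0"
proof -
  have "1 = norm e8" by (simp add: norm_exp_eq_Re)
  also have "\<dots> \<le> norm (gS_slope x w) + norm (gS_slope x w - e8)" using norm_triangle_ineq4[of "gS_slope x w"
      "gS_slope x w - e8"] by simp
  finally show *: "norm (gS_slope x w) \<ge> 1/2" using gS_slope_near[OF assms] by simp
  thus "gS_slope x w \<noteq> 0" by auto
qed

definition phi_ext where "phi_ext \<tau>1 \<tau>2 u v x y = 1 / gS_slope x (\<i> * y) *
  exp (- of_real v * gS x - of_real \<tau>2 * (gS x)^2 + of_real u * gS (\<i> * y) + of_real \<tau>1 * (gS (\<i> * y))^2)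
  * deriv gS x * (\<i> * deriv gS (\<i> * y))"

definition Phi_ext where "Phi_ext \<tau>1 \<tau>2 u v x y =
  exp (- of_real v * gS x - of_real \<tau>2 * (gS x)^2 - of_real u * gS (- y) + of_real \<tau>1 * (gS (- y))^2)
  / (gS x + gS (- y)) * deriv gS x * deriv gS (- y)"

lemma ball_i: "y \<in> ball 0 R \<Longrightarrow> \<i> * y \<in> ball 0 R" "y \<in> ball 0 R \<Longrightarrow> - y \<in> ball 0 R"
  by (simp_all add: norm_mult)

lemma deriv_gS_i: "y \<in> ball 0 R \<Longrightarrow> deriv (\<lambda>y. gS (\<i> * y)) y = \<i> * deriv gS (\<i> * y)"
proof -
  assume y: "y \<in> ball 0 R"
  have "((\<lambda>y. gS (\<i> * y)) has_field_derivative deriv gS (\<i> * y) * \<i>) (at y)"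
    by (rule DERIV_chain2[where f=gS
        and g="\<lambda>y. \<i> * y", OF holomorphic_derivI[OF hol open_ball ball_i(1)[OF y]]])
        (auto intro!: derivative_eq_intros)
  thus ?thesis by (simp add: DERIV_imp_deriv)
qed

lemma deriv_gS_minus: "y \<in> ball 0 R \<Longrightarrow> deriv (\<lambda>y. - gS (- y)) y = deriv gS (- y)"
proof -
  assume y: "y \<in> ball 0 R"
  have "((\<lambda>y. gS (- y)) has_field_derivative deriv gS (- y) * (-1)) (at y)"
    by (rule DERIV_chain2[where f=gS
        and g=uminus, OF holomorphic_derivI[OF hol open_ball ball_i(2)[OF y]]]) (auto intro!: derivative_eq_intros)
  from DERIV_minus[OF this] show ?thesis by (simp add: DERIV_imp_deriv)
qed

lemma phi_fun_eq:
  assumes "x \<in> ball 0 R" "y \<in> ball 0 R" "x \<noteq> \<i> * y"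
  shows "phi_fun \<tau>1 \<tau>2 u v x y = phi_ext \<tau>1 \<tau>2 u v x y"
  using assms unfolding phi_fun_def phi_ext_def deriv_gS_i[OF assms(2)] gS_slope_def by simp

lemma Phi_fun_eq:
  assumes "y \<in> ball 0 R"
  shows "Phi_fun \<tau>1 \<tau>2 u v x y = Phi_ext \<tau>1 \<tau>2 u v x y"
  unfolding Phi_fun_def Phi_ext_def deriv_gS_minus[OF assms] ..

lemma gS_sum_lower:
  assumes "x \<in> ball 0 R" "y \<in> ball 0 R"
  shows "norm (gS x + gS y) \<ge> 1" "gS x + gS y \<noteq> 0"
proof -
  have "2 * \<i> = (gS x + gS y) - (gS x - \<i>) - (gS y - \<i>)" by simp
  hence "norm (2 * \<i>) \<le> norm (gS x + gS y) + norm (gS x - \<i>) + norm (gS y - \<i>)"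
    by (metis norm_triangle_ineq4 order_trans add_right_mono)
  thus *: "norm (gS x + gS y) \<ge> 1" using gS_near[OF assms(1)] gS_near[OF assms(2)] by (simp add: norm_mult)
  thus "gS x + gS y \<noteq> 0" by auto
qed

lemma exponent_bound:
  fixes a b :: complex
  assumes "\<bar>u\<bar> \<le> B" "\<bar>v\<bar> \<le> B" "\<bar>\<tau>1\<bar> \<le> B" "\<bar>\<tau>2\<bar> \<le> B" "norm a \<le> 3/2" "norm b \<le> 3/2"
  shows "norm (exp (- of_real v * a - of_real \<tau>2 * a^2 + of_real u * b + of_real \<tau>1 * b^2)) \<le> exp (8 * B)"
proof -
  have B: "B \<ge> 0" using assms(1) by simp
  have t: "norm (of_real c * z) \<le> B * (3/2)" "norm (of_real c * z^2) \<le> B * (9/4)"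
    if "\<bar>c\<bar> \<le> B" "norm z \<le> 3/2" for c :: real and z :: complex
  proof -
    show "norm (of_real c * z) \<le> B * (3/2)" unfolding norm_mult norm_of_real using that B by (intro mult_mono) auto
    have "norm z^2 \<le> (3/2)^2" using that by (intro power_mono) auto
    thus "norm (of_real c * z^2) \<le> B * (9/4)" unfolding norm_mult norm_of_real norm_power using that B
      by (intro mult_mono) (auto simp: power2_eq_square)
  qed
  have "Re (- of_real v * a - of_real \<tau>2 * a^2 + of_real u * b + of_real \<tau>1 * b^2) \<le>
    norm (of_real v * a) + norm (of_real \<tau>2 * a^2) + norm (of_real u * b) + norm (of_real \<tau>1 * b^2)"
    using abs_Re_le_cmod[of "of_real v * a"] abs_Re_le_cmod[of "of_real \<tau>2 * a^2"] abs_Re_le_cmod[of "of_real u * b"]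
      abs_Re_le_cmod[of "of_real \<tau>1 * b^2"] by (simp add: abs_le_iff)
  \<comment> \<open>The sum is 7.5 B, rounded up to 8 B.\<close>
  also have "\<dots> \<le> B * (3/2) + B * (9/4) + B * (3/2) + B * (9/4)"
    by (intro add_mono t assms)
  also have "\<dots> \<le> 8 * B" using B by simp
  finally show ?thesis by simp
qed

lemma bivariate_phi_ext:
  assumes B: "\<bar>u\<bar> \<le> B" "\<bar>v\<bar> \<le> B" "\<bar>\<tau>1\<bar> \<le> B" "\<bar>\<tau>2\<bar> \<le> B"
  shows "bivariate_bounded (phi_ext \<tau>1 \<tau>2 u v) R (5 * exp (8 * B)) (R / 2)"
proof
  show "0 < R / 2" "R / 2 < R" using R by auto
  have hd: "deriv gS holomorphic_on ball 0 R" by (intro holomorphic_deriv hol open_ball)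
  have comp: "(\<lambda>y. f (\<i> * y)) holomorphic_on ball 0 R" if "f holomorphic_on ball 0 R" for f
  proof -
    have "(*) \<i> ` ball 0 R \<subseteq> ball 0 R" by (auto simp: norm_mult)
    from holomorphic_on_compose_gen[OF _ that this] show ?thesis by (simp add: o_def holomorphic_intros)
  qed
  fix x y :: complex
  {
    assume y: "y \<in> ball 0 R"
    show "(\<lambda>x. phi_ext \<tau>1 \<tau>2 u v x y) holomorphic_on ball 0 R"
      unfolding phi_ext_def using gS_slope_lower(2)[OF _ ball_i(1)[OF y]]
          by (intro holomorphic_intros gS_slope_holomorphic hol hd) auto
  next
    assume x: "x \<in> ball 0 R"
    show "phi_ext \<tau>1 \<tau>2 u v x holomorphic_on ball 0 R"
      unfolding phi_ext_def[abs_def] gS_slope_commute[of x] using gS_slope_lower(2)[OF ball_i(1) x]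
      by (intro holomorphic_intros comp[of "\<lambda>w. gS_slope w x"] comp[OF hol] comp[OF hd] gS_slope_holomorphic) auto
  next
    assume x: "x \<in> ball 0 R" and y: "y \<in> ball 0 R"
    note iy = ball_i(1)[OF y]
    have "norm (1 / gS_slope x (\<i> * y)) \<le> 2" using gS_slope_lower(1)[OF x iy] by (simp add: norm_divide divide_le_eq)
    \<comment> \<open>The factor 2 bounds the reciprocal slope and each 3/2 a derivative of
      \<open>gS\<close>; the product 4.5 is rounded up to 5.\<close>
    hence "norm (phi_ext \<tau>1 \<tau>2 u v x y) \<le> 2 * exp (8 * B) * (3/2) * (3/2)"
      unfolding phi_ext_def norm_mult[of _ "deriv gS x"] norm_mult[of "1 / gS_slope x (\<i> * y)"] norm_mult[of _
          "\<i> * deriv gS (\<i> * y)"] norm_mult[of \<i>] norm_ii mult_1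
      by (intro mult_mono exponent_bound B gS_bound x iy deriv_gS_bound) auto
    thus "norm (phi_ext \<tau>1 \<tau>2 u v x y) \<le> 5 * exp (8 * B)" using exp_gt_zero[of "8*B"] by linarith
  }
qed

lemma bivariate_Phi_ext:
  assumes B: "\<bar>u\<bar> \<le> B" "\<bar>v\<bar> \<le> B" "\<bar>\<tau>1\<bar> \<le> B" "\<bar>\<tau>2\<bar> \<le> B"
  shows "bivariate_bounded (Phi_ext \<tau>1 \<tau>2 u v) R (5 * exp (8 * B)) (R / 2)"
proof
  show "0 < R / 2" "R / 2 < R" using R by auto
  have hd: "deriv gS holomorphic_on ball 0 R" by (intro holomorphic_deriv hol open_ball)
  have comp: "(\<lambda>y. f (- y)) holomorphic_on ball 0 R" if "f holomorphic_on ball 0 R" for f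
  proof -
    have "uminus ` ball 0 R \<subseteq> ball (0::complex) R" by auto
    from holomorphic_on_compose_gen[OF _ that this] show ?thesis
      using holomorphic_on_minus[OF holomorphic_on_ident] by (simp add: o_def)
  qed
  fix x y :: complex
  {
    assume y: "y \<in> ball 0 R"
    show "(\<lambda>x. Phi_ext \<tau>1 \<tau>2 u v x y) holomorphic_on ball 0 R"
      unfolding Phi_ext_def using gS_sum_lower(2)[OF _ ball_i(2)[OF y]] by (intro holomorphic_intros hol hd) auto
  next
    assume x: "x \<in> ball 0 R"
    show "Phi_ext \<tau>1 \<tau>2 u v x holomorphic_on ball 0 R"
      unfolding Phi_ext_def[abs_def] using gS_sum_lower(2)[OF x ball_i(2)]
      by (intro holomorphic_intros comp[OF hol] comp[OF hd]) auto
  next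
    assume x: "x \<in> ball 0 R" and y: "y \<in> ball 0 R"
    note my = ball_i(2)[OF y]
    define E where "E = exp (- of_real v * gS x - of_real \<tau>2 * (gS x)^2 - of_real u * gS (- y)
        + of_real \<tau>1 * (gS (- y))^2)"
    have E: "norm E \<le> exp (8 * B)"
      using exponent_bound[of "-u" B v \<tau>1 \<tau>2 "gS x" "gS (- y)"] B gS_bound[OF x] gS_bound[OF my] by (simp add: E_def)
    have "norm (E / (gS x + gS (- y))) \<le> exp (8 * B) / 1"
      unfolding norm_divide by (intro frac_le E gS_sum_lower x my) auto
    hence "norm (Phi_ext \<tau>1 \<tau>2 u v x y) \<le> exp (8 * B) / 1 * (3/2) * (3/2)"
      unfolding Phi_ext_def E_def[symmetric] norm_mult by (intro mult_mono deriv_gS_bound x my) auto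
    thus "norm (Phi_ext \<tau>1 \<tau>2 u v x y) \<le> 5 * exp (8 * B)" using exp_gt_zero[of "8*B"] by linarith
  }
qed

lemma b_coef_eq: "b_coef \<tau>1 \<tau>2 u v = bivariate_bounded.coeff (phi_ext \<tau>1 \<tau>2 u v)"
proof -
  define B where "B = \<bar>u\<bar> + \<bar>v\<bar> + \<bar>\<tau>1\<bar> + \<bar>\<tau>2\<bar>"
  interpret bb: bivariate_bounded "phi_ext \<tau>1 \<tau>2 u v" R "5 * exp (8 * B)" "R / 2"
    by (rule bivariate_phi_ext) (auto simp: B_def)
  have hs: "((\<lambda>(k, l). bb.coeff k l * x^k * y^l) has_sum phi_fun \<tau>1 \<tau>2 u v x y) UNIV"
    if "x \<in> ball 0 (R/2)" "y \<in> ball 0 (R/2)" "x \<noteq> \<i> * y" for x y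
  proof -
    have "x \<in> ball 0 R" "y \<in> ball 0 R" using that R by auto
    thus ?thesis using bb.coeff_has_sum[OF that(1,2)] phi_fun_eq that(3) by simp
  qed
  show ?thesis unfolding b_coef_def
  proof (rule the_equality)
    show "\<exists>r>0. \<forall>x y. x \<in> ball 0 r \<longrightarrow> y \<in> ball 0 r \<longrightarrow> x \<noteq> \<i> * y \<longrightarrow>
      ((\<lambda>(k, l). bb.coeff k l * x^k * y^l) has_sum phi_fun \<tau>1 \<tau>2 u v x y) UNIV"
      using hs R by (intro exI[of _ "R/2"]) auto
    fix b assume "\<exists>r>0. \<forall>x y. x \<in> ball 0 r \<longrightarrow> y \<in> ball 0 r \<longrightarrow> x \<noteq> \<i> * y \<longrightarrow>
      ((\<lambda>(k, l). b k l * x^k * y^l) has_sum phi_fun \<tau>1 \<tau>2 u v x y) UNIV"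
    then obtain r where r: "r > 0" "\<And>x y. x \<in> ball 0 r \<Longrightarrow> y \<in> ball 0 r \<Longrightarrow> x \<noteq> \<i> * y \<Longrightarrow>
      ((\<lambda>(k, l). b k l * x^k * y^l) has_sum phi_fun \<tau>1 \<tau>2 u v x y) UNIV" by blast
    show "b = bb.coeff"
      by (rule bivariate_coeff_unique[of r "R/2" b "phi_fun \<tau>1 \<tau>2 u v"]) (use r hs R in auto)
  qed
qed

lemma c_coef_eq: "c_coef \<tau>1 \<tau>2 u v = bivariate_bounded.coeff (Phi_ext \<tau>1 \<tau>2 u v)"
proof -
  define B where "B = \<bar>u\<bar> + \<bar>v\<bar> + \<bar>\<tau>1\<bar> + \<bar>\<tau>2\<bar>"
  interpret bb: bivariate_bounded "Phi_ext \<tau>1 \<tau>2 u v" R "5 * exp (8 * B)" "R / 2"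
    by (rule bivariate_Phi_ext) (auto simp: B_def)
  have hs: "((\<lambda>(k, l). bb.coeff k l * x^k * y^l) has_sum Phi_fun \<tau>1 \<tau>2 u v x y) UNIV"
    if "x \<in> ball 0 (R/2)" "y \<in> ball 0 (R/2)" for x y
  proof -
    have "y \<in> ball 0 R" using that R by auto
    thus ?thesis using bb.coeff_has_sum[OF that] Phi_fun_eq by simp
  qed
  show ?thesis unfolding c_coef_def
  proof (rule the_equality)
    show "\<exists>r>0. \<forall>x y. x \<in> ball 0 r \<longrightarrow> y \<in> ball 0 r \<longrightarrow>
      ((\<lambda>(k, l). bb.coeff k l * x^k * y^l) has_sum Phi_fun \<tau>1 \<tau>2 u v x y) UNIV"
      using hs R by (intro exI[of _ "R/2"]) auto
    fix b assume "\<exists>r>0. \<forall>x y. x \<in> ball 0 r \<longrightarrow> y \<in> ball 0 r \<longrightarrow>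
      ((\<lambda>(k, l). b k l * x^k * y^l) has_sum Phi_fun \<tau>1 \<tau>2 u v x y) UNIV"
    then obtain r where r: "r > 0" "\<And>x y. x \<in> ball 0 r \<Longrightarrow> y \<in> ball 0 r \<Longrightarrow>
      ((\<lambda>(k, l). b k l * x^k * y^l) has_sum Phi_fun \<tau>1 \<tau>2 u v x y) UNIV" by blast
    show "b = bb.coeff"
      by (rule bivariate_coeff_unique[of r "R/2" b "Phi_fun \<tau>1 \<tau>2 u v"]) (use r hs R in auto)
  qed
qed

section \<open>Geometry of the arcs through the saddle point\<close>

lemma real_line_bounds:
  assumes "\<bar>t\<bar> < R"
  shows "\<bar>Re (gS (of_real t)) - sqrt 2 / 2 * t\<bar> \<le> \<bar>t\<bar> / 10" "\<bar>Im (gS (of_real t)) - 1 - sqrt 2 / 2 * t\<bar> \<le> \<bar>t\<bar> / 10"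
proof -
  have n: "norm (gS (of_real t) - \<i> - e8 * of_real t) \<le> \<bar>t\<bar> / 10" using lin[of "of_real t"] assms by simp
  have "Re (gS (of_real t) - \<i> - e8 * of_real t) = Re (gS (of_real t)) - sqrt 2 / 2 * t"
    "Im (gS (of_real t) - \<i> - e8 * of_real t) = Im (gS (of_real t)) - 1 - sqrt 2 / 2 * t"
    by (simp_all add: e8_eq)
  thus "\<bar>Re (gS (of_real t)) - sqrt 2 / 2 * t\<bar> \<le> \<bar>t\<bar> / 10" "\<bar>Im (gS (of_real t)) - 1 - sqrt 2 / 2 * t\<bar> \<le> \<bar>t\<bar> / 10"
    using n abs_Re_le_cmod[of "gS (of_real t) - \<i> - e8 * of_real t"] abs_Im_le_cmod[of "gS (of_real t) - \<i>
        - e8 * of_real t"] by linarith+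
qed

lemma sqrt2_bounds: "sqrt 2 / 2 * t \<ge> 7/10 * t" "sqrt 2 / 2 * t \<le> 72/100 * t" if "t \<ge> 0" for t :: real
proof -
  have "sqrt 2 \<ge> 14/10" by (rule real_le_rsqrt) (simp add: power2_eq_square)
  thus "sqrt 2 / 2 * t \<ge> 7/10 * t" using that by (intro mult_right_mono) auto
  have "sqrt 2 \<le> 144/100" by (rule real_le_lsqrt) (simp_all add: power2_eq_square)
  thus "sqrt 2 / 2 * t \<le> 72/100 * t" using that by (intro mult_right_mono) auto
qed

text \<open>For real t both components of gS t - \<i> have the sign of t and absolute value between
  0.6 \<bar>t\<bar> and 0.82 \<bar>t\<bar>, so their ratio lies between 1/2 and 2. The length R / 8
  is \<rho> / 4 for the power series radius \<rho> = R / 2, the largest box that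
  \<open>box_measurable\<close> admits.\<close>

lemma saddle_curve_gS: "saddle_curve gS R (R / 8)"
proof
  show "0 < R / 8" "R / 8 < R" using R by auto
  fix t :: real
  {
    assume t: "0 \<le> t" "t \<le> R / 8"
    hence "\<bar>t\<bar> < R" using R by simp
    from real_line_bounds[OF this] sqrt2_bounds[OF t(1)] t show "gS (of_real t) \<in> NE"
      unfolding NE_def mem_Collect_eq by linarith
  next
    assume t: "- (R / 8) \<le> t" "t \<le> 0"
    hence tR: "\<bar>t\<bar> < R" and t': "0 \<le> - t" using R by auto
    from real_line_bounds[OF tR] sqrt2_bounds[OF t'] t show "gS (of_real t) \<in> SW"
      unfolding SW_def mem_Collect_eq by linarith
    from real_line_bounds[OF tR] sqrt2_bounds[OF t'] t R show "Im (gS (of_real t)) \<ge> 0"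
      by linarith
  next
    assume t: "- (R / 8) \<le> t" "t \<le> R / 8"
    hence tR: "complex_of_real t \<in> ball 0 R" using R by auto
    have "\<bar>t\<bar> = norm (e8 * of_real t)" by (simp add: norm_mult norm_exp_eq_Re)
    also have "\<dots> \<le> norm (gS (of_real t) - \<i>) + norm (gS (of_real t) - \<i> - e8 * of_real t)"
      using norm_triangle_ineq4[of "gS (of_real t) - \<i>" "gS (of_real t) - \<i> - e8 * of_real t"] by simp
    also have "\<dots> \<le> norm (gS (of_real t) - \<i>) + \<bar>t\<bar> / 10" using lin[OF tR] by simp
    finally show "\<bar>t\<bar> / 2 \<le> norm (gS (of_real t) - \<i>)" by simp
  }
qed (use hol gS_0 in auto)

text \<open>Identifies the reflected arcs and their line elements with the curve y \<mapsto> gS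
  (\<i> y), so that the integral near (\<i>, \<i>) appears in the coordinates of
  \<open>phi_ext\<close>.\<close>

lemma deriv_mirror:
  assumes "\<bar>y\<bar> < R"
  shows "gS (\<i> * of_real y) = - cnj (gS (of_real y))" "\<i> * deriv gS (\<i> * of_real y) = - cnj (deriv gS (of_real y))"
proof -
  have y: "complex_of_real y \<in> ball 0 R" using assms by simp
  have iy: "\<i> * complex_of_real y \<in> ball 0 R" by (rule ball_i(1)[OF y])
  show "gS (\<i> * of_real y) = - cnj (gS (of_real y))" using mirror[OF iy] by simp
  have "(gS has_field_derivative deriv gS (of_real y)) (at (of_real y))"
    by (rule holomorphic_derivI[OF hol open_ball y])
  hence "((\<lambda>t. gS (of_real t)) has_vector_derivative deriv gS (of_real y)) (at y)"
    by (rule has_vector_derivative_real_field)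
  hence 1: "((\<lambda>t. - cnj (gS (of_real t))) has_vector_derivative - cnj (deriv gS (of_real y))) (at y)"
    by (intro has_vector_derivative_minus has_vector_derivative_cnj)
  have "((\<lambda>w. gS (\<i> * w)) has_field_derivative deriv gS (\<i> * of_real y) * \<i>) (at (of_real y))"
    by (rule DERIV_chain2[where f=gS and g="\<lambda>y. \<i> * y", OF holomorphic_derivI[OF hol open_ball iy]])
        (auto intro!: derivative_eq_intros)
  hence 2: "((\<lambda>t. gS (\<i> * of_real t)) has_vector_derivative deriv gS (\<i> * of_real y) * \<i>) (at y)"
    by (rule has_vector_derivative_real_field)
  have "((\<lambda>t. - cnj (gS (of_real t))) has_vector_derivative deriv gS (\<i> * of_real y) * \<i>) (at y)"
  proof (rule has_vector_derivative_transform_within_open[OF 2, of "{-R<..<R}"])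
    fix t :: real assume "t \<in> {-R<..<R}"
    hence "\<i> * complex_of_real t \<in> ball 0 R" by (intro ball_i) auto
    thus "gS (\<i> * of_real t) = - cnj (gS (of_real t))" using mirror[of "\<i> * of_real t"] by simp
  qed (use assms in auto)
  from vector_derivative_unique_at[OF this 1] show "\<i> * deriv gS (\<i> * of_real y) = - cnj (deriv gS (of_real y))"
    by (simp add: mult.commute)
qed

end

section \<open>The Airy kernel near the saddle points\<close>

definition airyF :: "real \<Rightarrow> real \<Rightarrow> real \<Rightarrow> real \<Rightarrow> real \<Rightarrow> complex \<Rightarrow> complex \<Rightarrow> complex" where
  "airyF \<Lambda> \<tau>1 \<tau>2 u v z w = exp (of_real \<Lambda> * (fAi z - fAi w)) *
     exp (- of_real v * z - of_real \<tau>2 * z^2 + of_real u * w + of_real \<tau>1 * w^2)"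

lemma fAi_cnj: "fAi (cnj z) = cnj (fAi z)" "fAi (- z) = - fAi z" by (simp_all add: fAi_def power3_eq_cube)

lemma kernel_data_airyF: "kernel_data (airyF \<Lambda> \<tau>1 \<tau>2 u v)"
proof
  show "continuous_on UNIV (\<lambda>(z, w). airyF \<Lambda> \<tau>1 \<tau>2 u v z w)"
    unfolding airyF_def fAi_def case_prod_unfold by (intro continuous_intros) auto
  show "(\<lambda>z. airyF \<Lambda> \<tau>1 \<tau>2 u v z w) holomorphic_on UNIV" for w
    unfolding airyF_def fAi_def by (intro holomorphic_intros) auto
  show "airyF \<Lambda> \<tau>1 \<tau>2 u v z holomorphic_on UNIV" for z
    unfolding airyF_def[abs_def] fAi_def by (intro holomorphic_intros) auto
  show "(\<lambda>z. airyF \<Lambda> \<tau>1 \<tau>2 u v z z) holomorphic_on UNIV"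
    unfolding airyF_def fAi_def by (intro holomorphic_intros) auto
  show "airyF \<Lambda> \<tau>1 \<tau>2 u v (cnj z) (cnj w) = cnj (airyF \<Lambda> \<tau>1 \<tau>2 u v z w)" for z w
    unfolding airyF_def fAi_cnj complex_cnj_mult exp_cnj by simp
qed

lemma norm_sum_list2_le:
  fixes d :: "'a \<Rightarrow> 'b \<Rightarrow> complex"
  assumes "\<And>x y. x \<in> set xs \<Longrightarrow> y \<in> set ys \<Longrightarrow> norm (d x y) \<le> b * K x y"
  shows "norm (\<Sum>x\<leftarrow>xs. \<Sum>y\<leftarrow>ys. d x y) \<le> b * (\<Sum>x\<leftarrow>xs. \<Sum>y\<leftarrow>ys. K x y :: real)"
proof -
  have inner: "norm (\<Sum>y\<leftarrow>ys. d x y) \<le> b * (\<Sum>y\<leftarrow>ys. K x y)" if "\<And>y. y \<in> set ys \<Longrightarrow> norm (d x y) \<le> b * K x y" for x ys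
    using that by (induction ys) (auto simp: distrib_left intro!: norm_triangle_le add_mono)
  show ?thesis using assms
    by (induction xs) (auto simp: distrib_left intro!: norm_triangle_le add_mono inner)
qed

context gS_disc
begin

sublocale sc: saddle_curve gS R "R / 8" by (rule saddle_curve_gS)

abbreviation "Lp \<equiv> sc.Lp"
abbreviation "Lm \<equiv> sc.Lm"

lemma contour_setup_airy: "contour_setup gS R (R / 8) (airyF \<Lambda> \<tau>1 \<tau>2 u v)"
  by (intro contour_setup.intro kernel_data_airyF saddle_curve_gS)

abbreviation "airy_kern \<Lambda> \<tau>1 \<tau>2 u v \<equiv> kernel_data.kern (airyF \<Lambda> \<tau>1 \<tau>2 u v)"

lemma airy_kern_eq: "airy_kern \<Lambda> \<tau>1 \<tau>2 u v z w = airyF \<Lambda> \<tau>1 \<tau>2 u v z w / (z - w)"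
  by (rule kernel_data.kern_def[OF kernel_data_airyF])

lemma local_upper:
  assumes "\<bar>x\<bar> < R" "\<bar>y\<bar> < R" "x \<noteq> 0"
  shows "airy_kern \<Lambda> \<tau>1 \<tau>2 u v (gS (of_real x)) (- cnj (gS (of_real y))) * deriv gS (of_real x)
      * (- cnj (deriv gS (of_real y)))
    = of_real (exp (- (\<Lambda> * (x^2 + y^2)))) * phi_ext \<tau>1 \<tau>2 u v (of_real x) (of_real y) * cauchy_kernel (x, y)"
proof -
  have x: "complex_of_real x \<in> ball 0 R" and y: "complex_of_real y \<in> ball 0 R" using assms by auto
  note iy = ball_i(1)[OF y]
  have ne: "complex_of_real x - \<i> * of_real y \<noteq> 0" using assms(3) by (auto simp: complex_eq_iff)
  \<comment> \<open>The critical values 2/3 \<i> cancel, and (\<i> y)^2 = - y^2 makes the quadratic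
    form negative definite.\<close>
  have E: "fAi (gS (of_real x)) - fAi (gS (\<i> * of_real y)) = - of_real (x^2 + y^2)"
    by (simp add: gS_eq[OF x] gS_eq[OF iy] power_mult_distrib)
  have "of_real \<Lambda> * (fAi (gS (of_real x)) - fAi (gS (\<i> * of_real y))) = of_real (- (\<Lambda> * (x^2 + y^2)))"
    unfolding E by (simp only: of_real_minus of_real_mult mult_minus_right)
  hence "exp (of_real \<Lambda> * (fAi (gS (of_real x)) - fAi (gS (\<i> * of_real y)))) = of_real (exp (- (\<Lambda> * (x^2 + y^2))))"
    by (simp only: exp_of_real)
  moreover have "1 / (gS (of_real x) - gS (\<i> * of_real y)) = 1 / gS_slope (of_real x) (\<i> * of_real y)
      * cauchy_kernel (x, y)"
    using ne by (simp add: gS_slope_def cauchy_kernel_def)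
  ultimately show ?thesis
    unfolding deriv_mirror[OF assms(2), symmetric] airy_kern_eq airyF_def phi_ext_def
    by (simp add: divide_inverse mult_ac)
qed

text \<open>Since \<open>fAi\<close> is odd, the critical values at \<i> and - \<i> add up in the
  exponent instead of cancelling; this is the origin of the oscillating factor.\<close>

lemma local_lower:
  assumes "\<bar>x\<bar> < R" "\<bar>y\<bar> < R"
  shows "airy_kern \<Lambda> \<tau>1 \<tau>2 u v (gS (of_real x)) (- gS (- of_real y)) * deriv gS (of_real x) * deriv gS (- of_real y)
    = exp (\<i> * of_real (4 / 3 * \<Lambda>)) * (of_real (exp (- (\<Lambda> * (x^2 + y^2)))) * Phi_ext \<tau>1 \<tau>2 u v (of_real x)
        (of_real y))"
proof -
  have x: "complex_of_real x \<in> ball 0 R" and y: "- complex_of_real y \<in> ball 0 R" using assms by auto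
  have "of_real \<Lambda> * (fAi (gS (of_real x)) - fAi (- gS (- of_real y))) = \<i> * of_real (4 / 3 * \<Lambda>)
      + of_real (- (\<Lambda> * (x^2 + y^2)))"
    unfolding fAi_cnj gS_eq[OF x] gS_eq[OF y] by (simp add: algebra_simps)
  hence "exp (of_real \<Lambda> * (fAi (gS (of_real x)) - fAi (- gS (- of_real y)))) = exp (\<i> * of_real (4 / 3 * \<Lambda>))
      * of_real (exp (- (\<Lambda> * (x^2 + y^2))))"
    by (simp only: exp_add exp_of_real)
  thus ?thesis unfolding airy_kern_eq airyF_def Phi_ext_def by (simp add: mult_ac)
qed

abbreviation "psi_upper \<tau>1 \<tau>2 u v p \<equiv> indicator ({-(R/8)..R/8} \<times> {-(R/8)..R/8}) p *\<^sub>R phi_ext \<tau>1 \<tau>2 u v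
    (of_real (fst p)) (of_real (snd p))"
abbreviation "psi_lower \<tau>1 \<tau>2 u v p \<equiv> indicator ({-(R/8)..R/8} \<times> {-(R/8)..R/8}) p *\<^sub>R Phi_ext \<tau>1 \<tau>2 u v
    (of_real (fst p)) (of_real (snd p))"

lemma psi_measurable [measurable]:
  "(\<lambda>p. psi_upper \<tau>1 \<tau>2 u v p) \<in> borel_measurable borel" "(\<lambda>p. psi_lower \<tau>1 \<tau>2 u v p) \<in> borel_measurable borel"
proof -
  define B where "B = \<bar>u\<bar> + \<bar>v\<bar> + \<bar>\<tau>1\<bar> + \<bar>\<tau>2\<bar>"
  have B: "\<bar>u\<bar> \<le> B" "\<bar>v\<bar> \<le> B" "\<bar>\<tau>1\<bar> \<le> B" "\<bar>\<tau>2\<bar> \<le> B" by (auto simp: B_def)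
  show "(\<lambda>p. psi_upper \<tau>1 \<tau>2 u v p) \<in> borel_measurable borel" "(\<lambda>p. psi_lower \<tau>1 \<tau>2 u v p) \<in> borel_measurable borel"
    using R by (auto intro!: bivariate_bounded.box_measurable[OF bivariate_phi_ext[OF B]]
        bivariate_bounded.box_measurable[OF bivariate_Phi_ext[OF B]])
qed

text \<open>Each curve is stored as two edges meeting at parameter 0, so four pairs of edges tile a
  square up to the coordinate axes.\<close>

lemma sum_of_four_integrals:
  fixes f1 f2 f3 f4 :: "real \<times> real \<Rightarrow> complex"
  assumes i: "integrable lborel f1" "integrable lborel f2" "integrable lborel f3" "integrable lborel f4"
    and eq: "\<And>x y. x \<noteq> 0 \<Longrightarrow> y \<noteq> 0 \<Longrightarrow> f1 (x, y) + f2 (x, y) + f3 (x, y) + f4 (x, y) = g (x, y)"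
    and g: "g \<in> borel_measurable borel"
  shows "integral\<^sup>L lborel f1 + integral\<^sup>L lborel f2 + integral\<^sup>L lborel f3 + integral\<^sup>L lborel f4
      = integral\<^sup>L lborel g"
    and "integrable lborel g"
proof -
  have sum: "integrable lborel (\<lambda>p. f1 p + f2 p + f3 p + f4 p)"
    by (intro Bochner_Integration.integrable_add i)
  have ae: "AE p in lborel. f1 p + f2 p + f3 p + f4 p = g p"
    using AE_fst_neq[of 0] AE_snd_neq[of 0]
  proof eventually_elim
    case (elim p)
    thus ?case using eq[of "fst p" "snd p"] by simp
  qed
  show "integral\<^sup>L lborel f1 + integral\<^sup>L lborel f2 + integral\<^sup>L lborel f3 + integral\<^sup>L lborel f4
      = integral\<^sup>L lborel g"
    using integral_cong_AE[OF borel_measurable_integrable[OF sum] _ ae] g i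
    by simp
  show "integrable lborel g"
    by (rule integrable_cong_AE_imp[OF sum]) (use g ae in auto)
qed

lemma airy_kern_integrable:
  assumes "e1 \<in> set sc.Sig2" "e2 \<in> set (cnj_sym sc.Gam2)"
  shows "integrable lborel (epair e1 e2 (airy_kern \<Lambda> \<tau>1 \<tau>2 u v))"
  using contour_setup.integrable_pairs(4)[OF contour_setup_airy] assms by (auto simp: integrable_pair_def cnj_sym_def)

lemma mem_chains: "Lm \<in> set sc.Sig2" "Lp \<in> set sc.Sig2" "sc.Cm \<in> set sc.Sig2" "sc.Cp \<in> set sc.Sig2"
  "neg_cnj sc.Cm \<in> set (cnj_sym sc.Gam2)" "neg_cnj sc.Cp \<in> set (cnj_sym sc.Gam2)"
      "rev_cnj (neg_cnj sc.Cm) \<in> set (cnj_sym sc.Gam2)" "rev_cnj (neg_cnj sc.Cp) \<in> set (cnj_sym sc.Gam2)"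
  "neg_cnj Lm \<in> set (cnj_sym sc.Gam2)" "neg_cnj Lp \<in> set (cnj_sym sc.Gam2)"
      "rev_cnj (neg_cnj Lm) \<in> set (cnj_sym sc.Gam2)" "rev_cnj (neg_cnj Lp) \<in> set (cnj_sym sc.Gam2)"
  by (auto simp: sc.Sig2_def sc.Gam2_def cnj_sym_def)

lemma upper_saddle_integral:
  fixes \<tau>1 \<tau>2 u v :: real
  assumes s: "s > 0"
  defines "k \<equiv> airy_kern (1 / s^2) \<tau>1 \<tau>2 u v"
  shows "dint sc.Cm (neg_cnj sc.Cm) k + dint sc.Cm (neg_cnj sc.Cp) k + dint sc.Cp (neg_cnj sc.Cm) k
      + dint sc.Cp (neg_cnj sc.Cp) k
    = (LINT p|lborel. of_real (exp (- (((fst p)^2 + (snd p)^2) / s^2))) * psi_upper \<tau>1 \<tau>2 u v p * cauchy_kernel p)"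
  unfolding dint_def
proof (rule sum_of_four_integrals(1))
  note i = airy_kern_integrable[of _ _ "1/s^2" \<tau>1 \<tau>2 u v, folded k_def]
  show "integrable lborel (epair sc.Cm (neg_cnj sc.Cm) k)" "integrable lborel (epair sc.Cm (neg_cnj sc.Cp) k)"
    "integrable lborel (epair sc.Cp (neg_cnj sc.Cm) k)" "integrable lborel (epair sc.Cp (neg_cnj sc.Cp) k)"
    by (intro i mem_chains)+
  have [measurable]: "(\<lambda>p. complex_of_real (exp (- (((fst p)^2 + (snd p)^2) / s^2)))) \<in> borel_measurable borel"
      by measurable
  show "(\<lambda>p. of_real (exp (- (((fst p)^2 + (snd p)^2) / s^2))) * psi_upper \<tau>1 \<tau>2 u v p
      * cauchy_kernel p) \<in> borel_measurable borel"
    by measurable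
  fix x y :: real assume xy: "x \<noteq> 0" "y \<noteq> 0"
  have ind: "indicator {-(R/8)..0} x + indicator {0..R/8} x = (indicator {-(R/8)..R/8} x :: real)" if "x \<noteq> 0" for x
    using that R by (auto simp: indicator_def)
  have "epair sc.Cm (neg_cnj sc.Cm) k (x, y) + epair sc.Cm (neg_cnj sc.Cp) k (x, y)
      + epair sc.Cp (neg_cnj sc.Cm) k (x, y) + epair sc.Cp (neg_cnj sc.Cp) k (x, y)
     = ((indicator {-(R/8)..0} x + indicator {0..R/8} x) * (indicator {-(R/8)..0} y + indicator {0..R/8} y)) *\<^sub>R
       (k (gS (of_real x)) (- cnj (gS (of_real y))) * deriv gS (of_real x) * (- cnj (deriv gS (of_real y))))"
    by (simp add: epair_def algebra_simps scaleR_add_left)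
  also have "\<dots> = (indicator {-(R/8)..R/8} x * indicator {-(R/8)..R/8} y) *\<^sub>R
       (k (gS (of_real x)) (- cnj (gS (of_real y))) * deriv gS (of_real x) * (- cnj (deriv gS (of_real y))))"
    unfolding ind[OF xy(1)] ind[OF xy(2)] ..
  also have "\<dots> = (indicator {-(R/8)..R/8} x * indicator {-(R/8)..R/8} y) *\<^sub>R
       (of_real (exp (- (1/s^2 * (x^2 + y^2)))) * phi_ext \<tau>1 \<tau>2 u v (of_real x) (of_real y) * cauchy_kernel (x, y))"
  proof (cases "x \<in> {-(R/8)..R/8} \<and> y \<in> {-(R/8)..R/8}")
    case True
    hence "\<bar>x\<bar> < R" "\<bar>y\<bar> < R" using R by auto
    thus ?thesis unfolding k_def by (simp only: local_upper[OF _ _ xy(1)])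
  qed (auto simp: indicator_def)
  also have "\<dots> = of_real (exp (- (((fst (x,y))^2 + (snd (x,y))^2) / s^2))) * psi_upper \<tau>1 \<tau>2 u v (x,y)
      * cauchy_kernel (x, y)"
    by (simp add: indicator_times)
  finally show "epair sc.Cm (neg_cnj sc.Cm) k (x, y) + epair sc.Cm (neg_cnj sc.Cp) k (x, y)
      + epair sc.Cp (neg_cnj sc.Cm) k (x, y) + epair sc.Cp (neg_cnj sc.Cp) k (x, y)
    = of_real (exp (- (((fst (x,y))^2 + (snd (x,y))^2) / s^2))) * psi_upper \<tau>1 \<tau>2 u v (x,y) * cauchy_kernel (x, y)" .
qed

lemma lower_saddle_integral:
  fixes \<tau>1 \<tau>2 u v :: real
  assumes s: "s > 0"
  defines "k \<equiv> airy_kern (1 / s^2) \<tau>1 \<tau>2 u v"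
  shows "dint sc.Cm (rev_cnj (neg_cnj sc.Cm)) k + dint sc.Cm (rev_cnj (neg_cnj sc.Cp)) k
      + dint sc.Cp (rev_cnj (neg_cnj sc.Cm)) k + dint sc.Cp (rev_cnj (neg_cnj sc.Cp)) k
    = exp (\<i> * of_real (4 / 3 * (1 / s^2))) * (LINT p|lborel. of_real (exp (- (((fst p)^2 + (snd p)^2) / s^2)))
        * psi_lower \<tau>1 \<tau>2 u v p * 1)"
proof -
  have "dint sc.Cm (rev_cnj (neg_cnj sc.Cm)) k + dint sc.Cm (rev_cnj (neg_cnj sc.Cp)) k
      + dint sc.Cp (rev_cnj (neg_cnj sc.Cm)) k + dint sc.Cp (rev_cnj (neg_cnj sc.Cp)) k
   = (LINT p|lborel. exp (\<i> * of_real (4 / 3 * (1 / s^2))) * (of_real (exp (- (((fst p)^2 + (snd p)^2) / s^2)))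
       * psi_lower \<tau>1 \<tau>2 u v p * 1))"
  unfolding dint_def
  proof (rule sum_of_four_integrals(1))
    note i = airy_kern_integrable[of _ _ "1/s^2" \<tau>1 \<tau>2 u v, folded k_def]
    show "integrable lborel (epair sc.Cm (rev_cnj (neg_cnj sc.Cm)) k)"
        "integrable lborel (epair sc.Cm (rev_cnj (neg_cnj sc.Cp)) k)"
      "integrable lborel (epair sc.Cp (rev_cnj (neg_cnj sc.Cm)) k)"
          "integrable lborel (epair sc.Cp (rev_cnj (neg_cnj sc.Cp)) k)"
      by (intro i mem_chains)+
    have [measurable]: "(\<lambda>p. complex_of_real (exp (- (((fst p)^2 + (snd p)^2) / s^2)))) \<in> borel_measurable
        borel" by measurable
    show "(\<lambda>p. exp (\<i> * of_real (4 / 3 * (1 / s^2))) * (of_real (exp (- (((fst p)^2 + (snd p)^2) / s^2)))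
        * psi_lower \<tau>1 \<tau>2 u v p * 1)) \<in> borel_measurable borel"
      by measurable
    fix x y :: real assume xy: "x \<noteq> 0" "y \<noteq> 0"
    have ind: "indicator {-(R/8)..0} x + indicator {0..R/8} x = (indicator {-(R/8)..R/8} x :: real)" if "x \<noteq> 0" for x
      using that R by (auto simp: indicator_def)
    have ind': "indicator {0..R/8} y + indicator {-(R/8)..0} y = (indicator {-(R/8)..R/8} y :: real)"
      using xy R by (auto simp: indicator_def)
    have "epair sc.Cm (rev_cnj (neg_cnj sc.Cm)) k (x, y) + epair sc.Cm (rev_cnj (neg_cnj sc.Cp)) k (x, y)
        + epair sc.Cp (rev_cnj (neg_cnj sc.Cm)) k (x, y) + epair sc.Cp (rev_cnj (neg_cnj sc.Cp)) k (x, y)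
       = ((indicator {-(R/8)..0} x + indicator {0..R/8} x) * (indicator {0..R/8} y + indicator {-(R/8)..0} y)) *\<^sub>R
         (k (gS (of_real x)) (- gS (- of_real y)) * deriv gS (of_real x) * deriv gS (- of_real y))"
      by (simp add: epair_def algebra_simps scaleR_add_left)
    also have "\<dots> = (indicator {-(R/8)..R/8} x * indicator {-(R/8)..R/8} y) *\<^sub>R
         (k (gS (of_real x)) (- gS (- of_real y)) * deriv gS (of_real x) * deriv gS (- of_real y))"
      unfolding ind[OF xy(1)] ind' ..
    also have "\<dots> = (indicator {-(R/8)..R/8} x * indicator {-(R/8)..R/8} y) *\<^sub>R
         (exp (\<i> * of_real (4 / 3 * (1/s^2))) * (of_real (exp (- (1/s^2 * (x^2 + y^2)))) * Phi_ext \<tau>1 \<tau>2 u v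
             (of_real x) (of_real y)))"
    proof (cases "x \<in> {-(R/8)..R/8} \<and> y \<in> {-(R/8)..R/8}")
      case True
      hence "\<bar>x\<bar> < R" "\<bar>y\<bar> < R" using R by auto
      thus ?thesis unfolding k_def by (simp only: local_lower)
    qed (auto simp: indicator_def)
    also have "\<dots> = exp (\<i> * of_real (4 / 3 * (1 / s^2)))
        * (of_real (exp (- (((fst (x,y))^2 + (snd (x,y))^2) / s^2))) * psi_lower \<tau>1 \<tau>2 u v (x,y) * 1)"
      by (simp add: indicator_times)
    finally show "epair sc.Cm (rev_cnj (neg_cnj sc.Cm)) k (x, y)
        + epair sc.Cm (rev_cnj (neg_cnj sc.Cp)) k (x, y) + epair sc.Cp (rev_cnj (neg_cnj sc.Cm)) k (x, y) +
        epair sc.Cp (rev_cnj (neg_cnj sc.Cp)) k (x, y)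
      = exp (\<i> * of_real (4 / 3 * (1 / s^2))) * (of_real (exp (- (((fst (x,y))^2 + (snd (x,y))^2) / s^2))) *
          psi_lower \<tau>1 \<tau>2 u v (x,y) * 1)" .
  qed
  thus ?thesis by (simp only: Bochner_Integration.integral_mult_right_zero)
qed

end

section \<open>Exponentially small contributions\<close>

lemma exp_decay_power:
  fixes c :: real
  assumes c: "c > 0"
  shows "\<exists>C\<ge>0. \<forall>s>0. exp (- c / s^2) \<le> C * s^(2*n)"
proof -
  have le: "exp (- c / s^2) \<le> (real (Suc n) / c)^n * s^(2*n)" if s: "s > 0" for s :: real
  proof -
    \<comment> \<open>Chosen so that exp x ^ Suc n = exp (c / s^2), while x \<le> exp x supplies the
      power x^n. Using Suc n avoids division by zero for n = 0.\<close>
    define x where "x = c / s^2 / real (Suc n)"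
    have x: "x > 0" using c s by (simp add: x_def)
    have "x^n \<le> exp x ^ n" using x exp_ge_add_one_self[of x] by (intro power_mono) linarith+
    also have "\<dots> \<le> exp x ^ Suc n" using x by (intro power_increasing) auto
    also have "\<dots> = exp (c / s^2)" unfolding exp_of_nat_mult[symmetric] by (simp add: x_def)
    finally have "1 / exp (c / s^2) \<le> 1 / x^n" using x by (intro divide_left_mono) auto
    moreover have "1 / x^n = (real (Suc n) / c)^n * s^(2*n)"
      using c s by (simp add: x_def power_divide power_mult_distrib power_mult divide_simps)
    ultimately show ?thesis by (simp add: exp_minus inverse_eq_divide)
  qed
  thus ?thesis using c by (intro exI[of _ "(real (Suc n) / c)^n"]) auto
qed

lemma Re_fAi: "Re (fAi z) = Re z * ((Re z)^2 / 3 - (Im z)^2 + 1)"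
  by (simp add: fAi_def power3_eq_cube power2_eq_square field_simps)

lemma exp_linear_quadratic_bound:
  fixes a b :: complex
  assumes "\<bar>u\<bar> \<le> B" "\<bar>v\<bar> \<le> B" "\<bar>\<tau>1\<bar> \<le> B" "\<bar>\<tau>2\<bar> \<le> B" "norm a \<le> 2" "norm b \<le> 2"
  shows "norm (exp (- of_real v * a - of_real \<tau>2 * a^2 + of_real u * b + of_real \<tau>1 * b^2)) \<le> exp (12 * B)"
proof -
  have B: "B \<ge> 0" using assms(1) by simp
  have t: "norm (of_real c * z) \<le> B * 2" "norm (of_real c * z^2) \<le> B * 4"
    if "\<bar>c\<bar> \<le> B" "norm z \<le> 2" for c :: real and z :: complex
  proof -
    show "norm (of_real c * z) \<le> B * 2" unfolding norm_mult norm_of_real using that B by (intro mult_mono) auto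
    have "norm z^2 \<le> 2^2" using that by (intro power_mono) auto
    thus "norm (of_real c * z^2) \<le> B * 4" unfolding norm_mult norm_of_real norm_power using that B
      by (intro mult_mono) auto
  qed
  have "Re (- of_real v * a - of_real \<tau>2 * a^2 + of_real u * b + of_real \<tau>1 * b^2) \<le>
    norm (of_real v * a) + norm (of_real \<tau>2 * a^2) + norm (of_real u * b) + norm (of_real \<tau>1 * b^2)"
    using abs_Re_le_cmod[of "of_real v * a"] abs_Re_le_cmod[of "of_real \<tau>2 * a^2"] abs_Re_le_cmod[of "of_real u * b"]
      abs_Re_le_cmod[of "of_real \<tau>1 * b^2"] by (simp add: abs_le_iff)
  also have "\<dots> \<le> B * 2 + B * 4 + B * 2 + B * 4"
    by (intro add_mono t assms)
  finally show ?thesis by simp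
qed

lemma edge_max_neg:
  assumes "is_edge e" "lo e \<le> hi e" "\<And>t. t \<in> {lo e..hi e} \<Longrightarrow> Re (fAi (ev e t)) < 0"
  shows "\<exists>c>0. \<forall>t\<in>{lo e..hi e}. Re (fAi (ev e t)) \<le> - c"
proof -
  have "continuous_on {lo e..hi e} (\<lambda>t. Re (fAi (ev e t)))"
    unfolding fAi_def by (intro continuous_intros is_edge_continuous[OF assms(1)]) auto
  from continuous_attains_sup[OF compact_Icc _ this] assms(2) obtain t where
    "t \<in> {lo e..hi e}" "\<forall>y\<in>{lo e..hi e}. Re (fAi (ev e y)) \<le> Re (fAi (ev e t))" by auto
  thus ?thesis using assms(3)[of t] by (intro exI[of _ "- Re (fAi (ev e t))"]) auto
qed

text \<open>In \<open>NE\<close> the square of Im z is at least (1 + Re z / 2)^2, so the bracket in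
  \<open>Re_fAi\<close> is at most (Re z)^2 / 12 - Re z, which is negative on the given
  range.\<close>

lemma NE_Re_fAi:
  assumes "z \<in> NE" "0 < Re z" "Re z \<le> 2"
  shows "Re (fAi z) < 0"
proof -
  have "Im z \<ge> 1 + Re z / 2" using assms by (simp add: NE_def)
  hence "(1 + Re z / 2)^2 \<le> (Im z)^2" using assms by (intro power_mono) auto
  hence "1 + Re z + (Re z)^2 / 4 \<le> (Im z)^2" by (simp add: power2_eq_square algebra_simps)
  moreover have "(Re z)^2 \<le> 2 * Re z" using assms by (simp add: power2_eq_square mult_right_mono)
  ultimately have "(Re z)^2 / 3 - (Im z)^2 + 1 < 0" using assms(2) by linarith
  thus ?thesis unfolding Re_fAi using assms(2) by (simp add: mult_pos_neg)
qed

lemma SW_Re_fAi: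
  assumes "Re z < 0" "0 \<le> Im z" "Im z < 1"
  shows "Re (fAi z) < 0"
proof -
  have "(Im z)^2 < 1" using assms by (simp add: power_less_one_iff abs_square_less_1)
  hence "(Re z)^2 / 3 - (Im z)^2 + 1 > 0" using zero_le_power2[of "Re z"] by linarith
  thus ?thesis unfolding Re_fAi using assms(1) by (simp add: mult_neg_pos)
qed

context gS_disc
begin

lemma saddle_arc_bounds:
  assumes "e \<in> {sc.Cm, sc.Cp}" "t \<in> {lo e..hi e}"
  shows "norm (ev e t) \<le> 2" "Re (fAi (ev e t)) \<le> 0"
proof -
  have "\<bar>t\<bar> < R" using assms R by auto
  hence t: "complex_of_real t \<in> ball 0 R" by simp
  have e: "ev e t = gS t" using assms(1) by auto
  show "norm (ev e t) \<le> 2" using gS_bound[OF t] unfolding e by simp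
  show "Re (fAi (ev e t)) \<le> 0" unfolding e gS_eq[OF t] by (simp flip: of_real_power)
qed

lemma chord_bounds:
  assumes "e \<in> {Lm, Lp}" "t \<in> {lo e..hi e}"
  shows "norm (ev e t) \<le> 2" "Re (fAi (ev e t)) < 0"
proof -
  have g: "gS (of_real (R / 8)) \<in> cball 0 2" "gS (- of_real (R / 8)) \<in> cball 0 2" "corner \<in> cball 0 2"
    "(-2::complex) \<in> cball 0 2"
    using gS_bound[of "of_real (R / 8)"] gS_bound[of "- of_real (R / 8)"] R by (simp_all add: cmod_def)
  from assms(1) consider "e = Lm" | "e = Lp" by blast
  thus "norm (ev e t) \<le> 2"
  proof cases
    case 1 thus ?thesis
      using seg_in_convex[OF convex_cball g(4,2), of t] assms(2) by simp
  next
    case 2 thus ?thesis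
      using seg_in_convex[OF convex_cball g(1,3), of t] assms(2) by simp
  qed
  from assms(1) consider "e = Lm" | "e = Lp" by blast
  thus "Re (fAi (ev e t)) < 0"
  proof cases
    case 1
    hence t: "t \<in> {lo Lm..hi Lm}" using assms(2) by simp
    show ?thesis unfolding 1 using sc.Lm_neg[OF t] sc.Lm_Im_nonneg[OF t] by (intro SW_Re_fAi) auto
  next
    case 2
    hence t: "t \<in> {lo Lp..hi Lp}" using assms(2) by simp
    have "Re (ev Lp t) \<le> norm (ev Lp t)" by (rule complex_Re_le_cmod)
    also have "\<dots> \<le> 2" using seg_in_convex[OF convex_cball g(1,3) t] by simp
    finally show ?thesis unfolding 2 using sc.Lp_pos[OF t] by (intro NE_Re_fAi sc.Lp_mem t) auto
  qed
qed

lemma chord_decay: "\<exists>c>0. \<forall>e\<in>{Lm, Lp}. \<forall>t\<in>{lo e..hi e}. Re (fAi (ev e t)) \<le> - c"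
proof -
  obtain c1 where c1: "c1 > 0" "\<forall>t\<in>{lo Lm..hi Lm}. Re (fAi (ev Lm t)) \<le> - c1"
    using edge_max_neg[OF is_edge_seg, of "-2" "gS (- of_real (R/8))"] chord_bounds(2)[of Lm] by auto
  obtain c2 where c2: "c2 > 0" "\<forall>t\<in>{lo Lp..hi Lp}. Re (fAi (ev Lp t)) \<le> - c2"
    using edge_max_neg[OF is_edge_seg, of "gS (of_real (R/8))" corner] chord_bounds(2)[of Lp] by auto
  have "Re (fAi (ev e t)) \<le> - min c1 c2" if "e \<in> {Lm, Lp}" "t \<in> {lo e..hi e}" for e t
  proof -
    from that(1) consider "e = Lm" | "e = Lp" by blast
    thus ?thesis
    proof cases
      case 1
      hence "Re (fAi (ev e t)) \<le> - c1" using c1(2) that(2) by blast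
      thus ?thesis by linarith
    next
      case 2
      hence "Re (fAi (ev e t)) \<le> - c2" using c2(2) that(2) by blast
      thus ?thesis by linarith
    qed
  qed
  thus ?thesis using c1(1) c2(1) by (intro exI[of _ "min c1 c2"]) auto
qed

lemma reflected_edge_values:
  assumes "e' = neg_cnj b \<or> e' = rev_cnj (neg_cnj b)" "t \<in> {lo e'..hi e'}"
  shows "\<exists>t'\<in>{lo b..hi b}. norm (ev e' t) = norm (ev b t') \<and> Re (fAi (ev e' t)) = - Re (fAi (ev b t'))"
proof -
  have f: "Re (fAi (cnj z)) = Re (fAi z)" "Re (fAi (- z)) = - Re (fAi z)" for z
    by (simp_all add: fAi_cnj)
  from assms(1) show ?thesis
  proof
    assume "e' = neg_cnj b"
    thus ?thesis using assms(2) by (intro bexI[of _ t]) (simp_all add: f)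
  next
    assume "e' = rev_cnj (neg_cnj b)"
    thus ?thesis using assms(2) by (intro bexI[of _ "-t"]) (simp_all add: f)
  qed
qed

text \<open>The first four terms have both variables on arcs at \<i>, the next four have w on arcs
  at - \<i>. In all remaining pairs at least one edge is a chord.\<close>

lemma sum_split_pairs:
  fixes d :: "edge \<Rightarrow> edge \<Rightarrow> complex"
  shows "(\<Sum>e1\<leftarrow>sc.Sig2. \<Sum>e2\<leftarrow>cnj_sym sc.Gam2. d e1 e2) =
     (d sc.Cm (neg_cnj sc.Cm) + d sc.Cm (neg_cnj sc.Cp) + d sc.Cp (neg_cnj sc.Cm) + d sc.Cp (neg_cnj sc.Cp)) +
     (d sc.Cm (rev_cnj (neg_cnj sc.Cm)) + d sc.Cm (rev_cnj (neg_cnj sc.Cp)) + d sc.Cp (rev_cnj (neg_cnj sc.Cm))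
         + d sc.Cp (rev_cnj (neg_cnj sc.Cp))) +
     ((\<Sum>e1\<leftarrow>[Lm, Lp]. \<Sum>e2\<leftarrow>cnj_sym sc.Gam2. d e1 e2) +
      (\<Sum>e1\<leftarrow>[sc.Cm, sc.Cp]. \<Sum>e2\<leftarrow>[neg_cnj Lm, neg_cnj Lp, rev_cnj (neg_cnj Lm), rev_cnj (neg_cnj Lp)]. d e1 e2))"
proof -
  define D where "D e = (\<Sum>e2\<leftarrow>cnj_sym sc.Gam2. d e e2)" for e
  have "D e = d e (neg_cnj sc.Cm) + d e (neg_cnj sc.Cp)
      + (d e (rev_cnj (neg_cnj sc.Cm)) + d e (rev_cnj (neg_cnj sc.Cp))) +
      (\<Sum>e2\<leftarrow>[neg_cnj Lm, neg_cnj Lp, rev_cnj (neg_cnj Lm), rev_cnj (neg_cnj Lp)]. d e e2)" for e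
    unfolding D_def by (simp add: cnj_sym_def sc.Gam2_def sc.Sig2_def)
  moreover have "(\<Sum>e1\<leftarrow>sc.Sig2. D e1) = (\<Sum>e1\<leftarrow>[Lm, Lp]. D e1) + D sc.Cm + D sc.Cp"
    by (simp add: sc.Sig2_def)
  ultimately show ?thesis unfolding D_def[symmetric] by simp
qed

text \<open>A chord in either variable contributes at most - c to the real part of f z - f w, and an
  arc at most 0. The singular factor is integrated once and for all in \<open>W\<close>, so the
  constants depend on B alone.\<close>

lemma error_bound:
  "\<exists>c>0. \<exists>K\<ge>0. \<forall>\<Lambda>\<ge>0. \<forall>u v \<tau>1 \<tau>2. \<bar>u\<bar> \<le> B \<longrightarrow> \<bar>v\<bar> \<le> B \<longrightarrow> \<bar>\<tau>1\<bar> \<le> B \<longrightarrow> \<bar>\<tau>2\<bar> \<le> B \<longrightarrow>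
     norm ((\<Sum>e1\<leftarrow>[Lm, Lp]. \<Sum>e2\<leftarrow>cnj_sym sc.Gam2. dint e1 e2 (airy_kern \<Lambda> \<tau>1 \<tau>2 u v)) +
      (\<Sum>e1\<leftarrow>[sc.Cm, sc.Cp]. \<Sum>e2\<leftarrow>[neg_cnj Lm, neg_cnj Lp, rev_cnj (neg_cnj Lm), rev_cnj (neg_cnj Lp)]. dint e1 e2
          (airy_kern \<Lambda> \<tau>1 \<tau>2 u v))) \<le> K * exp (- c * \<Lambda>)"
proof -
  define W where "W e1 e2 = (LINT p|lborel. norm (epair e1 e2 (\<lambda>z w. 1 / (z - w)) p))" for e1 e2
  obtain c where c: "c > 0" "\<forall>e\<in>{Lm, Lp}. \<forall>t\<in>{lo e..hi e}. Re (fAi (ev e t)) \<le> - c" using chord_decay by blast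
  have all: "norm (ev e t) \<le> 2 \<and> Re (fAi (ev e t)) \<le> 0" if "e \<in> {Lm, Lp, sc.Cm, sc.Cp}" "t \<in> {lo e..hi e}" for e t
  proof -
    from that(1) consider "e \<in> {Lm, Lp}" | "e \<in> {sc.Cm, sc.Cp}" by blast
    thus ?thesis using chord_bounds[of e t] saddle_arc_bounds[of e t] that(2) by cases auto
  qed
  have pair: "norm (dint e1 e2 (airy_kern \<Lambda> \<tau>1 \<tau>2 u v)) \<le> (exp (- c * \<Lambda>) * exp (12 * B)) * W e1 e2"
    if e1: "e1 \<in> {Lm, Lp, sc.Cm, sc.Cp}" and b: "b \<in> {Lm, Lp, sc.Cm, sc.Cp}"
        and e2: "e2 = neg_cnj b \<or> e2 = rev_cnj (neg_cnj b)"
      and L: "e1 \<in> {Lm, Lp} \<or> b \<in> {Lm, Lp}"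
      and \<Lambda>: "\<Lambda> \<ge> 0" and B: "\<bar>u\<bar> \<le> B" "\<bar>v\<bar> \<le> B" "\<bar>\<tau>1\<bar> \<le> B" "\<bar>\<tau>2\<bar> \<le> B" for e1 e2 b \<Lambda> u v \<tau>1 \<tau>2
  proof -
    have sep: "separated e1 e2"
      using contour_setup.separated_at_i[OF contour_setup_airy, of e1 b]
          contour_setup.separated_lower[OF contour_setup_airy, of e1 b] e1 b e2 by blast
    have ie: "is_edge e1" "is_edge b" using e1 b sc.basic_edges by blast+
    hence ie2: "is_edge e2" using e2 is_edge_neg_cnj is_edge_rev_cnj by blast
    have airy_kern: "airy_kern \<Lambda> \<tau>1 \<tau>2 u v = (\<lambda>z w. airyF \<Lambda> \<tau>1 \<tau>2 u v z w / (z - w))" by (intro ext airy_kern_eq)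
    show ?thesis unfolding airy_kern W_def
    proof (rule norm_dint_le[OF ie(1) ie2 sep])
      fix t s assume t: "t \<in> {lo e1..hi e1}" and s: "s \<in> {lo e2..hi e2}"
      obtain s' where s': "s' \<in> {lo b..hi b}" "norm (ev e2 s) = norm (ev b s')"
          "Re (fAi (ev e2 s)) = - Re (fAi (ev b s'))"
        using reflected_edge_values[OF e2 s] by blast
      have re: "Re (fAi (ev e1 t)) - Re (fAi (ev e2 s)) \<le> - c"
      proof -
        have 1: "Re (fAi (ev e1 t)) \<le> 0" "Re (fAi (ev b s')) \<le> 0" using all[OF e1 t] all[OF b s'(1)] by auto
        from L show ?thesis
        proof
          assume "e1 \<in> {Lm, Lp}"
          hence "Re (fAi (ev e1 t)) \<le> - c" using c(2) t by blast
          thus ?thesis using 1 s'(3) by linarith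
        next
          assume "b \<in> {Lm, Lp}"
          hence "Re (fAi (ev b s')) \<le> - c" using c(2) s'(1) by blast
          thus ?thesis using 1 s'(3) by linarith
        qed
      qed
      have "norm (exp (of_real \<Lambda> * (fAi (ev e1 t) - fAi (ev e2 s))))
          = exp (\<Lambda> * (Re (fAi (ev e1 t)) - Re (fAi (ev e2 s))))"
        by simp
      also have "\<dots> \<le> exp (\<Lambda> * (- c))" using re \<Lambda> by (simp only: exp_le_cancel_iff mult_left_mono)
      finally have n1: "norm (exp (of_real \<Lambda> * (fAi (ev e1 t) - fAi (ev e2 s)))) \<le> exp (- c * \<Lambda>)"
          by (simp add: mult.commute)
      have "norm (ev e1 t) \<le> 2" "norm (ev e2 s) \<le> 2" using all[OF e1 t] all[OF b s'(1)] s'(2) by auto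
      from exp_linear_quadratic_bound[OF B this] n1
      show "norm (airyF \<Lambda> \<tau>1 \<tau>2 u v (ev e1 t) (ev e2 s)) \<le> exp (- c * \<Lambda>) * exp (12 * B)"
        unfolding airyF_def norm_mult by (intro mult_mono) auto
    qed
  qed
  define W1 where "W1 = (\<Sum>e1\<leftarrow>[Lm, Lp]. \<Sum>e2\<leftarrow>cnj_sym sc.Gam2. W e1 e2)"
  define W2 where "W2 = (\<Sum>e1\<leftarrow>[sc.Cm, sc.Cp]. \<Sum>e2\<leftarrow>[neg_cnj Lm, neg_cnj Lp, rev_cnj (neg_cnj Lm), rev_cnj
      (neg_cnj Lp)]. W e1 e2)"
  have W0: "W e1 e2 \<ge> 0" for e1 e2 by (simp add: W_def)
  have "W1 \<ge> 0" "W2 \<ge> 0" unfolding W1_def W2_def using W0 by (auto intro!: sum_list_nonneg add_nonneg_nonneg)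
  show ?thesis
  proof (rule exI[of _ c], rule conjI, rule c(1), rule exI[of _ "exp (12 * B) * (W1 + W2)"], intro conjI allI impI)
    show "0 \<le> exp (12 * B) * (W1 + W2)" using \<open>W1 \<ge> 0\<close> \<open>W2 \<ge> 0\<close> by simp
    fix \<Lambda> u v \<tau>1 \<tau>2 :: real
    assume as: "\<Lambda> \<ge> 0" "\<bar>u\<bar> \<le> B" "\<bar>v\<bar> \<le> B" "\<bar>\<tau>1\<bar> \<le> B" "\<bar>\<tau>2\<bar> \<le> B"
    have 1: "norm (\<Sum>e1\<leftarrow>[Lm, Lp]. \<Sum>e2\<leftarrow>cnj_sym sc.Gam2. dint e1 e2 (airy_kern \<Lambda> \<tau>1 \<tau>2 u v))
        \<le> (exp (- c * \<Lambda>) * exp (12 * B)) * W1"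
      unfolding W1_def
    proof (rule norm_sum_list2_le)
      fix e1 e2 assume e: "e1 \<in> set [Lm, Lp]" "e2 \<in> set (cnj_sym sc.Gam2)"
      have "set (cnj_sym sc.Gam2) = neg_cnj ` {Lm, sc.Cm, sc.Cp, Lp} \<union> rev_cnj ` neg_cnj ` {Lm, sc.Cm, sc.Cp, Lp}"
        by (auto simp: cnj_sym_def sc.Gam2_def sc.Sig2_def)
      with e obtain b where b: "b \<in> {Lm, Lp, sc.Cm, sc.Cp}" "e2 = neg_cnj b \<or> e2 = rev_cnj (neg_cnj b)" by blast
      show "norm (dint e1 e2 (airy_kern \<Lambda> \<tau>1 \<tau>2 u v)) \<le> (exp (- c * \<Lambda>) * exp (12 * B)) * W e1 e2"
        by (rule pair[OF _ b _ as]) (use e in auto)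
    qed
    have 2: "norm (\<Sum>e1\<leftarrow>[sc.Cm, sc.Cp]. \<Sum>e2\<leftarrow>[neg_cnj Lm, neg_cnj Lp, rev_cnj (neg_cnj Lm), rev_cnj (neg_cnj Lp)].
        dint e1 e2 (airy_kern \<Lambda> \<tau>1 \<tau>2 u v)) \<le> (exp (- c * \<Lambda>) * exp (12 * B)) * W2"
      unfolding W2_def
    proof (rule norm_sum_list2_le)
      fix e1 e2 assume e: "e1 \<in> set [sc.Cm, sc.Cp]"
          "e2 \<in> set [neg_cnj Lm, neg_cnj Lp, rev_cnj (neg_cnj Lm), rev_cnj (neg_cnj Lp)]"
      then obtain b where b: "b \<in> {Lm, Lp}" "e2 = neg_cnj b \<or> e2 = rev_cnj (neg_cnj b)" by auto
      show "norm (dint e1 e2 (airy_kern \<Lambda> \<tau>1 \<tau>2 u v)) \<le> (exp (- c * \<Lambda>) * exp (12 * B)) * W e1 e2"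
        by (rule pair[OF _ _ b(2) _ as]) (use e b(1) in auto)
    qed
    from norm_triangle_le[OF add_mono[OF 1 2]]
    show "norm ((\<Sum>e1\<leftarrow>[Lm, Lp]. \<Sum>e2\<leftarrow>cnj_sym sc.Gam2. dint e1 e2 (airy_kern \<Lambda> \<tau>1 \<tau>2 u v)) +
      (\<Sum>e1\<leftarrow>[sc.Cm, sc.Cp]. \<Sum>e2\<leftarrow>[neg_cnj Lm, neg_cnj Lp, rev_cnj (neg_cnj Lm), rev_cnj (neg_cnj Lp)]. dint e1 e2
          (airy_kern \<Lambda> \<tau>1 \<tau>2 u v))) \<le> exp (12 * B) * (W1 + W2) * exp (- c * \<Lambda>)"
      by (simp only: algebra_simps)
  qed
qed

end

section \<open>Expansion of the two saddle point contributions\<close>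

lemma sum_odd_only:
  fixes f :: "nat \<Rightarrow> 'a :: comm_monoid_add"
  assumes "\<And>n. even n \<Longrightarrow> f n = 0"
  shows "(\<Sum>n<2*N+1. f n) = (\<Sum>\<nu>=1..N. f (2*\<nu>-1))"
proof (induction N)
  case (Suc N)
  have "(\<Sum>n<2*Suc N+1. f n) = (\<Sum>n<2*N+1. f n) + f (2*N+1) + f (2*N+2)" by (simp add: add_ac)
  thus ?case using Suc assms[of "2*N+2"] by (simp add: add_ac)
qed (use assms[of 0] in simp)

lemma sum_even_only:
  fixes f :: "nat \<Rightarrow> 'a :: comm_monoid_add"
  assumes "\<And>n. odd n \<Longrightarrow> f n = 0"
  shows "(\<Sum>n<2*N. f n) = (\<Sum>j<N. f (2*j))"
proof (induction N)
  case (Suc N)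
  have "(\<Sum>n<2*Suc N. f n) = (\<Sum>n<2*N. f n) + f (2*N) + f (2*N+1)" by (simp add: add_ac)
  thus ?case using Suc assms[of "2*N+1"] by (simp add: add_ac)
qed simp

lemma sum_even_only_le:
  fixes f :: "nat \<Rightarrow> 'a :: comm_monoid_add"
  assumes "\<And>n. odd n \<Longrightarrow> f n = 0"
  shows "(\<Sum>n\<le>2*N. f n) = (\<Sum>j\<le>N. f (2*j))"
proof -
  have "(\<Sum>n\<le>2*N. f n) = (\<Sum>n<2*N. f n) + f (2*N)" by (simp flip: lessThan_Suc_atMost)
  also have "\<dots> = (\<Sum>j\<le>N. f (2*j))" by (simp add: sum_even_only[OF assms] flip: lessThan_Suc_atMost)
  finally show ?thesis .
qed

lemma B_coef_gauss: "B_coef k l = gauss_moment cauchy_kernel k l"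
  by (simp add: B_coef_def gauss_moment_def cauchy_kernel_def)

context gS_disc
begin

lemma upper_expansion:
  "\<exists>C\<ge>0. \<forall>s>0. \<forall>u v \<tau>1 \<tau>2. \<bar>u\<bar> \<le> B \<longrightarrow> \<bar>v\<bar> \<le> B \<longrightarrow> \<bar>\<tau>1\<bar> \<le> B \<longrightarrow> \<bar>\<tau>2\<bar> \<le> B \<longrightarrow>
    norm ((LINT p|lborel. of_real (exp (- (((fst p)^2 + (snd p)^2) / s^2))) * psi_upper \<tau>1 \<tau>2 u v p * cauchy_kernel p)
      - (\<Sum>\<nu>=1..N. of_real (s^(2*\<nu>)) * (\<Sum>k\<le>2*\<nu>-1. b_coef \<tau>1 \<tau>2 u v k (2*\<nu>-1-k) * B_coef k (2*\<nu>-1-k)))) \<le> C * s^(2*N+2)"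
proof -
  \<comment> \<open>The kernel costs one power of s, so the remainder is s^(m + 2) / s = s^(2 N +
    2). Terms of even degree vanish by parity.\<close>
  define m where "m = 2*N+1"
  define A where "A = (2 * (5 * exp (8 * B)) * (m + 1) + 5 * exp (8 * B) * (m * m)) / (R/8)^m"
  define C where "C = A * gauss_abs_moment cauchy_kernel m"
  have "gauss_abs_moment cauchy_kernel m \<ge> 0" unfolding gauss_abs_moment_def
      by (intro Bochner_Integration.integral_nonneg) auto
  moreover have "A \<ge> 0" using R by (simp add: A_def)
  ultimately have C: "C \<ge> 0" by (simp add: C_def)
  have "norm ((LINT p|lborel. of_real (exp (- (((fst p)^2 + (snd p)^2) / s^2))) * psi_upper \<tau>1 \<tau>2 u v p
      * cauchy_kernel p)
      - (\<Sum>\<nu>=1..N. of_real (s^(2*\<nu>)) * (\<Sum>k\<le>2*\<nu>-1. b_coef \<tau>1 \<tau>2 u v k (2*\<nu>-1-k) * B_coef k (2*\<nu>-1-k)))) \<le> C * s^(2*N+2)"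
    if s: "s > 0" and B: "\<bar>u\<bar> \<le> B" "\<bar>v\<bar> \<le> B" "\<bar>\<tau>1\<bar> \<le> B" "\<bar>\<tau>2\<bar> \<le> B" for s u v \<tau>1 \<tau>2
  proof -
    interpret bb: bivariate_bounded "phi_ext \<tau>1 \<tau>2 u v" R "5 * exp (8 * B)" "R / 2" by (rule bivariate_phi_ext[OF B])
    have "norm (psi_upper \<tau>1 \<tau>2 u v p - (\<Sum>n<m. \<Sum>k\<le>n. bb.coeff k (n - k) * of_real (fst p)^k * of_real (snd p)^(n-k)))
        \<le> A * (\<bar>fst p\<bar> + \<bar>snd p\<bar>)^m" for p
      unfolding A_def using bb.box_remainder[of "R/8" p m] R by simp
    from watson_2d[OF gauss_kernel_cauchy psi_measurable(1) s this]
    have W: "norm ((LINT p|lborel. of_real (exp (- (((fst p)^2 + (snd p)^2) / s^2))) * psi_upper \<tau>1 \<tau>2 u v p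
        * cauchy_kernel p)
      - (\<Sum>n<m. \<Sum>k\<le>n. bb.coeff k (n - k) * gauss_moment cauchy_kernel k (n - k) * of_real (s^(n+2) / s^1))) \<le> C *
          (s^(m+2) / s^1)"
      by (simp only: C_def)
    have "(\<Sum>n<m. \<Sum>k\<le>n. bb.coeff k (n - k) * gauss_moment cauchy_kernel k (n - k) * of_real (s^(n+2) / s^1))
      = (\<Sum>n<2*N+1. of_real (s^(n+1)) * (\<Sum>k\<le>n. bb.coeff k (n - k) * gauss_moment cauchy_kernel k (n - k)))"
      unfolding m_def using s by (intro sum.cong refl) (simp add: sum_distrib_left mult_ac)
    also have "\<dots> = (\<Sum>\<nu>=1..N. of_real (s^(2*\<nu>-1+1)) * (\<Sum>k\<le>2*\<nu>-1. bb.coeff k (2*\<nu>-1 - k)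
        * gauss_moment cauchy_kernel k (2*\<nu>-1 - k)))"
    proof (rule sum_odd_only)
      fix n :: nat assume "even n"
      hence "gauss_moment cauchy_kernel k (n - k) = 0" if "k \<le> n" for k
        using that by (intro gauss_moment_cauchy_even) auto
      thus "of_real (s^(n+1)) * (\<Sum>k\<le>n. bb.coeff k (n - k) * gauss_moment cauchy_kernel k (n - k)) = 0" by simp
    qed
    also have "\<dots> = (\<Sum>\<nu>=1..N. of_real (s^(2*\<nu>)) * (\<Sum>k\<le>2*\<nu>-1. b_coef \<tau>1 \<tau>2 u v k (2*\<nu>-1-k) * B_coef k (2*\<nu>-1-k)))"
      unfolding b_coef_eq B_coef_gauss by (intro sum.cong refl) auto
    finally have S: "(\<Sum>n<m. \<Sum>k\<le>n. bb.coeff k (n - k) * gauss_moment cauchy_kernel k (n - k) * of_real (s^(n+2) / s^1))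
      = (\<Sum>\<nu>=1..N. of_real (s^(2*\<nu>)) * (\<Sum>k\<le>2*\<nu>-1. b_coef \<tau>1 \<tau>2 u v k (2*\<nu>-1-k) * B_coef k (2*\<nu>-1-k)))" .
    have "s^(m+2) / s^1 = s^(2*N+2)" using s by (simp add: m_def)
    with W show ?thesis unfolding S by (simp only:)
  qed
  thus ?thesis using C by blast
qed

lemma lower_expansion:
  "\<exists>C\<ge>0. \<forall>s>0. \<forall>u v \<tau>1 \<tau>2. \<bar>u\<bar> \<le> B \<longrightarrow> \<bar>v\<bar> \<le> B \<longrightarrow> \<bar>\<tau>1\<bar> \<le> B \<longrightarrow> \<bar>\<tau>2\<bar> \<le> B \<longrightarrow>
    norm ((LINT p|lborel. of_real (exp (- (((fst p)^2 + (snd p)^2) / s^2))) * psi_lower \<tau>1 \<tau>2 u v p * 1)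
      - (\<Sum>\<nu>=1..N. of_real (s^(2*\<nu>)) * (\<Sum>k\<le>\<nu>-1. c_coef \<tau>1 \<tau>2 u v (2*k) (2*(\<nu>-1-k)) *
           of_real (Gamma (real k + 1/2) * Gamma (real (\<nu>-1-k) + 1/2))))) \<le> C * s^(2*N+2)"
proof -
  \<comment> \<open>Here the kernel has degree 0, so m = 2 N already gives the remainder s^(2 N +
    2). Only monomials with both exponents even survive.\<close>
  define m where "m = 2*N"
  define A where "A = (2 * (5 * exp (8 * B)) * (m + 1) + 5 * exp (8 * B) * (m * m)) / (R/8)^m"
  define C where "C = A * gauss_abs_moment (\<lambda>_. 1) m"
  have "gauss_abs_moment (\<lambda>_. 1) m \<ge> 0" unfolding gauss_abs_moment_def
      by (intro Bochner_Integration.integral_nonneg) auto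
  moreover have "A \<ge> 0" using R by (simp add: A_def)
  ultimately have C: "C \<ge> 0" by (simp add: C_def)
  have "norm ((LINT p|lborel. of_real (exp (- (((fst p)^2 + (snd p)^2) / s^2))) * psi_lower \<tau>1 \<tau>2 u v p * 1)
      - (\<Sum>\<nu>=1..N. of_real (s^(2*\<nu>)) * (\<Sum>k\<le>\<nu>-1. c_coef \<tau>1 \<tau>2 u v (2*k) (2*(\<nu>-1-k)) *
           of_real (Gamma (real k + 1/2) * Gamma (real (\<nu>-1-k) + 1/2))))) \<le> C * s^(2*N+2)"
    if s: "s > 0" and B: "\<bar>u\<bar> \<le> B" "\<bar>v\<bar> \<le> B" "\<bar>\<tau>1\<bar> \<le> B" "\<bar>\<tau>2\<bar> \<le> B" for s u v \<tau>1 \<tau>2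
  proof -
    interpret bb: bivariate_bounded "Phi_ext \<tau>1 \<tau>2 u v" R "5 * exp (8 * B)" "R / 2" by (rule bivariate_Phi_ext[OF B])
    have "norm (psi_lower \<tau>1 \<tau>2 u v p - (\<Sum>n<m. \<Sum>k\<le>n. bb.coeff k (n - k) * of_real (fst p)^k * of_real (snd p)^(n-k)))
        \<le> A * (\<bar>fst p\<bar> + \<bar>snd p\<bar>)^m" for p
      unfolding A_def using bb.box_remainder[of "R/8" p m] R by simp
    from watson_2d[OF gauss_kernel_one psi_measurable(2) s this]
    have W: "norm ((LINT p|lborel. of_real (exp (- (((fst p)^2 + (snd p)^2) / s^2))) * psi_lower \<tau>1 \<tau>2 u v p * 1)
      - (\<Sum>n<m. \<Sum>k\<le>n. bb.coeff k (n - k) * gauss_moment (\<lambda>_. 1) k (n - k) * of_real (s^(n+2) / s^0))) \<le> C *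
          (s^(m+2) / s^0)"
      by (simp only: C_def)
    have "(\<Sum>n<m. \<Sum>k\<le>n. bb.coeff k (n - k) * gauss_moment (\<lambda>_. 1) k (n - k) * of_real (s^(n+2) / s^0))
      = (\<Sum>n<2*N. of_real (s^(n+2)) * (\<Sum>k\<le>n. bb.coeff k (n - k) * gauss_moment (\<lambda>_. 1) k (n - k)))"
      unfolding m_def using s by (intro sum.cong refl) (simp add: sum_distrib_left mult_ac)
    also have "\<dots> = (\<Sum>j<N. of_real (s^(2*j+2)) * (\<Sum>k\<le>2*j. bb.coeff k (2*j - k) * gauss_moment (\<lambda>_. 1) k (2*j - k)))"
    proof (rule sum_even_only)
      fix n :: nat assume "odd n"
      hence "gauss_moment (\<lambda>_. 1) k (n - k) = 0" if "k \<le> n" for k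
        using that by (intro gauss_moment_one_odd) auto
      thus "of_real (s^(n+2)) * (\<Sum>k\<le>n. bb.coeff k (n - k) * gauss_moment (\<lambda>_. 1) k (n - k)) = 0" by simp
    qed
    also have "\<dots> = (\<Sum>j<N. of_real (s^(2*j+2)) * (\<Sum>k\<le>j. bb.coeff (2*k) (2*(j-k))
        * of_real (Gamma (real k + 1/2) * Gamma (real (j-k) + 1/2))))"
    proof -
      have E: "(\<Sum>k\<le>2*j. bb.coeff k (2*j - k) * gauss_moment (\<lambda>_. 1) k (2*j - k))
          = (\<Sum>k\<le>j. bb.coeff (2*k) (2*(j-k)) * of_real (Gamma (real k + 1/2) * Gamma (real (j-k) + 1/2)))" for j
      proof -
      have "(\<Sum>k\<le>2*j. bb.coeff k (2*j - k) * gauss_moment (\<lambda>_. 1) k (2*j - k))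
          = (\<Sum>k\<le>j. bb.coeff (2*k) (2*j - 2*k) * gauss_moment (\<lambda>_. 1) (2*k) (2*j - 2*k))"
        by (rule sum_even_only_le) (simp add: gauss_moment_one_odd)
      also have "\<dots> = (\<Sum>k\<le>j. bb.coeff (2*k) (2*(j-k)) * of_real (Gamma (real k + 1/2) * Gamma (real (j-k) + 1/2)))"
        by (simp only: diff_mult_distrib2[symmetric] gauss_moment_one_even)
      finally show ?thesis .
      qed
      show ?thesis by (simp only: E)
    qed
    also have "\<dots> = (\<Sum>\<nu>=1..N. of_real (s^(2*\<nu>)) * (\<Sum>k\<le>\<nu>-1. bb.coeff (2*k) (2*(\<nu>-1-k))
        * of_real (Gamma (real k + 1/2) * Gamma (real (\<nu>-1-k) + 1/2))))"
      by (rule sum.reindex_bij_witness[of _ "\<lambda>\<nu>. \<nu> - 1" Suc]) auto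
    finally have S: "(\<Sum>n<m. \<Sum>k\<le>n. bb.coeff k (n - k) * gauss_moment (\<lambda>_. 1) k (n - k) * of_real (s^(n+2) / s^0))
      = (\<Sum>\<nu>=1..N. of_real (s^(2*\<nu>)) * (\<Sum>k\<le>\<nu>-1. bb.coeff (2*k) (2*(\<nu>-1-k)) * of_real
          (Gamma (real k + 1/2) * Gamma (real (\<nu>-1-k) + 1/2))))" .
    have "s^(m+2) / s^0 = s^(2*N+2)" by (simp add: m_def)
    with W show ?thesis unfolding S c_coef_eq by (simp only:)
  qed
  thus ?thesis using C by blast
qed

end

section \<open>Scaling and truncation of the extended Airy kernel\<close>

abbreviation "omega3 \<equiv> Complex (1/2) (sqrt 3/2)"

lemma exp_pi3: "exp (\<i> * of_real pi / 3) = omega3" "exp (- \<i> * of_real pi / 3) = cnj omega3"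
  "exp (2 * \<i> * of_real pi / 3) = - cnj omega3" "exp (- 2 * \<i> * of_real pi / 3) = - omega3"
  using cos_60 sin_60 cos_120 sin_120 by (simp_all add: complex_eq_iff Re_exp Im_exp)

lemma Ai_contour_simps:
  "sigma_Ai t = (if t < 0 then of_real (- t) * cnj omega3 else of_real t * omega3)"
  "sigma_Ai' t = (if t < 0 then - cnj omega3 else omega3)"
  "gamma_Ai t = (if t < 0 then of_real t * omega3 else - of_real t * cnj omega3)"
  "gamma_Ai' t = (if t < 0 then omega3 else - cnj omega3)"
  unfolding sigma_Ai_def sigma_Ai'_def gamma_Ai_def gamma_Ai'_def exp_pi3 by auto

lemma Re_fAi_contours:
  "Re (fAi (sigma_Ai t)) = \<bar>t\<bar> / 2 - \<bar>t\<bar>^3 / 3" "Re (fAi (gamma_Ai t)) = - (\<bar>t\<bar> / 2 - \<bar>t\<bar>^3 / 3)"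
  unfolding Re_fAi Ai_contour_simps by (auto simp: power2_eq_square power3_eq_cube field_simps)

lemma norm_contours: "norm (sigma_Ai t) = \<bar>t\<bar>" "norm (gamma_Ai t) = \<bar>t\<bar>"
    "norm (sigma_Ai' t) = 1" "norm (gamma_Ai' t) = 1"
proof -
  have "norm omega3 = 1" by (simp add: cmod_def power_divide)
  thus "norm (sigma_Ai t) = \<bar>t\<bar>" "norm (gamma_Ai t) = \<bar>t\<bar>" "norm (sigma_Ai' t) = 1" "norm (gamma_Ai' t) = 1"
    unfolding Ai_contour_simps by (simp_all add: norm_mult)
qed

lemma contour_distance: "sqrt (\<bar>t\<bar> * \<bar>s\<bar>) \<le> norm (sigma_Ai t - gamma_Ai s)"
proof -
  have "sqrt (\<bar>t\<bar> * \<bar>s\<bar>) \<le> (\<bar>t\<bar> + \<bar>s\<bar>) / 2" by (intro arith_geo_mean_sqrt) auto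
  also have "\<dots> = Re (sigma_Ai t - gamma_Ai s)" unfolding Ai_contour_simps by auto
  also have "\<dots> \<le> norm (sigma_Ai t - gamma_Ai s)" by (rule complex_Re_le_cmod)
  finally show ?thesis .
qed

text \<open>Quadratic majorants of the real part of f along the Airy rays. The first touches the
  cubic at r = 1, the second meets it at r = 2. Their constants add up to 5/12 - 2/3 = - 1/4, so one
  coordinate beyond 2 suffices for a negative total.\<close>

lemma cubic_bounds:
  fixes r :: real
  shows "0 \<le> r \<Longrightarrow> r / 2 - r^3 / 3 \<le> 5/12 - r^2 / 4" "2 \<le> r \<Longrightarrow> r / 2 - r^3 / 3 \<le> - 2/3 - r^2 / 4"
proof -
  assume "0 \<le> r"
  hence "0 \<le> (r - 1)^2 * (r / 3 + 5/12)" by simp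
  moreover have "(r - 1)^2 * (r / 3 + 5/12) = 5/12 - r^2 / 4 - (r / 2 - r^3 / 3)"
    by (simp add: power2_eq_square power3_eq_cube field_simps)
  ultimately show "r / 2 - r^3 / 3 \<le> 5/12 - r^2 / 4" by linarith
next
  assume "2 \<le> r"
  hence "0 \<le> (r - 2) * (r^2 / 3 + 5/12 * r + 1/3)" by (intro mult_nonneg_nonneg add_nonneg_nonneg) auto
  moreover have "(r - 2) * (r^2 / 3 + 5/12 * r + 1/3) = - 2/3 - r^2 / 4 - (r / 2 - r^3 / 3)"
    by (simp add: power2_eq_square power3_eq_cube field_simps)
  ultimately show "r / 2 - r^3 / 3 \<le> - 2/3 - r^2 / 4" by linarith
qed

lemma norm_airyF_le:
  assumes "\<bar>u\<bar> \<le> B" "\<bar>v\<bar> \<le> B" "\<bar>\<tau>1\<bar> \<le> B" "\<bar>\<tau>2\<bar> \<le> B"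
  shows "norm (airyF \<Lambda> \<tau>1 \<tau>2 u v z w)
      \<le> exp (\<Lambda> * (Re (fAi z) - Re (fAi w)) + B * (norm z + norm z^2 + norm w + norm w^2))"
proof -
  have B: "B \<ge> 0" using assms(1) by simp
  have t: "norm (of_real c * x) \<le> B * norm x" if "\<bar>c\<bar> \<le> B" for c :: real and x :: complex
    unfolding norm_mult norm_of_real using that by (intro mult_right_mono) auto
  have "Re (- of_real v * z - of_real \<tau>2 * z^2 + of_real u * w + of_real \<tau>1 * w^2) \<le>
    norm (of_real v * z) + norm (of_real \<tau>2 * z^2) + norm (of_real u * w) + norm (of_real \<tau>1 * w^2)"
    using abs_Re_le_cmod[of "of_real v * z"] abs_Re_le_cmod[of "of_real \<tau>2 * z^2"] abs_Re_le_cmod[of "of_real u * w"]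
      abs_Re_le_cmod[of "of_real \<tau>1 * w^2"] by (simp add: abs_le_iff)
  also have "\<dots> \<le> B * norm z + B * norm (z^2) + B * norm w + B * norm (w^2)"
    by (intro add_mono t assms)
  finally have "Re (- of_real v * z - of_real \<tau>2 * z^2 + of_real u * w + of_real \<tau>1 * w^2)
      \<le> B * (norm z + norm z^2 + norm w + norm w^2)"
    by (simp add: norm_power algebra_simps)
  hence "exp (\<Lambda> * (Re (fAi z) - Re (fAi w))) * exp (Re (- of_real v * z - of_real \<tau>2 * z^2 + of_real u * w
      + of_real \<tau>1 * w^2))
    \<le> exp (\<Lambda> * (Re (fAi z) - Re (fAi w))) * exp (B * (norm z + norm z^2 + norm w + norm w^2))"
    by (intro mult_left_mono) auto
  thus ?thesis unfolding airyF_def norm_mult norm_exp_eq_Re exp_add[of "\<Lambda> * (Re (fAi z) - Re (fAi w))"] by simp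
qed

definition plane_integrand :: "real \<Rightarrow> real \<Rightarrow> real \<Rightarrow> real \<Rightarrow> real \<Rightarrow> real \<times> real \<Rightarrow> complex" where
  "plane_integrand \<Lambda> \<tau>1 \<tau>2 u v p = airyF \<Lambda> \<tau>1 \<tau>2 u v (sigma_Ai (fst p)) (gamma_Ai (snd p)) / (sigma_Ai (fst p)
      - gamma_Ai (snd p))
     * sigma_Ai' (fst p) * gamma_Ai' (snd p)"

lemma contour_measurable [measurable]: "sigma_Ai \<in> borel_measurable borel" "sigma_Ai' \<in> borel_measurable borel"
   "gamma_Ai \<in> borel_measurable borel" "gamma_Ai' \<in> borel_measurable borel"
  unfolding Ai_contour_simps[abs_def] by measurable

lemma plane_integrand_measurable [measurable]: "plane_integrand \<Lambda> \<tau>1 \<tau>2 u v \<in> borel_measurable borel"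
  unfolding plane_integrand_def airyF_def fAi_def by measurable

text \<open>The threshold 8 B + 4 makes \<Lambda> / 4 \<ge> 2 B + 1: the quadratic decay then
  absorbs the growth 2 B (t^2 + s^2) of the factor independent of \<Lambda> and still leaves the
  Gaussian of \<open>sing_weight\<close>.\<close>

lemma plane_integrand_tail:
  assumes B: "\<bar>u\<bar> \<le> B" "\<bar>v\<bar> \<le> B" "\<bar>\<tau>1\<bar> \<le> B" "\<bar>\<tau>2\<bar> \<le> B" and \<Lambda>: "\<Lambda> \<ge> 8 * B + 4"
    and ts: "t \<noteq> 0" "s \<noteq> 0" "\<bar>t\<bar> > 2 \<or> \<bar>s\<bar> > 2"
  shows "norm (plane_integrand \<Lambda> \<tau>1 \<tau>2 u v (t, s)) \<le> exp (2 * B) * exp (- \<Lambda> / 4)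
      * (sing_weight 0 t * sing_weight 0 s)"
proof -
  have B0: "B \<ge> 0" using B(1) by simp
  define h where "h = (\<bar>t\<bar> / 2 - \<bar>t\<bar>^3 / 3) + (\<bar>s\<bar> / 2 - \<bar>s\<bar>^3 / 3)"
  have h: "h \<le> - 1/4 - (t^2 + s^2) / 4"
  proof -
    have "\<bar>t\<bar> / 2 - \<bar>t\<bar>^3 / 3 \<le> 5/12 - t^2 / 4" "\<bar>s\<bar> / 2 - \<bar>s\<bar>^3 / 3 \<le> 5/12 - s^2 / 4"
      using cubic_bounds(1)[of "\<bar>t\<bar>"] cubic_bounds(1)[of "\<bar>s\<bar>"] by simp_all
    moreover have "\<bar>t\<bar> > 2 \<Longrightarrow> \<bar>t\<bar> / 2 - \<bar>t\<bar>^3 / 3 \<le> - 2/3 - t^2 / 4" "\<bar>s\<bar> > 2 \<Longrightarrow> \<bar>s\<bar> / 2 - \<bar>s\<bar>^3 / 3 \<le> - 2/3 - s^2 / 4"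
      using cubic_bounds(2)[of "\<bar>t\<bar>"] cubic_bounds(2)[of "\<bar>s\<bar>"] by simp_all
    ultimately show ?thesis using ts(3) unfolding h_def by argo
  qed
  have le1: "\<bar>x\<bar> \<le> 1 + x^2" for x :: real
    using zero_le_power2[of "\<bar>x\<bar> - 1/2"] by (simp add: power2_eq_square algebra_simps abs_mult_self_eq)
  have "\<Lambda> * h + B * (\<bar>t\<bar> + \<bar>t\<bar>^2 + \<bar>s\<bar> + \<bar>s\<bar>^2) \<le> 2 * B + (- \<Lambda> / 4) + (- (t^2)) + (- (s^2))"
  proof -
    have "\<Lambda> * h \<le> \<Lambda> * (- 1/4 - (t^2 + s^2) / 4)" using h \<Lambda> B0 by (intro mult_left_mono) auto
    also have "\<dots> = - \<Lambda> / 4 - \<Lambda> / 4 * (t^2 + s^2)" by (simp add: algebra_simps)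
    also have "\<dots> \<le> - \<Lambda> / 4 - (2 * B + 1) * (t^2 + s^2)" using \<Lambda> by (intro diff_left_mono mult_right_mono) auto
    finally have 1: "\<Lambda> * h \<le> - \<Lambda> / 4 - (2 * B + 1) * (t^2 + s^2)" .
    have "B * (\<bar>t\<bar> + \<bar>t\<bar>^2 + \<bar>s\<bar> + \<bar>s\<bar>^2) \<le> B * (2 + 2 * (t^2 + s^2))"
      using le1[of t] le1[of s] B0 by (intro mult_left_mono) auto
    with 1 show ?thesis by (simp add: algebra_simps)
  qed
  hence e: "exp (\<Lambda> * h + B * (\<bar>t\<bar> + \<bar>t\<bar>^2 + \<bar>s\<bar> + \<bar>s\<bar>^2)) \<le> exp (2 * B) * exp (- \<Lambda> / 4) * exp (- (t^2))
      * exp (- (s^2))"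
    by (simp only: exp_add[symmetric] exp_le_cancel_iff)
  have "norm (airyF \<Lambda> \<tau>1 \<tau>2 u v (sigma_Ai t) (gamma_Ai s)) \<le> exp (\<Lambda> * h + B * (\<bar>t\<bar> + \<bar>t\<bar>^2 + \<bar>s\<bar> + \<bar>s\<bar>^2))"
    using norm_airyF_le[OF B, of \<Lambda> "sigma_Ai t" "gamma_Ai s"] unfolding norm_contours Re_fAi_contours h_def
    by (simp only: diff_minus_eq_add)
  also note e
  finally have n: "norm (airyF \<Lambda> \<tau>1 \<tau>2 u v (sigma_Ai t) (gamma_Ai s)) \<le> exp (2 * B) * exp (- \<Lambda> / 4)
      * exp (- (t^2)) * exp (- (s^2))" .
  have "norm (plane_integrand \<Lambda> \<tau>1 \<tau>2 u v (t, s))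
      = norm (airyF \<Lambda> \<tau>1 \<tau>2 u v (sigma_Ai t) (gamma_Ai s)) / norm (sigma_Ai t - gamma_Ai s)"
    by (simp add: plane_integrand_def norm_mult norm_divide norm_contours)
  also have "\<dots> \<le> exp (2 * B) * exp (- \<Lambda> / 4) * exp (- (t^2)) * exp (- (s^2)) / sqrt (\<bar>t\<bar> * \<bar>s\<bar>)"
    using ts by (intro frac_le n contour_distance) auto
  also have "\<dots> = exp (2 * B) * exp (- \<Lambda> / 4) * (sing_weight 0 t * sing_weight 0 s)"
    by (simp add: sing_weight_def real_sqrt_mult)
  finally show ?thesis .
qed

text \<open>After the substitution \<zeta> = q z the shift by - q^2 in u and v contributes the terms
  q^3 z and - q^3 w, which complete the cubes to q^3 * (fAi z - fAi w).\<close>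

lemma airy_integrand_scale:
  assumes q: "q > 0"
  shows "airy_integrand (\<tau>1 / q^2) (\<tau>2 / q^2) (u / q - q^2) (v / q - q^2) (of_real q * z) (of_real q * w)
     = airyF (q^3) \<tau>1 \<tau>2 u v z w / (z - w) / of_real q"
proof -
  have E: "(of_real q * z)^3 / 3 - of_real q * z * of_real (v / q - q^2) - of_real (\<tau>2 / q^2) * (of_real q * z)^2
      - (of_real q * w)^3 / 3 + of_real q * w * of_real (u / q - q^2) + of_real (\<tau>1 / q^2) * (of_real q * w)^2
     = of_real (q^3) * (fAi z - fAi w) + (- of_real v * z - of_real \<tau>2 * z^2 + of_real u * w + of_real \<tau>1 * w^2)"
    using q by (simp add: fAi_def field_simps power2_eq_square power3_eq_cube)
  have D: "of_real q * z - of_real q * w = (z - w) * of_real q" by (simp add: algebra_simps)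
  show ?thesis unfolding airy_integrand_def airyF_def E D exp_add[of "of_real (q^3) * (fAi z - fAi w)"]
      divide_divide_eq_left ..
qed

lemma contour_scale:
  assumes "q > 0"
  shows "sigma_Ai (q * t) = of_real q * sigma_Ai t" "gamma_Ai (q * t) = of_real q * gamma_Ai t"
   "sigma_Ai' (q * t) = sigma_Ai' t" "gamma_Ai' (q * t) = gamma_Ai' t"
  unfolding Ai_contour_simps using assms by (auto simp: mult_less_0_iff)

lemma heat_term_scale:
  assumes q: "q > 0"
  shows "heat_term (\<tau>1 / q^2) (\<tau>2 / q^2) (u / q - q^2) (v / q - q^2) = q * heat_term \<tau>1 \<tau>2 u v"
proof (cases "\<tau>1 > \<tau>2")
  case True
  have d: "\<tau>1 / q^2 - \<tau>2 / q^2 = (\<tau>1 - \<tau>2) / q^2" by (simp add: diff_divide_distrib)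
  have s: "sqrt (4 * pi * ((\<tau>1 - \<tau>2) / q^2)) = sqrt (4 * pi * (\<tau>1 - \<tau>2)) / q"
    using q by (simp add: real_sqrt_divide)
  have e: "((u / q - q^2) - (v / q - q^2))^2 = (u - v)^2 / q^2" by (simp add: power_divide flip: diff_divide_distrib)
  have lt: "\<tau>1 / q^2 > \<tau>2 / q^2" using True q by (simp add: divide_strict_right_mono)
  show ?thesis unfolding heat_term_def d s e using True lt q by simp
next
  case False
  hence "\<not> \<tau>1 / q^2 > \<tau>2 / q^2" using q by (simp add: divide_right_mono not_less)
  thus ?thesis using False by (simp add: heat_term_def)
qed

text \<open>With q = sqrt a, the Jacobian q^2, the factor 1 / q from the denominator and the
  prefactor 1 / q cancel.\<close>

lemma K_Ai_scaled_eq: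
  assumes a: "a > 0"
  shows "K_Ai_scaled a \<tau>1 \<tau>2 u v = 1 / (2 * of_real pi * \<i>)^2
      * (LINT p|lborel. plane_integrand (sqrt a^3) \<tau>1 \<tau>2 u v p) - of_real (heat_term \<tau>1 \<tau>2 u v)"
proof -
  define q where "q = sqrt a"
  have q: "q > 0" "a = q^2" using a by (simp_all add: q_def)
  define f where "f p = airy_integrand (\<tau>1 / q^2) (\<tau>2 / q^2) (u / q - q^2) (v / q
      - q^2) (sigma_Ai (fst p)) (gamma_Ai (snd p)) * sigma_Ai' (fst p) * gamma_Ai' (snd p)" for p
  have [measurable]: "f \<in> borel_measurable borel" unfolding f_def airy_integrand_def by measurable
  have "(LINT p|lborel. f p) = of_real (q^2) * (LINT p|lborel. f (q *\<^sub>R p))"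
    by (rule lborel_integral_scale) (use q in auto)
  also have "\<dots> = of_real (q^2) * (LINT p|lborel. plane_integrand (q^3) \<tau>1 \<tau>2 u v p / of_real q)"
    unfolding f_def plane_integrand_def by (simp add: contour_scale[OF q(1)] airy_integrand_scale[OF q(1)])
  also have "\<dots> = of_real q * (LINT p|lborel. plane_integrand (q^3) \<tau>1 \<tau>2 u v p)"
    using q by (simp add: power2_eq_square)
  finally have I: "(LINT p|lborel. f p) = of_real q * (LINT p|lborel. plane_integrand (q^3) \<tau>1 \<tau>2 u v p)" .
  have "K_Ai_scaled a \<tau>1 \<tau>2 u v = of_real (1 / q) * (1 / (2 * of_real pi * \<i>)^2 * (LINT p|lborel. f p)
      - of_real (q * heat_term \<tau>1 \<tau>2 u v))"
  proof -
    have "sqrt (q^2) = q" using q by simp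
    thus ?thesis unfolding q(2) K_Ai_scaled_def K_Ai_def heat_term_scale[OF q(1), symmetric] f_def by (simp only:)
  qed
  thus ?thesis unfolding I q_def[symmetric] using q(1) by (simp add: right_diff_distrib)
qed

section \<open>Cutting the Airy contours at modulus 2\<close>

context gS_disc
begin

lemma dint_truncated_rays:
  "(\<Sum>e1\<leftarrow>cnj_sym sc.Sig0. \<Sum>e2\<leftarrow>cnj_sym sc.Gam0. dint e1 e2 (airy_kern \<Lambda> \<tau>1 \<tau>2 u v)) =
    (LINT p|lborel. indicator ({-2..2} \<times> {-2..2}) p *\<^sub>R plane_integrand \<Lambda> \<tau>1 \<tau>2 u v p)" (is ?A)
  "integrable lborel (\<lambda>p. indicator ({-2..2} \<times> {-2..2}) p *\<^sub>R plane_integrand \<Lambda> \<tau>1 \<tau>2 u v p)" (is ?B)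
proof -
  define k where "k = airy_kern \<Lambda> \<tau>1 \<tau>2 u v"
  define H where "H = plane_integrand \<Lambda> \<tau>1 \<tau>2 u v"
  have i: "integrable lborel (epair e1 e2 k)" if "e1 \<in> set (cnj_sym sc.Sig0)" "e2 \<in> set (cnj_sym sc.Gam0)" for e1 e2
    using contour_setup.integrable_pairs(1)[OF contour_setup_airy] that unfolding k_def
        by (auto simp: integrable_pair_def)
  have mem: "ray \<in> set (cnj_sym sc.Sig0)" "rev_cnj ray \<in> set (cnj_sym sc.Sig0)"
      "neg_cnj ray \<in> set (cnj_sym sc.Gam0)" "rev_cnj (neg_cnj ray) \<in> set (cnj_sym sc.Gam0)"
    by (auto simp: cnj_sym_def sc.Sig0_def sc.Gam0_def)
  have [measurable]: "{-2..2} \<times> {-2..2} \<in> sets (borel :: (real \<times> real) measure)"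
      by (intro borel_closed closed_Times closed_atLeastAtMost)
  have m: "(\<lambda>p. indicator ({-2..2} \<times> {-2..2}) p *\<^sub>R H p) \<in> borel_measurable borel" unfolding H_def by measurable
  have eq: "epair (rev_cnj ray) (rev_cnj (neg_cnj ray)) k (t, s) + epair (rev_cnj ray) (neg_cnj ray) k (t, s)
      + epair ray (rev_cnj (neg_cnj ray)) k (t, s) + epair ray (neg_cnj ray) k (t, s)
     = indicator ({-2..2} \<times> {-2..2}) (t, s) *\<^sub>R H (t, s)" if ts: "t \<noteq> 0" "s \<noteq> 0" for t s
  proof -
    have P: "H (t, s) = k (sigma_Ai t) (gamma_Ai s) * sigma_Ai' t * gamma_Ai' s"
      by (simp add: H_def k_def airy_kern_eq plane_integrand_def)
    have C: "sigma_Ai t = (if t < 0 then ev (rev_cnj ray) t else ev ray t)"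
        "sigma_Ai' t = (if t < 0 then ed (rev_cnj ray) t else ed ray t)"
       "gamma_Ai s = (if s < 0 then ev (rev_cnj (neg_cnj ray)) s else ev (neg_cnj ray) s)"
           "gamma_Ai' s = (if s < 0 then ed (rev_cnj (neg_cnj ray)) s else ed (neg_cnj ray) s)"
      unfolding Ai_contour_simps by auto
    show ?thesis
      using ts unfolding P C by (cases "t < 0"; cases
          "s < 0") (simp_all add: epair_def indicator_times, simp_all add: indicator_def)
  qed
  have S: "(\<Sum>e1\<leftarrow>cnj_sym sc.Sig0. \<Sum>e2\<leftarrow>cnj_sym sc.Gam0. dint e1 e2 k)
      = dint (rev_cnj ray) (rev_cnj (neg_cnj ray)) k + dint (rev_cnj ray) (neg_cnj ray) k + dint ray
      (rev_cnj (neg_cnj ray)) k + dint ray (neg_cnj ray) k"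
    by (simp add: cnj_sym_def sc.Sig0_def sc.Gam0_def)
  note four = sum_of_four_integrals[OF i[OF mem(2,4)] i[OF mem(2,3)] i[OF mem(1,4)] i[OF mem(1,3)] _ m]
  have "dint (rev_cnj ray) (rev_cnj (neg_cnj ray)) k + dint (rev_cnj ray) (neg_cnj ray) k
      + dint ray (rev_cnj (neg_cnj ray)) k + dint ray (neg_cnj ray) k
    = (LINT p|lborel. indicator ({-2..2} \<times> {-2..2}) p *\<^sub>R H p)"
    unfolding dint_def by (rule four(1)) (rule eq)
  with S show ?A unfolding k_def H_def by (simp only:)
  have "integrable lborel (\<lambda>p. indicator ({-2..2} \<times> {-2..2}) p *\<^sub>R H p)" by (rule four(2)) (rule eq)
  thus ?B unfolding H_def .
qed

lemma truncation:
  assumes B: "\<bar>u\<bar> \<le> B" "\<bar>v\<bar> \<le> B" "\<bar>\<tau>1\<bar> \<le> B" "\<bar>\<tau>2\<bar> \<le> B" and \<Lambda>: "\<Lambda> \<ge> 8 * B + 4"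
  shows "norm ((LINT p|lborel. plane_integrand \<Lambda> \<tau>1 \<tau>2 u v p)
      - (\<Sum>e1\<leftarrow>cnj_sym sc.Sig0. \<Sum>e2\<leftarrow>cnj_sym sc.Gam0. dint e1 e2 (airy_kern \<Lambda> \<tau>1 \<tau>2 u v)))
     \<le> exp (2 * B) * (LINT p|(lborel :: (real \<times> real) measure). sing_weight 0 (fst p) * sing_weight 0 (snd p)) *
         exp (- \<Lambda> / 4)"
proof -
  define H where "H = plane_integrand \<Lambda> \<tau>1 \<tau>2 u v"
  define I where "I p = indicator ({-2..2} \<times> {-2..2}) p *\<^sub>R H p" for p
  have [measurable]: "{-2..2} \<times> {-2..2} \<in> sets (borel :: (real \<times> real) measure)"
      by (intro borel_closed closed_Times closed_atLeastAtMost)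
  have Im: "I \<in> borel_measurable borel" "H \<in> borel_measurable borel" unfolding I_def H_def by measurable
  have iI: "integrable lborel I" using dint_truncated_rays(2) unfolding I_def H_def .
  have sw: "integrable (lborel :: (real \<times> real) measure) (\<lambda>p. sing_weight 0 (fst p) * sing_weight 0 (snd p))"
    by (rule integrable_prod_lborel[OF integrable_sing_weight integrable_sing_weight])
  define W where "W p = exp (2 * B) * exp (- \<Lambda> / 4) * (sing_weight 0 (fst p) * sing_weight 0 (snd p))"
      for p :: "real \<times> real"
  have iW: "integrable lborel W" unfolding W_def by (intro integrable_mult_right sw)
  have W0: "W p \<ge> 0" for p unfolding W_def by (intro mult_nonneg_nonneg sing_weight_nonneg) auto
  have ae: "AE p in lborel. norm (H p - I p) \<le> W p"
    using AE_fst_neq[of 0] AE_snd_neq[of 0]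
  proof eventually_elim
    case (elim p)
    show ?case
    proof (cases "p \<in> {-2..2} \<times> {-2..2}")
      case True thus ?thesis using W0 by (simp add: I_def)
    next
      case False
      hence "\<bar>fst p\<bar> > 2 \<or> \<bar>snd p\<bar> > 2" by (cases p) auto
      from plane_integrand_tail[OF B \<Lambda> elim this] False show ?thesis by (simp add: I_def H_def W_def)
    qed
  qed
  have iD: "integrable lborel (\<lambda>p. H p - I p)"
    by (rule Bochner_Integration.integrable_bound[OF iW]) (use ae W0 Im in auto)
  have "(LINT p|lborel. H p) = (LINT p|lborel. (H p - I p) + I p)" by simp
  also have "\<dots> = (LINT p|lborel. H p - I p) + (LINT p|lborel. I p)"
    by (rule Bochner_Integration.integral_add[OF iD iI])
  finally have "norm ((LINT p|lborel. H p) - (LINT p|lborel. I p)) = norm (LINT p|lborel. H p - I p)" by simp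
  also have "\<dots> \<le> (LINT p|lborel. W p)"
    by (rule order_trans[OF integral_norm_bound integral_mono_AE[OF integrable_norm[OF iD] iW ae]])
  also have "\<dots> = exp (2 * B) * (LINT p|(lborel :: (real \<times> real) measure). sing_weight 0 (fst p)
      * sing_weight 0 (snd p)) * exp (- \<Lambda> / 4)"
    unfolding W_def by simp
  finally show ?thesis unfolding dint_truncated_rays(1) I_def H_def .
qed

end

section \<open>The asymptotic expansion\<close>

lemma even_function_deriv_zero:
  fixes f :: "complex \<Rightarrow> complex"
  assumes "(f has_field_derivative D) (at 0)" "\<And>x. f (- x) = f x"
  shows "D = 0"
proof -
  have "((\<lambda>x. f (- x)) has_field_derivative D * (-1)) (at 0)"
    by (rule DERIV_chain2[where f=f and g=uminus]) (use assms(1) in \<open>auto intro!: derivative_eq_intros\<close>)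
  hence "(f has_field_derivative - D) (at 0)" unfolding assms(2) by simp
  from DERIV_unique[OF this assms(1)] show ?thesis by (simp add: equation_minus_iff)
qed

text \<open>Turns a remainder estimate such as \<open>taylor_remainder\<close> along a complex line
  into a derivative, from which first-order coefficients are read off.\<close>

lemma has_field_derivative_quadratic_error:
  fixes f :: "complex \<Rightarrow> complex"
  assumes "r > 0" "\<And>x. norm x < r \<Longrightarrow> norm (f x - f 0 - D * x) \<le> C * norm x^2"
  shows "(f has_field_derivative D) (at 0)"
proof -
  have "((\<lambda>x. (f x - f 0) / x - D) \<longlongrightarrow> 0) (at 0)"
  proof (rule Lim_null_comparison)
    have "\<forall>\<^sub>F x in at 0. norm x < r \<and> x \<noteq> (0::complex)"
      unfolding eventually_at using assms(1) by (intro exI[of _ r]) auto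
    thus "\<forall>\<^sub>F x in at 0. norm ((f x - f 0) / x - D) \<le> C * norm x"
    proof eventually_elim
      case (elim x)
      have "(f x - f 0) / x - D = (f x - f 0 - D * x) / x" using elim by (simp add: field_simps)
      hence "norm ((f x - f 0) / x - D) = norm (f x - f 0 - D * x) / norm x" by (simp add: norm_divide)
      also have "\<dots> \<le> C * norm x^2 / norm x" using assms(2) elim by (intro divide_right_mono) auto
      also have "\<dots> = C * norm x" using elim by (simp add: power2_eq_square)
      finally show ?case .
    qed
    show "((\<lambda>x. C * norm x) \<longlongrightarrow> 0) (at (0::complex))"
      by (intro tendsto_mult_right_zero tendsto_norm_zero tendsto_ident_at)
  qed
  thus ?thesis unfolding has_field_derivative_iff by (simp add: LIM_zero_cancel)
qed

lemma deriv_gS_0: "deriv gS 0 = e8"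
  using gS_is_g by (auto simp: is_g_def)

context gS_disc
begin

text \<open>Restricting z to the upper half of its contour and doubling the real part is the source
  of the factor 2 and of the real parts in the expansion.\<close>

lemma saddle_sum:
  "cint (cnj_sym sc.Gam2) (\<lambda>w. cint (cnj_sym sc.Sig2) (\<lambda>z. airy_kern \<Lambda> \<tau>1 \<tau>2 u v z w))
   = of_real (2 * Re (\<Sum>e1\<leftarrow>sc.Sig2. \<Sum>e2\<leftarrow>cnj_sym sc.Gam2. dint e1 e2 (airy_kern \<Lambda> \<tau>1 \<tau>2 u v)))"
proof -
  note ip = contour_setup.integrable_pairs(4)[OF contour_setup_airy, of \<Lambda> \<tau>1 \<tau>2 u v]
  have ip': "integrable_pair sc.Sig2 (cnj_sym sc.Gam2) (airy_kern \<Lambda> \<tau>1 \<tau>2 u v)"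
    using ip unfolding integrable_pair_def cnj_sym_def by auto
  have "cint (cnj_sym sc.Gam2) (\<lambda>w. cint (cnj_sym sc.Sig2) (\<lambda>z. airy_kern \<Lambda> \<tau>1 \<tau>2 u v z w))
      = cint (cnj_sym sc.Sig2) (\<lambda>z. cint (cnj_sym sc.Gam2) (airy_kern \<Lambda> \<tau>1 \<tau>2 u v z))"
    by (rule cint_swap[OF ip])
  also have "\<dots> = of_real (2 * Re (cint sc.Sig2 (\<lambda>z. cint (cnj_sym sc.Gam2) (airy_kern \<Lambda> \<tau>1 \<tau>2 u v z))))"
    by (rule cint_sym_odd) (rule kernel_data.inner_odd1[OF kernel_data_airyF])
  also have "cint sc.Sig2 (\<lambda>z. cint (cnj_sym sc.Gam2) (airy_kern \<Lambda> \<tau>1 \<tau>2 u v z))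
      = (\<Sum>e1\<leftarrow>sc.Sig2. \<Sum>e2\<leftarrow>cnj_sym sc.Gam2. dint e1 e2 (airy_kern \<Lambda> \<tau>1 \<tau>2 u v))"
    by (rule iterated_cint(2)[OF ip'])
  finally show ?thesis .
qed

lemma ray_sum:
  "(\<Sum>e1\<leftarrow>cnj_sym sc.Sig0. \<Sum>e2\<leftarrow>cnj_sym sc.Gam0. dint e1 e2 (airy_kern \<Lambda> \<tau>1 \<tau>2 u v)) =
    of_real (2 * Re (\<Sum>e1\<leftarrow>sc.Sig2. \<Sum>e2\<leftarrow>cnj_sym sc.Gam2. dint e1 e2 (airy_kern \<Lambda> \<tau>1 \<tau>2 u v))) +
    2 * of_real pi * \<i> * contour_integral (linepath (- \<i>) \<i>)
        (\<lambda>\<omega>. exp (of_real (\<tau>1 - \<tau>2) * \<omega>^2 + of_real (u - v) * \<omega>))"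
proof -
  note ip = contour_setup.integrable_pairs(1)[OF contour_setup_airy, of \<Lambda> \<tau>1 \<tau>2 u v]
  \<comment> \<open>On the diagonal the large exponent cancels, so the residue term does not depend
    on \<Lambda>.\<close>
  have "airyF \<Lambda> \<tau>1 \<tau>2 u v z z = exp (of_real (\<tau>1 - \<tau>2) * z^2 + of_real (u - v) * z)" for z
    by (simp add: airyF_def algebra_simps)
  with contour_setup.contour_deformation[OF contour_setup_airy, of \<Lambda> \<tau>1 \<tau>2 u v]
    contour_setup.segment_chain[OF contour_setup_airy, of \<Lambda> \<tau>1 \<tau>2 u v]
  show ?thesis unfolding saddle_sum iterated_cint(2)[OF ip, symmetric] cint_swap[OF ip, symmetric] by simp
qed

text \<open>The variable s stands for a powr (- 3/4), so that \<Lambda> = 1 / s^2 and s^(2 \<nu>) is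
  the scale of the term with index \<nu>. "Upper" means w near \<i>, "lower" w near - \<i>.\<close>

definition upper_terms :: "nat \<Rightarrow> real \<Rightarrow> real \<Rightarrow> real \<Rightarrow> real \<Rightarrow> real \<Rightarrow> real" where
  "upper_terms N s \<tau>1 \<tau>2 u v
      = (\<Sum>\<nu>=1..N. s^(2*\<nu>) * (\<Sum>k\<le>2*\<nu>-1. Re (b_coef \<tau>1 \<tau>2 u v k (2*\<nu>-1-k) * B_coef k (2*\<nu>-1-k))))"

definition lower_terms :: "nat \<Rightarrow> real \<Rightarrow> real \<Rightarrow> real \<Rightarrow> real \<Rightarrow> real \<Rightarrow> real" where
  "lower_terms N s \<tau>1 \<tau>2 u v
      = (\<Sum>\<nu>=1..N. s^(2*\<nu>) * (\<Sum>k\<le>\<nu>-1. Re (c_coef \<tau>1 \<tau>2 u v (2*k) (2*(\<nu>-1-k)) * exp (\<i> * of_real (4/3 * (1/s^2))))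
      * Gamma (real k + 1/2) * Gamma (real (\<nu>-1-k) + 1/2)))"

text \<open>Four errors are collected: the cut tails, the pairs containing a chord, and two Watson
  remainders. The first two are exponentially small and are converted to s^(2 N + 2) by
  \<open>exp_decay_power\<close>. \<open>L\<close> is the threshold 8 B + 4 of the
  truncation.\<close>

lemma expansion:
  assumes B: "B \<ge> 0"
  shows "\<exists>M L. \<forall>s>0. 1 / s^2 \<ge> L \<longrightarrow> (\<forall>u v \<tau>1 \<tau>2. \<bar>u\<bar> \<le> B \<longrightarrow> \<bar>v\<bar> \<le> B \<longrightarrow> \<bar>\<tau>1\<bar> \<le> B \<longrightarrow> \<bar>\<tau>2\<bar> \<le> B \<longrightarrow>
    norm ((LINT p|lborel. plane_integrand (1/s^2) \<tau>1 \<tau>2 u v p)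
      - 2 * of_real pi * \<i> * contour_integral (linepath (- \<i>) \<i>)
          (\<lambda>\<omega>. exp (of_real (\<tau>1 - \<tau>2) * \<omega>^2 + of_real (u - v) * \<omega>))
      - of_real (2 * upper_terms N s \<tau>1 \<tau>2 u v) - of_real (2 * lower_terms N s \<tau>1 \<tau>2 u v)) \<le> M * s^(2*N+2))"
proof -
  obtain C1 where C1: "C1 \<ge> 0" "\<And>s u v \<tau>1 \<tau>2. s > 0 \<Longrightarrow> \<bar>u\<bar> \<le> B \<Longrightarrow> \<bar>v\<bar> \<le> B \<Longrightarrow> \<bar>\<tau>1\<bar> \<le> B \<Longrightarrow> \<bar>\<tau>2\<bar> \<le> B \<Longrightarrow>
    norm ((LINT p|lborel. of_real (exp (- (((fst p)^2 + (snd p)^2) / s^2))) * psi_upper \<tau>1 \<tau>2 u v p * cauchy_kernel p)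
      - (\<Sum>\<nu>=1..N. of_real (s^(2*\<nu>)) * (\<Sum>k\<le>2*\<nu>-1. b_coef \<tau>1 \<tau>2 u v k (2*\<nu>-1-k) * B_coef k (2*\<nu>-1-k)))) \<le> C1 *
          s^(2*N+2)"
    using upper_expansion[of B N] by blast
  obtain C2 where C2: "C2 \<ge> 0" "\<And>s u v \<tau>1 \<tau>2. s > 0 \<Longrightarrow> \<bar>u\<bar> \<le> B \<Longrightarrow> \<bar>v\<bar> \<le> B \<Longrightarrow> \<bar>\<tau>1\<bar> \<le> B \<Longrightarrow> \<bar>\<tau>2\<bar> \<le> B \<Longrightarrow>
    norm ((LINT p|lborel. of_real (exp (- (((fst p)^2 + (snd p)^2) / s^2))) * psi_lower \<tau>1 \<tau>2 u v p * 1)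
      - (\<Sum>\<nu>=1..N. of_real (s^(2*\<nu>)) * (\<Sum>k\<le>\<nu>-1. c_coef \<tau>1 \<tau>2 u v (2*k) (2*(\<nu>-1-k)) *
           of_real (Gamma (real k + 1/2) * Gamma (real (\<nu>-1-k) + 1/2))))) \<le> C2 * s^(2*N+2)"
    using lower_expansion[of B N] by blast
  obtain c K where c: "c > 0" "K \<ge> 0" and E: "\<And>\<Lambda> u v \<tau>1 \<tau>2. \<Lambda> \<ge> 0 \<Longrightarrow> \<bar>u\<bar> \<le> B \<Longrightarrow> \<bar>v\<bar> \<le> B \<Longrightarrow> \<bar>\<tau>1\<bar> \<le> B \<Longrightarrow> \<bar>\<tau>2\<bar> \<le> B \<Longrightarrow>
     norm ((\<Sum>e1\<leftarrow>[Lm, Lp]. \<Sum>e2\<leftarrow>cnj_sym sc.Gam2. dint e1 e2 (airy_kern \<Lambda> \<tau>1 \<tau>2 u v)) +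
      (\<Sum>e1\<leftarrow>[sc.Cm, sc.Cp]. \<Sum>e2\<leftarrow>[neg_cnj Lm, neg_cnj Lp, rev_cnj (neg_cnj Lm), rev_cnj (neg_cnj Lp)]. dint e1 e2
          (airy_kern \<Lambda> \<tau>1 \<tau>2 u v))) \<le> K * exp (- c * \<Lambda>)"
    using error_bound[of B] by blast
  obtain D1 where D1: "D1 \<ge> 0" "\<And>s. s > 0 \<Longrightarrow> exp (- c / s^2) \<le> D1 * s^(2*(N+1))"
    using exp_decay_power[OF c(1), of "N+1"] by blast
  obtain D2 :: real where D2: "D2 \<ge> 0" "\<And>s. s > 0 \<Longrightarrow> exp (- (1/4) / s^2) \<le> D2 * s^(2*(N+1))"
    using exp_decay_power[of "1/4" "N+1"] by auto
  define W where "W = exp (2 * B) * (LINT p|(lborel :: (real \<times> real) measure). sing_weight 0 (fst p)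
      * sing_weight 0 (snd p))"
  have W: "W \<ge> 0" unfolding W_def
      by (intro mult_nonneg_nonneg Bochner_Integration.integral_nonneg sing_weight_nonneg) auto
  have "norm ((LINT p|lborel. plane_integrand (1/s^2) \<tau>1 \<tau>2 u v p)
      - 2 * of_real pi * \<i> * contour_integral (linepath (- \<i>) \<i>)
          (\<lambda>\<omega>. exp (of_real (\<tau>1 - \<tau>2) * \<omega>^2 + of_real (u - v) * \<omega>))
      - of_real (2 * upper_terms N s \<tau>1 \<tau>2 u v) - of_real (2 * lower_terms N s \<tau>1 \<tau>2 u v)) \<le>
          (W * D2 + 2 * (C1 + C2 + K * D1)) * s^(2*N+2)"
    if s: "s > 0" and L: "1 / s^2 \<ge> 8 * B + 4" and par: "\<bar>u\<bar> \<le> B" "\<bar>v\<bar> \<le> B" "\<bar>\<tau>1\<bar> \<le> B" "\<bar>\<tau>2\<bar> \<le> B" for s u v \<tau>1 \<tau>2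
  proof -
    define k where "k = airy_kern (1/s^2) \<tau>1 \<tau>2 u v"
    define T where "T = (\<Sum>e1\<leftarrow>sc.Sig2. \<Sum>e2\<leftarrow>cnj_sym sc.Gam2. dint e1 e2 k)"
    define J1 where "J1 = (LINT p|lborel. of_real (exp (- (((fst p)^2 + (snd p)^2) / s^2)))
        * psi_upper \<tau>1 \<tau>2 u v p * cauchy_kernel p)"
    define J2 where "J2 = (LINT p|lborel. of_real (exp (- (((fst p)^2 + (snd p)^2) / s^2)))
        * psi_lower \<tau>1 \<tau>2 u v p * 1)"
    define S1 where "S1 = (\<Sum>\<nu>=1..N. of_real (s^(2*\<nu>)) * (\<Sum>k\<le>2*\<nu>-1. b_coef \<tau>1 \<tau>2 u v k (2*\<nu>-1-k)
        * B_coef k (2*\<nu>-1-k)))"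
    define S2 where "S2 = (\<Sum>\<nu>=1..N. of_real (s^(2*\<nu>)) * (\<Sum>k\<le>\<nu>-1. c_coef \<tau>1 \<tau>2 u v (2*k) (2*(\<nu>-1-k)) *
           of_real (Gamma (real k + 1/2) * Gamma (real (\<nu>-1-k) + 1/2))))"
    define er where "er = (\<Sum>e1\<leftarrow>[Lm, Lp]. \<Sum>e2\<leftarrow>cnj_sym sc.Gam2. dint e1 e2 k) +
      (\<Sum>e1\<leftarrow>[sc.Cm, sc.Cp]. \<Sum>e2\<leftarrow>[neg_cnj Lm, neg_cnj Lp, rev_cnj (neg_cnj Lm), rev_cnj (neg_cnj Lp)]. dint e1 e2 k)"
    define \<theta> where "\<theta> = exp (\<i> * of_real (4/3 * (1/s^2)))"
    have \<theta>: "norm \<theta> = 1" by (simp add: \<theta>_def norm_exp_eq_Re)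
    have T: "T = J1 + \<theta> * J2 + er"
      unfolding T_def sum_split_pairs k_def upper_saddle_integral[OF s] lower_saddle_integral[OF s] er_def
          J1_def J2_def \<theta>_def ..
    have m1: "upper_terms N s \<tau>1 \<tau>2 u v = Re S1"
      unfolding upper_terms_def S1_def by simp
    have m2: "lower_terms N s \<tau>1 \<tau>2 u v = Re (\<theta> * S2)"
    proof -
      have "\<theta> * S2 = (\<Sum>\<nu>=1..N. of_real (s^(2*\<nu>)) * (\<Sum>k\<le>\<nu>-1. (c_coef \<tau>1 \<tau>2 u v (2*k) (2*(\<nu>-1-k)) * \<theta>) *
           of_real (Gamma (real k + 1/2) * Gamma (real (\<nu>-1-k) + 1/2))))"
        unfolding S2_def sum_distrib_left by (intro sum.cong refl) (simp add: mult_ac)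
      thus ?thesis unfolding lower_terms_def \<theta>_def[symmetric]
          by (simp add: mult.assoc left_diff_distrib flip: of_real_mult)
    qed
    have n1: "norm (J1 - S1) \<le> C1 * s^(2*N+2)" unfolding J1_def S1_def by (rule C1(2)[OF s par])
    have n2: "norm (\<theta> * (J2 - S2)) \<le> C2 * s^(2*N+2)" unfolding norm_mult \<theta> J2_def S2_def using C2(2)[OF s par] by simp
    have n3: "norm er \<le> (K * D1) * s^(2*N+2)"
    proof -
      have "norm er \<le> K * exp (- c * (1/s^2))" unfolding er_def k_def by (rule E[OF _ par]) simp
      also have "\<dots> = K * exp (- c / s^2)" by simp
      also have "\<dots> \<le> K * (D1 * s^(2*(N+1)))" by (intro mult_left_mono D1 s c)
      finally show ?thesis by (simp add: mult.assoc)
    qed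
    have n4: "norm ((LINT p|lborel. plane_integrand (1/s^2) \<tau>1 \<tau>2 u v p)
        - (\<Sum>e1\<leftarrow>cnj_sym sc.Sig0. \<Sum>e2\<leftarrow>cnj_sym sc.Gam0. dint e1 e2 (airy_kern (1/s^2) \<tau>1 \<tau>2 u v))) \<le> (W * D2) *
        s^(2*N+2)"
    proof -
      have "norm ((LINT p|lborel. plane_integrand (1/s^2) \<tau>1 \<tau>2 u v p)
          - (\<Sum>e1\<leftarrow>cnj_sym sc.Sig0. \<Sum>e2\<leftarrow>cnj_sym sc.Gam0. dint e1 e2 (airy_kern (1/s^2) \<tau>1 \<tau>2 u v))) \<le> W * exp
          (- (1/s^2) / 4)"
        unfolding W_def by (rule truncation[OF par L])
      also have "\<dots> = W * exp (- (1/4) / s^2)" by simp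
      also have "\<dots> \<le> W * (D2 * s^(2*(N+1)))" by (intro mult_left_mono D2 s W)
      finally show ?thesis by (simp add: mult.assoc)
    qed
    define X where "X = (LINT p|lborel. plane_integrand (1/s^2) \<tau>1 \<tau>2 u v p)
        - (\<Sum>e1\<leftarrow>cnj_sym sc.Sig0. \<Sum>e2\<leftarrow>cnj_sym sc.Gam0. dint e1 e2 (airy_kern (1/s^2) \<tau>1 \<tau>2 u v))"
    have eq: "(LINT p|lborel. plane_integrand (1/s^2) \<tau>1 \<tau>2 u v p)
      - 2 * of_real pi * \<i> * contour_integral (linepath (- \<i>) \<i>)
          (\<lambda>\<omega>. exp (of_real (\<tau>1 - \<tau>2) * \<omega>^2 + of_real (u - v) * \<omega>))
      - of_real (2 * upper_terms N s \<tau>1 \<tau>2 u v) - of_real (2 * lower_terms N s \<tau>1 \<tau>2 u v)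
      = X + of_real (2 * Re ((J1 - S1) + \<theta> * (J2 - S2) + er))"
    proof -
      have "Re ((J1 - S1) + \<theta> * (J2 - S2) + er) = Re T - Re S1 - Re (\<theta> * S2)"
        unfolding T by (simp add: right_diff_distrib)
      hence R: "of_real (2 * Re ((J1 - S1) + \<theta> * (J2 - S2) + er)) = of_real (2 * Re T) - of_real (2 * Re S1)
          - (of_real (2 * Re (\<theta> * S2)) :: complex)"
        unfolding of_real_diff[symmetric] by (simp only: right_diff_distrib)
      show ?thesis unfolding R X_def ray_sum m1 m2 unfolding k_def[symmetric] T_def[symmetric]
          by (simp only: algebra_simps)
    qed
    have "norm (X + of_real (2 * Re ((J1 - S1) + \<theta> * (J2 - S2) + er))) \<le> norm X
        + 2 * norm ((J1 - S1) + \<theta> * (J2 - S2) + er)"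
      using norm_triangle_ineq[of X "of_real (2 * Re ((J1 - S1) + \<theta> * (J2 - S2) + er))"]
          abs_Re_le_cmod[of "(J1 - S1) + \<theta> * (J2 - S2) + er"]
      unfolding norm_of_real abs_mult by simp
    also have "norm ((J1 - S1) + \<theta> * (J2 - S2) + er) \<le> C1 * s^(2*N+2) + C2 * s^(2*N+2) + (K * D1) * s^(2*N+2)"
      by (intro norm_triangle_mono n1 n2 n3)
    also have "norm X \<le> (W * D2) * s^(2*N+2)" unfolding X_def by (rule n4)
    finally show ?thesis unfolding eq by (simp add: algebra_simps)
  qed
  thus ?thesis by (intro exI[of _ "W * D2 + 2 * (C1 + C2 + K * D1)"] exI[of _ "8 * B + 4"]) blast
qed

section \<open>The coefficients of first order\<close>

lemma c_coef_00: "c_coef \<tau>1 \<tau>2 u v 0 0 = exp (of_real (- (\<tau>1 - \<tau>2)) - \<i> * of_real (u + v)) / 2"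
proof -
  define B where "B = \<bar>u\<bar> + \<bar>v\<bar> + \<bar>\<tau>1\<bar> + \<bar>\<tau>2\<bar>"
  interpret bb: bivariate_bounded "Phi_ext \<tau>1 \<tau>2 u v" R "5 * exp (8 * B)" "R / 2"
    by (rule bivariate_Phi_ext) (auto simp: B_def)
  have "norm (Phi_ext \<tau>1 \<tau>2 u v 0 0 - bb.coeff 0 0) \<le> 0"
    using bb.taylor_remainder[of 0 0 1] R by simp
  hence "bb.coeff 0 0 = Phi_ext \<tau>1 \<tau>2 u v 0 0" by simp
  also have "\<dots> = exp (- of_real v * \<i> - of_real \<tau>2 * \<i>^2 - of_real u * \<i> + of_real \<tau>1 * \<i>^2) / (2 * \<i>) * e8^2"
    by (simp add: Phi_ext_def gS_0 deriv_gS_0 power2_eq_square)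
  also have "\<dots> = exp (of_real (- (\<tau>1 - \<tau>2)) - \<i> * of_real (u + v)) / 2"
    unfolding e8_squared by (simp add: algebra_simps)
  finally show ?thesis by (simp add: c_coef_eq)
qed

text \<open>
  Along \<open>(t, \<i> t)\<close> the function \<open>phi_ext\<close> is \<open>E t\<close> times an even function, so its derivative at
  \<open>0\<close> is known without the second derivative of \<open>g\<close>.
\<close>

lemma b_coef_first_order:
  "b_coef \<tau>1 \<tau>2 u v 1 0 + \<i> * b_coef \<tau>1 \<tau>2 u v 0 1 =
     exp (of_real (- (\<tau>1 - \<tau>2)) + \<i> * of_real (u - v)) * (of_real (u + v) + 2 * \<i> * of_real (\<tau>1 + \<tau>2))"
proof -
  define B where "B = \<bar>u\<bar> + \<bar>v\<bar> + \<bar>\<tau>1\<bar> + \<bar>\<tau>2\<bar>"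
  interpret bb: bivariate_bounded "phi_ext \<tau>1 \<tau>2 u v" R "5 * exp (8 * B)" "R / 2"
    by (rule bivariate_phi_ext) (auto simp: B_def)
  define f where "f t = phi_ext \<tau>1 \<tau>2 u v t (\<i> * t)" for t
  define D where "D = bb.coeff 1 0 + \<i> * bb.coeff 0 1"
  define E where "E t = exp (- of_real v * gS t - of_real \<tau>2 * (gS t)^2 + of_real u * gS (- t)
      + of_real \<tau>1 * (gS (- t))^2)" for t
  have f0: "f 0 = bb.coeff 0 0"
    using bb.taylor_remainder[of 0 0 1] R by (simp add: f_def)
  have "(f has_field_derivative D) (at 0)"
  proof (rule has_field_derivative_quadratic_error)
    show "R / 4 > 0" using R by simp
    fix t :: complex assume t: "norm t < R / 4"
    have "norm (phi_ext \<tau>1 \<tau>2 u v t (\<i> * t) - (\<Sum>k<2. \<Sum>l<2-k. bb.coeff k l * t^k * (\<i> * t)^l))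
      \<le> 2 * (5 * exp (8 * B)) * (real 2 + 1) * ((norm t + norm (\<i> * t)) / (R / 2))^2"
      using bb.taylor_remainder[of t "\<i> * t" 2] t by (simp add: norm_mult)
    also have "(\<Sum>k<2. \<Sum>l<2-k. bb.coeff k l * t^k * (\<i> * t)^l) = f 0 + D * t"
      by (simp add: f0 D_def numeral_2_eq_2 algebra_simps)
    finally show "norm (f t - f 0 - D * t) \<le> (30 * exp (8 * B) * (4 / R)^2) * norm t^2"
      by (simp add: f_def norm_mult power_mult_distrib power_divide diff_diff_eq)
  qed
  have gd: "(gS has_field_derivative e8) (at 0)"
    using holomorphic_derivI[OF hol open_ball, of 0] R deriv_gS_0 by simp
  have gmd: "((\<lambda>t. gS (- t)) has_field_derivative e8 * (-1)) (at 0)"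
    by (rule DERIV_chain2[where f=gS and g=uminus]) (use gd in \<open>auto intro!: derivative_eq_intros\<close>)
  have E0: "E 0 = exp (of_real (- (\<tau>1 - \<tau>2)) + \<i> * of_real (u - v))"
    by (simp add: E_def gS_0 algebra_simps)
  define E' where "E' = E 0 * (e8 * (- of_real (u + v) - 2 * \<i> * of_real (\<tau>1 + \<tau>2)))"
  have Ed: "(E has_field_derivative E') (at 0)"
    unfolding E_def[abs_def] E'_def
    by (rule derivative_eq_intros refl gd gmd | simp add: gS_0)+ (simp add: gS_0 algebra_simps)
  \<comment> \<open>The even factor: as \<i> * (\<i> * t) = - t, it consists of the symmetric slope
    between t and - t and the product of the derivatives at these points.\<close>
  define q where "q t = f t / E t" for t
  have "(q has_field_derivative (D * E 0 - f 0 * E') / (E 0 * E 0)) (at 0)"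
    unfolding q_def[abs_def] by (rule DERIV_divide[OF \<open>(f has_field_derivative D) (at 0)\<close> Ed]) (simp add: E_def)
  moreover have "q (- t) = q t" for t
  proof -
    have "q t = 1 / gS_slope t (- t) * deriv gS t * (\<i> * deriv gS (- t))" for t
      by (simp add: q_def f_def E_def phi_ext_def)
    thus ?thesis using gS_slope_commute[of t "- t"] by (simp add: mult_ac)
  qed
  ultimately have "(D * E 0 - f 0 * E') / (E 0 * E 0) = 0" by (rule even_function_deriv_zero)
  moreover have ne: "E 0 \<noteq> 0" by (simp add: E_def)
  ultimately have "D * E 0 = f 0 * E'" by simp
  also have "f 0 = \<i> * e8 * E 0"
    by (simp add: f_def phi_ext_def E_def gS_slope_def deriv_gS_0)
  also have "\<i> * e8 * E 0 * E' = (\<i> * e8^2 * E 0 * (- of_real (u + v) - 2 * \<i> * of_real (\<tau>1 + \<tau>2))) * E 0"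
    by (simp add: E'_def power2_eq_square mult_ac)
  finally have "D = \<i> * e8^2 * E 0 * (- of_real (u + v) - 2 * \<i> * of_real (\<tau>1 + \<tau>2))" using ne by simp
  also have "\<dots> = E 0 * (of_real (u + v) + 2 * \<i> * of_real (\<tau>1 + \<tau>2))"
    unfolding e8_squared by (simp add: algebra_simps)
  finally show ?thesis by (simp add: b_coef_eq D_def E0)
qed

text \<open>The moments pi / 2 and \<i> pi / 2 weight the coefficients exactly in the combination of
  \<open>b_coef_first_order\<close>, a derivative of \<open>phi_ext\<close> along (t, \<i> t); the
  coefficients are never computed separately. The cosine comes from the phase of
  \<open>c_coef_00\<close>.\<close>

lemma first_order_terms:
  assumes "s > 0"
  shows "2 * upper_terms 1 s \<tau>1 \<tau>2 u v + 2 * lower_terms 1 s \<tau>1 \<tau>2 u v =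
    pi * s^2 * exp (- (\<tau>1 - \<tau>2)) * (f_S1 \<tau>1 \<tau>2 u v + cos (4/3 * (1/s^2) - (u + v)))"
proof -
  have B: "B_coef 1 0 = of_real (pi / 2)" "B_coef 0 1 = \<i> * of_real (pi / 2)"
    unfolding B_coef_gauss gauss_moment_cauchy_10_01 gauss_moment_cauchy_10 by (rule refl)+
  have "upper_terms 1 s \<tau>1 \<tau>2 u v = s^2 * Re (of_real (pi / 2) * (b_coef \<tau>1 \<tau>2 u v 1 0 + \<i> * b_coef \<tau>1 \<tau>2 u v 0 1))"
  proof -
    have "upper_terms 1 s \<tau>1 \<tau>2 u v = s^2 * (Re (b_coef \<tau>1 \<tau>2 u v 0 1 * B_coef 0 1)
        + Re (b_coef \<tau>1 \<tau>2 u v 1 0 * B_coef 1 0))"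
      by (simp add: upper_terms_def)
    thus ?thesis unfolding B by (simp add: algebra_simps)
  qed
  also have "\<dots> = s^2 * (pi / 2) * Re (exp (of_real (- (\<tau>1 - \<tau>2)) + \<i> * of_real (u - v))
      * (of_real (u + v) + 2 * \<i> * of_real (\<tau>1 + \<tau>2)))"
    unfolding b_coef_first_order by simp
  also have "\<dots> = s^2 * (pi / 2) * (exp (- (\<tau>1 - \<tau>2)) * f_S1 \<tau>1 \<tau>2 u v)"
    by (simp add: f_S1_def Re_exp Im_exp algebra_simps)
  finally have 1: "upper_terms 1 s \<tau>1 \<tau>2 u v = s^2 * (pi / 2) * (exp (- (\<tau>1 - \<tau>2)) * f_S1 \<tau>1 \<tau>2 u v)" .
  have "lower_terms 1 s \<tau>1 \<tau>2 u v = s^2 * Re (c_coef \<tau>1 \<tau>2 u v 0 0 * exp (\<i> * of_real (4/3 * (1/s^2))))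
      * (Gamma (1/2) * Gamma (1/2))"
    by (simp add: lower_terms_def)
  also have "\<dots> = s^2 * Re (exp (of_real (- (\<tau>1 - \<tau>2)) - \<i> * of_real (u + v) + \<i> * of_real (4/3 * (1/s^2)))) / 2 * pi"
    unfolding c_coef_00 exp_add[of _ "\<i> * of_real (4/3 * (1/s^2))"] by (simp add: Gamma_one_half_real)
  also have "\<dots> = s^2 * (exp (- (\<tau>1 - \<tau>2)) * cos (4/3 * (1/s^2) - (u + v))) / 2 * pi"
    by (simp add: Re_exp algebra_simps)
  finally have 2: "lower_terms 1 s \<tau>1 \<tau>2 u v = s^2 * (exp (- (\<tau>1 - \<tau>2)) * cos (4/3 * (1/s^2) - (u + v))) / 2 * pi" .
  show ?thesis unfolding 1 2 by (simp add: algebra_simps)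
qed

end

lemma scaling_parameter:
  assumes a: "a > 0"
  defines "s \<equiv> a powr (- 3/4)"
  shows "s > 0" "1 / s^2 = a powr (3/2)" "sqrt a^3 = 1 / s^2" "s^(2*n) = 1 / a powr (3/2 * real n)"
proof -
  show "s > 0" using a by (simp add: s_def)
  have p: "s^n = a powr (- 3/4 * real n)" for n using a by (simp add: s_def powr_realpow[symmetric] powr_powr)
  show 1: "1 / s^2 = a powr (3/2)" unfolding p by (simp add: powr_minus_divide)
  have "sqrt a^3 = (a powr (1/2))^3" using a by (simp add: powr_half_sqrt)
  also have "\<dots> = a powr (3/2)" using a by (simp add: powr_realpow[symmetric] powr_powr)
  finally show "sqrt a^3 = 1 / s^2" using 1 by simp
  show "s^(2*n) = 1 / a powr (3/2 * real n)" unfolding p by (simp add: powr_minus_divide[symmetric])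
qed

theorem theorem1p1:
  shows "(\<forall>K :: real set. compact K \<longrightarrow>
           (\<exists>A M. \<forall>a \<ge> A. \<forall>u\<in>K. \<forall>v\<in>K. \<forall>\<tau>1\<in>K. \<forall>\<tau>2\<in>K.
              norm (K_Ai_scaled a \<tau>1 \<tau>2 u v - K_S1 \<tau>1 \<tau>2 u v - fluc_S1 u v \<tau>1 \<tau>2 a)
                \<le> M * a powr (-3)))
       \<and> (\<forall>(N :: nat) (K :: real set). compact K \<longrightarrow>
           (\<exists>A M. \<forall>a \<ge> A. \<forall>u\<in>K. \<forall>v\<in>K. \<forall>\<tau>1\<in>K. \<forall>\<tau>2\<in>K.
              norm (K_Ai_scaled a \<tau>1 \<tau>2 u v - K_S1 \<tau>1 \<tau>2 u v
                 - (\<Sum>\<nu>=1..N. 2 / ((2 * of_real pi * \<i>)^2 * of_real (a powr (3/2 * real \<nu>))) *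
                      of_real (\<Sum>k\<le>2*\<nu>-1. Re (b_coef \<tau>1 \<tau>2 u v k (2*\<nu>-1-k) * B_coef k (2*\<nu>-1-k))))
                 - (\<Sum>\<nu>=1..N. 2 / ((2 * of_real pi * \<i>)^2 * of_real (a powr (3/2 * real \<nu>))) *
                      of_real (\<Sum>k\<le>\<nu>-1. Re (c_coef \<tau>1 \<tau>2 u v (2*k) (2*(\<nu>-1-k))
                                              * exp (\<i> * of_real (4/3 * a powr (3/2))))
                                  * Gamma (real k + 1/2) * Gamma (real (\<nu>-1-k) + 1/2))))
                \<le> M * a powr (- 3/2 * real (N + 1))))"
proof -
  obtain R where "gS_disc R" using gS_disc_exists by blast
  then interpret gS_disc R .
  define P where "P = (2 * complex_of_real pi * \<i>)^2"
  have P0: "P \<noteq> 0" by (simp add: P_def)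
  have main: "\<exists>A M. A \<ge> 1 \<and> (\<forall>a\<ge>A. \<forall>u\<in>K. \<forall>v\<in>K. \<forall>\<tau>1\<in>K. \<forall>\<tau>2\<in>K.
      norm (K_Ai_scaled a \<tau>1 \<tau>2 u v - K_S1 \<tau>1 \<tau>2 u v - 1 / P * of_real (2 * upper_terms N (a powr (- 3/4)) \<tau>1 \<tau>2 u v)
         - 1 / P * of_real (2 * lower_terms N (a powr (- 3/4)) \<tau>1 \<tau>2 u v)) \<le> M * a powr (- 3/2 * real (N + 1)))"
    if K: "compact K" for N :: nat and K :: "real set"
  proof -
    from compact_imp_bounded[OF K] obtain B where B: "B \<ge> 0" "\<And>x. x \<in> K \<Longrightarrow> \<bar>x\<bar> \<le> B"
      unfolding bounded_iff real_norm_def by (metis abs_ge_self abs_ge_zero order_trans)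
    obtain M L where bnd: "\<And>s u v \<tau>1 \<tau>2. s > 0 \<Longrightarrow> 1 / s^2 \<ge> L \<Longrightarrow> \<bar>u\<bar> \<le> B \<Longrightarrow> \<bar>v\<bar> \<le> B \<Longrightarrow> \<bar>\<tau>1\<bar> \<le> B \<Longrightarrow> \<bar>\<tau>2\<bar> \<le> B \<Longrightarrow>
       norm ((LINT p|lborel. plane_integrand (1/s^2) \<tau>1 \<tau>2 u v p)
      - 2 * of_real pi * \<i> * contour_integral (linepath (- \<i>) \<i>)
          (\<lambda>\<omega>. exp (of_real (\<tau>1 - \<tau>2) * \<omega>^2 + of_real (u - v) * \<omega>))
      - of_real (2 * upper_terms N s \<tau>1 \<tau>2 u v) - of_real (2 * lower_terms N s \<tau>1 \<tau>2 u v)) \<le> M * s^(2*N+2)"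
      using expansion[OF B(1), of N] by blast
    show ?thesis
    proof (rule exI[of _ "max 1 L"], rule exI[of _ "norm (1 / P) * M"], intro conjI allI impI ballI)
      fix a u v \<tau>1 \<tau>2 :: real
      assume a: "a \<ge> max 1 L" and par: "u \<in> K" "v \<in> K" "\<tau>1 \<in> K" "\<tau>2 \<in> K"
      hence a0: "a > 0" "a \<ge> 1" "a \<ge> L" by auto
      define s where "s = a powr (- 3/4)"
      note s = scaling_parameter[OF a0(1), folded s_def]
      \<comment> \<open>For a \<ge> 1 one has a \<le> a powr (3/2), so max 1 L is a valid threshold
        for a although L bounds 1 / s^2.\<close>
      have "L \<le> a powr 1" using a0 by simp
      also have "\<dots> \<le> a powr (3/2)" using a0 by (intro powr_mono) auto
      finally have L: "1 / s^2 \<ge> L" unfolding s(2) .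
      define I where "I = (LINT p|lborel. plane_integrand (1/s^2) \<tau>1 \<tau>2 u v p)"
      define CI where "CI = contour_integral (linepath (- \<i>) \<i>) (\<lambda>\<omega>. exp (of_real (\<tau>1 - \<tau>2) * \<omega>^2
          + of_real (u - v) * \<omega>))"
      have "K_Ai_scaled a \<tau>1 \<tau>2 u v - K_S1 \<tau>1 \<tau>2 u v = 1 / P * I - 1 / (2 * of_real pi * \<i>) * CI"
        unfolding K_Ai_scaled_eq[OF a0(1)] s(3) K_S1_def I_def CI_def P_def by simp
      also have "1 / (2 * of_real pi * \<i>) * CI = 1 / P * (2 * of_real pi * \<i> * CI)"
        by (simp add: P_def power2_eq_square)
      finally have "K_Ai_scaled a \<tau>1 \<tau>2 u v - K_S1 \<tau>1 \<tau>2 u v - 1 / P * of_real (2 * upper_terms N s \<tau>1 \<tau>2 u v)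
          - 1 / P * of_real (2 * lower_terms N s \<tau>1 \<tau>2 u v)
        = 1 / P * (I - 2 * of_real pi * \<i> * CI - of_real (2 * upper_terms N s \<tau>1 \<tau>2 u v) - of_real
            (2 * lower_terms N s \<tau>1 \<tau>2 u v))"
        by (simp only: right_diff_distrib)
      hence "norm (K_Ai_scaled a \<tau>1 \<tau>2 u v - K_S1 \<tau>1 \<tau>2 u v - 1 / P * of_real (2 * upper_terms N s \<tau>1 \<tau>2 u v)
          - 1 / P * of_real (2 * lower_terms N s \<tau>1 \<tau>2 u v))
        = norm (1 / P) * norm (I - 2 * of_real pi * \<i> * CI - of_real (2 * upper_terms N s \<tau>1 \<tau>2 u v) - of_real
            (2 * lower_terms N s \<tau>1 \<tau>2 u v))"
        by (simp only: norm_mult)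
      also have "\<dots> \<le> norm (1 / P) * (M * s^(2*N+2))"
        unfolding I_def CI_def by (intro mult_left_mono bnd s(1) L B(2) par norm_ge_zero)
      also have "s^(2*N+2) = a powr (- 3/2 * real (N + 1))"
        using s(4)[of "N+1"] by (simp add: powr_minus_divide[symmetric])
      finally show "norm (K_Ai_scaled a \<tau>1 \<tau>2 u v - K_S1 \<tau>1 \<tau>2 u v
          - 1 / P * of_real (2 * upper_terms N (a powr (- 3/4)) \<tau>1 \<tau>2 u v)
         - 1 / P * of_real (2 * lower_terms N (a powr (- 3/4)) \<tau>1 \<tau>2 u v)) \<le> norm (1 / P) * M * a powr
             (- 3/2 * real (N + 1))"
        unfolding s_def by (simp only: mult.assoc)
    qed simp
  qed
  have t1: "1 / P * of_real (2 * upper_terms N (a powr (- 3/4)) \<tau>1 \<tau>2 u v)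
      = (\<Sum>\<nu>=1..N. 2 / ((2 * of_real pi * \<i>)^2 * of_real (a powr (3/2 * real \<nu>))) *
                      of_real (\<Sum>k\<le>2*\<nu>-1. Re (b_coef \<tau>1 \<tau>2 u v k (2*\<nu>-1-k) * B_coef k (2*\<nu>-1-k))))"
    if "a > 0" for N a \<tau>1 \<tau>2 u v
    unfolding upper_terms_def scaling_parameter(4)[OF that] P_def[symmetric] sum_distrib_left of_real_sum
    by (intro sum.cong refl) simp
  have t2: "1 / P * of_real (2 * lower_terms N (a powr (- 3/4)) \<tau>1 \<tau>2 u v)
      = (\<Sum>\<nu>=1..N. 2 / ((2 * of_real pi * \<i>)^2 * of_real (a powr (3/2 * real \<nu>))) *
                      of_real (\<Sum>k\<le>\<nu>-1. Re (c_coef \<tau>1 \<tau>2 u v (2*k) (2*(\<nu>-1-k)) * exp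
                          (\<i> * of_real (4/3 * a powr (3/2))))
                                  * Gamma (real k + 1/2) * Gamma (real (\<nu>-1-k) + 1/2)))"
    if "a > 0" for N a \<tau>1 \<tau>2 u v
    unfolding lower_terms_def scaling_parameter(2,4)[OF that] P_def[symmetric] sum_distrib_left of_real_sum
    by (intro sum.cong refl) simp
  show ?thesis
  proof (intro conjI allI impI)
    fix K :: "real set" assume K: "compact K"
    \<comment> \<open>The first claim is the case N = 1, whose error exponent is - 3/2 * 2 = -
      3.\<close>
    from main[OF K, of 1] obtain A M where A: "A \<ge> 1" and AM: "\<And>a u v \<tau>1 \<tau>2. a \<ge> A \<Longrightarrow> u \<in> K \<Longrightarrow> v \<in> K \<Longrightarrow> \<tau>1 \<in> K \<Longrightarrow> \<tau>2 \<in> K \<Longrightarrow>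
      norm (K_Ai_scaled a \<tau>1 \<tau>2 u v - K_S1 \<tau>1 \<tau>2 u v - 1 / P * of_real (2 * upper_terms 1 (a powr (- 3/4)) \<tau>1 \<tau>2 u v)
         - 1 / P * of_real (2 * lower_terms 1 (a powr (- 3/4)) \<tau>1 \<tau>2 u v)) \<le> M * a powr
             (- 3/2 * real (1 + 1))" by blast
    show "\<exists>A M. \<forall>a \<ge> A. \<forall>u\<in>K. \<forall>v\<in>K. \<forall>\<tau>1\<in>K. \<forall>\<tau>2\<in>K.
              norm (K_Ai_scaled a \<tau>1 \<tau>2 u v - K_S1 \<tau>1 \<tau>2 u v - fluc_S1 u v \<tau>1 \<tau>2 a) \<le> M * a powr (-3)"
    proof (rule exI[of _ A], rule exI[of _ M], intro allI impI ballI)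
      fix a u v \<tau>1 \<tau>2 :: real
      assume a: "a \<ge> A" and par: "u \<in> K" "v \<in> K" "\<tau>1 \<in> K" "\<tau>2 \<in> K"
      hence a0: "a > 0" using A by simp
      define s where "s = a powr (- 3/4)"
      note s = scaling_parameter[OF a0, folded s_def]
      have "1 / P * of_real (2 * upper_terms 1 s \<tau>1 \<tau>2 u v) + 1 / P * of_real (2 * lower_terms 1 s \<tau>1 \<tau>2 u v)
        = 1 / P * of_real (2 * upper_terms 1 s \<tau>1 \<tau>2 u v + 2 * lower_terms 1 s \<tau>1 \<tau>2 u v)"
        by (simp only: of_real_add distrib_left)
      also have "\<dots> = fluc_S1 u v \<tau>1 \<tau>2 a"
        unfolding first_order_terms[OF s(1)] fluc_S1_def P_def[symmetric] s(2)
        using s(4)[of 1] by simp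
      finally have f: "fluc_S1 u v \<tau>1 \<tau>2 a = 1 / P * of_real (2 * upper_terms 1 s \<tau>1 \<tau>2 u v)
          + 1 / P * of_real (2 * lower_terms 1 s \<tau>1 \<tau>2 u v)" ..
      show "norm (K_Ai_scaled a \<tau>1 \<tau>2 u v - K_S1 \<tau>1 \<tau>2 u v - fluc_S1 u v \<tau>1 \<tau>2 a) \<le> M * a powr (-3)"
        using AM[OF a par] unfolding f s_def diff_diff_eq[symmetric] by (simp add: diff_diff_eq[symmetric])
    qed
  next
    fix N :: nat and K :: "real set" assume K: "compact K"
    from main[OF K, of N] obtain A M where A: "A \<ge> 1" and AM: "\<And>a u v \<tau>1 \<tau>2. a \<ge> A \<Longrightarrow> u \<in> K \<Longrightarrow> v \<in> K \<Longrightarrow> \<tau>1 \<in> K \<Longrightarrow> \<tau>2 \<in> K \<Longrightarrow>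
      norm (K_Ai_scaled a \<tau>1 \<tau>2 u v - K_S1 \<tau>1 \<tau>2 u v - 1 / P * of_real (2 * upper_terms N (a powr (- 3/4)) \<tau>1 \<tau>2 u v)
         - 1 / P * of_real (2 * lower_terms N (a powr (- 3/4)) \<tau>1 \<tau>2 u v)) \<le> M * a powr
             (- 3/2 * real (N + 1))" by blast
    show "\<exists>A M. \<forall>a \<ge> A. \<forall>u\<in>K. \<forall>v\<in>K. \<forall>\<tau>1\<in>K. \<forall>\<tau>2\<in>K.
              norm (K_Ai_scaled a \<tau>1 \<tau>2 u v - K_S1 \<tau>1 \<tau>2 u v
                 - (\<Sum>\<nu>=1..N. 2 / ((2 * of_real pi * \<i>)^2 * of_real (a powr (3/2 * real \<nu>))) *
                      of_real (\<Sum>k\<le>2*\<nu>-1. Re (b_coef \<tau>1 \<tau>2 u v k (2*\<nu>-1-k) * B_coef k (2*\<nu>-1-k))))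
                 - (\<Sum>\<nu>=1..N. 2 / ((2 * of_real pi * \<i>)^2 * of_real (a powr (3/2 * real \<nu>))) *
                      of_real (\<Sum>k\<le>\<nu>-1. Re (c_coef \<tau>1 \<tau>2 u v (2*k) (2*(\<nu>-1-k))
                                              * exp (\<i> * of_real (4/3 * a powr (3/2))))
                                  * Gamma (real k + 1/2) * Gamma (real (\<nu>-1-k) + 1/2))))
                \<le> M * a powr (- 3/2 * real (N + 1))"
    proof (rule exI[of _ A], rule exI[of _ M], intro allI impI ballI)
      fix a u v \<tau>1 \<tau>2 :: real
      assume a: "a \<ge> A" and par: "u \<in> K" "v \<in> K" "\<tau>1 \<in> K" "\<tau>2 \<in> K"
      hence a0: "a > 0" using A by simp
      from AM[OF a par] show "norm (K_Ai_scaled a \<tau>1 \<tau>2 u v - K_S1 \<tau>1 \<tau>2 u v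
                 - (\<Sum>\<nu>=1..N. 2 / ((2 * of_real pi * \<i>)^2 * of_real (a powr (3/2 * real \<nu>))) *
                      of_real (\<Sum>k\<le>2*\<nu>-1. Re (b_coef \<tau>1 \<tau>2 u v k (2*\<nu>-1-k) * B_coef k (2*\<nu>-1-k))))
                 - (\<Sum>\<nu>=1..N. 2 / ((2 * of_real pi * \<i>)^2 * of_real (a powr (3/2 * real \<nu>))) *
                      of_real (\<Sum>k\<le>\<nu>-1. Re (c_coef \<tau>1 \<tau>2 u v (2*k) (2*(\<nu>-1-k))
                                              * exp (\<i> * of_real (4/3 * a powr (3/2))))
                                  * Gamma (real k + 1/2) * Gamma (real (\<nu>-1-k) + 1/2))))
                \<le> M * a powr (- 3/2 * real (N + 1))"
        unfolding t1[OF a0] t2[OF a0] .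
    qed
  qed
qed

end
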